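(* Assume that (A1) the design matrix $\boldsymbol X$ has i.i.d. sub-Gaussian rows; (A2) the smallest eigenvalue $\Lambda_{\min}^2$ of $\boldsymbol\Sigma$ is strictly positive with $1/\Lambda_{\min}^2=O(1)$, and $\max_j\Sigma_{j,j}=O(1)$; (A3) the error terms $\epsilon_i^{(j)}$, $i=1,\dots,n_j$, $j=1,\dots,b$, are sub-exponential. Then there exist constants $C>0$ and $c>0$, not depending on $N_b$, such that the following holds. Suppose the tuning parameters are $\lambda_j=C\sqrt{\log p/N_j}$, $j=1,\dots,b$, the first batch size satisfies $n_1\ge c\,s_r\log p$, the subsequent batch sizes satisfy $n_j\ge c\log p$, $j=2,\dots,b$, and $$s_0s_r\frac{\log p}{\sqrt{N_b}}=o(1),\qquad s_r^2\,\frac{\log p}{N_b}\,\log\frac{N_b}{n_1}=o(1).$$ Then for any $r=1,\dots,p$ and sufficiently large $N_b$, $$\frac{\widehat\beta^{(b)}_{\mathrm{on},r}-\beta_{0,r}}{\widehat\tau_r^{(b)}}=W_r+\Delta_r,\qquad W_r=\frac{\widehat{\boldsymbol z}_r^\top\boldsymbol\epsilon}{\|\widehat{\boldsymbol z}_r\|_2},\qquad |\Delta_r|=o_{\mathbb P}(1).$$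
   Context: Model. Data arrive in $b\ge 2$ batches $\{\boldsymbol y^{(j)},\boldsymbol X^{(j)}\}$, $j=1,\dots,b$, with $\boldsymbol y^{(j)}=\boldsymbol X^{(j)}\boldsymbol\beta_0+\boldsymbol\epsilon^{(j)}$, where $\boldsymbol y^{(j)}\in\mathbb R^{n_j}$, $\boldsymbol X^{(j)}$ is an $n_j\times p$ random design matrix, $\boldsymbol\beta_0=(\beta_{0,1},\dots,\beta_{0,p})^\top\in\mathbb R^p$ is unknown and sparse, and the errors $\epsilon_i^{(j)}$ are i.i.d. with mean zero and finite variance $\sigma_\epsilon^2$. Put $N_j=\sum_{i=1}^j n_i$. High dimension is allowed: $p\ge N_b$ is permitted. Let $\boldsymbol X,\boldsymbol y,\boldsymbol\epsilon$ be the vertical stacks of $\boldsymbol X^{(j)},\boldsymbol y^{(j)},\boldsymbol\epsilon^{(j)}$, $j=1,\dots,b$. The rows of $\boldsymbol X$ are i.i.d.; $\boldsymbol\Sigma$ is the covariance matrix of a row and $\boldsymbol\Theta=\boldsymbol\Sigma^{-1}$. Notation. $\boldsymbol x_r^{(j)}$ is the $r$-th column of $\boldsymbol X^{(j)}$, $\boldsymbol X_{-r}^{(j)}$ is $\boldsymbol X^{(j)}$ with the $r$-th column removed. Sparsity levels: $s_0=|\{j:\beta_{0,j}\ne0\}|$ and $s_r=|\{k\ne r:\boldsymbol\Theta_{k,r}\neq0\}|$. Estimators. With tuning parameters $\lambda_1,\dots,\lambda_b$, the online lasso estimator is $$\widehat{\boldsymbol\beta}^{(b)}=\arg\min_{\boldsymbol\beta\in\mathbb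 R^p}\Big\{\tfrac1{2N_b}\sum_{j=1}^b\|\boldsymbol y^{(j)}-\boldsymbol X^{(j)}\boldsymbol\beta\|_2^2+\lambda_b\|\boldsymbol\beta\|_1\Big\}.$$ For each $j=1,\dots,b$, $$\widehat{\boldsymbol\gamma}_r^{(j)}=\arg\min_{\boldsymbol\gamma\in\mathbb R^{p-1}}\Big\{\tfrac1{2N_j}\sum_{i=1}^j\|\boldsymbol x_r^{(i)}-\boldsymbol X_{-r}^{(i)}\boldsymbol\gamma\|_2^2+\lambda_j\|\boldsymbol\gamma\|_1\Big\},\qquad \widehat{\boldsymbol z}_r^{(j)}=\boldsymbol x_r^{(j)}-\boldsymbol X_{-r}^{(j)}\widehat{\boldsymbol\gamma}_r^{(j)},$$ and $\widehat{\boldsymbol z}_r=((\widehat{\boldsymbol z}_r^{(1)})^\top,\dots,(\widehat{\boldsymbol z}_r^{(b)})^\top)^\top\in\mathbb R^{N_b}$. The online debiased lasso (ODL) estimator of $\beta_{0,r}$ is $$\widehat\beta^{(b)}_{\mathrm{on},r}=\widehat\beta_r^{(b)}+\Big\{\sum_{j=1}^b(\widehat{\boldsymbol z}_r^{(j)})^\top\boldsymbol x_r^{(j)}\Big\}^{-1}\Big\{\sum_{j=1}^b(\widehat{\boldsymbol z}_r^{(j)})^\top\boldsymbol y^{(j)}-\sum_{j=1}^b(\widehat{\boldsymbol z}_r^{(j)})^\top\boldsymbol X^{(j)}\widehat{\boldsymbol\beta}^{(b)}\Big\},$$ and $$\widehat\tau_r^{(b)}=\frac{\sqrt{\sum_{j=1}^b(\widehat{\boldsymbol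 z}_r^{(j)})^\top\widehat{\boldsymbol z}_r^{(j)}}}{\sum_{j=1}^b(\widehat{\boldsymbol z}_r^{(j)})^\top\boldsymbol x_r^{(j)}}.$$ Asymptotics: all $o(\cdot)$, $O(\cdot)$, $o_{\mathbb P}(\cdot)$ are along a sequence of such models with cumulative sample size $N_b\to\infty$, where $p,b,n_j,s_0,s_r,\boldsymbol\Sigma,\boldsymbol\beta_0$ may vary; $X_N=o_{\mathbb P}(Y_N)$ means $X_N/Y_N\to0$ in probability.
   Formalization: In the batch-size and rate conditions s_r is replaced by max(1, s_r), since for s_r = 0 the stated conditions put no limit on s_0 and the claim fails; the rows are taken to be centred and the errors independent of the design, as is usual. *)

theory Defs
  imports "HOL-Probability.Probability" "Jordan_Normal_Form.Spectral_Radius"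
    "Jordan_Normal_Form.Gauss_Jordan_Elimination"
begin

(* Vectors and matrices are those of Jordan_Normal_Form, since all dimensions vary along the
   asymptotic sequence.  The competing type and notations of HOL-Analysis are switched off. *)
hide_type (open) Finite_Cartesian_Product.vec
hide_const (open) Finite_Cartesian_Product.vec Finite_Cartesian_Product.row
no_notation inner (infix "\<bullet>" 70)
no_notation vec_nth (infixl "$" 90)

definition norm1 :: "real vec \<Rightarrow> real" where
  "norm1 v = (\<Sum>i<dim_vec v. \<bar>v $ i\<bar>)"

definition norm2 :: "real vec \<Rightarrow> real" where
  "norm2 v = sqrt (\<Sum>i<dim_vec v. (v $ i)\<^sup>2)"

definition drop_col :: "nat \<Rightarrow> real mat \<Rightarrow> real mat" where
  "drop_col r A = mat (dim_row A) (dim_col A - 1) (\<lambda>(i, k). A $$ (i, if k < r then k else Suc k))"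

definition stack :: "nat \<Rightarrow> (nat \<Rightarrow> real vec) \<Rightarrow> real vec" where
  "stack b v = foldr (\<lambda>j w. v j @\<^sub>v w) [1..<Suc b] vNil"

(* Moment generating function version with variance proxy K^2, for centred variables.  Hence
   sub-Gaussian rows have mean zero (the regressions below have no intercept), and their
   covariance matrix is also their second moment matrix. *)
definition sub_gaussian :: "'a measure \<Rightarrow> real \<Rightarrow> ('a \<Rightarrow> real) \<Rightarrow> bool" where
  "sub_gaussian M K Z \<longleftrightarrow> K > 0 \<and> integrable M Z \<and> (\<integral>\<omega>. Z \<omega> \<partial>M) = 0 \<and>
     (\<forall>t. (\<integral>\<^sup>+\<omega>. ennreal (exp (t * Z \<omega>)) \<partial>M) \<le> ennreal (exp (K\<^sup>2 * t\<^sup>2 / 2)))"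

definition sub_exponential :: "'a measure \<Rightarrow> real \<Rightarrow> ('a \<Rightarrow> real) \<Rightarrow> bool" where
  "sub_exponential M K Z \<longleftrightarrow> K > 0 \<and> integrable M Z \<and> (\<integral>\<omega>. Z \<omega> \<partial>M) = 0 \<and>
     (\<forall>t. \<bar>t\<bar> \<le> 1 / K \<longrightarrow>
        (\<integral>\<^sup>+\<omega>. ennreal (exp (t * Z \<omega>)) \<partial>M) \<le> ennreal (exp (K\<^sup>2 * t\<^sup>2 / 2)))"

definition sub_gaussian_vec :: "'a measure \<Rightarrow> nat \<Rightarrow> real \<Rightarrow> ('a \<Rightarrow> real vec) \<Rightarrow> bool" where
  "sub_gaussian_vec M d K V \<longleftrightarrow>
     (\<forall>u \<in> carrier_vec d. norm2 u = 1 \<longrightarrow> sub_gaussian M K (\<lambda>\<omega>. V \<omega> \<bullet> u))"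

(* Batches are numbered 1, ..., nbatch; rows inside a batch and the ncov covariates are
   numbered from 0. *)
record 'a stream_model =
  psp :: "'a measure"
  nbatch :: nat
  ncov :: nat
  bsize :: "nat \<Rightarrow> nat"
  design :: "nat \<Rightarrow> 'a \<Rightarrow> real mat"
  noise :: "nat \<Rightarrow> 'a \<Rightarrow> real vec"
  beta0 :: "real vec"

definition cumsize :: "'a stream_model \<Rightarrow> nat \<Rightarrow> nat" where
  "cumsize S j = (\<Sum>i = 1..j. bsize S i)"

abbreviation totsize :: "'a stream_model \<Rightarrow> nat" where
  "totsize S \<equiv> cumsize S (nbatch S)"

definition obs :: "'a stream_model \<Rightarrow> (nat \<times> nat) set" where
  "obs S = (SIGMA j : {1..nbatch S}. {..<bsize S j})"

definition row_space :: "'a stream_model \<Rightarrow> (nat \<Rightarrow> real) measure" where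
  "row_space S = (\<Pi>\<^sub>M k \<in> {..<ncov S}. borel)"

(* A row of the design as an element of the product space row_space, where independence and
   equality in distribution can be expressed. *)
definition design_row :: "'a stream_model \<Rightarrow> nat \<times> nat \<Rightarrow> 'a \<Rightarrow> nat \<Rightarrow> real" where
  "design_row S = (\<lambda>(j, i) \<omega>. \<lambda>k \<in> {..<ncov S}. design S j \<omega> $$ (i, k))"

definition noise_entry :: "'a stream_model \<Rightarrow> nat \<times> nat \<Rightarrow> 'a \<Rightarrow> real" where
  "noise_entry S = (\<lambda>(j, i) \<omega>. noise S j \<omega> $ i)"

definition response :: "'a stream_model \<Rightarrow> nat \<Rightarrow> 'a \<Rightarrow> real vec" where
  "response S j \<omega> = design S j \<omega> *\<^sub>v beta0 S + noise S j \<omega>"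

(* The last independence conjunct is the usual convention for regression with random design
   (the noise is independent of the covariates). *)
definition linear_stream_model :: "'a stream_model \<Rightarrow> bool" where
  "linear_stream_model S \<longleftrightarrow>
     prob_space (psp S) \<and> nbatch S \<ge> 2 \<and> (\<forall>j \<in> {1..nbatch S}. bsize S j \<ge> 1) \<and>
     beta0 S \<in> carrier_vec (ncov S) \<and>
     (\<forall>j \<in> {1..nbatch S}. \<forall>\<omega> \<in> space (psp S).
        design S j \<omega> \<in> carrier_mat (bsize S j) (ncov S) \<and>
        noise S j \<omega> \<in> carrier_vec (bsize S j)) \<and>
     prob_space.indep_vars (psp S) (\<lambda>_. row_space S) (design_row S) (obs S) \<and>
     (\<forall>x \<in> obs S. \<forall>x' \<in> obs S. distr (psp S) (row_space S) (design_row S x)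
                            = distr (psp S) (row_space S) (design_row S x')) \<and>
     prob_space.indep_vars (psp S) (\<lambda>_. borel) (noise_entry S) (obs S) \<and>
     (\<forall>x \<in> obs S. \<forall>x' \<in> obs S. distr (psp S) borel (noise_entry S x)
                            = distr (psp S) borel (noise_entry S x')) \<and>
     (\<forall>x \<in> obs S. integrable (psp S) (noise_entry S x) \<and>
        (\<integral>\<omega>. noise_entry S x \<omega> \<partial>psp S) = 0 \<and>
        integrable (psp S) (\<lambda>\<omega>. (noise_entry S x \<omega>)\<^sup>2)) \<and>
     prob_space.indep_set (psp S)
       (sets (vimage_algebra (space (psp S)) (\<lambda>\<omega>. \<lambda>x \<in> obs S. design_row S x \<omega>)
               (\<Pi>\<^sub>M x \<in> obs S. row_space S)))
       (sets (vimage_algebra (space (psp S)) (\<lambda>\<omega>. \<lambda>x \<in> obs S. noise_entry S x \<omega>)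
               (\<Pi>\<^sub>M x \<in> obs S. borel)))"

definition covariance :: "'a measure \<Rightarrow> ('a \<Rightarrow> real) \<Rightarrow> ('a \<Rightarrow> real) \<Rightarrow> real" where
  "covariance M Y Z = (\<integral>\<omega>. (Y \<omega> - (\<integral>\<omega>'. Y \<omega>' \<partial>M)) * (Z \<omega> - (\<integral>\<omega>'. Z \<omega>' \<partial>M)) \<partial>M)"

(* All rows have the same distribution, so the first row represents them. *)
definition cov_mat :: "'a stream_model \<Rightarrow> real mat" where
  "cov_mat S = mat (ncov S) (ncov S) (\<lambda>(k, l). covariance (psp S)
     (\<lambda>\<omega>. design S 1 \<omega> $$ (0, k)) (\<lambda>\<omega>. design S 1 \<omega> $$ (0, l)))"

definition prec_mat :: "'a stream_model \<Rightarrow> real mat" where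
  "prec_mat S = the (mat_inverse (cov_mat S))"

definition min_eigenvalue :: "real mat \<Rightarrow> real" where
  "min_eigenvalue A = Min (spectrum A)"

definition max_diag :: "real mat \<Rightarrow> real" where
  "max_diag A = Max ((\<lambda>k. A $$ (k, k)) ` {..<dim_row A})"

definition sparsity_coef :: "'a stream_model \<Rightarrow> nat" where
  "sparsity_coef S = card {k. k < ncov S \<and> beta0 S $ k \<noteq> 0}"

definition sparsity_prec :: "'a stream_model \<Rightarrow> nat \<Rightarrow> nat" where
  "sparsity_prec S r = card {k. k < ncov S \<and> k \<noteq> r \<and> prec_mat S $$ (k, r) \<noteq> 0}"

(* The level entering the rate conditions.  For sparsity 0 the unguarded conditions would be
   void for every beta0, although the remainder still depends on the sparsity of beta0. *)
definition sparsity_prec1 :: "'a stream_model \<Rightarrow> nat \<Rightarrow> nat" where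
  "sparsity_prec1 S r = max 1 (sparsity_prec S r)"

definition lasso_objective ::
  "'a stream_model \<Rightarrow> nat \<Rightarrow> real \<Rightarrow> (nat \<Rightarrow> real vec) \<Rightarrow> (nat \<Rightarrow> real mat) \<Rightarrow> real vec \<Rightarrow> real" where
  "lasso_objective S j l Y A v =
     1 / (2 * real (cumsize S j)) * (\<Sum>i = 1..j. (norm2 (Y i - A i *\<^sub>v v))\<^sup>2) + l * norm1 v"

definition random_vec :: "'a measure \<Rightarrow> nat \<Rightarrow> ('a \<Rightarrow> real vec) \<Rightarrow> bool" where
  "random_vec M d V \<longleftrightarrow> (\<forall>\<omega> \<in> space M. V \<omega> \<in> carrier_vec d) \<and>
     (\<forall>k<d. (\<lambda>\<omega>. V \<omega> $ k) \<in> borel_measurable M)"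

(* Lasso minimisers need not be unique: an estimator is any measurable choice of a minimiser. *)
definition online_lasso :: "'a stream_model \<Rightarrow> (nat \<Rightarrow> real) \<Rightarrow> ('a \<Rightarrow> real vec) \<Rightarrow> bool" where
  "online_lasso S l bhat \<longleftrightarrow> random_vec (psp S) (ncov S) bhat \<and>
     (\<forall>\<omega> \<in> space (psp S).
        is_arg_min
          (lasso_objective S (nbatch S) (l (nbatch S)) (\<lambda>i. response S i \<omega>) (\<lambda>i. design S i \<omega>))
          (\<lambda>v. v \<in> carrier_vec (ncov S)) (bhat \<omega>))"

definition nodewise_lasso ::
  "'a stream_model \<Rightarrow> nat \<Rightarrow> (nat \<Rightarrow> real) \<Rightarrow> (nat \<Rightarrow> 'a \<Rightarrow> real vec) \<Rightarrow> bool" where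
  "nodewise_lasso S r l ghat \<longleftrightarrow> (\<forall>j \<in> {1..nbatch S}. random_vec (psp S) (ncov S - 1) (ghat j) \<and>
     (\<forall>\<omega> \<in> space (psp S).
        is_arg_min
          (lasso_objective S j (l j) (\<lambda>i. col (design S i \<omega>) r) (\<lambda>i. drop_col r (design S i \<omega>)))
          (\<lambda>v. v \<in> carrier_vec (ncov S - 1)) (ghat j \<omega>)))"

definition zhat ::
  "'a stream_model \<Rightarrow> nat \<Rightarrow> (nat \<Rightarrow> 'a \<Rightarrow> real vec) \<Rightarrow> nat \<Rightarrow> 'a \<Rightarrow> real vec" where
  "zhat S r ghat j \<omega> = col (design S j \<omega>) r - drop_col r (design S j \<omega>) *\<^sub>v ghat j \<omega>"

definition odl_denom :: "'a stream_model \<Rightarrow> nat \<Rightarrow> (nat \<Rightarrow> 'a \<Rightarrow> real vec) \<Rightarrow> 'a \<Rightarrow> real" where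
  "odl_denom S r ghat \<omega> = (\<Sum>j = 1..nbatch S. zhat S r ghat j \<omega> \<bullet> col (design S j \<omega>) r)"

definition odl ::
  "'a stream_model \<Rightarrow> nat \<Rightarrow> ('a \<Rightarrow> real vec) \<Rightarrow> (nat \<Rightarrow> 'a \<Rightarrow> real vec) \<Rightarrow> 'a \<Rightarrow> real" where
  "odl S r bhat ghat \<omega> = bhat \<omega> $ r + inverse (odl_denom S r ghat \<omega>) *
     ((\<Sum>j = 1..nbatch S. zhat S r ghat j \<omega> \<bullet> response S j \<omega>) -
      (\<Sum>j = 1..nbatch S. zhat S r ghat j \<omega> \<bullet> (design S j \<omega> *\<^sub>v bhat \<omega>)))"

definition tau_hat :: "'a stream_model \<Rightarrow> nat \<Rightarrow> (nat \<Rightarrow> 'a \<Rightarrow> real vec) \<Rightarrow> 'a \<Rightarrow> real" where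
  "tau_hat S r ghat \<omega> =
     sqrt (\<Sum>j = 1..nbatch S. zhat S r ghat j \<omega> \<bullet> zhat S r ghat j \<omega>) / odl_denom S r ghat \<omega>"

definition W_stat :: "'a stream_model \<Rightarrow> nat \<Rightarrow> (nat \<Rightarrow> 'a \<Rightarrow> real vec) \<Rightarrow> 'a \<Rightarrow> real" where
  "W_stat S r ghat \<omega> =
     (stack (nbatch S) (\<lambda>j. zhat S r ghat j \<omega>) \<bullet> stack (nbatch S) (\<lambda>j. noise S j \<omega>))
       / norm2 (stack (nbatch S) (\<lambda>j. zhat S r ghat j \<omega>))"

definition little_o_P_1 :: "(nat \<Rightarrow> 'a measure) \<Rightarrow> (nat \<Rightarrow> 'a \<Rightarrow> real) \<Rightarrow> bool" where
  "little_o_P_1 M Z \<longleftrightarrow> (\<forall>m. Z m \<in> borel_measurable (M m)) \<and>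
     (\<forall>e>0. (\<lambda>m. measure (M m) {\<omega> \<in> space (M m). \<bar>Z m \<omega>\<bar> > e}) \<longlonglongrightarrow> 0)"

definition sub_gaussian_design :: "real \<Rightarrow> (nat \<Rightarrow> 'a stream_model) \<Rightarrow> bool" where
  "sub_gaussian_design K S \<longleftrightarrow> (\<forall>m. \<forall>(j, i) \<in> obs (S m).
     sub_gaussian_vec (psp (S m)) (ncov (S m)) K (\<lambda>\<omega>. row (design (S m) j \<omega>) i))"

(* L and D are the constants hidden in the two O(1) bounds. *)
definition bounded_covariance :: "real \<Rightarrow> real \<Rightarrow> (nat \<Rightarrow> 'a stream_model) \<Rightarrow> bool" where
  "bounded_covariance L D S \<longleftrightarrow> (\<forall>m. min_eigenvalue (cov_mat (S m)) > 0) \<and>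
     (\<forall>\<^sub>F m in sequentially. 1 / min_eigenvalue (cov_mat (S m)) \<le> L) \<and>
     (\<forall>\<^sub>F m in sequentially. max_diag (cov_mat (S m)) \<le> D)"

definition sub_exponential_noise :: "real \<Rightarrow> (nat \<Rightarrow> 'a stream_model) \<Rightarrow> bool" where
  "sub_exponential_noise E S \<longleftrightarrow> (\<forall>m. \<forall>x \<in> obs (S m). sub_exponential (psp (S m)) E (noise_entry (S m) x))"

end

theory Submission
  imports Defs
begin

text \<open>Let \<open>z\<close> be the stacked nodewise residuals.  The remainder \<open>\<Delta>\<close> is
  \<open>z\<^sup>T X\<^bsub>-r\<^esub> (\<beta>\<^sub>0 - \<beta>)\<^bsub>-r\<^esub> / \<parallel>z\<parallel>\<close> with the lasso \<open>\<beta>\<close>, hence at most the largest entry of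
  \<open>z\<^sup>T X\<^bsub>-r\<^esub>\<close> times the \<open>l\<^sub>1\<close> error of \<open>\<beta>\<close>, divided by \<open>\<parallel>z\<parallel>\<close>.  Batch \<open>j\<close> contributes to that entry
  at most \<open>n\<^sub>j G\<^sub>j\<close> times the \<open>l\<^sub>1\<close> error of the \<open>j\<close>-th nodewise lasso, where \<open>n\<^sub>j G\<^sub>j\<close> bounds the squared column
  norms of the batch, and to the squared distance of \<open>z\<close> from the population residuals at most \<open>n\<^sub>j G\<^sub>j\<close>
  times the square of that error (for \<open>j = 1\<close> the prediction error is used instead).  The rates
  then sum up by \<open>\<Sum> n\<^sub>j / \<surd>N\<^sub>j \<le> 2 \<surd>N\<^sub>b\<close> and \<open>\<Sum> n\<^sub>j / N\<^sub>j \<le> ln (N\<^sub>b / n\<^sub>1)\<close>, the second sum running over \<open>j \<ge> 2\<close>.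

  Neither \<open>p\<close> nor \<open>n\<^sub>1\<close> needs to grow and the number of batches is arbitrary, so the usual lasso bounds cannot
  hold in all batches simultaneously with high probability.  Instead each lasso error is bounded
  surely by its usual rate plus a term whose high moments are of the order of that rate, and only
  the expectations of the sums over the batches are used.

  Restricted eigenvalues come from the lower tail of the quadratic form on a finite net, transferred
  to all vectors by Maurey's method.  Given the noise, the scores of the main lasso are sub-Gaussian
  with variance proxy proportional to \<open>\<parallel>\<epsilon>\<parallel>\<^sup>2\<close>.\<close>

section \<open>Quadratic forms and Maurey's method\<close>

text \<open>The trivial bound on a lasso error, from comparing objectives, exceeds the usual rate by
  a factor of order up to \<open>1 / lam^2\<close>, hence up to the sample size. This is affordable
  where restricted eigenvalues fail, an event of exponentially small probability. Scores above half
  the penalty are not rare when \<open>p\<close> is bounded, so the size of the excess is measured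
  instead of its event: the penalty constant is taken so large that \<open>p^2\<close> times the
  squared excess over \<open>lam^2\<close> has a bounded eighth moment. The factor
  \<open>p^2\<close> removes the logarithm of \<open>p\<close> from terms that must be of order
  \<open>1 / N\<close>. The order eight comes from using the inequality between arithmetic and
  geometric means twice: column norms are paired with the square of a lasso deviation, which needs
  its fourth moment, and that deviation is a product of two variables. Of the lasso estimators only
  one property enters the bounds, that the objective there is at most its value at the true
  coefficients. For \<open>p = 1\<close> the penalty vanishes and the remainder is treated
  directly.\<close>

definition l1 :: "nat \<Rightarrow> (nat \<Rightarrow> real) \<Rightarrow> real" where
  "l1 p v = (\<Sum>k<p. \<bar>v k\<bar>)"

definition ip :: "nat \<Rightarrow> (nat \<Rightarrow> real) \<Rightarrow> (nat \<Rightarrow> real) \<Rightarrow> real" where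
  "ip p u v = (\<Sum>k<p. u k * v k)"

definition bil :: "nat \<Rightarrow> (nat \<Rightarrow> nat \<Rightarrow> real) \<Rightarrow> (nat \<Rightarrow> real) \<Rightarrow> (nat \<Rightarrow> real) \<Rightarrow> real" where
  "bil p A u v = (\<Sum>k<p. \<Sum>l<p. A k l * u k * v l)"

definition unit_fun :: "nat \<Rightarrow> nat \<Rightarrow> real" where
  "unit_fun k = (\<lambda>l. if l = k then 1 else 0)"

lemma ip_add_left: "ip p (\<lambda>k. u k + w k) v = ip p u v + ip p w v"
  by (simp add: ip_def sum.distrib algebra_simps)
lemma ip_add_right: "ip p v (\<lambda>k. u k + w k) = ip p v u + ip p v w"
  by (simp add: ip_def sum.distrib algebra_simps)
lemma ip_scale_left: "ip p (\<lambda>k. c * u k) v = c * ip p u v"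
  by (simp add: ip_def sum_distrib_left algebra_simps)
lemma ip_scale_right: "ip p v (\<lambda>k. c * u k) = c * ip p v u"
  by (simp add: ip_def sum_distrib_left algebra_simps)
lemma ip_diff_right: "ip p v (\<lambda>k. u k - w k) = ip p v u - ip p v w"
  by (simp add: ip_def sum_subtractf algebra_simps)
lemma ip_commute: "ip p u v = ip p v u"
  by (simp add: ip_def mult.commute)
lemma ip_self_nonneg: "0 \<le> ip p u u"
  by (simp add: ip_def sum_nonneg)
lemma l1_nonneg: "0 \<le> l1 p u"
  by (simp add: l1_def sum_nonneg)
lemma ip_self_sum: "ip p u u = (\<Sum>k<p. (u k)\<^sup>2)"
  by (simp add: ip_def power2_eq_square)

lemma ip_unit: "k < p \<Longrightarrow> ip p u (unit_fun k) = u k"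
  by (simp add: ip_def unit_fun_def if_distrib[of "\<lambda>t. _ * t"] cong: if_cong)

lemma ip_unit_unit: "k < p \<Longrightarrow> ip p (unit_fun k) (unit_fun k) = 1"
  using ip_unit[of k p "unit_fun k"] by (simp add: unit_fun_def)

lemma bil_add_left: "bil p A (\<lambda>k. u k + w k) v = bil p A u v + bil p A w v"
  by (simp add: bil_def sum.distrib algebra_simps)

lemma bil_scale_left: "bil p A (\<lambda>k. c * u k) v = c * bil p A u v"
  by (simp add: bil_def sum_distrib_left algebra_simps)

lemma bil_commute:
  assumes "\<And>k l. k < p \<Longrightarrow> l < p \<Longrightarrow> A k l = A l k"
  shows "bil p A u v = bil p A v u"
  unfolding bil_def by (subst sum.swap, intro sum.cong refl) (auto simp: assms mult_ac)

lemma bil_unit_left: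
  assumes "k < p"
  shows "bil p A (unit_fun k) v = (\<Sum>l<p. A k l * v l)"
  unfolding bil_def unit_fun_def
  using assms by (simp add: if_distrib[of "\<lambda>t. _ * t * _"] if_distrib[of sum] sum.delta cong: if_cong)
     (subst sum.remove[of _ k]; simp)

lemma bil_unit_unit:
  assumes "k < p"
  shows "bil p A (unit_fun k) (unit_fun k) = A k k"
  unfolding bil_unit_left[OF assms] using assms by (simp add: unit_fun_def if_distrib[of "\<lambda>t. _ * t"] cong: if_cong)

lemma bil_sum_left: "(\<Sum>k<p. c k * bil p A (unit_fun k) v) = bil p A c v"
proof -
  have "(\<Sum>k<p. c k * bil p A (unit_fun k) v) = (\<Sum>k<p. c k * (\<Sum>l<p. A k l * v l))"
    by (intro sum.cong refl) (simp add: bil_unit_left)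
  then show ?thesis by (simp add: bil_def sum_distrib_left mult_ac)
qed

lemma l1_le_card_ip:
  assumes "card {k. k < p \<and> v k \<noteq> 0} \<le> s"
  shows "l1 p v \<le> sqrt (real s) * sqrt (ip p v v)"
proof -
  let ?S = "{k. k < p \<and> v k \<noteq> 0}"
  have "l1 p v = (\<Sum>k\<in>?S. \<bar>v k\<bar> * 1)"
    unfolding l1_def by (simp, rule sum.mono_neutral_right) auto
  also have "\<dots> \<le> L2_set v ?S * L2_set (\<lambda>_. 1) ?S"
    using L2_set_mult_ineq[of v "\<lambda>_. 1" ?S] by simp
  also have "L2_set (\<lambda>_. 1) ?S = sqrt (real (card ?S))" by (simp add: L2_set_def)
  also have "L2_set v ?S = sqrt (ip p v v)"
    unfolding L2_set_def ip_self_sum by (intro arg_cong[of _ _ sqrt] sum.mono_neutral_left) auto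
  also have "sqrt (ip p v v) * sqrt (real (card ?S)) \<le> sqrt (ip p v v) * sqrt (real s)"
    by (intro mult_left_mono) (use assms ip_self_nonneg in auto)
  finally show ?thesis by (simp add: mult.commute)
qed

text \<open>The net of Maurey's empirical method.\<close>

fun signed_sums :: "nat \<Rightarrow> nat \<Rightarrow> (nat \<Rightarrow> real) set" where
  "signed_sums p 0 = {\<lambda>_. 0}"
| "signed_sums p (Suc d) = (\<lambda>((k, s), w). \<lambda>l. s * unit_fun k l + w l) ` (({..<p} \<times> {-1, 1}) \<times> signed_sums p d)"

lemma finite_signed_sums: "finite (signed_sums p d)"
  by (induction d) auto

lemma card_signed_sums: "card (signed_sums p d) \<le> (2 * p) ^ d"
proof (induction d)
  case (Suc d)
  have "card (signed_sums p (Suc d)) \<le> card (({..<p} \<times> {-1, 1::real}) \<times> signed_sums p d)"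
    unfolding signed_sums.simps by (intro card_image_le finite_cartesian_product finite_signed_sums) auto
  also have "\<dots> = (p * 2) * card (signed_sums p d)" by (simp add: card_cartesian_product)
  finally show ?case using Suc by (simp add: mult.commute mult_le_mono order.trans)
qed simp

text \<open>The probabilistic method reduced to a finite weighted mean: some atom does no worse than
  the average, so random basis vectors can be chosen one at a time.\<close>

lemma exists_le_weighted_mean:
  fixes c f :: "nat \<Rightarrow> real"
  assumes "\<And>k. k < p \<Longrightarrow> 0 \<le> c k" "(\<Sum>k<p. c k) = 1"
  shows "\<exists>k<p. f k \<le> (\<Sum>k<p. c k * f k)"
proof (rule ccontr)
  assume *: "\<not> ?thesis"
  define m where "m = (\<Sum>k<p. c k * f k)"
  have gt: "f k > m" if "k < p" for k using * that unfolding m_def by force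
  obtain k0 where k0: "k0 < p" "c k0 > 0"
  proof -
    have "\<exists>k<p. c k \<noteq> 0" using assms(2) by (metis lessThan_iff sum.neutral zero_neq_one)
    then show ?thesis using that assms(1) by (metis order_less_le)
  qed
  have "(\<Sum>k<p. c k * m) < (\<Sum>k<p. c k * f k)"
  proof (rule sum_strict_mono_ex1)
    show "\<forall>k\<in>{..<p}. c k * m \<le> c k * f k"
      using gt assms(1) by (meson lessThan_iff less_imp_le mult_left_mono)
    show "\<exists>k\<in>{..<p}. c k * m < c k * f k"
      using gt k0 by (intro bexI[of _ k0]) auto
  qed simp
  then show False using assms(2) by (simp add: m_def flip: sum_distrib_right)
qed

text \<open>The right-hand side is the expected value of the form at \<open>a\<close> plus \<open>j\<close> independent random
  signed basis vectors with mean \<open>v\<close>.\<close>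

lemma maurey_selection:
  assumes sym: "\<And>k l. k < p \<Longrightarrow> l < p \<Longrightarrow> A k l = A l k" and one: "l1 p v = 1"
  shows "\<exists>w\<in>signed_sums p j. bil p A (\<lambda>k. a k + w k) (\<lambda>k. a k + w k)
     \<le> bil p A a a + 2 * real j * bil p A a v + real j * (\<Sum>k<p. \<bar>v k\<bar> * A k k)
        + real j * (real j - 1) * bil p A v v"
proof (induction j arbitrary: a)
  case 0
  then show ?case by simp
next
  case (Suc j)
  let ?B = "bil p A"
  define \<tau> where "\<tau> = (\<Sum>k<p. \<bar>v k\<bar> * A k k)"
  \<comment> \<open>Signed basis vectors whose mean under the weights \<open>|v k|\<close> is
    \<open>v\<close>.\<close>
  define e where "e k = (\<lambda>l. (if v k < 0 then -1 else 1) * unit_fun k l)" for k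
  \<comment> \<open>The part of the induction bound that depends on \<open>k\<close>, once the first
    vector is fixed to \<open>e k\<close>.\<close>
  define f where "f k = ?B (\<lambda>l. a l + e k l) (\<lambda>l. a l + e k l) + 2 * real j * ?B (\<lambda>l. a l + e k l) v" for k
  note bs = bil_add_left bil_scale_left
  have addr: "?B u (\<lambda>l. w l + z l) = ?B u w + ?B u z" for u w z
    by (subst (1 2 3) bil_commute[OF sym]) (auto simp: bs)
  have fe: "f k = ?B a a + 2 * ?B (e k) a + A k k + 2 * real j * ?B a v + 2 * real j * ?B (e k) v" if "k < p" for k
  proof -
    have "?B (e k) (e k) = A k k"
    proof -
      have "?B (e k) (e k) = (if v k < 0 then -1 else 1) * ?B (e k) (unit_fun k)"
        unfolding e_def by (subst (1 2) bil_commute[OF sym]) (auto simp: bil_scale_left[of _ _ "-1", simplified] bil_scale_left[of _ _ "1", simplified])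
      also have "?B (e k) (unit_fun k) = (if v k < 0 then -1 else 1) * ?B (unit_fun k) (unit_fun k)"
        unfolding e_def by (rule bil_scale_left)
      finally show ?thesis using bil_unit_unit[OF that] by auto
    qed
    moreover have "?B a (e k) = ?B (e k) a" by (rule bil_commute) (rule sym)
    ultimately show ?thesis unfolding f_def by (simp add: bs addr algebra_simps)
  qed
  have wt: "(\<Sum>k<p. \<bar>v k\<bar> * ?B (e k) u) = ?B v u" for u
  proof -
    have "\<bar>v k\<bar> * ?B (e k) u = v k * ?B (unit_fun k) u" for k
      unfolding e_def bil_scale_left by auto
    then show ?thesis by (simp add: bil_sum_left)
  qed
  have c1: "(\<Sum>k<p. \<bar>v k\<bar>) = 1" using one by (simp add: l1_def)
  have "(\<Sum>k<p. \<bar>v k\<bar> * f k) = (\<Sum>k<p. \<bar>v k\<bar> * (?B a a + 2 * real j * ?B a v) + 2 * (\<bar>v k\<bar> * ?B (e k) a)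
      + \<bar>v k\<bar> * A k k + 2 * real j * (\<bar>v k\<bar> * ?B (e k) v))"
    by (intro sum.cong refl) (simp add: fe algebra_simps)
  also have "\<dots> = (?B a a + 2 * real j * ?B a v) + 2 * ?B v a + \<tau> + 2 * real j * ?B v v"
    by (simp add: sum.distrib wt \<tau>_def c1 flip: sum_distrib_left sum_distrib_right)
  finally have mean: "(\<Sum>k<p. \<bar>v k\<bar> * f k) = ?B a a + 2 * real (Suc j) * ?B a v + \<tau> + 2 * real j * ?B v v"
    using bil_commute[of p A v a, OF sym] by (simp add: algebra_simps)
  obtain k where k: "k < p" "f k \<le> (\<Sum>k<p. \<bar>v k\<bar> * f k)"
    using exists_le_weighted_mean[of p "\<lambda>k. \<bar>v k\<bar>" f] c1 by auto
  obtain w where w: "w \<in> signed_sums p j" "?B (\<lambda>l. (a l + e k l) + w l) (\<lambda>l. (a l + e k l) + w l)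
     \<le> ?B (\<lambda>l. a l + e k l) (\<lambda>l. a l + e k l) + 2 * real j * ?B (\<lambda>l. a l + e k l) v + real j * \<tau>
        + real j * (real j - 1) * ?B v v"
    using Suc[of "\<lambda>l. a l + e k l"] unfolding \<tau>_def by blast
  have mem: "(\<lambda>l. e k l + w l) \<in> signed_sums p (Suc j)"
    unfolding signed_sums.simps e_def
    by (rule image_eqI[of _ _ "((k, if v k < 0 then -1 else 1), w)"]) (use w(1) k(1) in auto)
  have "?B (\<lambda>l. a l + (e k l + w l)) (\<lambda>l. a l + (e k l + w l)) \<le> f k + real j * \<tau> + real j * (real j - 1) * ?B v v"
    using w(2) unfolding f_def by (simp add: add.assoc)
  also have "\<dots> \<le> ?B a a + 2 * real (Suc j) * ?B a v + \<tau> + 2 * real j * ?B v v + real j * \<tau> + real j * (real j - 1) * ?B v v"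
    using k(2) mean by linarith
  also have "\<dots> = ?B a a + 2 * real (Suc j) * ?B a v + real (Suc j) * \<tau> + real (Suc j) * (real (Suc j) - 1) * ?B v v"
    by (simp add: algebra_simps)
  finally show ?case using mem unfolding \<tau>_def by (intro bexI[of _ "\<lambda>l. e k l + w l"])
qed

text \<open>For a vector \<open>u\<close> of l1 norm \<open>1\<close>, the selection finds a net
  point whose form is at most \<open>d * m + d * (d - 1) * bil p A u u\<close>. Nonnegativity there
  bounds the form at \<open>u\<close> from below, so a finite check controls all vectors up to an l1
  term.\<close>

lemma maurey_lower_bound:
  assumes sym: "\<And>k l. k < p \<Longrightarrow> l < p \<Longrightarrow> A k l = A l k" and d: "d \<ge> 2"
    and nonneg: "\<And>w. w \<in> signed_sums p d \<Longrightarrow> 0 \<le> bil p A w w"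
    and diag: "\<And>k. k < p \<Longrightarrow> A k k \<le> m"
  shows "bil p A v v \<ge> - (m / (real d - 1)) * (l1 p v)\<^sup>2"
proof (cases "l1 p v = 0")
  case True
  then have "v k = 0" if "k < p" for k
    using that unfolding l1_def by (subst (asm) sum_nonneg_eq_0_iff) auto
  then show ?thesis using True by (simp add: bil_def)
next
  case False
  define c where "c = l1 p v"
  have c: "c > 0" using False l1_nonneg[of p v] by (simp add: c_def)
  define u where "u = (\<lambda>k. v k / c)"
  have u1: "l1 p u = 1" using c unfolding u_def l1_def c_def by (simp add: l1_def flip: sum_divide_distrib)
  have vu: "bil p A v v = c\<^sup>2 * bil p A u u"
    using c unfolding u_def bil_def by (simp add: sum_distrib_left power2_eq_square)
  obtain w where w: "w \<in> signed_sums p d" "bil p A w w \<le> real d * (\<Sum>k<p. \<bar>u k\<bar> * A k k) + real d * (real d - 1) * bil p A u u"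
    using maurey_selection[of p A u d "\<lambda>_. 0", OF sym u1] by (auto simp: bil_def)
  have "(\<Sum>k<p. \<bar>u k\<bar> * A k k) \<le> (\<Sum>k<p. \<bar>u k\<bar> * m)"
    by (intro sum_mono mult_left_mono) (use diag in auto)
  also have "\<dots> = m" using u1 by (simp add: l1_def flip: sum_distrib_right)
  finally have "0 \<le> real d * (m + (real d - 1) * bil p A u u)"
    using w nonneg[OF w(1)] mult_left_mono[of "\<Sum>k<p. \<bar>u k\<bar> * A k k" m "real d"] by (simp add: algebra_simps)
  then have "0 \<le> m + (real d - 1) * bil p A u u" using d by (simp add: zero_le_mult_iff)
  then have "bil p A u u \<ge> - (m / (real d - 1))" using d by (simp add: field_simps)
  then have "c\<^sup>2 * bil p A u u \<ge> c\<^sup>2 * - (m / (real d - 1))" by (intro mult_left_mono) auto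
  then show ?thesis using vu by (simp add: c_def mult.commute)
qed

section \<open>Deterministic lasso bounds\<close>

text \<open>The squared excess of the scores \<open>T\<close> over half the penalty level.  The event that it vanishes need
  not have probability close to 1, since \<open>p\<close> may stay bounded.\<close>

definition excess :: "nat \<Rightarrow> real \<Rightarrow> (nat \<Rightarrow> real) \<Rightarrow> real" where
  "excess p l T = (\<Sum>k<p. (max 0 (\<bar>T k\<bar> - l / 2))\<^sup>2)"

lemma excess_nonneg: "0 \<le> excess p l T"
  by (simp add: excess_def sum_nonneg)

text \<open>The scores are cut at half the penalty level: the part below pairs with the l1 norm, the
  part above is bounded by Cauchy-Schwarz.\<close>

lemma ip_le_excess:
  "\<bar>ip p T v\<bar> \<le> l / 2 * l1 p v + sqrt (excess p l T) * sqrt (ip p v v)"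
proof -
  let ?q = "\<lambda>k. max 0 (\<bar>T k\<bar> - l / 2)"
  have "\<bar>ip p T v\<bar> \<le> (\<Sum>k<p. \<bar>T k * v k\<bar>)"
    unfolding ip_def by (rule sum_abs)
  also have "\<dots> \<le> (\<Sum>k<p. l / 2 * \<bar>v k\<bar> + \<bar>?q k\<bar> * \<bar>v k\<bar>)"
  proof (rule sum_mono)
    fix k
    have "\<bar>T k\<bar> \<le> l / 2 + \<bar>?q k\<bar>" by auto
    from mult_right_mono[OF this, of "\<bar>v k\<bar>"]
    show "\<bar>T k * v k\<bar> \<le> l / 2 * \<bar>v k\<bar> + \<bar>?q k\<bar> * \<bar>v k\<bar>" by (simp add: abs_mult algebra_simps)
  qed
  also have "\<dots> = l / 2 * l1 p v + (\<Sum>k<p. \<bar>?q k\<bar> * \<bar>v k\<bar>)"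
    by (simp add: sum.distrib l1_def sum_distrib_left)
  also have "(\<Sum>k<p. \<bar>?q k\<bar> * \<bar>v k\<bar>) \<le> L2_set ?q {..<p} * L2_set v {..<p}"
    by (rule L2_set_mult_ineq)
  finally show ?thesis by (simp add: L2_set_def excess_def ip_self_sum)
qed

text \<open>Everything is deterministic, at one sample point. \<open>opt\<close> compares the
  objective at the estimate \<open>b\<close> with that at the true \<open>\<beta>\<close>. The array
  \<open>x\<close> is arbitrary, so a nodewise regression fits in with the regressed column replaced
  by zero.\<close>

locale lasso_point =
  fixes p :: nat and J :: "'i set" and N lam :: real and x :: "'i \<Rightarrow> nat \<Rightarrow> real"
    and \<beta> b :: "nat \<Rightarrow> real" and e :: "'i \<Rightarrow> real" and s :: nat
  assumes N: "N > 0" and lam: "lam > 0"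
    and sparse: "card {k. k < p \<and> \<beta> k \<noteq> 0} \<le> s"
    and opt: "(1 / (2 * N)) * (\<Sum>i\<in>J. (ip p (x i) \<beta> + e i - ip p (x i) b)\<^sup>2) + lam * l1 p b
       \<le> (1 / (2 * N)) * (\<Sum>i\<in>J. (e i)\<^sup>2) + lam * l1 p \<beta>"
begin

definition "\<delta> = (\<lambda>k. b k - \<beta> k)"
definition "P = (1 / N) * (\<Sum>i\<in>J. (ip p (x i) \<delta>)\<^sup>2)"
definition "V = (1 / N) * (\<Sum>i\<in>J. (e i)\<^sup>2)"
definition "T k = (1 / N) * (\<Sum>i\<in>J. e i * x i k)"
abbreviation "R \<equiv> excess p lam T"

lemma residual: "ip p (x i) \<beta> + e i - ip p (x i) b = e i - ip p (x i) \<delta>"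
  by (simp add: \<delta>_def ip_diff_right)

lemma P_nonneg: "0 \<le> P" and V_nonneg: "0 \<le> V"
  using N by (simp_all add: P_def V_def sum_nonneg)

lemma ip_T: "ip p T v = (1 / N) * (\<Sum>i\<in>J. e i * ip p (x i) v)"
  unfolding ip_def T_def by (simp add: sum_distrib_left sum_distrib_right mult_ac, subst sum.swap) simp

text \<open>Outside the support of \<open>\<beta>\<close> the terms of
  \<open>l1 p \<delta> + l1 p \<beta> - l1 p b\<close> vanish, on it they are at most twice the
  error, and \<open>l1_le_card_ip\<close> turns the support size into \<open>sqrt s\<close>. Half of
  the penalty absorbs the scores, the other half keeps the l1 error on the left.\<close>

lemma basic_ineq:
  "P / 2 + lam / 2 * l1 p \<delta> \<le> (2 * lam * sqrt (real s) + sqrt R) * sqrt (ip p \<delta> \<delta>)"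
proof -
  have "(\<Sum>i\<in>J. (e i - ip p (x i) \<delta>)\<^sup>2)
      = (\<Sum>i\<in>J. (e i)\<^sup>2) - 2 * (\<Sum>i\<in>J. e i * ip p (x i) \<delta>) + (\<Sum>i\<in>J. (ip p (x i) \<delta>)\<^sup>2)"
    by (simp add: power2_diff sum.distrib sum_subtractf sum_distrib_left algebra_simps)
  also have "\<dots> = (\<Sum>i\<in>J. (e i)\<^sup>2) - 2 * N * ip p T \<delta> + N * P"
    using N by (simp add: ip_T P_def)
  finally have eq: "(1 / (2 * N)) * (\<Sum>i\<in>J. (e i - ip p (x i) \<delta>)\<^sup>2)
      = (1 / (2 * N)) * (\<Sum>i\<in>J. (e i)\<^sup>2) - ip p T \<delta> + P / 2"
    using N by (simp add: field_simps)
  have "P / 2 \<le> ip p T \<delta> + lam * (l1 p \<beta> - l1 p b)"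
    using opt unfolding residual eq by (simp add: algebra_simps)
  also have "ip p T \<delta> \<le> lam / 2 * l1 p \<delta> + sqrt R * sqrt (ip p \<delta> \<delta>)"
    using ip_le_excess[of p T \<delta> lam] by linarith
  finally have 1: "P / 2 + lam / 2 * l1 p \<delta> \<le> lam * (l1 p \<delta> + l1 p \<beta> - l1 p b) + sqrt R * sqrt (ip p \<delta> \<delta>)"
    by (simp add: algebra_simps)
  define \<eta> where "\<eta> k = (if \<beta> k = 0 then 0 else \<delta> k)" for k
  have "l1 p \<delta> + l1 p \<beta> - l1 p b = (\<Sum>k<p. \<bar>\<delta> k\<bar> + \<bar>\<beta> k\<bar> - \<bar>b k\<bar>)"
    by (simp add: l1_def sum.distrib sum_subtractf)
  also have "\<dots> \<le> (\<Sum>k<p. 2 * \<bar>\<eta> k\<bar>)"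
    by (rule sum_mono) (auto simp: \<eta>_def \<delta>_def)
  also have "\<dots> = 2 * l1 p \<eta>" by (simp add: l1_def sum_distrib_left)
  also have "l1 p \<eta> \<le> sqrt (real s) * sqrt (ip p \<eta> \<eta>)"
  proof (rule l1_le_card_ip)
    have "card {k. k < p \<and> \<eta> k \<noteq> 0} \<le> card {k. k < p \<and> \<beta> k \<noteq> 0}"
      by (rule card_mono) (auto simp: \<eta>_def)
    then show "card {k. k < p \<and> \<eta> k \<noteq> 0} \<le> s" using sparse by linarith
  qed
  also have "sqrt (ip p \<eta> \<eta>) \<le> sqrt (ip p \<delta> \<delta>)"
    unfolding ip_self_sum by (intro real_sqrt_le_mono sum_mono) (auto simp: \<eta>_def)
  finally have "l1 p \<delta> + l1 p \<beta> - l1 p b \<le> 2 * (sqrt (real s) * sqrt (ip p \<delta> \<delta>))"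
    by (simp add: mult_left_mono)
  then have "lam * (l1 p \<delta> + l1 p \<beta> - l1 p b) \<le> lam * (2 * (sqrt (real s) * sqrt (ip p \<delta> \<delta>)))"
    using lam by (intro mult_left_mono) auto
  with 1 show ?thesis by (simp add: algebra_simps)
qed

text \<open>Let \<open>M = 2 * lam * sqrt s + sqrt R\<close> and let \<open>h\<close> be the l2 norm
  of the error. The basic inequality bounds \<open>lam\<close> times the l1 error by
  \<open>2 * M * h\<close>; under \<open>small\<close> the negative term of the eigenvalue condition
  therefore takes away at most half of \<open>kap * h^2\<close>.\<close>

lemma fast_rate:
  assumes kap: "kap > 0" and a: "a \<ge> 0"
    and RE: "kap * ip p \<delta> \<delta> - a * (l1 p \<delta>)\<^sup>2 \<le> P"
    and small: "a * (8 * lam\<^sup>2 * real s + 2 * R) \<le> kap * lam\<^sup>2 / 8"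
  shows "l1 p \<delta> \<le> 2 * (8 * lam\<^sup>2 * real s + 2 * R) / (kap * lam)"
    and "P \<le> 8 * (8 * lam\<^sup>2 * real s + 2 * R) / kap"
proof -
  define M where "M = 2 * lam * sqrt (real s) + sqrt R"
  define h where "h = sqrt (ip p \<delta> \<delta>)"
  define l where "l = l1 p \<delta>"
  have h0: "h \<ge> 0" and h2: "h\<^sup>2 = ip p \<delta> \<delta>" by (auto simp: h_def ip_self_nonneg)
  have l0: "l \<ge> 0" by (simp add: l_def l1_nonneg)
  have M0: "M \<ge> 0" using lam by (simp add: M_def excess_nonneg)
  have M2: "M\<^sup>2 \<le> 8 * lam\<^sup>2 * real s + 2 * R"
  proof -
    have "M\<^sup>2 \<le> 2 * (2 * lam * sqrt (real s))\<^sup>2 + 2 * (sqrt R)\<^sup>2"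
      unfolding M_def using sum_squares_bound[of "2 * lam * sqrt (real s)" "sqrt R"] by (simp add: power2_sum)
    then show ?thesis by (simp add: power_mult_distrib excess_nonneg)
  qed
  have basic: "P / 2 + lam / 2 * l \<le> M * h"
    using basic_ineq by (simp add: M_def h_def l_def)
  have "lam * l \<le> 2 * (M * h)" using basic P_nonneg by linarith
  then have "(lam * l)\<^sup>2 \<le> (2 * (M * h))\<^sup>2" using lam l0 by (intro power_mono) auto
  then have "a * (lam * l)\<^sup>2 \<le> a * (2 * (M * h))\<^sup>2" using a by (rule mult_left_mono)
  also have "\<dots> = 4 * h\<^sup>2 * (a * M\<^sup>2)" by (simp add: power_mult_distrib)
  also have "\<dots> \<le> 4 * h\<^sup>2 * (kap * lam\<^sup>2 / 8)"
    using small mult_left_mono[OF M2 a] by (intro mult_left_mono) auto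
  finally have "lam\<^sup>2 * (a * l\<^sup>2) \<le> lam\<^sup>2 * (kap * h\<^sup>2 / 2)" by (simp add: power_mult_distrib mult_ac)
  then have "a * l\<^sup>2 \<le> kap * h\<^sup>2 / 2" using lam by simp
  with RE have P: "kap * h\<^sup>2 / 2 \<le> P" unfolding h2 l_def by simp
  \<comment> \<open>Young's inequality; \<open>P / 2\<close> is at least
    \<open>kap * h^2 / 4\<close> and absorbs the quadratic part.\<close>
  have "M * h - kap * h\<^sup>2 / 4 \<le> M\<^sup>2 / kap"
  proof -
    have "0 \<le> (2 * M - kap * h)\<^sup>2" by simp
    then show ?thesis using kap by (simp add: field_simps power2_eq_square)
  qed
  then have "lam / 2 * l \<le> M\<^sup>2 / kap" using basic P by linarith
  also have "\<dots> \<le> (8 * lam\<^sup>2 * real s + 2 * R) / kap" using M2 kap by (intro divide_right_mono) auto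
  finally show "l1 p \<delta> \<le> 2 * (8 * lam\<^sup>2 * real s + 2 * R) / (kap * lam)"
    using lam kap unfolding l_def by (simp add: field_simps)
  have "0 \<le> lam / 2 * l" using lam l0 by simp
  then have Ph: "P \<le> 2 * (M * h)" using basic by linarith
  have "h \<le> 4 * M / kap"
  proof (cases "h = 0")
    case True then show ?thesis using M0 kap by simp
  next
    case False
    then have "h > 0" using h0 by simp
    moreover have "h * (kap * h) \<le> h * (4 * M)" using P Ph by (simp add: power2_eq_square algebra_simps)
    ultimately have "kap * h \<le> 4 * M" by simp
    then show ?thesis using kap by (simp add: field_simps)
  qed
  then have "2 * (M * h) \<le> 2 * (M * (4 * M / kap))" using M0 by (intro mult_left_mono) auto
  also have "\<dots> = 8 * M\<^sup>2 / kap" by (simp add: power2_eq_square)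
  also have "\<dots> \<le> 8 * (8 * lam\<^sup>2 * real s + 2 * R) / kap" using M2 kap by (intro divide_right_mono) auto
  finally show "P \<le> 8 * (8 * lam\<^sup>2 * real s + 2 * R) / kap" using Ph by linarith
qed

text \<open>This is the trivial bound: nonnegative terms of the two objectives are dropped. It
  serves the samples where the eigenvalue condition fails or the excess is too large for
  \<open>fast_rate\<close>.\<close>

lemma slow_rate:
  "l1 p \<delta> \<le> V / (2 * lam) + 2 * l1 p \<beta>" "P \<le> 4 * V + 4 * lam * l1 p \<beta>"
proof -
  define W where "W = (1 / N) * (\<Sum>i\<in>J. (e i - ip p (x i) \<delta>)\<^sup>2)"
  have W0: "W \<ge> 0" using N by (simp add: W_def sum_nonneg)
  have main: "W / 2 + lam * l1 p b \<le> V / 2 + lam * l1 p \<beta>"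
    using opt unfolding residual by (simp add: W_def V_def)
  have "lam * l1 p b \<le> V / 2 + lam * l1 p \<beta>" using main W0 by linarith
  then have "l1 p b \<le> V / (2 * lam) + l1 p \<beta>" using lam by (simp add: field_simps)
  moreover have "l1 p \<delta> \<le> l1 p b + l1 p \<beta>"
    unfolding l1_def \<delta>_def sum.distrib[symmetric] by (rule sum_mono) (rule abs_triangle_ineq4)
  ultimately show "l1 p \<delta> \<le> V / (2 * lam) + 2 * l1 p \<beta>" by linarith
  have "(\<Sum>i\<in>J. (ip p (x i) \<delta>)\<^sup>2) \<le> (\<Sum>i\<in>J. 2 * (e i)\<^sup>2 + 2 * (e i - ip p (x i) \<delta>)\<^sup>2)"
  proof (rule sum_mono)
    fix i
    have "0 \<le> (2 * e i - ip p (x i) \<delta>)\<^sup>2" by simp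
    then show "(ip p (x i) \<delta>)\<^sup>2 \<le> 2 * (e i)\<^sup>2 + 2 * (e i - ip p (x i) \<delta>)\<^sup>2"
      by (simp add: power2_eq_square algebra_simps)
  qed
  then have "(1 / N) * (\<Sum>i\<in>J. (ip p (x i) \<delta>)\<^sup>2) \<le> (1 / N) * (\<Sum>i\<in>J. 2 * (e i)\<^sup>2 + 2 * (e i - ip p (x i) \<delta>)\<^sup>2)"
    using N by (intro mult_left_mono) auto
  then have "P \<le> 2 * V + 2 * W"
    by (simp add: P_def V_def W_def sum.distrib add_divide_distrib flip: sum_distrib_left)
  moreover have "0 \<le> lam * l1 p b" using lam l1_nonneg[of p b] by (intro mult_nonneg_nonneg) linarith+
  then have "W \<le> V + 2 * (lam * l1 p \<beta>)" using main by linarith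
  ultimately show "P \<le> 4 * V + 4 * lam * l1 p \<beta>" by (simp add: algebra_simps)
qed

end

section \<open>Sums of batch sizes weighted by cumulative sizes\<close>

text \<open>Each term is at most the increment of \<open>2 * sqrt\<close> between consecutive
  totals: with \<open>r\<close> and \<open>q\<close> the square roots of the totals,
  \<open>r^2 - q^2 <= r * (2 * r - 2 * q)\<close> amounts to \<open>0 <= (r - q)^2\<close>.\<close>

lemma sum_size_over_sqrt:
  fixes n :: "nat \<Rightarrow> nat"
  assumes "n 1 \<ge> 1"
  shows "(\<Sum>j=1..b. real (n j) / sqrt (real (\<Sum>i=1..j. n i))) \<le> 2 * sqrt (real (\<Sum>i=1..b. n i))"
proof (induction b)
  case (Suc b)
  define u where "u = real (\<Sum>i=1..b. n i)"
  define m where "m = real (n (Suc b))"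
  have S: "real (\<Sum>i=1..Suc b. n i) = u + m" by (simp add: u_def m_def)
  have "n 1 \<le> (\<Sum>i=1..Suc b. n i)" by (rule member_le_sum) auto
  then have pos: "u + m > 0" using assms S by linarith
  have u0: "u \<ge> 0" and m0: "m \<ge> 0" by (simp_all add: u_def m_def sum_nonneg)
  have "m / sqrt (u + m) + 2 * sqrt u \<le> 2 * sqrt (u + m)"
  proof -
    define r q where "r = sqrt (u + m)" and "q = sqrt u"
    have r: "r > 0" "r\<^sup>2 = u + m" and q: "q\<^sup>2 = u" using pos u0 by (auto simp: r_def q_def)
    have "0 \<le> (r - q)\<^sup>2" by simp
    then have "m \<le> r * (2 * r - 2 * q)" using r q by (simp add: power2_eq_square algebra_simps)
    then show ?thesis unfolding r_def[symmetric] q_def[symmetric] using r(1) by (simp add: field_simps)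
  qed
  moreover have "(\<Sum>j=1..Suc b. real (n j) / sqrt (real (\<Sum>i=1..j. n i)))
     = (\<Sum>j=1..b. real (n j) / sqrt (real (\<Sum>i=1..j. n i))) + m / sqrt (u + m)"
    using S by (simp add: m_def)
  ultimately show ?case using Suc unfolding S by (simp add: u_def)
qed simp

text \<open>Each term is at most the increment of the logarithm of the total. The sum starts at
  \<open>2\<close> because the term at \<open>1\<close> equals \<open>1\<close>, while the
  right-hand side vanishes for \<open>b = 1\<close>.\<close>

lemma sum_size_over_total:
  fixes n :: "nat \<Rightarrow> nat"
  assumes "n 1 \<ge> 1" "b \<ge> 1"
  shows "(\<Sum>j=2..b. real (n j) / real (\<Sum>i=1..j. n i)) \<le> ln (real (\<Sum>i=1..b. n i) / real (n 1))"
  using assms(2)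
proof (induction b rule: dec_induct)
  case base
  then show ?case using assms(1) by simp
next
  case (step b)
  define u where "u = real (\<Sum>i=1..b. n i)"
  define m where "m = real (n (Suc b))"
  have S: "real (\<Sum>i=1..Suc b. n i) = u + m" by (simp add: u_def m_def)
  have "n 1 \<le> (\<Sum>i=1..b. n i)" using step by (intro member_le_sum) auto
  then have u: "u > 0" using assms unfolding u_def by linarith
  have m0: "m \<ge> 0" by (simp add: m_def)
  have n1: "real (n 1) > 0" using assms by simp
  have "ln (u / (u + m)) \<le> u / (u + m) - 1" using u m0 by (intro ln_le_minus_one) auto
  then have "m / (u + m) \<le> ln ((u + m) / u)" using u m0 by (simp add: ln_div field_simps)
  also have "\<dots> = ln ((u + m) / real (n 1)) - ln (u / real (n 1))" using u m0 n1 by (simp add: ln_div)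
  finally have 1: "m / (u + m) + ln (u / real (n 1)) \<le> ln ((u + m) / real (n 1))" by simp
  have "(\<Sum>j=2..Suc b. real (n j) / real (\<Sum>i=1..j. n i)) = (\<Sum>j=2..b. real (n j) / real (\<Sum>i=1..j. n i)) + m / (u + m)"
    using S step by (simp add: m_def)
  then show ?case using step.IH 1 unfolding S u_def[symmetric] by linarith
qed

section \<open>Moments and tails\<close>

text \<open>A bound on the Bochner integral alone is void for a non-integrable function, whose
  integral is \<open>0\<close> by convention; hence the conjunction.\<close>

definition mean_le :: "'a measure \<Rightarrow> ('a \<Rightarrow> real) \<Rightarrow> real \<Rightarrow> bool" where
  "mean_le M f a \<longleftrightarrow> integrable M f \<and> integral\<^sup>L M f \<le> a"

lemma mean_leD: "mean_le M f a \<Longrightarrow> integrable M f" "mean_le M f a \<Longrightarrow> integral\<^sup>L M f \<le> a"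
  by (auto simp: mean_le_def)

lemma mean_le_mono: "mean_le M f a \<Longrightarrow> a \<le> b \<Longrightarrow> mean_le M f b"
  by (auto simp: mean_le_def)

lemma mean_le_dom:
  assumes "mean_le M g a" and [measurable]: "f \<in> borel_measurable M"
    and "\<And>\<omega>. \<omega> \<in> space M \<Longrightarrow> 0 \<le> f \<omega> \<and> f \<omega> \<le> g \<omega>"
  shows "mean_le M f a"
proof -
  have "integrable M f"
    by (rule Bochner_Integration.integrable_bound[of M g])
       (use assms in \<open>auto simp: mean_le_def intro!: AE_I2 order.trans[OF _ abs_ge_self]\<close>)
  moreover have "integral\<^sup>L M f \<le> integral\<^sup>L M g"
    using calculation assms by (intro integral_mono) (auto simp: mean_le_def)
  ultimately show ?thesis using assms(1) by (auto simp: mean_le_def)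
qed

lemma mean_le_add: "mean_le M f a \<Longrightarrow> mean_le M g b \<Longrightarrow> mean_le M (\<lambda>\<omega>. f \<omega> + g \<omega>) (a + b)"
  by (auto simp: mean_le_def)

lemma mean_le_cmult: "mean_le M f a \<Longrightarrow> 0 \<le> c \<Longrightarrow> mean_le M (\<lambda>\<omega>. c * f \<omega>) (c * a)"
  by (auto simp: mean_le_def mult_left_mono)

lemma mean_le_sum:
  "(\<And>i. i \<in> I \<Longrightarrow> mean_le M (f i) (a i)) \<Longrightarrow> mean_le M (\<lambda>\<omega>. \<Sum>i\<in>I. f i \<omega>) (\<Sum>i\<in>I. a i)"
  by (auto simp: mean_le_def intro: sum_mono)

lemma (in prob_space) mean_le_const: "c \<le> a \<Longrightarrow> mean_le M (\<lambda>_. c) a"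
  by (auto simp: mean_le_def prob_space)

lemma mean_le_cong: "(\<And>\<omega>. \<omega> \<in> space M \<Longrightarrow> f \<omega> = g \<omega>) \<Longrightarrow> mean_le M f a = mean_le M g a"
  unfolding mean_le_def using Bochner_Integration.integrable_cong[of M M f g] Bochner_Integration.integral_cong[of M M f g] by auto

lemma mean_le_nonneg:
  assumes "mean_le M f a" "\<And>\<omega>. \<omega> \<in> space M \<Longrightarrow> 0 \<le> f \<omega>"
  shows "0 \<le> a"
proof -
  have "0 \<le> integral\<^sup>L M f" by (rule Bochner_Integration.integral_nonneg_AE) (use assms in auto)
  then show ?thesis using mean_leD(2)[OF assms(1)] by linarith
qed

lemma (in prob_space) mean_le_prob:
  assumes "mean_le M f a" "\<And>\<omega>. \<omega> \<in> space M \<Longrightarrow> 0 \<le> f \<omega>" "t > 0"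
  shows "prob {\<omega> \<in> space M. t \<le> f \<omega>} \<le> a / t"
proof -
  have "prob {\<omega> \<in> space M. t \<le> f \<omega>} \<le> (\<integral>\<omega>. f \<omega> \<partial>M) / t"
    using assms by (intro integral_Markov_inequality_measure[where A="{}"]) (auto simp: mean_le_def)
  also have "\<dots> \<le> a / t" using assms by (auto simp: mean_le_def divide_right_mono)
  finally show ?thesis .
qed

lemma (in prob_space) mean_le_indicator:
  assumes "A \<in> sets M" "prob A \<le> a"
  shows "mean_le M (indicator A) a"
  using assms by (auto simp: mean_le_def intro!: integrable_real_indicator simp: emeasure_eq_measure)

lemma mean_le_nn_integral:
  assumes [measurable]: "f \<in> borel_measurable M" and "\<And>\<omega>. \<omega> \<in> space M \<Longrightarrow> 0 \<le> f \<omega>" "0 \<le> a"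
    and le: "(\<integral>\<^sup>+\<omega>. ennreal (f \<omega>) \<partial>M) \<le> ennreal a"
  shows "mean_le M f a"
proof -
  have AE: "AE \<omega> in M. 0 \<le> f \<omega>" using assms by auto
  have "(\<integral>\<^sup>+\<omega>. ennreal (f \<omega>) \<partial>M) < \<infinity>" using le by (auto simp: order_le_less_trans)
  then have int: "integrable M f" using AE by (intro integrableI_nonneg) auto
  moreover have "ennreal (integral\<^sup>L M f) \<le> ennreal a"
    using le nn_integral_eq_integral[OF int AE] by simp
  ultimately show ?thesis using assms by (auto simp: mean_le_def)
qed

section \<open>Inequalities for the exponential function and sub-Gaussian squares\<close>

lemma power_le_fact_exp: "0 \<le> (y::real) \<Longrightarrow> y ^ n \<le> fact n * exp y"
proof -
  assume y: "0 \<le> y"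
  have "y ^ n /\<^sub>R fact n \<le> exp y"
    using sum_le_suminf[of "\<lambda>n. y ^ n /\<^sub>R fact n" "{n}"] exp_converges[of y] y
    by (auto simp: sums_iff)
  then show ?thesis by (simp add: field_simps)
qed

text \<open>The product of \<open>1 - y + y^2 / 2\<close> and \<open>1 + y + y^2 / 2\<close> is
  \<open>1 + y^4 / 4\<close>, and the second factor is at most \<open>exp y\<close>.\<close>

lemma exp_minus_le_quadratic: "0 \<le> (y::real) \<Longrightarrow> exp (- y) \<le> 1 - y + y\<^sup>2 / 2"
proof -
  assume y: "0 \<le> y"
  have "1 \<le> (1 - y + y\<^sup>2 / 2) * (1 + y + y\<^sup>2 / 2)"
  proof -
    have "(1 - y + y\<^sup>2 / 2) * (1 + y + y\<^sup>2 / 2) = 1 + (y\<^sup>2)\<^sup>2 / 4"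
      by (simp add: power2_eq_square algebra_simps)
    then show ?thesis by simp
  qed
  moreover have q: "0 \<le> 1 - y + y\<^sup>2 / 2"
  proof -
    have "0 \<le> (1 - y)\<^sup>2" by simp
    then show ?thesis by (simp add: power2_eq_square algebra_simps)
  qed
  ultimately have "1 \<le> (1 - y + y\<^sup>2 / 2) * exp y"
    using exp_lower_Taylor_quadratic[OF y] by (meson mult_left_mono order_trans)
  then show ?thesis by (simp add: exp_minus field_simps)
qed

lemma exp_le_quadratic: "exp (y::real) \<le> 1 + y + y\<^sup>2 * exp \<bar>y\<bar>"
proof -
  have a: "exp y - 1 \<le> y * exp y"
    using mult_right_mono[OF exp_ge_add_one_self[of "-y"], of "exp y"] by (simp add: exp_minus algebra_simps)
  show ?thesis
  proof (cases "y \<ge> 0")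
    case True
    have "y * (exp y - 1) \<le> y * (y * exp y)" using a True by (rule mult_left_mono)
    then show ?thesis using a True by (simp add: power2_eq_square algebra_simps)
  next
    case False
    have "- y * (1 - exp y) \<le> - y * - y"
    proof (rule mult_left_mono)
      show "1 - exp y \<le> - y" using exp_ge_add_one_self[of y] by linarith
    qed (use False in auto)
    also have "\<dots> \<le> y\<^sup>2 * exp \<bar>y\<bar>" using mult_left_mono[of 1 "exp \<bar>y\<bar>" "y\<^sup>2"] by (simp add: power2_eq_square)
    finally show ?thesis using a by (simp add: algebra_simps)
  qed
qed

text \<open>The exponent in the Orlicz condition for the square of a sub-Gaussian variable. The
  factor \<open>16\<close> bounds the mean of the \<open>k\<close>-th term of the exponential series
  by \<open>2 * (3/16)^k\<close> for positive \<open>k\<close>, so that the series sums to at most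
  \<open>2\<close>.\<close>

definition psi2 :: "real \<Rightarrow> real" where "psi2 K = 1 / (16 * K\<^sup>2)"

text \<open>The exponential series is integrated term by term; the even moments come from the moment
  generating function at \<open>t\<close> and \<open>- t\<close>, with \<open>t\<close> depending on
  the order.\<close>

lemma (in prob_space) sub_gaussian_square:
  assumes "sub_gaussian M K Z"
  shows "mean_le M (\<lambda>\<omega>. exp (psi2 K * (Z \<omega>)\<^sup>2)) 2"
proof -
  have K: "K > 0" and [measurable]: "Z \<in> borel_measurable M"
    and mgf: "(\<integral>\<^sup>+\<omega>. ennreal (exp (t * Z \<omega>)) \<partial>M) \<le> ennreal (exp (K\<^sup>2 * t\<^sup>2 / 2))" for t
    using assms by (auto simp: sub_gaussian_def)
  define f where "f k \<omega> = (psi2 K * (Z \<omega>)\<^sup>2) ^ k / fact k" for k \<omega>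
  have psi0: "psi2 K > 0" using K by (simp add: psi2_def)
  have f0: "0 \<le> f k \<omega>" for k \<omega> using psi0 by (simp add: f_def)
  have summand: "(\<integral>\<^sup>+\<omega>. ennreal (f k \<omega>) \<partial>M) \<le> ennreal ((1/2) ^ k)" for k
  proof (cases "k = 0")
    case True then show ?thesis by (simp add: f_def emeasure_space_1)
  next
    case False
    \<comment> \<open>This \<open>t\<close> minimises \<open>t^(-2k) * exp (K^2 * t^2 / 2)\<close>;
      the exponential then equals \<open>exp k\<close>.\<close>
    define t where "t = sqrt (2 * real k) / K"
    define c where "c = psi2 K ^ k / fact k * (fact (2 * k) / t ^ (2 * k))"
    have t: "t > 0" and t2: "t\<^sup>2 = 2 * real k / K\<^sup>2" using K False by (auto simp: t_def power_divide)
    have c0: "c \<ge> 0" using psi0 t by (simp add: c_def)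
    have fact_le: "fact (2 * k) / fact k \<le> (2 * real k) ^ k"
    proof -
      have dv: "fact k dvd (fact (2 * k) :: nat)" by (rule fact_dvd) simp
      have "fact (2 * k) div fact (2 * k - k) \<le> (2 * k) ^ k" by (rule fact_div_fact_le_pow) simp
      then have "real (fact (2 * k) div fact k) \<le> real ((2 * k) ^ k)" unfolding of_nat_le_iff by simp
      then show ?thesis using dv by (simp add: real_of_nat_div)
    qed
    have c_le: "c \<le> (1/16) ^ k"
    proof -
      have "t ^ (2 * k) = (2 * real k / K\<^sup>2) ^ k" by (simp add: power_mult t2)
      then have "c = (psi2 K * K\<^sup>2 / (2 * real k)) ^ k * (fact (2 * k) / fact k)"
        by (simp add: c_def power_divide power_mult_distrib mult_ac)
      also have "\<dots> \<le> (psi2 K * K\<^sup>2 / (2 * real k)) ^ k * (2 * real k) ^ k"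
        using fact_le psi0 by (intro mult_left_mono) auto
      also have "\<dots> = (psi2 K * K\<^sup>2) ^ k" using False by (simp add: power_divide)
      also have "psi2 K * K\<^sup>2 = 1/16" using K by (simp add: psi2_def)
      finally show ?thesis .
    qed
    have pt: "f k \<omega> \<le> c * exp (t * Z \<omega>) + c * exp ((-t) * Z \<omega>)" for \<omega>
    proof -
      have "\<bar>t * Z \<omega>\<bar> ^ (2 * k) \<le> fact (2 * k) * exp \<bar>t * Z \<omega>\<bar>" by (rule power_le_fact_exp) simp
      also have "exp \<bar>t * Z \<omega>\<bar> \<le> exp (t * Z \<omega>) + exp ((-t) * Z \<omega>)" by (cases "t * Z \<omega> \<ge> 0") auto
      also have "\<bar>t * Z \<omega>\<bar> ^ (2 * k) = t ^ (2 * k) * ((Z \<omega>)\<^sup>2) ^ k"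
        by (simp add: power_even_abs power_mult_distrib power_mult)
      finally have "((Z \<omega>)\<^sup>2) ^ k \<le> fact (2 * k) / t ^ (2 * k) * (exp (t * Z \<omega>) + exp ((-t) * Z \<omega>))"
        using t by (simp add: field_simps)
      then have "psi2 K ^ k / fact k * ((Z \<omega>)\<^sup>2) ^ k \<le> c * (exp (t * Z \<omega>) + exp ((-t) * Z \<omega>))"
        unfolding c_def using psi0 by (subst mult.assoc) (intro mult_left_mono, auto)
      then show ?thesis by (simp add: f_def power_mult_distrib algebra_simps)
    qed
    have e: "(\<integral>\<^sup>+\<omega>. ennreal (c * exp (u * Z \<omega>)) \<partial>M) \<le> ennreal (c * exp 1 ^ k)" if "u\<^sup>2 = t\<^sup>2" for u
    proof -
      have "(\<integral>\<^sup>+\<omega>. ennreal (c * exp (u * Z \<omega>)) \<partial>M) = ennreal c * (\<integral>\<^sup>+\<omega>. ennreal (exp (u * Z \<omega>)) \<partial>M)"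
        using c0 by (simp add: ennreal_mult nn_integral_cmult)
      also have "\<dots> \<le> ennreal c * ennreal (exp (K\<^sup>2 * u\<^sup>2 / 2))" by (intro mult_left_mono mgf) simp
      also have "K\<^sup>2 * u\<^sup>2 / 2 = real k" using K by (simp add: that t2)
      finally show ?thesis using c0 by (simp add: ennreal_mult exp_of_nat_mult[of k 1, simplified])
    qed
    have "(\<integral>\<^sup>+\<omega>. ennreal (f k \<omega>) \<partial>M) \<le> (\<integral>\<^sup>+\<omega>. ennreal (c * exp (t * Z \<omega>)) + ennreal (c * exp ((-t) * Z \<omega>)) \<partial>M)"
      using c0 pt by (intro nn_integral_mono) (simp flip: ennreal_plus)
    also have "\<dots> = (\<integral>\<^sup>+\<omega>. ennreal (c * exp (t * Z \<omega>)) \<partial>M) + (\<integral>\<^sup>+\<omega>. ennreal (c * exp ((-t) * Z \<omega>)) \<partial>M)"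
      by (rule nn_integral_add) auto
    also have "\<dots> \<le> ennreal (c * exp 1 ^ k) + ennreal (c * exp 1 ^ k)"
      by (intro add_mono e) auto
    also have "\<dots> = ennreal (2 * (c * exp 1 ^ k))" using c0 by (simp flip: ennreal_plus)
    also have "2 * (c * exp 1 ^ k) \<le> 2 * ((1/16) ^ k * 3 ^ k)"
      using c_le c0 exp_le by (intro mult_left_mono mult_mono power_mono) auto
    also have "\<dots> = 2 * (3/16) ^ k" by (simp add: power_divide)
    also have "\<dots> \<le> (1/2) ^ k"
    proof -
      have "2 * (3/8) ^ k \<le> (1::real)" using power_decreasing[of 1 k "3/8::real"] False by simp
      then have "(1/2) ^ k * (2 * (3/8) ^ k) \<le> (1/2::real) ^ k * 1" by (intro mult_left_mono) auto
      also have "(1/2) ^ k * (2 * (3/8) ^ k) = 2 * ((1/2 * (3/8)) ^ k :: real)"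
        by (simp only: power_mult_distrib mult_ac)
      finally show ?thesis by simp
    qed
    finally show ?thesis by (auto intro: ennreal_leI)
  qed
  have "(\<integral>\<^sup>+\<omega>. ennreal (exp (psi2 K * (Z \<omega>)\<^sup>2)) \<partial>M) = (\<integral>\<^sup>+\<omega>. (\<Sum>k. ennreal (f k \<omega>)) \<partial>M)"
  proof (rule nn_integral_cong)
    fix \<omega>
    have "(\<lambda>k. f k \<omega>) sums exp (psi2 K * (Z \<omega>)\<^sup>2)"
      using exp_converges[of "psi2 K * (Z \<omega>)\<^sup>2"] by (simp add: f_def field_simps)
    then show "ennreal (exp (psi2 K * (Z \<omega>)\<^sup>2)) = (\<Sum>k. ennreal (f k \<omega>))"
      by (intro suminf_ennreal_eq[symmetric] f0)
  qed
  also have "\<dots> = (\<Sum>k. \<integral>\<^sup>+\<omega>. ennreal (f k \<omega>) \<partial>M)"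
    by (rule nn_integral_suminf) (simp add: f_def)
  also have "\<dots> \<le> (\<Sum>k. ennreal ((1/2) ^ k))" by (intro suminf_le summand) auto
  also have "\<dots> = ennreal 2" by (rule suminf_ennreal_eq) (use geometric_sums[of "1/2::real"] in auto)
  finally show ?thesis by (intro mean_le_nn_integral) auto
qed

lemma moment_le_exp:
  assumes "mean_le M (\<lambda>\<omega>. exp (\<tau> * (Z \<omega>)\<^sup>2)) a" "\<tau> > 0" and [measurable]: "Z \<in> borel_measurable M"
  shows "mean_le M (\<lambda>\<omega>. (Z \<omega>) ^ (2 * n)) (fact n / \<tau> ^ n * a)"
proof (rule mean_le_dom)
  show "mean_le M (\<lambda>\<omega>. fact n / \<tau> ^ n * exp (\<tau> * (Z \<omega>)\<^sup>2)) (fact n / \<tau> ^ n * a)"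
    using assms by (intro mean_le_cmult) auto
  fix \<omega>
  have "(\<tau> * (Z \<omega>)\<^sup>2) ^ n \<le> fact n * exp (\<tau> * (Z \<omega>)\<^sup>2)" using assms by (intro power_le_fact_exp) auto
  then show "0 \<le> (Z \<omega>) ^ (2 * n) \<and> (Z \<omega>) ^ (2 * n) \<le> fact n / \<tau> ^ n * exp (\<tau> * (Z \<omega>)\<^sup>2)"
    using assms unfolding power_mult by (simp add: field_simps power_mult_distrib)
qed simp

text \<open>The mean removes the linear term of \<open>exp\<close>. The quadratic remainder is
  integrated against the exponential moment at \<open>\<tau>\<close>, one half of that exponent
  paying for \<open>Y^2\<close> and the other half for the exponential of \<open>|t * Y|\<close>;
  hence the range \<open>\<tau> / 2\<close>.\<close>

lemma (in prob_space) mgf_centred: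
  assumes "mean_le M (\<lambda>\<omega>. exp (\<tau> * \<bar>Y \<omega>\<bar>)) 2" "\<tau> > 0" and [measurable]: "Y \<in> borel_measurable M"
    and int: "integrable M Y" and mean: "(\<integral>\<omega>. Y \<omega> \<partial>M) = 0" and t: "\<bar>t\<bar> \<le> \<tau> / 2"
  shows "mean_le M (\<lambda>\<omega>. exp (t * Y \<omega>)) (exp (16 * t\<^sup>2 / \<tau>\<^sup>2))"
proof -
  have dom: "exp (t * Y \<omega>) \<le> 1 + t * Y \<omega> + 8 * t\<^sup>2 / \<tau>\<^sup>2 * exp (\<tau> * \<bar>Y \<omega>\<bar>)" for \<omega>
  proof -
    define y where "y = \<bar>Y \<omega>\<bar>"
    have y0: "y \<ge> 0" by (simp add: y_def)
    have "(\<tau> / 2 * y)\<^sup>2 \<le> fact 2 * exp (\<tau> / 2 * y)" using assms y0 by (intro power_le_fact_exp) auto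
    then have y2: "y\<^sup>2 \<le> 8 / \<tau>\<^sup>2 * exp (\<tau> / 2 * y)" using assms(2) by (simp add: field_simps power_mult_distrib fact_numeral)
    have "(t * Y \<omega>)\<^sup>2 * exp \<bar>t * Y \<omega>\<bar> = t\<^sup>2 * y\<^sup>2 * exp (\<bar>t\<bar> * y)"
      by (simp add: y_def power_mult_distrib abs_mult)
    also have "\<dots> \<le> t\<^sup>2 * (8 / \<tau>\<^sup>2 * exp (\<tau> / 2 * y)) * exp (\<tau> / 2 * y)"
    proof -
      have "\<bar>t\<bar> * y \<le> \<tau> / 2 * y" using t y0 by (rule mult_right_mono)
      then show ?thesis using y2 y0 by (intro mult_mono mult_left_mono) auto
    qed
    also have "\<dots> = 8 * t\<^sup>2 / \<tau>\<^sup>2 * (exp (\<tau> / 2 * y) * exp (\<tau> / 2 * y))" by simp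
    also have "exp (\<tau> / 2 * y) * exp (\<tau> / 2 * y) = exp (\<tau> * y)" by (simp flip: exp_add)
    finally show ?thesis using exp_le_quadratic[of "t * Y \<omega>"] by (simp add: y_def)
  qed
  have g: "mean_le M (\<lambda>\<omega>. 1 + t * Y \<omega> + 8 * t\<^sup>2 / \<tau>\<^sup>2 * exp (\<tau> * \<bar>Y \<omega>\<bar>)) (1 + 0 + 8 * t\<^sup>2 / \<tau>\<^sup>2 * 2)"
    by (intro mean_le_add mean_le_const mean_le_cmult assms) (use int mean in \<open>auto simp: mean_le_def\<close>)
  have "mean_le M (\<lambda>\<omega>. exp (t * Y \<omega>)) (1 + 0 + 8 * t\<^sup>2 / \<tau>\<^sup>2 * 2)"
    by (rule mean_le_dom[OF g]) (use dom in auto)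
  moreover have "1 + 0 + 8 * t\<^sup>2 / \<tau>\<^sup>2 * 2 \<le> exp (16 * t\<^sup>2 / \<tau>\<^sup>2)"
    using exp_ge_add_one_self[of "16 * t\<^sup>2 / \<tau>\<^sup>2"] by simp
  ultimately show ?thesis by (rule mean_le_mono)
qed

section \<open>Sums of independent variables\<close>

lemma (in prob_space) mean_le_exp_sum:
  assumes J: "finite J" and ind: "indep_vars (\<lambda>_. borel) Y J"
    and m: "\<And>i. i \<in> J \<Longrightarrow> mean_le M (\<lambda>\<omega>. exp (Y i \<omega>)) (exp (g i))"
  shows "mean_le M (\<lambda>\<omega>. exp (\<Sum>i\<in>J. Y i \<omega>)) (exp (\<Sum>i\<in>J. g i))"
proof -
  have ind': "indep_vars (\<lambda>_. borel) (\<lambda>i \<omega>. exp (Y i \<omega>)) J"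
    by (rule indep_vars_compose2[OF ind]) simp
  have int: "integrable M (\<lambda>\<omega>. exp (Y i \<omega>))" if "i \<in> J" for i using m[OF that] by (simp add: mean_le_def)
  have "integrable M (\<lambda>\<omega>. \<Prod>i\<in>J. exp (Y i \<omega>))" by (rule indep_vars_integrable[OF J ind' int])
  moreover have "(\<integral>\<omega>. (\<Prod>i\<in>J. exp (Y i \<omega>)) \<partial>M) = (\<Prod>i\<in>J. \<integral>\<omega>. exp (Y i \<omega>) \<partial>M)"
    by (rule indep_vars_lebesgue_integral[OF J ind' int])
  moreover have "\<dots> \<le> (\<Prod>i\<in>J. exp (g i))"
    using m by (intro prod_mono) (auto simp: mean_le_def)
  ultimately show ?thesis by (simp add: mean_le_def exp_sum J)
qed

lemma (in prob_space) chernoff: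
  assumes "mean_le M (\<lambda>\<omega>. exp (Y \<omega>)) (exp g)"
  shows "prob {\<omega> \<in> space M. a \<le> Y \<omega>} \<le> exp (g - a)"
  using mean_le_prob[OF assms, of "exp a"] by (simp add: exp_diff)

text \<open>For a nonnegative variable \<open>exp (- t * Y)\<close> is at most its second-order
  expansion, so a second moment already yields an exponential lower tail. For squared projections
  this is a fourth moment of a sub-Gaussian variable.\<close>

lemma (in prob_space) lower_tail:
  assumes J: "finite J" and ind: "indep_vars (\<lambda>_. borel) Y J"
    and nonneg: "\<And>i \<omega>. i \<in> J \<Longrightarrow> 0 \<le> Y i \<omega>"
    and mean: "\<And>i. i \<in> J \<Longrightarrow> integrable M (Y i) \<and> \<mu> \<le> expectation (Y i)"
    and sq: "\<And>i. i \<in> J \<Longrightarrow> mean_le M (\<lambda>\<omega>. (Y i \<omega>)\<^sup>2) m" and "\<mu> > 0" "m > 0"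
  shows "prob {\<omega> \<in> space M. (\<Sum>i\<in>J. Y i \<omega>) \<le> real (card J) * \<mu> / 2} \<le> exp (- (real (card J) * \<mu>\<^sup>2 / (8 * m)))"
proof -
  \<comment> \<open>Minimises \<open>- t * \<mu> / 2 + t^2 * m / 2\<close>, the exponent per summand
    at the level \<open>\<mu> / 2\<close>.\<close>
  define t where "t = \<mu> / (2 * m)"
  define N where "N = real (card J)"
  have t: "t > 0" using assms by (simp add: t_def)
  have [measurable]: "Y i \<in> borel_measurable M" if "i \<in> J" for i using mean that by auto
  have one: "mean_le M (\<lambda>\<omega>. exp (- t * Y i \<omega>)) (exp (- t * \<mu> + t\<^sup>2 * m / 2))" if i: "i \<in> J" for i
  proof -
    have "mean_le M (\<lambda>\<omega>. 1 + (- t) * Y i \<omega> + t\<^sup>2 / 2 * (Y i \<omega>)\<^sup>2) (1 + (- t) * \<mu> + t\<^sup>2 / 2 * m)"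
    proof (intro mean_le_add)
      have "t * \<mu> \<le> t * expectation (Y i)" using mean[OF i] t by (intro mult_left_mono) auto
      then show "mean_le M (\<lambda>\<omega>. - t * Y i \<omega>) (- t * \<mu>)" using mean[OF i] by (simp add: mean_le_def)
    qed (auto intro!: mean_le_const mean_le_cmult[OF sq[OF i], of "t\<^sup>2 / 2", simplified])
    then have "mean_le M (\<lambda>\<omega>. exp (- t * Y i \<omega>)) (1 + (- t) * \<mu> + t\<^sup>2 / 2 * m)"
    proof (rule mean_le_dom)
      fix \<omega>
      have "0 \<le> t * Y i \<omega>" using t nonneg[OF i] by simp
      from exp_minus_le_quadratic[OF this]
      show "0 \<le> exp (- t * Y i \<omega>) \<and> exp (- t * Y i \<omega>) \<le> 1 + (- t) * Y i \<omega> + t\<^sup>2 / 2 * (Y i \<omega>)\<^sup>2"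
        by (simp add: power_mult_distrib)
    qed (use i in simp)
    moreover have "1 + (- t) * \<mu> + t\<^sup>2 / 2 * m \<le> exp (- t * \<mu> + t\<^sup>2 * m / 2)"
      using exp_ge_add_one_self[of "- t * \<mu> + t\<^sup>2 * m / 2"] by (simp add: algebra_simps)
    ultimately show ?thesis by (rule mean_le_mono)
  qed
  have ind': "indep_vars (\<lambda>_. borel) (\<lambda>i \<omega>. - t * Y i \<omega>) J"
    by (rule indep_vars_compose2[OF ind]) simp
  have "mean_le M (\<lambda>\<omega>. exp (\<Sum>i\<in>J. - t * Y i \<omega>)) (exp (\<Sum>i\<in>J. - t * \<mu> + t\<^sup>2 * m / 2))"
    by (rule mean_le_exp_sum[OF J ind' one])
  then have "prob {\<omega> \<in> space M. - t * (N * \<mu> / 2) \<le> (\<Sum>i\<in>J. - t * Y i \<omega>)}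
      \<le> exp ((\<Sum>i\<in>J. - t * \<mu> + t\<^sup>2 * m / 2) - (- t * (N * \<mu> / 2)))" by (rule chernoff)
  also have "{\<omega> \<in> space M. - t * (N * \<mu> / 2) \<le> (\<Sum>i\<in>J. - t * Y i \<omega>)} = {\<omega> \<in> space M. (\<Sum>i\<in>J. Y i \<omega>) \<le> N * \<mu> / 2}"
  proof (rule Collect_cong)
    fix \<omega>
    have "(\<Sum>i\<in>J. - t * Y i \<omega>) = - (t * (\<Sum>i\<in>J. Y i \<omega>))"
      unfolding sum_distrib_left[symmetric] by simp
    moreover have "t * (\<Sum>i\<in>J. Y i \<omega>) \<le> t * (N * \<mu> / 2) \<longleftrightarrow> (\<Sum>i\<in>J. Y i \<omega>) \<le> N * \<mu> / 2"
      using t by (rule mult_le_cancel_left_pos)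
    ultimately show "(\<omega> \<in> space M \<and> - t * (N * \<mu> / 2) \<le> (\<Sum>i\<in>J. - t * Y i \<omega>)) =
        (\<omega> \<in> space M \<and> (\<Sum>i\<in>J. Y i \<omega>) \<le> N * \<mu> / 2)" by linarith
  qed
  also have "(\<Sum>i\<in>J. - t * \<mu> + t\<^sup>2 * m / 2) - (- t * (N * \<mu> / 2)) = - (N * \<mu>\<^sup>2 / (8 * m))"
    using \<open>m > 0\<close> by (simp add: N_def t_def field_simps power2_eq_square)
  finally show ?thesis by (simp add: N_def)
qed

lemma (in prob_space) second_moment_sum:
  assumes J: "finite J" and ind: "indep_vars (\<lambda>_. borel) Y J"
    and z: "\<And>i. i \<in> J \<Longrightarrow> integrable M (Y i) \<and> expectation (Y i) = 0"
    and sq: "\<And>i. i \<in> J \<Longrightarrow> mean_le M (\<lambda>\<omega>. (Y i \<omega>)\<^sup>2) m"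
  shows "mean_le M (\<lambda>\<omega>. (\<Sum>i\<in>J. Y i \<omega>)\<^sup>2) (real (card J) * m)"
  using J ind z sq
proof (induction J rule: finite_induct)
  case empty
  then show ?case by (simp add: mean_le_def)
next
  case (insert i F)
  have IH: "mean_le M (\<lambda>\<omega>. (\<Sum>i\<in>F. Y i \<omega>)\<^sup>2) (real (card F) * m)"
    using insert by (intro insert.IH indep_vars_subset[OF insert.prems(1)]) auto
  have iv: "indep_var borel (Y i) borel (\<lambda>\<omega>. \<Sum>i\<in>F. Y i \<omega>)"
    using insert by (intro indep_vars_sum) auto
  have intF: "integrable M (\<lambda>\<omega>. \<Sum>i\<in>F. Y i \<omega>)" using insert by auto
  have cross: "integrable M (\<lambda>\<omega>. Y i \<omega> * (\<Sum>i\<in>F. Y i \<omega>))"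
    "expectation (\<lambda>\<omega>. Y i \<omega> * (\<Sum>i\<in>F. Y i \<omega>)) = expectation (Y i) * expectation (\<lambda>\<omega>. \<Sum>i\<in>F. Y i \<omega>)"
    using indep_var_integrable[OF iv] indep_var_lebesgue_integral[OF iv] insert intF by auto
  have "mean_le M (\<lambda>\<omega>. (Y i \<omega>)\<^sup>2 + 2 * (Y i \<omega> * (\<Sum>i\<in>F. Y i \<omega>)) + (\<Sum>i\<in>F. Y i \<omega>)\<^sup>2) (m + 0 + real (card F) * m)"
    by (intro mean_le_add IH insert.prems) (use cross insert in \<open>auto simp: mean_le_def\<close>)
  then show ?case using insert by (simp add: power2_sum algebra_simps)
qed

section \<open>Sub-Gaussian designs\<close>

lemma power_mean:
  fixes y :: "'i \<Rightarrow> real"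
  assumes "finite S" "S \<noteq> {}" "even n"
  shows "((\<Sum>i\<in>S. y i) / real (card S)) ^ n \<le> (\<Sum>i\<in>S. y i ^ n) / real (card S)"
  using convex_on_sum[OF assms(1,2) convex_power_even[OF assms(3)], of "\<lambda>_. 1 / real (card S)" y] assms
  by (simp add: sum_divide_distrib)

lemma exp_mean: "exp ((a + b) / 2) \<le> (exp a + exp b) / (2 :: real)"
proof -
  have "exp ((a + b) / 2) = sqrt (exp a * exp b)"
    by (rule real_sqrt_unique[symmetric]) (simp_all add: power2_eq_square flip: exp_add)
  then show ?thesis using arith_geo_mean_sqrt[of "exp a" "exp b"] by simp
qed

lemma ln_ge_half: "p \<ge> 2 \<Longrightarrow> ln (real p) \<ge> 1/2"
proof -
  assume p: "p \<ge> 2"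
  have "ln (2::real) \<ge> 1/2" using ln2_ge_two_thirds by linarith
  moreover have "ln 2 \<le> ln (real p)" using p by (subst ln_le_cancel_iff) auto
  ultimately show ?thesis by linarith
qed

text \<open>With \<open>\<lambda> = lasso_const kk * sqrt (ln p / N)\<close> the exponential moment at \<open>N\<lambda>/(4kk)\<close> gives tails of order
  \<open>p^(-28)\<close>, which absorbs all powers of \<open>p\<close> lost below.\<close>

definition lasso_const :: "real \<Rightarrow> real" where "lasso_const kk = sqrt (448 * kk)"

text \<open>The indicator admits scores whose exponential moments are controlled only on an event
  \<open>A\<close>. The sixteenth powers of the exceedances have means of order
  \<open>lam^16 * p^(-28)\<close>; the powers lost are \<open>p^16\<close> from the normalisation,
  \<open>p^7\<close> from the power mean and \<open>p\<close> from the sum over coordinates.\<close>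

lemma (in prob_space) excess_moment:
  assumes [measurable]: "\<And>k. k < p \<Longrightarrow> T k \<in> borel_measurable M" "A \<in> sets M"
    and p: "p \<ge> 2" and N: "N > 0" and kk: "kk > 0"
    and lam: "lam = lasso_const kk * sqrt (ln (real p) / N)"
    and mgf: "\<And>k. k < p \<Longrightarrow> mean_le M (\<lambda>\<omega>. indicator A \<omega> * exp (N * lam / (4 * kk) * \<bar>T k \<omega>\<bar>))
        (2 * exp (N * lam\<^sup>2 / (16 * kk)))"
  shows "mean_le M (\<lambda>\<omega>. indicator A \<omega> * ((real p)\<^sup>2 * excess p lam (\<lambda>k. T k \<omega>) / lam\<^sup>2) ^ 8) 2"
proof -
  define s where "s = N * lam / (4 * kk)"
  have lnp: "ln (real p) \<ge> 1/2" using p by (rule ln_ge_half)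
  have lam0: "lam > 0" using kk N lnp by (simp add: lam lasso_const_def)
  have Nl: "N * lam\<^sup>2 = 448 * kk * ln (real p)"
    using kk N lnp by (simp add: lam lasso_const_def power_mult_distrib)
  have s0: "s > 0" using lam0 N kk by (simp add: s_def)
  have sl: "s * lam = 112 * ln (real p)"
  proof -
    have "s * lam = N * lam\<^sup>2 / (4 * kk)" by (simp add: s_def power2_eq_square)
    then show ?thesis using kk by (simp add: Nl)
  qed
  have e28: "N * lam\<^sup>2 / (16 * kk) = 28 * ln (real p)" using kk by (simp add: Nl)
  define c where "c = fact 16 / s ^ 16 * exp (- (56 * ln (real p)))"
  have c0: "c \<ge> 0" using s0 by (simp add: c_def)
  define q where "q k \<omega> = max 0 (\<bar>T k \<omega>\<bar> - lam / 2)" for k \<omega>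
  have q16: "q k \<omega> ^ 16 \<le> c * exp (s * \<bar>T k \<omega>\<bar>)" for k \<omega>
  proof (cases "q k \<omega> = 0")
    case True then show ?thesis using c0 by simp
  next
    case False
    then have qe: "q k \<omega> = \<bar>T k \<omega>\<bar> - lam / 2" "q k \<omega> \<ge> 0" by (auto simp: q_def max_def split: if_splits)
    have "(s * q k \<omega>) ^ 16 \<le> fact 16 * exp (s * q k \<omega>)" using s0 qe(2) by (intro power_le_fact_exp) auto
    also have "exp (s * q k \<omega>) = exp (- (56 * ln (real p))) * exp (s * \<bar>T k \<omega>\<bar>)"
      using sl by (simp add: qe algebra_simps flip: exp_add)
    finally have "s ^ 16 * q k \<omega> ^ 16 \<le> fact 16 * (exp (- (56 * ln (real p))) * exp (s * \<bar>T k \<omega>\<bar>))"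
      by (simp only: power_mult_distrib)
    then show ?thesis using s0 by (simp add: c_def field_simps)
  qed
  have m1: "mean_le M (\<lambda>\<omega>. indicator A \<omega> * q k \<omega> ^ 16) (c * (2 * exp (28 * ln (real p))))" if k: "k < p" for k
  proof (rule mean_le_dom)
    show "mean_le M (\<lambda>\<omega>. c * (indicator A \<omega> * exp (s * \<bar>T k \<omega>\<bar>))) (c * (2 * exp (28 * ln (real p))))"
      using mgf[OF k] c0 unfolding s_def[symmetric] e28 by (rule mean_le_cmult)
    show "(\<lambda>\<omega>. indicator A \<omega> * q k \<omega> ^ 16) \<in> borel_measurable M" using k by (simp add: q_def)
  qed (use q16 in \<open>auto simp: indicator_def\<close>)
  have pt: "((real p)\<^sup>2 * excess p lam (\<lambda>k. T k \<omega>) / lam\<^sup>2) ^ 8 \<le> (real p) ^ 23 / lam ^ 16 * (\<Sum>k<p. q k \<omega> ^ 16)" for \<omega>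
  proof -
    have "(excess p lam (\<lambda>k. T k \<omega>) / real p) ^ 8 \<le> (\<Sum>k<p. ((q k \<omega>)\<^sup>2) ^ 8) / real p"
      using power_mean[of "{..<p}" 8 "\<lambda>k. (q k \<omega>)\<^sup>2"] p by (simp add: excess_def q_def lessThan_empty_iff)
    then have "excess p lam (\<lambda>k. T k \<omega>) ^ 8 \<le> real p ^ 7 * (\<Sum>k<p. q k \<omega> ^ 16)"
      using p by (simp add: field_simps power_divide eval_nat_numeral flip: power_mult)
    then have "((real p)\<^sup>2 / lam\<^sup>2) ^ 8 * excess p lam (\<lambda>k. T k \<omega>) ^ 8 \<le> ((real p)\<^sup>2 / lam\<^sup>2) ^ 8 * (real p ^ 7 * (\<Sum>k<p. q k \<omega> ^ 16))"
      by (intro mult_left_mono) auto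
    moreover have "((real p)\<^sup>2 / lam\<^sup>2) ^ 8 * real p ^ 7 = real p ^ 23 / lam ^ 16"
      by (simp add: power_divide flip: power_mult power_add)
    ultimately show ?thesis by (simp add: power_mult_distrib power_divide mult.assoc[symmetric])
  qed
  have "mean_le M (\<lambda>\<omega>. (real p) ^ 23 / lam ^ 16 * (\<Sum>k<p. indicator A \<omega> * q k \<omega> ^ 16))
      ((real p) ^ 23 / lam ^ 16 * (\<Sum>k<p. c * (2 * exp (28 * ln (real p)))))"
    using lam0 by (intro mean_le_cmult mean_le_sum m1) auto
  then have "mean_le M (\<lambda>\<omega>. indicator A \<omega> * ((real p)\<^sup>2 * excess p lam (\<lambda>k. T k \<omega>) / lam\<^sup>2) ^ 8)
      ((real p) ^ 23 / lam ^ 16 * (\<Sum>k<p. c * (2 * exp (28 * ln (real p)))))"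
  proof (rule mean_le_dom)
    fix \<omega>
    have "indicator A \<omega> * ((real p)\<^sup>2 * excess p lam (\<lambda>k. T k \<omega>) / lam\<^sup>2) ^ 8
       \<le> indicator A \<omega> * ((real p) ^ 23 / lam ^ 16 * (\<Sum>k<p. q k \<omega> ^ 16))"
      by (intro mult_left_mono pt) auto
    then show "0 \<le> indicator A \<omega> * ((real p)\<^sup>2 * excess p lam (\<lambda>k. T k \<omega>) / lam\<^sup>2) ^ 8 \<and>
       indicator A \<omega> * ((real p)\<^sup>2 * excess p lam (\<lambda>k. T k \<omega>) / lam\<^sup>2) ^ 8
        \<le> (real p) ^ 23 / lam ^ 16 * (\<Sum>k<p. indicator A \<omega> * q k \<omega> ^ 16)"
      by (simp only: sum_distrib_left mult.left_commute[of "indicator A \<omega>"]) simp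
  qed (simp add: excess_def)
  moreover have "(real p) ^ 23 / lam ^ 16 * (\<Sum>k<p. c * (2 * exp (28 * ln (real p)))) \<le> 2"
  proof -
    have ex: "exp (real n * ln (real p)) = real p ^ n" for n using p by (simp add: exp_of_nat_mult)
    have "exp (- (56 * ln (real p))) * exp (28 * ln (real p)) = 1 / real p ^ 28"
    proof -
      have "exp (- (56 * ln (real p))) * exp (28 * ln (real p)) = exp (- (real 28 * ln (real p)))"
        by (simp flip: exp_add)
      then show ?thesis using ex[of 28] by (simp add: exp_minus divide_inverse)
    qed
    then have "(real p) ^ 23 / lam ^ 16 * (\<Sum>k<p. c * (2 * exp (28 * ln (real p))))
       = (real p) ^ 23 / lam ^ 16 * (real p * (2 * (fact 16 / s ^ 16) * (1 / real p ^ 28)))"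
      by (simp add: c_def mult_ac)
    also have "\<dots> = 2 * (fact 16 / (s * lam) ^ 16) * (real p ^ 24 / real p ^ 28)"
      by (simp add: power_mult_distrib eval_nat_numeral)
    also have "\<dots> \<le> 2 * 1 * 1"
    proof (intro mult_mono)
      \<comment> \<open>Here \<open>s * lam = 112 * ln p\<close> is at least \<open>56\<close>,
        since \<open>p >= 2\<close>.\<close>
      have "fact 16 \<le> real (16 ^ 16)" using fact_le_power[of 16] by (simp add: fact_numeral)
      also have "\<dots> \<le> (s * lam) ^ 16" unfolding sl using lnp by (simp only: of_nat_power) (intro power_mono, auto)
      finally show "fact 16 / (s * lam) ^ 16 \<le> 1" using s0 lam0 by simp
      show "real p ^ 24 / real p ^ 28 \<le> 1" using p power_increasing[of 24 28 "real p"] by simp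
    qed (use s0 lam0 in auto)
    finally show ?thesis by simp
  qed
  ultimately show ?thesis by (rule mean_le_mono)
qed

text \<open>The index set is abstract because the estimates are applied to subsets of the rows:
  single batches, cumulative samples, the full sample. \<open>low\<close> is the eigenvalue
  condition in the form in which it is used.\<close>

locale sub_gaussian_rows = prob_space M for M :: "'a measure" +
  fixes I :: "'i set" and p :: nat and x :: "'i \<Rightarrow> nat \<Rightarrow> 'a \<Rightarrow> real"
    and Sg :: "nat \<Rightarrow> nat \<Rightarrow> real" and K L D :: real
  assumes finI: "finite I" and K1: "K \<ge> 1" and L1: "L \<ge> 1" and D1: "D \<ge> 1"
    and ind: "indep_vars (\<lambda>_. \<Pi>\<^sub>M k\<in>{..<p}. borel) (\<lambda>i \<omega>. \<lambda>k\<in>{..<p}. x i k \<omega>) I"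
    and sg: "\<And>i u. i \<in> I \<Longrightarrow> ip p u u = 1 \<Longrightarrow> sub_gaussian M K (\<lambda>\<omega>. ip p (\<lambda>k. x i k \<omega>) u)"
    and cov: "\<And>i k l. i \<in> I \<Longrightarrow> k < p \<Longrightarrow> l < p \<Longrightarrow> (\<integral>\<omega>. x i k \<omega> * x i l \<omega> \<partial>M) = Sg k l"
    and low: "\<And>u. ip p u u / L \<le> bil p Sg u u"
    and diag: "\<And>k. k < p \<Longrightarrow> Sg k k \<le> D"
begin

abbreviation "xr i \<omega> \<equiv> \<lambda>k. x i k \<omega>"

lemma x_meas[measurable]: "i \<in> I \<Longrightarrow> k < p \<Longrightarrow> x i k \<in> borel_measurable M"
proof -
  assume i: "i \<in> I" and k: "k < p"
  have "(\<lambda>\<omega>. \<lambda>k\<in>{..<p}. x i k \<omega>) \<in> measurable M (\<Pi>\<^sub>M k\<in>{..<p}. borel)"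
    using ind i by (auto simp: indep_vars_def)
  from measurable_compose[OF this measurable_component_singleton[of k]]
  show "x i k \<in> borel_measurable M" using k by simp
qed

lemma ip_meas[measurable]: "i \<in> I \<Longrightarrow> (\<lambda>\<omega>. ip p (xr i \<omega>) u) \<in> borel_measurable M"
  unfolding ip_def by (intro borel_measurable_sum borel_measurable_times) auto

lemma indep_fun:
  assumes J: "J \<subseteq> I" and f: "f \<in> borel_measurable (\<Pi>\<^sub>M k\<in>{..<p}. borel)"
    and restr: "\<And>g. f (\<lambda>k\<in>{..<p}. g k) = f g"
  shows "indep_vars (\<lambda>_. borel) (\<lambda>i \<omega>. f (xr i \<omega>)) J"
  using indep_vars_compose2[OF indep_vars_subset[OF ind J], of "\<lambda>_. f" "\<lambda>_. borel"] f restr by simp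

lemma ip_fun[measurable]: "(\<lambda>g. ip p g u) \<in> borel_measurable (\<Pi>\<^sub>M k\<in>{..<p}. borel)"
  unfolding ip_def by (intro borel_measurable_sum borel_measurable_times) auto

lemma comp_fun[measurable]: "k < p \<Longrightarrow> (\<lambda>g. g k) \<in> borel_measurable (\<Pi>\<^sub>M k\<in>{..<p}. borel)"
  by (rule measurable_component_singleton) simp

lemma ip_restrict[simp]: "ip p (\<lambda>k\<in>{..<p}. g k) u = ip p g u"
  by (simp add: ip_def)

lemma row_unit: "k < p \<Longrightarrow> ip p (xr i \<omega>) (unit_fun k) = x i k \<omega>"
  by (rule ip_unit)

lemma psi2_pos: "psi2 K > 0" using K1 by (simp add: psi2_def)

text \<open>The exponent is normalised by an upper bound \<open>h\<close> of the squared norm, so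
  that several directions can share it.\<close>

lemma exp_square:
  assumes i: "i \<in> I" and h: "h > 0" "ip p u u \<le> h"
  shows "mean_le M (\<lambda>\<omega>. exp (psi2 K / h * (ip p (xr i \<omega>) u)\<^sup>2)) 2"
proof (cases "ip p u u = 0")
  case True
  then have "\<forall>k\<in>{..<p}. (u k)\<^sup>2 = 0" unfolding ip_self_sum by (subst (asm) sum_nonneg_eq_0_iff) auto
  then have "ip p (xr i \<omega>) u = 0" for \<omega> by (simp add: ip_def)
  then show ?thesis by (simp add: mean_le_const)
next
  case False
  define c where "c = sqrt (ip p u u)"
  have c: "c > 0" "c\<^sup>2 = ip p u u" using False ip_self_nonneg[of p u] by (auto simp: c_def)
  have "ip p (\<lambda>k. (1/c) * u k) (\<lambda>k. (1/c) * u k) = 1"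
    unfolding ip_scale_left ip_scale_right c(2)[symmetric] using c(1) by (simp add: power2_eq_square)
  from sub_gaussian_square[OF sg[OF i this]]
  have "mean_le M (\<lambda>\<omega>. exp (psi2 K * (ip p (xr i \<omega>) u / c)\<^sup>2)) 2" by (simp only: ip_scale_right) simp
  then show ?thesis
  proof (rule mean_le_dom)
    fix \<omega>
    have "psi2 K * (ip p (xr i \<omega>) u)\<^sup>2 / h \<le> psi2 K * (ip p (xr i \<omega>) u)\<^sup>2 / c\<^sup>2"
      using psi2_pos c(1) h unfolding c(2)[symmetric] by (intro divide_left_mono mult_pos_pos zero_less_power mult_nonneg_nonneg) auto
    then show "0 \<le> exp (psi2 K / h * (ip p (xr i \<omega>) u)\<^sup>2) \<and>
      exp (psi2 K / h * (ip p (xr i \<omega>) u)\<^sup>2) \<le> exp (psi2 K * (ip p (xr i \<omega>) u / c)\<^sup>2)"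
      by (simp add: power_divide)
  qed (use i in simp)
qed

lemma moment:
  assumes i: "i \<in> I" and h: "h > 0" "ip p u u \<le> h"
  shows "mean_le M (\<lambda>\<omega>. (ip p (xr i \<omega>) u) ^ (2 * n)) (2 * fact n * (h / psi2 K) ^ n)"
  using moment_le_exp[OF exp_square[OF assms], of n] i psi2_pos h by (simp add: power_divide mult_ac)

lemma x_exp_square: "i \<in> I \<Longrightarrow> k < p \<Longrightarrow> mean_le M (\<lambda>\<omega>. exp (psi2 K * (x i k \<omega>)\<^sup>2)) 2"
  using exp_square[of i 1 "unit_fun k"] by (simp add: row_unit ip_unit_unit)

lemma x_square_int: "i \<in> I \<Longrightarrow> k < p \<Longrightarrow> integrable M (\<lambda>\<omega>. (x i k \<omega>)\<^sup>2)"
  using moment[of i 1 "unit_fun k" 1] by (simp add: row_unit ip_unit_unit mean_le_def)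

lemma xx_int: "i \<in> I \<Longrightarrow> k < p \<Longrightarrow> l < p \<Longrightarrow> integrable M (\<lambda>\<omega>. x i k \<omega> * x i l \<omega>)"
proof -
  assume *: "i \<in> I" "k < p" "l < p"
  show ?thesis
  proof (rule Bochner_Integration.integrable_bound)
    show "integrable M (\<lambda>\<omega>. (x i k \<omega>)\<^sup>2 + (x i l \<omega>)\<^sup>2)" using * by (intro Bochner_Integration.integrable_add x_square_int)
    show "AE \<omega> in M. norm (x i k \<omega> * x i l \<omega>) \<le> norm ((x i k \<omega>)\<^sup>2 + (x i l \<omega>)\<^sup>2)"
    proof (rule AE_I2)
      fix \<omega>
      have "2 * \<bar>x i k \<omega>\<bar> * \<bar>x i l \<omega>\<bar> \<le> \<bar>x i k \<omega>\<bar>\<^sup>2 + \<bar>x i l \<omega>\<bar>\<^sup>2" by (rule sum_squares_bound)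
      then show "norm (x i k \<omega> * x i l \<omega>) \<le> norm ((x i k \<omega>)\<^sup>2 + (x i l \<omega>)\<^sup>2)"
        by (simp add: abs_mult) (use zero_le_mult_iff[of "\<bar>x i k \<omega>\<bar>" "\<bar>x i l \<omega>\<bar>"] in linarith)
    qed
  qed (use * in measurable)
qed

lemma mean_prod:
  assumes i: "i \<in> I"
  shows "integrable M (\<lambda>\<omega>. ip p (xr i \<omega>) u * ip p (xr i \<omega>) v)"
    "(\<integral>\<omega>. ip p (xr i \<omega>) u * ip p (xr i \<omega>) v \<partial>M) = bil p Sg u v"
proof -
  have eq: "ip p (xr i \<omega>) u * ip p (xr i \<omega>) v = (\<Sum>k<p. \<Sum>l<p. (u k * v l) * (x i k \<omega> * x i l \<omega>))" for \<omega>
    unfolding ip_def sum_product by (simp add: mult_ac)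
  show "integrable M (\<lambda>\<omega>. ip p (xr i \<omega>) u * ip p (xr i \<omega>) v)"
    unfolding eq using xx_int[OF i] by (intro Bochner_Integration.integrable_sum integrable_mult_right) auto
  have "(\<integral>\<omega>. ip p (xr i \<omega>) u * ip p (xr i \<omega>) v \<partial>M) = (\<Sum>k<p. \<Sum>l<p. (u k * v l) * Sg k l)"
    unfolding eq using xx_int[OF i] cov[OF i]
    by (subst Bochner_Integration.integral_sum, (auto intro!: Bochner_Integration.integrable_sum)[1], intro sum.cong refl)
       (subst Bochner_Integration.integral_sum, auto)
  then show "(\<integral>\<omega>. ip p (xr i \<omega>) u * ip p (xr i \<omega>) v \<partial>M) = bil p Sg u v"
    by (simp add: bil_def mult_ac)
qed

end

section \<open>Lower tail of the quadratic form and restricted eigenvalues\<close>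

text \<open>This is \<open>\<mu>^2 / (8 * m)\<close> from \<open>lower_tail\<close> with
  \<open>\<mu> = h / L\<close> and \<open>m = 4 * (h / psi2 K)^2\<close> for a direction of squared
  norm \<open>h\<close>, which cancels.\<close>

definition tail_const :: "real \<Rightarrow> real \<Rightarrow> real" where
  "tail_const K L = 1 / (8192 * K ^ 4 * L\<^sup>2)"

text \<open>The column bound \<open>48 * K^2\<close> times \<open>12 / tail_const K L\<close>, which
  comes from the depth of the net.\<close>

definition re_const :: "real \<Rightarrow> real \<Rightarrow> real" where
  "re_const K L = 576 * K\<^sup>2 / tail_const K L"

context sub_gaussian_rows
begin

lemma tail_const_pos: "tail_const K L > 0" and tail_const_le: "tail_const K L \<le> 1"
proof -
  have "1 \<le> K ^ 4" "1 \<le> L\<^sup>2" using K1 L1 by simp_all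
  then have "1 * 1 * 1 \<le> 8192 * K ^ 4 * L\<^sup>2" by (intro mult_mono) auto
  then have "1 \<le> 8192 * K ^ 4 * L\<^sup>2" by simp
  moreover have "0 < 8192 * K ^ 4 * L\<^sup>2" using calculation by linarith
  ultimately show "tail_const K L > 0" "tail_const K L \<le> 1" unfolding tail_const_def by (simp_all only: zero_less_divide_1_iff divide_le_eq_1_pos)
qed

lemma re_const_pos: "re_const K L > 0"
  using tail_const_pos K1 by (simp add: re_const_def)

lemma quad_meas[measurable]: "J \<subseteq> I \<Longrightarrow> (\<lambda>\<omega>. \<Sum>i\<in>J. (ip p (xr i \<omega>) w)\<^sup>2) \<in> borel_measurable M"
  by (intro borel_measurable_sum borel_measurable_power) auto

lemma col_meas[measurable]: "J \<subseteq> I \<Longrightarrow> k < p \<Longrightarrow> (\<lambda>\<omega>. \<Sum>i\<in>J. (x i k \<omega>)\<^sup>2) \<in> borel_measurable M"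
  by (intro borel_measurable_sum borel_measurable_power) auto

text \<open>The squared mean and the second moment of a squared projection scale alike in
  \<open>w\<close>, so the rate is the same for all directions, as the union over the net
  requires.\<close>

lemma lower_tail_quadratic:
  assumes J: "J \<subseteq> I"
  shows "prob {\<omega> \<in> space M. (\<Sum>i\<in>J. (ip p (xr i \<omega>) w)\<^sup>2) < real (card J) / 2 * bil p Sg w w}
     \<le> exp (- (tail_const K L * real (card J)))"
proof (cases "J = {} \<or> ip p w w = 0")
  case True
  have "bil p Sg w w = 0" if "ip p w w = 0"
  proof -
    have "\<forall>k\<in>{..<p}. (w k)\<^sup>2 = 0" using that unfolding ip_self_sum by (subst (asm) sum_nonneg_eq_0_iff) auto
    then show ?thesis by (simp add: bil_def)
  qed
  then have "{\<omega> \<in> space M. (\<Sum>i\<in>J. (ip p (xr i \<omega>) w)\<^sup>2) < real (card J) / 2 * bil p Sg w w} = {}"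
    using True by (auto simp: not_less intro!: sum_nonneg)
  then have "prob {\<omega> \<in> space M. (\<Sum>i\<in>J. (ip p (xr i \<omega>) w)\<^sup>2) < real (card J) / 2 * bil p Sg w w} = 0" by (simp only: measure_empty)
  then show ?thesis by (simp only: exp_ge_zero)
next
  case False
  define h where "h = ip p w w"
  have h: "h > 0" using False ip_self_nonneg[of p w] by (auto simp: h_def)
  define \<mu> where "\<mu> = bil p Sg w w"
  have \<mu>: "\<mu> \<ge> h / L" using low[of w] by (simp add: h_def \<mu>_def)
  have "h / L > 0" using h L1 by simp
  then have \<mu>0: "\<mu> > 0" using \<mu> by linarith
  define m where "m = 4 * (h / psi2 K)\<^sup>2"
  have m0: "m > 0" using h psi2_pos by (simp add: m_def)
  have fin: "finite J" using J finI finite_subset by blast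
  have "prob {\<omega> \<in> space M. (\<Sum>i\<in>J. (ip p (xr i \<omega>) w)\<^sup>2) \<le> real (card J) * \<mu> / 2} \<le> exp (- (real (card J) * \<mu>\<^sup>2 / (8 * m)))"
  proof (rule lower_tail[OF fin])
    show "indep_vars (\<lambda>_. borel) (\<lambda>i \<omega>. (ip p (xr i \<omega>) w)\<^sup>2) J"
    proof (rule indep_fun[OF J, of "\<lambda>g. (ip p g w)\<^sup>2"])
      show "(\<lambda>g. (ip p g w)\<^sup>2) \<in> borel_measurable (\<Pi>\<^sub>M k\<in>{..<p}. borel)" by measurable
    qed (simp only: ip_restrict)
    fix i assume i: "i \<in> J"
    then have iI: "i \<in> I" using J by auto
    show "integrable M (\<lambda>\<omega>. (ip p (xr i \<omega>) w)\<^sup>2) \<and> \<mu> \<le> expectation (\<lambda>\<omega>. (ip p (xr i \<omega>) w)\<^sup>2)"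
      using mean_prod[OF iI, of w w] by (simp add: power2_eq_square \<mu>_def)
    show "mean_le M (\<lambda>\<omega>. ((ip p (xr i \<omega>) w)\<^sup>2)\<^sup>2) m"
      using moment[OF iI h, of w 2] by (simp add: h_def m_def fact_numeral flip: power_mult)
  qed (use \<mu>0 m0 in auto)
  moreover have "prob {\<omega> \<in> space M. (\<Sum>i\<in>J. (ip p (xr i \<omega>) w)\<^sup>2) < real (card J) / 2 * bil p Sg w w}
     \<le> prob {\<omega> \<in> space M. (\<Sum>i\<in>J. (ip p (xr i \<omega>) w)\<^sup>2) \<le> real (card J) * \<mu> / 2}"
  proof (rule finite_measure_mono)
    show "{\<omega> \<in> space M. (\<Sum>i\<in>J. (ip p (xr i \<omega>) w)\<^sup>2) \<le> real (card J) * \<mu> / 2} \<in> sets M"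
      using quad_meas[OF J, of w] by measurable
  qed (auto simp: \<mu>_def)
  moreover have "tail_const K L * real (card J) \<le> real (card J) * \<mu>\<^sup>2 / (8 * m)"
  proof -
    have "tail_const K L = (h / L)\<^sup>2 / (8 * m)"
      using h K1 L1 by (simp add: tail_const_def m_def psi2_def power_divide power_mult_distrib eval_nat_numeral field_simps)
    also have "\<dots> \<le> \<mu>\<^sup>2 / (8 * m)" using \<mu> h L1 m0 by (intro divide_right_mono power_mono) auto
    finally have "tail_const K L * real (card J) \<le> \<mu>\<^sup>2 / (8 * m) * real (card J)" by (rule mult_right_mono) simp
    then show ?thesis by (simp add: mult.commute)
  qed
  ultimately show ?thesis using exp_le_cancel_iff[of "- (real (card J) * \<mu>\<^sup>2 / (8 * m))" "- (tail_const K L * real (card J))"] by linarith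
qed

lemma col_sum_exp:
  assumes J: "J \<subseteq> I" and k: "k < p"
  shows "mean_le M (\<lambda>\<omega>. exp (psi2 K * (\<Sum>i\<in>J. (x i k \<omega>)\<^sup>2))) (exp (real (card J) * ln 2))"
proof -
  have fin: "finite J" using J finI finite_subset by blast
  have "mean_le M (\<lambda>\<omega>. exp (\<Sum>i\<in>J. psi2 K * (x i k \<omega>)\<^sup>2)) (exp (\<Sum>i\<in>J. ln 2))"
  proof (rule mean_le_exp_sum[OF fin])
    show "indep_vars (\<lambda>_. borel) (\<lambda>i \<omega>. psi2 K * (x i k \<omega>)\<^sup>2) J"
      by (rule indep_fun[OF J]) (use k in auto)
    show "mean_le M (\<lambda>\<omega>. exp (psi2 K * (x i k \<omega>)\<^sup>2)) (exp (ln 2))" if "i \<in> J" for i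
      using x_exp_square[of i k] that J k by auto
  qed
  then show ?thesis by (simp add: sum_distrib_left)
qed

text \<open>The level is \<open>3 / psi2 K\<close> per row, so that the moment bound
  \<open>2^N\<close> leaves \<open>exp (- 2 * N)\<close>.\<close>

lemma col_tail:
  assumes J: "J \<subseteq> I" and k: "k < p"
  shows "prob {\<omega> \<in> space M. 48 * K\<^sup>2 * real (card J) \<le> (\<Sum>i\<in>J. (x i k \<omega>)\<^sup>2)} \<le> exp (- 2 * real (card J))"
proof -
  have "prob {\<omega> \<in> space M. 3 * real (card J) \<le> psi2 K * (\<Sum>i\<in>J. (x i k \<omega>)\<^sup>2)} \<le> exp (real (card J) * ln 2 - 3 * real (card J))"
    by (rule chernoff[OF col_sum_exp[OF J k]])
  also have "\<dots> \<le> exp (- 2 * real (card J))"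
    using mult_left_mono[of "ln 2" 1 "real (card J)"] ln_2_less_1 by simp
  also have "{\<omega> \<in> space M. 3 * real (card J) \<le> psi2 K * (\<Sum>i\<in>J. (x i k \<omega>)\<^sup>2)} = {\<omega> \<in> space M. 48 * K\<^sup>2 * real (card J) \<le> (\<Sum>i\<in>J. (x i k \<omega>)\<^sup>2)}"
    using K1 by (auto simp: psi2_def field_simps)
  finally show ?thesis .
qed

text \<open>A net of depth \<open>d\<close> has at most \<open>(2 * p)^d\<close>, hence at most
  \<open>p^(2 * d)\<close> points. This depth keeps their number below
  \<open>exp (tail_const K L * N / 2)\<close>, which spends half of the exponent available at each
  point.\<close>

definition net_size :: "'i set \<Rightarrow> nat" where
  "net_size J = nat \<lfloor>tail_const K L * real (card J) / (4 * ln (real p))\<rfloor>"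

definition good :: "'i set \<Rightarrow> 'a \<Rightarrow> bool" where
  "good J \<omega> \<longleftrightarrow> (\<forall>w\<in>signed_sums p (net_size J). real (card J) / 2 * bil p Sg w w \<le> (\<Sum>i\<in>J. (ip p (xr i \<omega>) w)\<^sup>2))
     \<and> (\<forall>k<p. (\<Sum>i\<in>J. (x i k \<omega>)\<^sup>2) \<le> 48 * K\<^sup>2 * real (card J))"

definition bad :: "'i set \<Rightarrow> 'a set" where "bad J = {\<omega> \<in> space M. \<not> good J \<omega>}"

lemma bad_eq: "bad J = (\<Union>w\<in>signed_sums p (net_size J). {\<omega> \<in> space M. (\<Sum>i\<in>J. (ip p (xr i \<omega>) w)\<^sup>2) < real (card J) / 2 * bil p Sg w w})
    \<union> (\<Union>k\<in>{..<p}. {\<omega> \<in> space M. 48 * K\<^sup>2 * real (card J) < (\<Sum>i\<in>J. (x i k \<omega>)\<^sup>2)})"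
  by (auto simp: bad_def good_def not_le)

lemma bad_sets[measurable]: assumes "J \<subseteq> I" shows "bad J \<in> sets M"
proof -
  note [measurable] = quad_meas[OF assms] col_meas[OF assms]
  have "{\<omega> \<in> space M. 48 * K\<^sup>2 * real (card J) < (\<Sum>i\<in>J. (x i k \<omega>)\<^sup>2)} \<in> sets M" if "k \<in> {..<p}" for k
    using that by simp
  then show ?thesis unfolding bad_eq by (intro sets.Un sets.finite_UN finite_signed_sums finite_lessThan) measurable
qed

text \<open>Union bounds. With \<open>c = tail_const K L\<close>, the net costs
  \<open>exp (c * N / 2)\<close> against \<open>exp (- c * N)\<close> for each point, and the
  columns cost \<open>p <= exp N\<close> against \<open>exp (- 2 * N)\<close> for each. The second
  contribution is dominated by the first because \<open>c <= 1\<close>.\<close>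

lemma bad_prob:
  assumes J: "J \<subseteq> I" and p: "p \<ge> 2" and N: "ln (real p) \<le> real (card J)"
  shows "prob (bad J) \<le> 2 * exp (- (tail_const K L / 2 * real (card J)))"
proof -
  let ?N = "real (card J)" and ?c = "tail_const K L"
  let ?A = "\<lambda>w. {\<omega> \<in> space M. (\<Sum>i\<in>J. (ip p (xr i \<omega>) w)\<^sup>2) < ?N / 2 * bil p Sg w w}"
  let ?B = "\<lambda>k. {\<omega> \<in> space M. 48 * K\<^sup>2 * ?N < (\<Sum>i\<in>J. (x i k \<omega>)\<^sup>2)}"
  have mA: "?A w \<in> sets M" for w
    using quad_meas[OF J, of w] by measurable
  have mB: "?B k \<in> sets M" if "k < p" for k
    using col_meas[OF J that] by measurable
  have lp: "ln (real p) \<ge> 1/2" by (rule ln_ge_half[OF p])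
  have "prob (bad J) \<le> prob (\<Union>w\<in>signed_sums p (net_size J). ?A w) + prob (\<Union>k\<in>{..<p}. ?B k)"
    unfolding bad_eq by (intro measure_Un_le sets.finite_UN finite_signed_sums finite_lessThan mA mB) simp
  also have "prob (\<Union>w\<in>signed_sums p (net_size J). ?A w) \<le> (\<Sum>w\<in>signed_sums p (net_size J). prob (?A w))"
    by (rule finite_measure_subadditive_finite[OF finite_signed_sums]) (use mA in blast)
  also have "\<dots> \<le> (\<Sum>w\<in>signed_sums p (net_size J). exp (- (?c * ?N)))"
    by (intro sum_mono lower_tail_quadratic J)
  also have "\<dots> \<le> real ((2 * p) ^ net_size J) * exp (- (?c * ?N))"
    using card_signed_sums[of p "net_size J"] by (simp add: of_nat_mono flip: of_nat_power of_nat_mult)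
  also have "real ((2 * p) ^ net_size J) \<le> exp (?c / 2 * ?N)"
  proof -
    have "real (2 * p) \<le> real p * real p" using p by simp
    also have "\<dots> = exp (2 * ln (real p))" using p by (simp add: exp_double power2_eq_square)
    finally have "real ((2 * p) ^ net_size J) \<le> exp (2 * ln (real p)) ^ net_size J"
      by (simp only: of_nat_power) (intro power_mono, auto)
    also have "\<dots> = exp (real (net_size J) * (2 * ln (real p)))" by (simp add: exp_of_nat_mult)
    also have "real (net_size J) * (2 * ln (real p)) \<le> ?c * ?N / (4 * ln (real p)) * (2 * ln (real p))"
      unfolding net_size_def using lp tail_const_pos by (intro mult_right_mono of_nat_floor) auto
    also have "\<dots> = ?c / 2 * ?N" using lp by simp
    finally show ?thesis by simp
  qed
  also have "exp (?c / 2 * ?N) * exp (- (?c * ?N)) = exp (- (?c / 2 * ?N))" by (simp flip: exp_add)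
  also have "prob (\<Union>k\<in>{..<p}. ?B k) \<le> (\<Sum>k<p. prob (?B k))"
    by (rule finite_measure_subadditive_finite) (use mB in \<open>blast | simp\<close>)+
  also have "\<dots> \<le> (\<Sum>k<p. exp (- 2 * ?N))"
  proof (rule sum_mono)
    fix k assume "k \<in> {..<p}"
    then have k: "k < p" by simp
    have "prob (?B k) \<le> prob {\<omega> \<in> space M. 48 * K\<^sup>2 * ?N \<le> (\<Sum>i\<in>J. (x i k \<omega>)\<^sup>2)}"
      using col_meas[OF J k] by (intro finite_measure_mono) auto
    also have "\<dots> \<le> exp (- 2 * ?N)" by (rule col_tail[OF J k])
    finally show "prob (?B k) \<le> exp (- 2 * ?N)" .
  qed
  also have "\<dots> = exp (ln (real p)) * exp (- 2 * ?N)" using p by simp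
  also have "\<dots> \<le> exp ?N * exp (- 2 * ?N)" using N by simp
  also have "\<dots> \<le> exp (- (?c / 2 * ?N))"
    using mult_right_mono[of "?c / 2" 1 ?N] tail_const_le by (simp flip: exp_add)
  finally show ?thesis by simp
qed

lemma Sg_sym: "I \<noteq> {} \<Longrightarrow> k < p \<Longrightarrow> l < p \<Longrightarrow> Sg k l = Sg l k"
  using cov[of _ k l] cov[of _ l k] by (auto simp: mult.commute)

lemma Sg_diag_nonneg: "I \<noteq> {} \<Longrightarrow> k < p \<Longrightarrow> 0 \<le> Sg k k"
proof -
  assume "I \<noteq> {}" "k < p"
  then obtain i where "i \<in> I" by auto
  then have "Sg k k = (\<integral>\<omega>. x i k \<omega> * x i k \<omega> \<partial>M)" using cov[of i k k] \<open>k < p\<close> by simp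
  then show ?thesis by (simp add: integral_nonneg_AE)
qed

lemma good_col: "good J \<omega> \<Longrightarrow> k < p \<Longrightarrow> (\<Sum>i\<in>J. (x i k \<omega>)\<^sup>2) \<le> 48 * K\<^sup>2 * real (card J)"
  by (simp add: good_def)

text \<open>Maurey's bound is applied to the empirical form minus half of the population form: on a
  good sample this difference is nonnegative on the net, and its diagonal is bounded by the column
  norms.\<close>

lemma restricted_eigenvalue:
  assumes J: "J \<subseteq> I" and p: "p \<ge> 2" and N: "12 / tail_const K L * ln (real p) \<le> real (card J)"
    and good: "good J \<omega>"
  shows "1 / (2 * L) * ip p v v - re_const K L * ln (real p) / real (card J) * (l1 p v)\<^sup>2
     \<le> 1 / real (card J) * (\<Sum>i\<in>J. (ip p (xr i \<omega>) v)\<^sup>2)"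
proof -
  let ?N = "real (card J)" and ?c = "tail_const K L"
  have lp: "ln (real p) \<ge> 1/2" by (rule ln_ge_half[OF p])
  have cp: "?c > 0" by (rule tail_const_pos)
  have "0 < 12 / tail_const K L * ln (real p)" using lp cp by simp
  then have N0: "?N > 0" using N by linarith
  then have Ine: "I \<noteq> {}" using J by auto
  define X where "X = ?c * ?N / (4 * ln (real p))"
  \<comment> \<open>The constant \<open>12\<close> in the sample size is for this: the depth
    \<open>d\<close> is then at least \<open>2\<close>, and
    \<open>d - 1 >= X - 2 >= X / 3\<close>.\<close>
  have X3: "X \<ge> 3" using N cp lp by (simp add: X_def field_simps)
  define d where "d = net_size J"
  have d: "real d \<ge> X - 1" "d \<ge> 2"
  proof -
    have f: "real_of_int \<lfloor>X\<rfloor> > X - 1" by linarith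
    have "d = nat \<lfloor>X\<rfloor>" by (simp add: d_def net_size_def X_def)
    then have "real d = real_of_int \<lfloor>X\<rfloor>" using X3 f by simp
    then show "real d \<ge> X - 1" using f by simp
    then show "d \<ge> 2" using X3 by simp
  qed
  define A where "A k l = 1 / ?N * (\<Sum>i\<in>J. x i k \<omega> * x i l \<omega>) - 1/2 * Sg k l" for k l
  have bA: "bil p A v v = 1 / ?N * (\<Sum>i\<in>J. (ip p (xr i \<omega>) v)\<^sup>2) - 1/2 * bil p Sg v v" for v
  proof -
    have "(\<Sum>i\<in>J. (ip p (xr i \<omega>) v)\<^sup>2) = (\<Sum>i\<in>J. \<Sum>k<p. \<Sum>l<p. (x i k \<omega> * x i l \<omega>) * v k * v l)"
      unfolding ip_def power2_eq_square sum_product by (simp add: mult_ac)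
    also have "\<dots> = (\<Sum>k<p. \<Sum>l<p. (\<Sum>i\<in>J. x i k \<omega> * x i l \<omega>) * v k * v l)"
      by (subst sum.swap, intro sum.cong refl, subst sum.swap) (simp add: sum_distrib_right)
    finally show ?thesis
      unfolding bil_def A_def by (simp add: sum_subtractf sum_distrib_left algebra_simps)
  qed
  have "bil p A v v \<ge> - (48 * K\<^sup>2 / (real d - 1)) * (l1 p v)\<^sup>2"
  proof (rule maurey_lower_bound)
    show "A k l = A l k" if "k < p" "l < p" for k l
      using Sg_sym[OF Ine that] by (simp add: A_def mult.commute)
    show "d \<ge> 2" by fact
    show "0 \<le> bil p A w w" if "w \<in> signed_sums p d" for w
    proof -
      have "?N / 2 * bil p Sg w w \<le> (\<Sum>i\<in>J. (ip p (xr i \<omega>) w)\<^sup>2)"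
        using good that by (simp add: good_def d_def)
      then show ?thesis unfolding bA using N0 by (simp add: field_simps)
    qed
    show "A k k \<le> 48 * K\<^sup>2" if "k < p" for k
    proof -
      have "1 / ?N * (\<Sum>i\<in>J. (x i k \<omega>)\<^sup>2) \<le> 48 * K\<^sup>2"
        using good_col[OF good that] N0 by (simp add: field_simps)
      then show ?thesis using Sg_diag_nonneg[OF Ine that] by (simp add: A_def power2_eq_square)
    qed
  qed
  moreover have "48 * K\<^sup>2 / (real d - 1) * (l1 p v)\<^sup>2 \<le> re_const K L * ln (real p) / ?N * (l1 p v)\<^sup>2"
  proof (rule mult_right_mono)
    have "48 * K\<^sup>2 / (real d - 1) \<le> 48 * K\<^sup>2 / (X / 3)"
      using d X3 by (intro divide_left_mono) auto
    also have "\<dots> = re_const K L * ln (real p) / ?N"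
      using cp N0 lp by (simp add: X_def re_const_def field_simps)
    finally show "48 * K\<^sup>2 / (real d - 1) \<le> re_const K L * ln (real p) / ?N" .
  qed simp
  moreover have "1 / (2 * L) * ip p v v \<le> 1/2 * bil p Sg v v"
    using low[of v] L1 by (simp add: field_simps)
  ultimately show ?thesis unfolding bA by linarith
qed

text \<open>A smooth upper bound for the largest squared column norm.\<close>

definition lse :: "'i set \<Rightarrow> 'a \<Rightarrow> real" where
  "lse J \<omega> = ln (\<Sum>k<p. exp (psi2 K * (\<Sum>i\<in>J. (x i k \<omega>)\<^sup>2)))"

lemma lse_ge:
  assumes "k < p"
  shows "psi2 K * (\<Sum>i\<in>J. (x i k \<omega>)\<^sup>2) \<le> lse J \<omega>"
proof -
  have "exp (psi2 K * (\<Sum>i\<in>J. (x i k \<omega>)\<^sup>2)) \<le> (\<Sum>k<p. exp (psi2 K * (\<Sum>i\<in>J. (x i k \<omega>)\<^sup>2)))"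
    using assms by (intro member_le_sum[of k "{..<p}" "\<lambda>k. exp (psi2 K * (\<Sum>i\<in>J. (x i k \<omega>)\<^sup>2))"]) auto
  then show ?thesis unfolding lse_def by (subst ln_ge_iff) (use assms in \<open>auto intro!: sum_pos\<close>)
qed

lemma lse_nonneg: "p > 0 \<Longrightarrow> 0 \<le> lse J \<omega>"
  by (rule order.trans[OF _ lse_ge[of 0]]) (use psi2_pos in \<open>auto intro!: mult_nonneg_nonneg sum_nonneg\<close>)

lemma lse_meas: "J \<subseteq> I \<Longrightarrow> lse J \<in> borel_measurable M"
  unfolding lse_def by (intro borel_measurable_ln borel_measurable_sum borel_measurable_exp borel_measurable_times col_meas) auto

text \<open>The mean of \<open>exp (lse J \<omega>)\<close> is at most \<open>exp B\<close>, so the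
  part of \<open>lse\<close> above \<open>B\<close> has a bounded second moment. The bound is of
  order \<open>n^2\<close> as soon as \<open>ln p <= n\<close>, even for batches too small for
  column norms to be controlled in all batches at once.\<close>

lemma lse_second_moment:
  assumes J: "J \<subseteq> I" and p: "p \<ge> 1"
  shows "mean_le M (\<lambda>\<omega>. (lse J \<omega>)\<^sup>2) (2 * (ln (real p) + real (card J) * ln 2)\<^sup>2 + 4)"
proof -
  define B where "B = ln (real p) + real (card J) * ln 2"
  have B0: "B \<ge> 0" using p by (simp add: B_def)
  have pos: "(\<Sum>k<p. exp (psi2 K * (\<Sum>i\<in>J. (x i k \<omega>)\<^sup>2))) > 0" for \<omega>
    using p by (intro sum_pos) (auto simp: lessThan_empty_iff)
  have "mean_le M (\<lambda>\<omega>. \<Sum>k<p. exp (psi2 K * (\<Sum>i\<in>J. (x i k \<omega>)\<^sup>2))) (\<Sum>k<p. exp (real (card J) * ln 2))"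
    by (intro mean_le_sum col_sum_exp[OF J]) auto
  then have e: "mean_le M (\<lambda>\<omega>. exp (lse J \<omega>)) (exp B)"
    using p pos by (simp add: lse_def B_def exp_add)
  have "mean_le M (\<lambda>\<omega>. 2 * B\<^sup>2 + 4 * exp (- B) * exp (lse J \<omega>)) (2 * B\<^sup>2 + 4 * exp (- B) * exp B)"
    by (intro mean_le_add mean_le_const mean_le_cmult e) auto
  then have "mean_le M (\<lambda>\<omega>. (lse J \<omega>)\<^sup>2) (2 * B\<^sup>2 + 4 * exp (- B) * exp B)"
  proof (rule mean_le_dom)
    fix \<omega>
    define y where "y = lse J \<omega>"
    have y0: "y \<ge> 0" using lse_nonneg p by (simp add: y_def)
    have "y\<^sup>2 \<le> 2 * B\<^sup>2 + 4 * exp (y - B)"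
    proof (cases "y \<le> B")
      case True
      then have "y\<^sup>2 \<le> B\<^sup>2" using y0 by (intro power_mono)
      then show ?thesis using zero_le_power2[of B] exp_ge_zero[of "y - B"] by linarith
    next
      case False
      have "(y - B)\<^sup>2 \<le> fact 2 * exp (y - B)" using False by (intro power_le_fact_exp) auto
      moreover have "y\<^sup>2 \<le> 2 * B\<^sup>2 + 2 * (y - B)\<^sup>2"
        using zero_le_power2[of "y - 2 * B"] by (simp add: power2_eq_square algebra_simps)
      ultimately show ?thesis by (simp add: fact_numeral)
    qed
    then show "0 \<le> (lse J \<omega>)\<^sup>2 \<and> (lse J \<omega>)\<^sup>2 \<le> 2 * B\<^sup>2 + 4 * exp (- B) * exp (lse J \<omega>)"
      by (simp add: y_def exp_diff exp_minus field_simps)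
  qed (use lse_meas[OF J] in simp)
  moreover have "4 * exp (- B) * exp B = 4" by (simp flip: exp_add)
  ultimately show ?thesis unfolding B_def[symmetric] by simp
qed

text \<open>A product of two sub-Gaussian variables is sub-exponential, because twice its absolute
  value is at most the sum of the squares; it is centred because \<open>\<theta>\<close> is
  orthogonal to covariate \<open>k\<close> in the population.\<close>

lemma product_mgf:
  assumes J: "J \<subseteq> I" and k: "k < p" and H: "H \<ge> 1" "ip p \<theta> \<theta> \<le> H"
    and z: "bil p Sg \<theta> (unit_fun k) = 0" and t: "\<bar>t\<bar> \<le> psi2 K / (2 * H)"
  shows "mean_le M (\<lambda>\<omega>. exp (t * (\<Sum>i\<in>J. ip p (xr i \<omega>) \<theta> * x i k \<omega>))) (exp (real (card J) * (16 * t\<^sup>2 * (H / psi2 K)\<^sup>2)))"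
proof -
  define \<tau> where "\<tau> = psi2 K / H"
  have \<tau>0: "\<tau> > 0" using psi2_pos H by (simp add: \<tau>_def)
  have fin: "finite J" using J finI finite_subset by blast
  have "mean_le M (\<lambda>\<omega>. exp (\<Sum>i\<in>J. t * (ip p (xr i \<omega>) \<theta> * x i k \<omega>))) (exp (\<Sum>i\<in>J. 16 * t\<^sup>2 / \<tau>\<^sup>2))"
  proof (rule mean_le_exp_sum[OF fin])
    show "indep_vars (\<lambda>_. borel) (\<lambda>i \<omega>. t * (ip p (xr i \<omega>) \<theta> * x i k \<omega>)) J"
      by (rule indep_fun[OF J, of "\<lambda>g. t * (ip p g \<theta> * g k)"]) (use k in \<open>measurable, simp\<close>)
    fix i assume "i \<in> J"
    then have i: "i \<in> I" using J by auto
    let ?Y = "\<lambda>\<omega>. ip p (xr i \<omega>) \<theta> * x i k \<omega>"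
    show "mean_le M (\<lambda>\<omega>. exp (t * ?Y \<omega>)) (exp (16 * t\<^sup>2 / \<tau>\<^sup>2))"
    proof (rule mgf_centred[OF _ \<tau>0])
      show "integrable M ?Y" "expectation ?Y = 0"
        using mean_prod[OF i, of \<theta> "unit_fun k"] k z by (auto simp: row_unit)
      have a: "mean_le M (\<lambda>\<omega>. exp (\<tau> * (ip p (xr i \<omega>) \<theta>)\<^sup>2)) 2"
        using exp_square[OF i, of H \<theta>] H by (simp add: \<tau>_def)
      have b: "mean_le M (\<lambda>\<omega>. exp (\<tau> * (x i k \<omega>)\<^sup>2)) 2"
        using exp_square[OF i, of H "unit_fun k"] H k by (simp add: \<tau>_def row_unit ip_unit_unit)
      have "mean_le M (\<lambda>\<omega>. 1/2 * (exp (\<tau> * (ip p (xr i \<omega>) \<theta>)\<^sup>2) + exp (\<tau> * (x i k \<omega>)\<^sup>2))) (1/2 * (2 + 2))"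
        by (intro mean_le_cmult mean_le_add a b) auto
      then show "mean_le M (\<lambda>\<omega>. exp (\<tau> * \<bar>?Y \<omega>\<bar>)) 2"
      proof (rule mean_le_mono[OF mean_le_dom])
        fix \<omega>
        let ?a = "ip p (xr i \<omega>) \<theta>" and ?b = "x i k \<omega>"
        have "2 * \<bar>?a\<bar> * \<bar>?b\<bar> \<le> \<bar>?a\<bar>\<^sup>2 + \<bar>?b\<bar>\<^sup>2" by (rule sum_squares_bound)
        then have "\<tau> * (2 * \<bar>?a\<bar> * \<bar>?b\<bar>) \<le> \<tau> * (?a\<^sup>2 + ?b\<^sup>2)" using \<tau>0 by (intro mult_left_mono) auto
        then have "exp (\<tau> * \<bar>?a * ?b\<bar>) \<le> exp ((\<tau> * ?a\<^sup>2 + \<tau> * ?b\<^sup>2) / 2)" by (simp add: abs_mult algebra_simps)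
        also have "\<dots> \<le> (exp (\<tau> * ?a\<^sup>2) + exp (\<tau> * ?b\<^sup>2)) / 2" by (rule exp_mean)
        finally show "0 \<le> exp (\<tau> * \<bar>?a * ?b\<bar>) \<and> exp (\<tau> * \<bar>?a * ?b\<bar>) \<le> 1/2 * (exp (\<tau> * ?a\<^sup>2) + exp (\<tau> * ?b\<^sup>2))"
          by simp
      qed (use i k in auto)
      show "\<bar>t\<bar> \<le> \<tau> / 2" using t by (simp add: \<tau>_def)
    qed (use i k in auto)
  qed
  then show ?thesis by (simp add: sum_distrib_left \<tau>_def power_divide)
qed

end

section \<open>Nodewise regression\<close>

lemma add_power_le: "0 \<le> a \<Longrightarrow> 0 \<le> b \<Longrightarrow> (a + b) ^ Suc n \<le> 2 ^ n * (a ^ Suc n + b ^ Suc n)" for a b :: real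
proof (induction n)
  case (Suc n)
  have "0 \<le> (a - b) * (a ^ Suc n - b ^ Suc n)"
  proof (cases "a \<le> b")
    case True
    then have "a ^ Suc n \<le> b ^ Suc n" using Suc.prems by (intro power_mono)
    then show ?thesis using True by (intro mult_nonpos_nonpos) auto
  next
    case False
    then have "b ^ Suc n \<le> a ^ Suc n" using Suc.prems by (intro power_mono) auto
    then show ?thesis using False by (intro mult_nonneg_nonneg) auto
  qed
  then have "(a + b) * (a ^ Suc n + b ^ Suc n) \<le> 2 * (a ^ Suc (Suc n) + b ^ Suc (Suc n))"
    by (simp add: algebra_simps)
  then have "2 ^ n * ((a + b) * (a ^ Suc n + b ^ Suc n)) \<le> 2 ^ n * (2 * (a ^ Suc (Suc n) + b ^ Suc (Suc n)))"
    by (rule mult_left_mono) simp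
  moreover have "(a + b) * (a + b) ^ Suc n \<le> (a + b) * (2 ^ n * (a ^ Suc n + b ^ Suc n))"
    using Suc by (intro mult_left_mono) auto
  moreover have "(a + b) ^ Suc (Suc n) = (a + b) * (a + b) ^ Suc n" by simp
  moreover have "(a + b) * (2 ^ n * (a ^ Suc n + b ^ Suc n)) = 2 ^ n * ((a + b) * (a ^ Suc n + b ^ Suc n))" by simp
  moreover have "2 ^ n * (2 * (a ^ Suc (Suc n) + b ^ Suc (Suc n))) = 2 ^ Suc n * (a ^ Suc (Suc n) + b ^ Suc (Suc n))" by simp
  ultimately show ?case by linarith
qed simp

text \<open>The excess that \<open>fast_rate\<close> tolerates when half of its budget is reserved
  for the sparsity term: \<open>32 * L * a * rho_const K L kk = lam^2 / 2\<close> with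
  \<open>a = re_const K L * ln p / N\<close>.\<close>

definition rho_const :: "real \<Rightarrow> real \<Rightarrow> real \<Rightarrow> real" where
  "rho_const K L kk = 7 * kk / (L * re_const K L)"

text \<open>The three summands serve, in this order, a good sample with small excess, a sample with
  large excess, and a sample without restricted eigenvalues.\<close>

definition rate_const :: "real \<Rightarrow> real \<Rightarrow> real \<Rightarrow> real \<Rightarrow> real" where
  "rate_const K L H kk = 128 * L + 4 * H / rho_const K L kk + 4 * H"

definition V_const :: "real \<Rightarrow> real \<Rightarrow> real" where
  "V_const K H = 2 * fact 8 * (H / psi2 K) ^ 8"

definition psi_const :: "real \<Rightarrow> real \<Rightarrow> real \<Rightarrow> real" where
  "psi_const K L H = 8 + 4 * (128 * (V_const K H + 1) + 128 * (2 + 2 * fact 8 * (2 / tail_const K L) ^ 8))"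

definition first_const :: "real \<Rightarrow> real \<Rightarrow> real \<Rightarrow> real \<Rightarrow> real" where
  "first_const K L H kk = V_const K H + 2 + 3 * (448 * kk)\<^sup>2 + 16 / (tail_const K L)\<^sup>2"

text \<open>The first summand gives a net of sufficient depth, the second the smallness of the
  sparsity term in \<open>fast_rate\<close>, the third \<open>s * lam^2 <= 1\<close>.\<close>

definition size_const :: "real \<Rightarrow> real \<Rightarrow> real \<Rightarrow> real" where
  "size_const K L kk = 12 / tail_const K L + 256 * L * re_const K L + 448 * kk"

text \<open>\<open>\<gamma>0\<close> are the population regression coefficients of covariate \<open>r\<close>, with a zero at position \<open>r\<close>.\<close>

locale nodewise = sub_gaussian_rows +
  fixes r :: nat and \<gamma>0 :: "nat \<Rightarrow> real" and s :: nat and H kk :: real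
  assumes p2: "p \<ge> 2" and r: "r < p" and g0r: "\<gamma>0 r = 0"
    and s1: "s \<ge> 1" and sparse: "card {k. k < p \<and> \<gamma>0 k \<noteq> 0} \<le> s"
    and H1: "H \<ge> 1" and Hg: "ip p \<gamma>0 \<gamma>0 \<le> H"
    and Ht: "ip p (\<lambda>k. unit_fun r k - \<gamma>0 k) (\<lambda>k. unit_fun r k - \<gamma>0 k) \<le> H"
    and orth: "\<And>k. k < p \<Longrightarrow> k \<noteq> r \<Longrightarrow> bil p Sg (\<lambda>k. unit_fun r k - \<gamma>0 k) (unit_fun k) = 0"
    and kk: "kk \<ge> 1" "kk \<ge> 16 * (H / psi2 K)\<^sup>2"
begin

definition "\<theta> = (\<lambda>k. unit_fun r k - \<gamma>0 k)"
definition "Z i \<omega> = ip p (xr i \<omega>) \<theta>"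
text \<open>Covariate \<open>r\<close> is zeroed rather than removed, which keeps all vectors in
  dimension \<open>p\<close>; the score at \<open>r\<close> is then \<open>0\<close>.\<close>

definition "xm i k \<omega> = (if k = r then 0 else x i k \<omega>)"
definition "lam J = lasso_const kk * sqrt (ln (real p) / real (card J))"
definition "Tn J k \<omega> = 1 / real (card J) * (\<Sum>i\<in>J. Z i \<omega> * xm i k \<omega>)"
definition "Rn J \<omega> = excess p (lam J) (\<lambda>k. Tn J k \<omega>)"
definition "Vn J \<omega> = 1 / real (card J) * (\<Sum>i\<in>J. (Z i \<omega>)\<^sup>2)"

lemma Z_meas[measurable]: "i \<in> I \<Longrightarrow> Z i \<in> borel_measurable M"
  unfolding Z_def by measurable

lemma xm_meas[measurable]: "i \<in> I \<Longrightarrow> k < p \<Longrightarrow> xm i k \<in> borel_measurable M"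
  unfolding xm_def by (cases "k = r") auto

lemma Tn_meas[measurable]: "J \<subseteq> I \<Longrightarrow> k < p \<Longrightarrow> Tn J k \<in> borel_measurable M"
  unfolding Tn_def by (intro borel_measurable_times borel_measurable_sum borel_measurable_const) auto

lemma Rn_meas[measurable]: "J \<subseteq> I \<Longrightarrow> Rn J \<in> borel_measurable M"
  unfolding Rn_def excess_def by (intro borel_measurable_sum borel_measurable_power borel_measurable_max borel_measurable_diff borel_measurable_abs borel_measurable_const) auto

lemma Vn_meas[measurable]: "J \<subseteq> I \<Longrightarrow> Vn J \<in> borel_measurable M"
  unfolding Vn_def by (intro borel_measurable_times borel_measurable_sum borel_measurable_power borel_measurable_const) auto

lemma Rn_nonneg: "0 \<le> Rn J \<omega>" by (simp add: Rn_def excess_nonneg)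
lemma Vn_nonneg: "0 \<le> Vn J \<omega>" by (simp add: Vn_def sum_nonneg)

lemma Z_eq: "Z i \<omega> = x i r \<omega> - ip p (xr i \<omega>) \<gamma>0"
  using r by (simp add: Z_def \<theta>_def ip_diff_right row_unit)

lemma lp: "ln (real p) \<ge> 1/2" by (rule ln_ge_half[OF p2])

lemma card_pos: "12 / tail_const K L * ln (real p) \<le> real (card J) \<Longrightarrow> 0 < real (card J)"
proof -
  have "0 < 12 / tail_const K L * ln (real p)" using lp tail_const_pos by simp
  then show "12 / tail_const K L * ln (real p) \<le> real (card J) \<Longrightarrow> 0 < real (card J)" by linarith
qed

lemma card_ge_ln: "12 / tail_const K L * ln (real p) \<le> real (card J) \<Longrightarrow> 12 * ln (real p) \<le> real (card J)"
proof -
  have "12 \<le> 12 / tail_const K L" using tail_const_pos tail_const_le by (simp add: field_simps)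
  then have "12 * ln (real p) \<le> 12 / tail_const K L * ln (real p)" using lp by (intro mult_right_mono) auto
  then show "12 / tail_const K L * ln (real p) \<le> real (card J) \<Longrightarrow> 12 * ln (real p) \<le> real (card J)" by linarith
qed

lemma lam_pos: "0 < real (card J) \<Longrightarrow> 0 < lam J"
  using kk lp by (simp add: lam_def lasso_const_def)

lemma lam_sq: "0 < real (card J) \<Longrightarrow> (lam J)\<^sup>2 = 448 * kk * ln (real p) / real (card J)"
  using kk lp by (simp add: lam_def lasso_const_def power_mult_distrib)

text \<open>The scores are means of products of the population residual with another covariate,
  centred by \<open>orth\<close>. The lower bound on \<open>kk\<close> keeps their exponent below
  \<open>N * lam^2 / (16 * kk)\<close>.\<close>

lemma Rn_moment:
  assumes J: "J \<subseteq> I" and N: "12 / tail_const K L * ln (real p) \<le> real (card J)"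
  shows "mean_le M (\<lambda>\<omega>. ((real p)\<^sup>2 * Rn J \<omega> / (lam J)\<^sup>2) ^ 8) 2"
proof -
  let ?N = "real (card J)"
  have N0: "?N > 0" using card_pos[OF N] .
  have l0: "lam J > 0" using lam_pos[OF N0] .
  define t where "t = lam J / (4 * kk)"
  have t0: "t > 0" using l0 kk by (simp add: t_def)
  have psi: "psi2 K > 0" by (rule psi2_pos)
  \<comment> \<open>The exponent must lie in the range where the moment generating function of the
    products is controlled; this uses \<open>12 * ln p <= N\<close> and
    \<open>kk >= 16 * (H / psi2 K)^2\<close>.\<close>
  have tb: "t \<le> psi2 K / (2 * H)"
  proof -
    have "t\<^sup>2 = 448 * kk * ln (real p) / ?N / (16 * kk\<^sup>2)"
      by (simp add: t_def power_divide lam_sq[OF N0] power_mult_distrib)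
    also have "\<dots> = 28 / kk * (ln (real p) / ?N)" using kk by (simp add: field_simps power2_eq_square)
    also have "\<dots> \<le> 28 / kk * (1 / 12)" using card_ge_ln[OF N] N0 kk by (intro mult_left_mono) (auto simp: field_simps)
    also have "\<dots> \<le> 4 / kk" using kk by (simp add: field_simps)
    also have "\<dots> \<le> 4 / (16 * (H / psi2 K)\<^sup>2)" using kk H1 psi by (intro divide_left_mono) auto
    also have "\<dots> = (psi2 K / (2 * H))\<^sup>2" by (simp add: power_divide power_mult_distrib)
    finally show ?thesis by (rule power2_le_imp_le) (use psi H1 in simp)
  qed
  have m: "mean_le M (\<lambda>\<omega>. exp (u * (\<Sum>i\<in>J. Z i \<omega> * x i k \<omega>))) (exp (?N * (lam J)\<^sup>2 / (16 * kk)))"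
    if k: "k < p" "k \<noteq> r" and u: "u = t \<or> u = - t" for u k
  proof -
    have "mean_le M (\<lambda>\<omega>. exp (u * (\<Sum>i\<in>J. ip p (xr i \<omega>) \<theta> * x i k \<omega>))) (exp (?N * (16 * u\<^sup>2 * (H / psi2 K)\<^sup>2)))"
      by (rule product_mgf[OF J]) (use k u H1 Ht orth t0 tb in \<open>auto simp: \<theta>_def\<close>)
    moreover have "?N * (16 * u\<^sup>2 * (H / psi2 K)\<^sup>2) \<le> ?N * (lam J)\<^sup>2 / (16 * kk)"
    proof -
      have "16 * u\<^sup>2 * (H / psi2 K)\<^sup>2 = (16 * (H / psi2 K)\<^sup>2) * t\<^sup>2" using u by auto
      also have "\<dots> \<le> kk * t\<^sup>2" using kk by (intro mult_right_mono) auto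
      also have "\<dots> = (lam J)\<^sup>2 / (16 * kk)" using kk by (simp add: t_def power_divide power2_eq_square)
      finally have "?N * (16 * u\<^sup>2 * (H / psi2 K)\<^sup>2) \<le> ?N * ((lam J)\<^sup>2 / (16 * kk))" by (rule mult_left_mono) simp
      then show ?thesis by simp
    qed
    ultimately show ?thesis unfolding Z_def by (auto intro: mean_le_mono)
  qed
  have "mean_le M (\<lambda>\<omega>. indicator (space M) \<omega> * ((real p)\<^sup>2 * excess p (lam J) (\<lambda>k. Tn J k \<omega>) / (lam J)\<^sup>2) ^ 8) 2"
  proof (rule excess_moment[of p "Tn J" "space M" ?N kk "lam J"])
    show "lam J = lasso_const kk * sqrt (ln (real p) / ?N)" by (simp add: lam_def)
    fix k assume k: "k < p"
    show "mean_le M (\<lambda>\<omega>. indicator (space M) \<omega> * exp (?N * lam J / (4 * kk) * \<bar>Tn J k \<omega>\<bar>)) (2 * exp (?N * (lam J)\<^sup>2 / (16 * kk)))"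
    proof (cases "k = r")
      case True
      then have "Tn J k \<omega> = 0" for \<omega> by (simp add: Tn_def xm_def)
      moreover have "1 \<le> exp (?N * (lam J)\<^sup>2 / (16 * kk))" using kk by simp
      then have "1 \<le> 2 * exp (?N * (lam J)\<^sup>2 / (16 * kk))" by linarith
      then have "mean_le M (\<lambda>_. 1) (2 * exp (?N * (lam J)\<^sup>2 / (16 * kk)))" by (rule mean_le_const)
      then have "mean_le M (\<lambda>\<omega>. indicator (space M) \<omega>) (2 * exp (?N * (lam J)\<^sup>2 / (16 * kk)))"
        by (rule mean_le_dom) (auto simp: indicator_def)
      ultimately show ?thesis by simp
    next
      case False
      let ?Y = "\<lambda>\<omega>. \<Sum>i\<in>J. Z i \<omega> * x i k \<omega>"
      have "mean_le M (\<lambda>\<omega>. exp (t * ?Y \<omega>) + exp (- t * ?Y \<omega>)) (exp (?N * (lam J)\<^sup>2 / (16 * kk)) + exp (?N * (lam J)\<^sup>2 / (16 * kk)))"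
        using k False by (intro mean_le_add m) auto
      then show ?thesis
      proof (rule mean_le_mono[OF mean_le_dom])
        fix \<omega>
        have "?N * lam J / (4 * kk) * \<bar>Tn J k \<omega>\<bar> = t * \<bar>?Y \<omega>\<bar>"
          using N0 False by (simp add: Tn_def xm_def t_def abs_mult)
        moreover have "exp (t * \<bar>?Y \<omega>\<bar>) \<le> exp (t * ?Y \<omega>) + exp (- t * ?Y \<omega>)" by (cases "?Y \<omega> \<ge> 0") auto
        ultimately show "0 \<le> indicator (space M) \<omega> * exp (?N * lam J / (4 * kk) * \<bar>Tn J k \<omega>\<bar>) \<and>
          indicator (space M) \<omega> * exp (?N * lam J / (4 * kk) * \<bar>Tn J k \<omega>\<bar>) \<le> exp (t * ?Y \<omega>) + exp (- t * ?Y \<omega>)"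
          by (simp add: indicator_def)
      qed (use J k in auto)
    qed
  qed (use J p2 N0 kk in auto)
  then show ?thesis unfolding Rn_def by (subst (asm) mean_le_cong[where g="\<lambda>\<omega>. ((real p)\<^sup>2 * excess p (lam J) (\<lambda>k. Tn J k \<omega>) / (lam J)\<^sup>2) ^ 8"]) auto
qed

lemma Vn_moment:
  assumes J: "J \<subseteq> I" and N: "0 < real (card J)"
  shows "mean_le M (\<lambda>\<omega>. (Vn J \<omega>) ^ 8) (V_const K H)"
proof -
  have fin: "finite J" using J finI finite_subset by blast
  have "mean_le M (\<lambda>\<omega>. 1 / real (card J) * (\<Sum>i\<in>J. (Z i \<omega>) ^ (2 * 8))) (1 / real (card J) * (\<Sum>i\<in>J. V_const K H))"
    unfolding Z_def V_const_def by (intro mean_le_cmult mean_le_sum moment) (use J H1 Ht in \<open>auto simp: \<theta>_def\<close>)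
  then have "mean_le M (\<lambda>\<omega>. (Vn J \<omega>) ^ 8) (1 / real (card J) * (\<Sum>i\<in>J. V_const K H))"
  proof (rule mean_le_dom)
    fix \<omega>
    have ne: "J \<noteq> {}" using N by auto
    have "(Vn J \<omega>) ^ 8 \<le> 1 / real (card J) * (\<Sum>i\<in>J. (Z i \<omega>) ^ (2 * 8))"
      using power_mean[OF fin ne, of 8 "\<lambda>i. (Z i \<omega>)\<^sup>2"] by (simp add: Vn_def flip: power_mult)
    then show "0 \<le> (Vn J \<omega>) ^ 8 \<and> (Vn J \<omega>) ^ 8 \<le> 1 / real (card J) * (\<Sum>i\<in>J. (Z i \<omega>) ^ (2 * 8))" by simp
  qed (use J in auto)
  then show ?thesis using N by simp
qed

lemma rho_pos: "rho_const K L kk > 0"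
  using kk L1 re_const_pos by (simp add: rho_const_def)

lemma rate_pos: "rate_const K L H kk > 0"
  using rho_pos L1 H1 by (auto simp: rate_const_def intro!: add_pos_pos)

lemma size_const_parts:
  assumes "size_const K L kk * real s * ln (real p) \<le> real (card J)"
  shows "12 / tail_const K L * ln (real p) \<le> real (card J)"
    "256 * L * re_const K L * (real s * ln (real p)) \<le> real (card J)"
    "448 * kk * (real s * ln (real p)) \<le> real (card J)"
proof -
  have pos: "12 / tail_const K L \<ge> 0" "256 * L * re_const K L \<ge> 0" "448 * kk \<ge> 0"
    using tail_const_pos re_const_pos L1 kk by auto
  have sl: "real s * ln (real p) \<ge> ln (real p)" using s1 lp by (simp add: mult_le_cancel_right1)
  have sl0: "real s * ln (real p) \<ge> 0" using sl lp by linarith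
  have "12 / tail_const K L * ln (real p) \<le> 12 / tail_const K L * (real s * ln (real p))"
    using sl pos by (intro mult_left_mono) auto
  moreover have "12 / tail_const K L * (real s * ln (real p)) + 256 * L * re_const K L * (real s * ln (real p)) + 448 * kk * (real s * ln (real p)) \<le> real (card J)"
    using assms by (simp add: size_const_def algebra_simps)
  moreover have "0 \<le> 12 / tail_const K L * (real s * ln (real p))" "0 \<le> 256 * L * re_const K L * (real s * ln (real p))" "0 \<le> 448 * kk * (real s * ln (real p))"
    using pos sl0 by (auto intro!: mult_nonneg_nonneg)
  ultimately show "12 / tail_const K L * ln (real p) \<le> real (card J)"
    "256 * L * re_const K L * (real s * ln (real p)) \<le> real (card J)"
    "448 * kk * (real s * ln (real p)) \<le> real (card J)" by linarith+
qed

text \<open>The deviation of the lasso errors from their usual rates: it accounts for the excess of the scores and,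
  through the trivial bound on a lasso error, for the failure of the restricted eigenvalue condition.\<close>

definition "Err J \<omega> = (Vn J \<omega> + 1) * (Rn J \<omega> + indicator (bad J) \<omega>)"

lemma Err_meas[measurable]: "J \<subseteq> I \<Longrightarrow> Err J \<in> borel_measurable M"
proof -
  assume J: "J \<subseteq> I"
  note [measurable] = bad_sets[OF J] Vn_meas[OF J] Rn_meas[OF J]
  show ?thesis unfolding Err_def by measurable
qed

lemma Err_nonneg: "0 \<le> Err J \<omega>"
  using Vn_nonneg Rn_nonneg by (simp add: Err_def)

text \<open>On a good sample with small excess the fast rate applies and the excess goes into
  \<open>Err\<close>. In all other cases \<open>Err\<close> is at least a fixed multiple of
  \<open>Vn + 1\<close>, and the trivial bound is at most a constant times
  \<open>Err / lam\<close>.\<close>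

lemma nodewise_rates:
  assumes J: "J \<subseteq> I" and N: "size_const K L kk * real s * ln (real p) \<le> real (card J)"
    and \<omega>: "\<omega> \<in> space M" and gr: "g r = 0"
    and opt: "(1 / (2 * real (card J))) * (\<Sum>i\<in>J. (x i r \<omega> - ip p (xr i \<omega>) g)\<^sup>2) + lam J * l1 p g
       \<le> (1 / (2 * real (card J))) * (\<Sum>i\<in>J. (Z i \<omega>)\<^sup>2) + lam J * l1 p \<gamma>0"
  shows "l1 p (\<lambda>k. g k - \<gamma>0 k) \<le> rate_const K L H kk * (real s * lam J + Err J \<omega> / lam J)"
    and "1 / real (card J) * (\<Sum>i\<in>J. (ip p (xr i \<omega>) (\<lambda>k. g k - \<gamma>0 k))\<^sup>2)
       \<le> rate_const K L H kk * (real s * (lam J)\<^sup>2 + Err J \<omega>)"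
proof -
  let ?N = "real (card J)"
  define l where "l = lam J"
  note parts = size_const_parts[OF N]
  have N0: "?N > 0" using card_pos[OF parts(1)] .
  have l0: "l > 0" using lam_pos[OF N0] by (simp add: l_def)
  have l2: "l\<^sup>2 = 448 * kk * ln (real p) / ?N" using lam_sq[OF N0] by (simp add: l_def)
  have ipm: "ip p (\<lambda>k. xm i k \<omega>) u = ip p (xr i \<omega>) u" if "u r = 0" for u i
    unfolding ip_def by (intro sum.cong refl) (use that in \<open>auto simp: xm_def\<close>)
  interpret lp: lasso_point p J ?N l "\<lambda>i k. xm i k \<omega>" \<gamma>0 g "\<lambda>i. Z i \<omega>" s
  proof
    have "ip p (\<lambda>k. xm i k \<omega>) \<gamma>0 + Z i \<omega> - ip p (\<lambda>k. xm i k \<omega>) g = x i r \<omega> - ip p (xr i \<omega>) g" for i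
      using g0r gr by (simp add: ipm Z_eq)
    then show "1 / (2 * ?N) * (\<Sum>i\<in>J. (ip p (\<lambda>k. xm i k \<omega>) \<gamma>0 + Z i \<omega> - ip p (\<lambda>k. xm i k \<omega>) g)\<^sup>2) + l * l1 p g
      \<le> 1 / (2 * ?N) * (\<Sum>i\<in>J. (Z i \<omega>)\<^sup>2) + l * l1 p \<gamma>0" using opt by (simp add: l_def)
  qed (use N0 l0 sparse in auto)
  have dr: "lp.\<delta> r = 0" using gr g0r by (simp add: lp.\<delta>_def)
  have P: "lp.P = 1 / ?N * (\<Sum>i\<in>J. (ip p (xr i \<omega>) lp.\<delta>)\<^sup>2)"
    using dr by (simp add: lp.P_def ipm)
  have V: "lp.V = Vn J \<omega>" by (simp add: lp.V_def Vn_def)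
  have R: "excess p l lp.T = Rn J \<omega>"
    by (simp add: Rn_def l_def lp.T_def[abs_def] Tn_def)
  have A: "128 * L \<le> rate_const K L H kk" "4 * H / rho_const K L kk \<le> rate_const K L H kk" "4 * H \<le> rate_const K L H kk"
    using L1 H1 rho_pos by (auto simp: rate_const_def)
  have E0: "0 \<le> Rn J \<omega>" "0 \<le> Vn J \<omega>" by (auto simp: Rn_nonneg Vn_nonneg)
  have ER: "Rn J \<omega> \<le> Err J \<omega>"
  proof -
    have "1 * Rn J \<omega> \<le> (Vn J \<omega> + 1) * (Rn J \<omega> + indicator (bad J) \<omega>)" using E0 by (intro mult_mono) auto
    then show ?thesis by (simp add: Err_def)
  qed
  have sl2: "real s * l\<^sup>2 \<le> 1"
    using parts(3) N0 by (simp add: l2 field_simps)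
  \<comment> \<open>Prepares the trivial bound: the penalty at the population coefficients stays
    bounded because \<open>s * lam^2 <= 1\<close>.\<close>
  have lg: "l * l1 p \<gamma>0 \<le> H"
  proof -
    have "l * l1 p \<gamma>0 \<le> l * (sqrt (real s) * sqrt (ip p \<gamma>0 \<gamma>0))"
      using l1_le_card_ip[OF sparse] l0 by (intro mult_left_mono) auto
    also have "\<dots> = sqrt (real s * l\<^sup>2) * sqrt (ip p \<gamma>0 \<gamma>0)" using l0 by (simp add: real_sqrt_mult)
    also have "\<dots> \<le> 1 * sqrt (H\<^sup>2)"
    proof (intro mult_mono real_sqrt_le_mono)
      have "H * 1 \<le> H * H" using H1 by (intro mult_left_mono) auto
      then show "ip p \<gamma>0 \<gamma>0 \<le> H\<^sup>2" using Hg by (simp add: power2_eq_square)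
    qed (use sl2 in \<open>auto simp: ip_self_nonneg\<close>)
    finally show ?thesis using H1 by simp
  qed
  have slow1: "l1 p lp.\<delta> \<le> 4 * H * (Vn J \<omega> + 1) / l"
  proof -
    have "l * l1 p lp.\<delta> \<le> Vn J \<omega> / 2 + 2 * (l * l1 p \<gamma>0)"
      using lp.slow_rate(1) l0 unfolding V by (simp add: field_simps)
    also have "\<dots> \<le> 4 * H * (Vn J \<omega> + 1)"
      using lg mult_right_mono[of 1 H "Vn J \<omega>"] H1 E0 by (simp add: algebra_simps)
    finally show ?thesis using l0 by (simp add: field_simps)
  qed
  have slow2: "lp.P \<le> 4 * H * (Vn J \<omega> + 1)"
    using lp.slow_rate(2) lg mult_right_mono[of 1 H "Vn J \<omega>"] H1 E0 unfolding V by (simp add: algebra_simps)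
  have slow: "l1 p lp.\<delta> \<le> rate_const K L H kk * (real s * l + Err J \<omega> / l) \<and> lp.P \<le> rate_const K L H kk * (real s * l\<^sup>2 + Err J \<omega>)"
    if c: "4 * H * (Vn J \<omega> + 1) \<le> rate_const K L H kk * Err J \<omega>"
  proof
    have "l1 p lp.\<delta> \<le> rate_const K L H kk * Err J \<omega> / l"
      using slow1 divide_right_mono[OF c, of l] l0 by linarith
    moreover have "0 \<le> rate_const K L H kk * (real s * l)" "0 \<le> rate_const K L H kk * (real s * l\<^sup>2)"
      using rate_pos l0 by auto
    ultimately show "l1 p lp.\<delta> \<le> rate_const K L H kk * (real s * l + Err J \<omega> / l)" "lp.P \<le> rate_const K L H kk * (real s * l\<^sup>2 + Err J \<omega>)"
      using slow2 c by (simp_all add: distrib_left)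
  qed
  have "l1 p lp.\<delta> \<le> rate_const K L H kk * (real s * l + Err J \<omega> / l) \<and> lp.P \<le> rate_const K L H kk * (real s * l\<^sup>2 + Err J \<omega>)"
  proof (cases "\<omega> \<in> bad J")
    case True
    have "4 * H * (Vn J \<omega> + 1) \<le> rate_const K L H kk * ((Vn J \<omega> + 1) * 1)"
      using mult_right_mono[OF A(3), of "Vn J \<omega> + 1"] E0 by simp
    also have "\<dots> \<le> rate_const K L H kk * Err J \<omega>"
      unfolding Err_def using True E0 rate_pos by (intro mult_left_mono) auto
    finally show ?thesis by (rule slow)
  next
    case nb: False
    show ?thesis
    proof (cases "Rn J \<omega> \<le> rho_const K L kk")
      case False
      have "4 * H * (Vn J \<omega> + 1) \<le> 4 * H * (Vn J \<omega> + 1) * (Rn J \<omega> / rho_const K L kk)"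
      proof -
        have "1 \<le> Rn J \<omega> / rho_const K L kk" using False rho_pos by simp
        then show ?thesis using mult_left_mono[of 1 "Rn J \<omega> / rho_const K L kk" "4 * H * (Vn J \<omega> + 1)"] H1 E0 by simp
      qed
      also have "\<dots> = 4 * H / rho_const K L kk * ((Vn J \<omega> + 1) * Rn J \<omega>)" by simp
      also have "\<dots> \<le> rate_const K L H kk * ((Vn J \<omega> + 1) * Rn J \<omega>)"
        using A(2) E0 by (intro mult_right_mono) auto
      also have "\<dots> = rate_const K L H kk * Err J \<omega>" using nb by (simp add: Err_def)
      finally show ?thesis by (rule slow)
    next
      case True
      have good: "good J \<omega>" using nb \<omega> by (simp add: bad_def)
      define a where "a = re_const K L * ln (real p) / ?N"
      have a0: "a \<ge> 0" using re_const_pos lp N0 by (simp add: a_def)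
      have RE: "1 / (2 * L) * ip p lp.\<delta> lp.\<delta> - a * (l1 p lp.\<delta>)\<^sup>2 \<le> lp.P"
        using restricted_eigenvalue[OF J p2 parts(1) good, of lp.\<delta>] unfolding P a_def by simp
      have "a * (8 * l\<^sup>2 * real s + 2 * excess p l lp.T) \<le> 1 / (2 * L) * l\<^sup>2 / 8"
      proof -
        have as: "256 * L * (a * real s) \<le> 1"
          using parts(2) N0 by (simp add: a_def field_simps)
        have "16 * L * (a * (8 * l\<^sup>2 * real s)) = 1/2 * l\<^sup>2 * (256 * L * (a * real s))" by simp
        also have "\<dots> \<le> 1/2 * l\<^sup>2 * 1" by (intro mult_left_mono as) auto
        finally have 1: "16 * L * (a * (8 * l\<^sup>2 * real s)) \<le> 1/2 * l\<^sup>2" by simp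
        have "16 * L * (a * (2 * Rn J \<omega>)) \<le> 16 * L * (a * (2 * rho_const K L kk))"
          using True a0 L1 by (intro mult_left_mono) auto
        also have "\<dots> = 1/2 * l\<^sup>2"
          using L1 re_const_pos N0 by (simp add: a_def rho_const_def l2 field_simps)
        finally have "16 * L * (a * (8 * l\<^sup>2 * real s + 2 * Rn J \<omega>)) \<le> l\<^sup>2" using 1 by (simp add: algebra_simps)
        then show ?thesis unfolding R using L1 by (simp add: field_simps)
      qed
      from lp.fast_rate[OF _ a0 RE this]
      have f1: "l1 p lp.\<delta> \<le> 2 * (8 * l\<^sup>2 * real s + 2 * Rn J \<omega>) / (1 / (2 * L) * l)"
        and f2: "lp.P \<le> 8 * (8 * l\<^sup>2 * real s + 2 * Rn J \<omega>) / (1 / (2 * L))"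
        using L1 unfolding R by auto
      have "2 * (8 * l\<^sup>2 * real s + 2 * Rn J \<omega>) / (1 / (2 * L) * l) = 32 * L * (real s * l) + 8 * L * (Rn J \<omega> / l)"
        using l0 L1 by (simp add: field_simps power2_eq_square)
      also have "\<dots> \<le> rate_const K L H kk * (real s * l) + rate_const K L H kk * (Err J \<omega> / l)"
        using A(1) L1 l0 E0 ER rate_pos by (intro add_mono mult_mono) (auto simp: divide_right_mono)
      finally have "l1 p lp.\<delta> \<le> rate_const K L H kk * (real s * l + Err J \<omega> / l)"
        using f1 by (simp add: distrib_left)
      moreover have "8 * (8 * l\<^sup>2 * real s + 2 * Rn J \<omega>) / (1 / (2 * L)) = 128 * L * (real s * l\<^sup>2) + 32 * L * Rn J \<omega>"
        by (simp add: algebra_simps)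
      moreover have "\<dots> \<le> rate_const K L H kk * (real s * l\<^sup>2) + rate_const K L H kk * Err J \<omega>"
        using A(1) L1 l0 E0 ER rate_pos by (intro add_mono mult_mono) auto
      ultimately show ?thesis using f2 by (simp add: distrib_left)
    qed
  qed
  then show "l1 p (\<lambda>k. g k - \<gamma>0 k) \<le> rate_const K L H kk * (real s * lam J + Err J \<omega> / lam J)"
    "1 / real (card J) * (\<Sum>i\<in>J. (ip p (xr i \<omega>) (\<lambda>k. g k - \<gamma>0 k))\<^sup>2)
       \<le> rate_const K L H kk * (real s * (lam J)\<^sup>2 + Err J \<omega>)"
    unfolding P by (simp_all add: lp.\<delta>_def l_def)
qed

end

section \<open>Moments of the deviation from the lasso rates\<close>

context nodewise
begin

text \<open>An exponentially small probability beats every power of the sample size; this pays for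
  the powers of \<open>1 / lam^2 <= N\<close> that the trivial bound costs.\<close>

lemma bad_prob_power:
  assumes J: "J \<subseteq> I" and N: "12 / tail_const K L * ln (real p) \<le> real (card J)"
  shows "real (card J) ^ n * prob (bad J) \<le> 2 * fact n * (2 / tail_const K L) ^ n"
proof -
  let ?N = "real (card J)" and ?c = "tail_const K L"
  have N0: "?N > 0" using card_pos[OF N] .
  have c: "?c > 0" by (rule tail_const_pos)
  have "ln (real p) \<le> ?N" using card_ge_ln[OF N] lp by linarith
  then have b: "prob (bad J) \<le> 2 * exp (- (?c / 2 * ?N))" by (rule bad_prob[OF J p2])
  have "(?c / 2 * ?N) ^ n \<le> fact n * exp (?c / 2 * ?N)" using c N0 by (intro power_le_fact_exp) auto
  then have "?N ^ n \<le> (2 / ?c) ^ n * (fact n * exp (?c / 2 * ?N))"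
    using c by (simp add: power_mult_distrib power_divide field_simps)
  then have "?N ^ n * prob (bad J) \<le> (2 / ?c) ^ n * (fact n * exp (?c / 2 * ?N)) * (2 * exp (- (?c / 2 * ?N)))"
    using b c by (intro mult_mono) auto
  also have "\<dots> = 2 * fact n * (2 / ?c) ^ n * (exp (?c / 2 * ?N) * exp (- (?c / 2 * ?N)))" by simp
  also have "exp (?c / 2 * ?N) * exp (- (?c / 2 * ?N)) = 1" by (simp flip: exp_add)
  finally show ?thesis by simp
qed

lemma R_bound:
  assumes J: "J \<subseteq> I" and N: "12 / tail_const K L * ln (real p) \<le> real (card J)"
  shows "mean_le M (\<lambda>\<omega>. (Rn J \<omega> / (lam J)\<^sup>2) ^ 8) 2"
proof (rule mean_le_dom[OF Rn_moment[OF J N]])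
  fix \<omega>
  have q: "0 \<le> Rn J \<omega> / (lam J)\<^sup>2" by (simp add: Rn_nonneg)
  have "1 * (Rn J \<omega> / (lam J)\<^sup>2) \<le> (real p)\<^sup>2 * (Rn J \<omega> / (lam J)\<^sup>2)"
    using p2 q by (intro mult_right_mono) auto
  then show "0 \<le> (Rn J \<omega> / (lam J)\<^sup>2) ^ 8 \<and> (Rn J \<omega> / (lam J)\<^sup>2) ^ 8 \<le> ((real p)\<^sup>2 * Rn J \<omega> / (lam J)\<^sup>2) ^ 8"
    using q by (auto intro!: power_mono)
qed (use J in measurable)

text \<open>\<open>Err / lam^2\<close> is a product, and its fourth power is split into the eighth
  powers of \<open>Vn + 1\<close> and of the normalised excess plus failure indicator. The indicator
  comes with \<open>1 / lam^16 <= N^8\<close>, for which its probability pays.\<close>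

lemma Err_moment:
  assumes J: "J \<subseteq> I" and N: "12 / tail_const K L * ln (real p) \<le> real (card J)"
  shows "mean_le M (\<lambda>\<omega>. (1 + Err J \<omega> / (lam J)\<^sup>2) ^ 4) (psi_const K L H)"
proof -
  let ?N = "real (card J)"
  have N0: "?N > 0" using card_pos[OF N] .
  define l2 where "l2 = (lam J)\<^sup>2"
  have l2p: "l2 > 0" using lam_pos[OF N0] by (simp add: l2_def)
  define F where "F \<omega> = (indicator (bad J) \<omega> :: real)" for \<omega>
  have mF: "mean_le M (\<lambda>\<omega>. 1 / l2 ^ 8 * F \<omega>) (2 * fact 8 * (2 / tail_const K L) ^ 8)"
  proof -
    have "mean_le M (\<lambda>\<omega>. 1 / l2 ^ 8 * F \<omega>) (1 / l2 ^ 8 * prob (bad J))"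
      unfolding F_def using l2p by (intro mean_le_cmult mean_le_indicator bad_sets J) auto
    moreover have "1 / l2 ^ 8 * prob (bad J) \<le> ?N ^ 8 * prob (bad J)"
    proof (rule mult_right_mono)
      have "1 * (1/2) \<le> (448 * kk) * ln (real p)" using kk lp by (intro mult_mono) auto
      moreover have "448 * ((1/2)::real) \<le> 448 * (kk * ln (real p))"
      proof -
        have "1 * (1/2) \<le> kk * ln (real p)" using kk lp by (intro mult_mono) auto
        then show ?thesis by simp
      qed
      ultimately have "1 / l2 \<le> ?N" unfolding l2_def lam_sq[OF N0] using N0 by (simp add: field_simps)
      then have "(1 / l2) ^ 8 \<le> ?N ^ 8" using l2p by (intro power_mono) auto
      then show "1 / l2 ^ 8 \<le> ?N ^ 8" by (simp add: power_divide)
    qed simp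
    ultimately show ?thesis using bad_prob_power[OF J N, of 8] by (auto intro: mean_le_mono)
  qed
  have mR: "mean_le M (\<lambda>\<omega>. (Rn J \<omega> / l2) ^ 8) 2" unfolding l2_def by (rule R_bound[OF J N])
  have "mean_le M (\<lambda>\<omega>. 8 + 4 * (128 * ((Vn J \<omega>) ^ 8 + 1) + 128 * ((Rn J \<omega> / l2) ^ 8 + 1 / l2 ^ 8 * F \<omega>))) (psi_const K L H)"
    unfolding psi_const_def by (intro mean_le_add mean_le_const mean_le_cmult Vn_moment[OF J N0] mR mF) auto
  then show ?thesis
  proof (rule mean_le_dom)
    fix \<omega>
    define v q where "v = Vn J \<omega>" and "q = Rn J \<omega> / l2"
    define f where "f = F \<omega> / l2"
    have v0: "0 \<le> v" and q0: "0 \<le> q" and f0: "0 \<le> f" using l2p by (auto simp: v_def q_def f_def Vn_nonneg Rn_nonneg F_def)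
    have E: "Err J \<omega> / (lam J)\<^sup>2 = (v + 1) * (q + f)"
      by (simp add: Err_def v_def q_def f_def F_def l2_def flip: add_divide_distrib)
    have f8: "f ^ 8 = 1 / l2 ^ 8 * F \<omega>"
      by (cases "\<omega> \<in> bad J") (simp_all add: f_def F_def power_divide)
    have a4: "(1 + w) ^ 4 \<le> 8 * (1 + w ^ 4)" if "0 \<le> w" for w :: real
      using add_power_le[of 1 w 3] that by (simp add: eval_nat_numeral)
    have a8: "(u + w) ^ 8 \<le> 128 * (u ^ 8 + w ^ 8)" if "0 \<le> u" "0 \<le> w" for u w :: real
      using add_power_le[of u w 7] that by (simp add: eval_nat_numeral)
    have "((v + 1) * (q + f)) ^ 4 \<le> 1/2 * ((v + 1) ^ 8 + (q + f) ^ 8)"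
    proof -
      have "2 * ((v + 1) ^ 4) * ((q + f) ^ 4) \<le> ((v + 1) ^ 4)\<^sup>2 + ((q + f) ^ 4)\<^sup>2" by (rule sum_squares_bound)
      then show ?thesis by (simp add: power_mult_distrib flip: power_mult)
    qed
    moreover have "(v + 1) ^ 8 \<le> 128 * (v ^ 8 + 1)" using a8[of v 1] v0 by simp
    moreover have "(q + f) ^ 8 \<le> 128 * (q ^ 8 + f ^ 8)" using a8 q0 f0 by simp
    moreover have "(1 + (v + 1) * (q + f)) ^ 4 \<le> 8 * (1 + ((v + 1) * (q + f)) ^ 4)"
      using v0 q0 f0 by (intro a4) auto
    moreover have "X \<le> 8 + 4 * (c + d)" if "Y \<le> 1/2 * (A + B)" "A \<le> c" "B \<le> d" "X \<le> 8 * (1 + Y)" for X Y A B c d :: real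
    proof -
      have "8 * Y \<le> 4 * (A + B)" using that(1) by simp
      then show ?thesis using that(2-4) by simp
    qed
    ultimately have "(1 + (v + 1) * (q + f)) ^ 4 \<le> 8 + 4 * (128 * (v ^ 8 + 1) + 128 * (q ^ 8 + f ^ 8))"
      by blast
    then show "0 \<le> (1 + Err J \<omega> / (lam J)\<^sup>2) ^ 4 \<and> (1 + Err J \<omega> / (lam J)\<^sup>2) ^ 4 \<le>
       8 + 4 * (128 * ((Vn J \<omega>) ^ 8 + 1) + 128 * ((Rn J \<omega> / l2) ^ 8 + 1 / l2 ^ 8 * F \<omega>))"
      unfolding E f8 v_def[symmetric] q_def[symmetric] using v0 q0 f0 by (auto intro!: zero_le_power add_nonneg_nonneg mult_nonneg_nonneg)
  qed (use Err_meas[OF J] in measurable)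
qed

text \<open>A finer scale than \<open>lam^2\<close>: the factor \<open>p^2\<close> in the moment of
  the excess absorbs the logarithm in \<open>N * lam^2 = 448 * kk * ln p\<close>, so the mean of
  \<open>Err\<close> is of order \<open>1 / N\<close>.\<close>

lemma Err_first_moment:
  assumes J: "J \<subseteq> I" and N: "12 / tail_const K L * ln (real p) \<le> real (card J)"
  shows "mean_le M (\<lambda>\<omega>. real (card J) * Err J \<omega>) (first_const K L H kk)"
proof -
  let ?N = "real (card J)"
  have N0: "?N > 0" using card_pos[OF N] .
  define F where "F \<omega> = (indicator (bad J) \<omega> :: real)" for \<omega>
  define y where "y \<omega> = (real p)\<^sup>2 * Rn J \<omega> / (lam J)\<^sup>2" for \<omega>
  have my: "mean_le M (\<lambda>\<omega>. y \<omega> ^ 8) 2" unfolding y_def by (rule Rn_moment[OF J N])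
  have mF: "mean_le M (\<lambda>\<omega>. ?N\<^sup>2 * F \<omega>) (16 / (tail_const K L)\<^sup>2)"
  proof -
    have "mean_le M (\<lambda>\<omega>. ?N\<^sup>2 * F \<omega>) (?N\<^sup>2 * prob (bad J))"
      unfolding F_def by (intro mean_le_cmult mean_le_indicator bad_sets J) auto
    then show ?thesis using bad_prob_power[OF J N, of 2]
      by (elim mean_le_mono) (simp add: power_divide fact_numeral)
  qed
  have "mean_le M (\<lambda>\<omega>. ((Vn J \<omega>) ^ 8 + 2) + ((448 * kk)\<^sup>2 * (1 + y \<omega> ^ 8) + ?N\<^sup>2 * F \<omega>))
     ((V_const K H + 2) + ((448 * kk)\<^sup>2 * (1 + 2) + 16 / (tail_const K L)\<^sup>2))"
    by (intro mean_le_add mean_le_const mean_le_cmult Vn_moment[OF J N0] my mF) auto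
  then have "mean_le M (\<lambda>\<omega>. ?N * Err J \<omega>) ((V_const K H + 2) + ((448 * kk)\<^sup>2 * (1 + 2) + 16 / (tail_const K L)\<^sup>2))"
  proof (rule mean_le_dom)
    fix \<omega>
    define v where "v = Vn J \<omega>"
    have v0: "0 \<le> v" by (simp add: v_def Vn_nonneg)
    have y0: "0 \<le> y \<omega>" by (simp add: y_def Rn_nonneg)
    have NR: "?N * Rn J \<omega> \<le> 448 * kk * y \<omega>"
    proof -
      have "?N * Rn J \<omega> = (?N * (lam J)\<^sup>2) / (real p)\<^sup>2 * y \<omega>"
        using p2 lam_pos[OF N0] by (simp add: y_def)
      also have "?N * (lam J)\<^sup>2 = 448 * kk * ln (real p)" using N0 by (simp add: lam_sq[OF N0])
      also have "448 * kk * ln (real p) / (real p)\<^sup>2 * y \<omega> \<le> 448 * kk * y \<omega>"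
      proof (rule mult_right_mono)
        have "ln (real p) \<le> real p" using p2 ln_le_minus_one[of "real p"] by simp
        also have "real p * 1 \<le> (real p)\<^sup>2" unfolding power2_eq_square using p2 by (intro mult_left_mono) auto
        finally have "ln (real p) / (real p)\<^sup>2 \<le> 1" using p2 by (simp add: field_simps)
        from mult_left_mono[OF this, of "448 * kk"] kk show "448 * kk * ln (real p) / (real p)\<^sup>2 \<le> 448 * kk" by simp
      qed (rule y0)
      finally show ?thesis .
    qed
    have le18: "w\<^sup>2 \<le> 1 + w ^ 8" if "0 \<le> w" for w :: real
    proof (cases "w \<le> 1")
      case True
      then have "w\<^sup>2 \<le> 1" using that by (simp add: power_le_one)
      then show ?thesis using zero_le_power[OF that, of 8] by linarith
    next
      case False
      then have "w\<^sup>2 \<le> w ^ 8" by (intro power_increasing) auto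
      then show ?thesis by linarith
    qed
    have "?N * Err J \<omega> = (v + 1) * (?N * Rn J \<omega> + ?N * F \<omega>)"
      by (simp add: Err_def v_def F_def algebra_simps)
    also have "2 * \<dots> \<le> (v + 1)\<^sup>2 + (?N * Rn J \<omega> + ?N * F \<omega>)\<^sup>2"
      using sum_squares_bound[of "v + 1" "?N * Rn J \<omega> + ?N * F \<omega>"] by (simp only: mult.assoc)
    also have "(v + 1)\<^sup>2 \<le> 2 * (v\<^sup>2 + 1)" using zero_le_power2[of "v - 1"] by (simp add: power2_eq_square algebra_simps)
    also have "(?N * Rn J \<omega> + ?N * F \<omega>)\<^sup>2 \<le> 2 * ((?N * Rn J \<omega>)\<^sup>2 + (?N * F \<omega>)\<^sup>2)"
      using zero_le_power2[of "?N * Rn J \<omega> - ?N * F \<omega>"] by (simp add: power2_eq_square algebra_simps)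
    also have "(?N * F \<omega>)\<^sup>2 = ?N\<^sup>2 * F \<omega>" by (simp add: F_def indicator_def power_mult_distrib)
    also have "(?N * Rn J \<omega>)\<^sup>2 \<le> (448 * kk * y \<omega>)\<^sup>2" using NR Rn_nonneg by (intro power_mono) auto
    also have "\<dots> \<le> (448 * kk)\<^sup>2 * (1 + y \<omega> ^ 8)"
      unfolding power_mult_distrib[of "448 * kk"] using le18[OF y0] by (intro mult_left_mono) auto
    finally have "?N * Err J \<omega> \<le> (v\<^sup>2 + 1) + ((448 * kk)\<^sup>2 * (1 + y \<omega> ^ 8) + ?N\<^sup>2 * F \<omega>)" by simp
    then show "0 \<le> ?N * Err J \<omega> \<and> ?N * Err J \<omega> \<le> ((Vn J \<omega>) ^ 8 + 2) + ((448 * kk)\<^sup>2 * (1 + y \<omega> ^ 8) + ?N\<^sup>2 * F \<omega>)"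
      using le18[OF v0] Err_nonneg by (simp add: v_def)
  qed (use Err_meas[OF J] in measurable)
  then show ?thesis by (simp add: first_const_def algebra_simps)
qed

end

section \<open>Sums over batches\<close>

text \<open>By Cauchy-Schwarz the bound \<open>m\<close> on the diagonal of the Gram matrix holds
  for all its entries; pairing one of its rows with \<open>v\<close> then costs the l1 norm.\<close>

lemma col_ip_le:
  fixes x :: "'i \<Rightarrow> nat \<Rightarrow> real"
  assumes m: "\<And>k. k < p \<Longrightarrow> (\<Sum>i\<in>B. (x i k)\<^sup>2) \<le> m" and k: "k < p"
  shows "\<bar>\<Sum>i\<in>B. x i k * ip p (x i) v\<bar> \<le> m * l1 p v"
proof -
  have g: "\<bar>\<Sum>i\<in>B. x i k * x i l\<bar> \<le> m" if l: "l < p" for l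
  proof -
    have m0: "0 \<le> m" using m[OF k] sum_nonneg[of B "\<lambda>i. (x i k)\<^sup>2"] by (meson order_trans zero_le_power2)
    have "\<bar>\<Sum>i\<in>B. x i k * x i l\<bar> \<le> (\<Sum>i\<in>B. \<bar>x i k\<bar> * \<bar>x i l\<bar>)"
      by (rule order.trans[OF sum_abs]) (simp add: abs_mult)
    also have "\<dots> \<le> L2_set (\<lambda>i. x i k) B * L2_set (\<lambda>i. x i l) B" by (rule L2_set_mult_ineq)
    also have "\<dots> \<le> sqrt m * sqrt m"
      unfolding L2_set_def using m[OF k] m[OF l] m0 by (intro mult_mono real_sqrt_le_mono) (auto intro: sum_nonneg)
    finally show ?thesis using m0 by simp
  qed
  have "(\<Sum>i\<in>B. x i k * ip p (x i) v) = (\<Sum>l<p. v l * (\<Sum>i\<in>B. x i k * x i l))"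
    unfolding ip_def sum_distrib_left by (subst sum.swap) (simp add: mult_ac)
  also have "\<bar>\<dots>\<bar> \<le> (\<Sum>l<p. \<bar>v l\<bar> * m)"
    by (rule order.trans[OF sum_abs]) (auto simp: abs_mult intro!: sum_mono mult_left_mono g)
  also have "\<dots> = m * l1 p v" by (simp add: l1_def sum_distrib_left mult.commute)
  finally show ?thesis .
qed

lemma quad_le_col:
  fixes x :: "'i \<Rightarrow> nat \<Rightarrow> real"
  assumes m: "\<And>k. k < p \<Longrightarrow> (\<Sum>i\<in>B. (x i k)\<^sup>2) \<le> m"
  shows "(\<Sum>i\<in>B. (ip p (x i) v)\<^sup>2) \<le> m * (l1 p v)\<^sup>2"
proof -
  have "(\<Sum>i\<in>B. (ip p (x i) v)\<^sup>2) = (\<Sum>i\<in>B. \<Sum>k<p. v k * (x i k * ip p (x i) v))"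
    unfolding power2_eq_square by (subst (1) ip_def) (simp add: sum_distrib_left sum_distrib_right mult_ac)
  also have "\<dots> = (\<Sum>k<p. v k * (\<Sum>i\<in>B. x i k * ip p (x i) v))"
    by (subst sum.swap) (simp add: sum_distrib_left)
  also have "\<dots> \<le> (\<Sum>k<p. \<bar>v k\<bar> * (m * l1 p v))"
  proof (rule sum_mono)
    fix k assume "k \<in> {..<p}"
    then have "\<bar>v k\<bar> * \<bar>\<Sum>i\<in>B. x i k * ip p (x i) v\<bar> \<le> \<bar>v k\<bar> * (m * l1 p v)"
      by (intro mult_left_mono col_ip_le m) auto
    then show "v k * (\<Sum>i\<in>B. x i k * ip p (x i) v) \<le> \<bar>v k\<bar> * (m * l1 p v)"
      using abs_ge_self[of "v k * (\<Sum>i\<in>B. x i k * ip p (x i) v)"] by (simp add: abs_mult)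
  qed
  also have "\<dots> = l1 p v * (m * l1 p v)" by (simp only: l1_def sum_distrib_right)
  also have "\<dots> = m * (l1 p v)\<^sup>2" by (simp add: power2_eq_square)
  finally show ?thesis .
qed

definition U_const :: "real \<Rightarrow> real \<Rightarrow> real \<Rightarrow> real" where
  "U_const K L H = 12 / (psi2 K)\<^sup>2 + psi_const K L H"

text \<open>If the residuals differ from the population residuals by at most \<open>eta_const * N\<close> in squared norm, with
  \<open>N\<close> the total sample size, then the denominator of the estimator stays of order \<open>N\<close>.\<close>

definition eta_const :: "real \<Rightarrow> real \<Rightarrow> real" where
  "eta_const K L = 1 / (3072 * K\<^sup>2 * L\<^sup>2)"

text \<open>The second summand makes the deterministic part of the prediction error in the first
  batch at most \<open>eta_const K L * Nb / 2\<close>; the third gives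
  \<open>lam^2 * s * H <= 1 / (64 * L^2)\<close> for the full sample.\<close>

definition first_size_const :: "real \<Rightarrow> real \<Rightarrow> real \<Rightarrow> real \<Rightarrow> real" where
  "first_size_const K L H kk = size_const K L kk + 2 * rate_const K L H kk * (448 * kk) / eta_const K L
      + 448 * kk * (64 * L\<^sup>2 * H)"

text \<open>\<open>g j\<close> stands for the nodewise coefficients after batch \<open>j\<close>,
  extended by zero at \<open>r\<close>. The probabilities below are those of events expressed by the
  data without \<open>g\<close>.\<close>

locale online = nodewise M I p x Sg K L D r \<gamma>0 s H kk
  for M :: "'a measure" and I :: "(nat \<times> nat) set" and p x Sg K L D r \<gamma>0 s H kk +
  fixes b :: nat and n :: "nat \<Rightarrow> nat" and g :: "nat \<Rightarrow> nat \<Rightarrow> 'a \<Rightarrow> real"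
  assumes I_eq: "I = (SIGMA j:{1..b}. {..<n j})" and b1: "b \<ge> 1"
    and n_pos: "\<And>j. j \<in> {1..b} \<Longrightarrow> n j \<ge> 1"
    and n_first: "first_size_const K L H kk * real s * ln (real p) \<le> real (n 1)"
    and n_ln: "\<And>j. j \<in> {2..b} \<Longrightarrow> ln (real p) \<le> real (n j)"
    and g_r: "\<And>j \<omega>. g j r \<omega> = 0"
    and g_opt: "\<And>j \<omega>. j \<in> {1..b} \<Longrightarrow> \<omega> \<in> space M \<Longrightarrow>
       (1 / (2 * real (\<Sum>i=1..j. n i))) * (\<Sum>i\<in>(SIGMA i:{1..j}. {..<n i}). (x i r \<omega> - ip p (xr i \<omega>) (\<lambda>k. g j k \<omega>))\<^sup>2)
          + lasso_const kk * sqrt (ln (real p) / real (\<Sum>i=1..j. n i)) * l1 p (\<lambda>k. g j k \<omega>)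
       \<le> (1 / (2 * real (\<Sum>i=1..j. n i))) * (\<Sum>i\<in>(SIGMA i:{1..j}. {..<n i}). (Z i \<omega>)\<^sup>2)
          + lasso_const kk * sqrt (ln (real p) / real (\<Sum>i=1..j. n i)) * l1 p \<gamma>0"
begin

definition "J j = (SIGMA i:{1..j}. {..<n i})"
definition "Bt j = {j} \<times> {..<n j}"
definition "del j \<omega> = (\<lambda>k. g j k \<omega> - \<gamma>0 k)"
definition "colG j \<omega> = lse (Bt j) \<omega> / (psi2 K * real (n j))"
text \<open>A common majorant: by the arithmetic-geometric mean inequality it dominates
  \<open>colG\<close> times the square of the relative lasso error, and hence also
  \<open>colG\<close> times that error, since the relative error is at least
  \<open>1\<close>.\<close>

definition "U j \<omega> = (colG j \<omega>)\<^sup>2 + (1 + Err (J j) \<omega> / (lam (J j))\<^sup>2) ^ 4"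
definition "Nb = real (card I)"
abbreviation "A0 \<equiv> rate_const K L H kk"

lemma card_J: "card (J j) = (\<Sum>i=1..j. n i)"
  by (simp add: J_def)

lemma I_J: "I = J b" by (simp add: I_eq J_def)

lemma J_sub: "j \<in> {1..b} \<Longrightarrow> J j \<subseteq> I" by (auto simp: I_eq J_def)
lemma Bt_sub: "j \<in> {1..b} \<Longrightarrow> Bt j \<subseteq> I" by (auto simp: I_eq Bt_def)
lemma card_Bt: "card (Bt j) = n j" by (simp add: Bt_def card_cartesian_product)
lemma J1: "J 1 = Bt 1" by (auto simp: J_def Bt_def)

lemma sum_I: "(\<Sum>i\<in>I. f i) = (\<Sum>j=1..b. \<Sum>i\<in>Bt j. f i)"
proof -
  have "I = (\<Union>j\<in>{1..b}. Bt j)" by (auto simp: I_eq Bt_def)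
  then show ?thesis by (simp only:) (rule sum.UNION_disjoint, auto simp: Bt_def)
qed

lemma n_le_J: "j \<in> {1..b} \<Longrightarrow> n j \<le> card (J j)" "j \<in> {1..b} \<Longrightarrow> n 1 \<le> card (J j)"
  unfolding card_J by (auto intro!: member_le_sum)

lemma card_J1: "card (J (Suc 0)) = n (Suc 0)"
  by (simp add: card_J)

lemma first_size_ge: "size_const K L kk \<le> first_size_const K L H kk"
  using rate_pos kk L1 H1 by (simp add: first_size_const_def eta_const_def)

lemma sl_pos: "real s * ln (real p) > 0"
  using s1 lp by (intro mult_pos_pos) auto

lemma n_first': "size_const K L kk * real s * ln (real p) \<le> real (n 1)"
proof -
  have "size_const K L kk * (real s * ln (real p)) \<le> first_size_const K L H kk * (real s * ln (real p))"
    using first_size_ge sl_pos by (intro mult_right_mono) auto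
  then show ?thesis using n_first by (simp add: mult.assoc)
qed

lemma J_size: "j \<in> {1..b} \<Longrightarrow> size_const K L kk * real s * ln (real p) \<le> real (card (J j))"
  using n_first' n_le_J(2)[of j] by (meson of_nat_mono order_trans)

lemma J_size12: "j \<in> {1..b} \<Longrightarrow> 12 / tail_const K L * ln (real p) \<le> real (card (J j))"
  using size_const_parts(1)[OF J_size] .

lemma J_pos: "j \<in> {1..b} \<Longrightarrow> 0 < real (card (J j))"
  using card_pos[OF J_size12] .

lemma n_ln': "j \<in> {1..b} \<Longrightarrow> ln (real p) \<le> real (n j)"
proof (cases "j = 1")
  case True
  assume "j \<in> {1..b}"
  then have "12 * ln (real p) \<le> real (card (J 1))" using card_ge_ln[OF J_size12[of j]] True by simp
  then show ?thesis using True lp by (simp add: card_J1)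
next
  case False
  assume "j \<in> {1..b}"
  then show ?thesis using n_ln[of j] False by auto
qed

lemma rates:
  assumes j: "j \<in> {1..b}" and \<omega>: "\<omega> \<in> space M"
  shows "l1 p (del j \<omega>) \<le> A0 * (real s * lam (J j) + Err (J j) \<omega> / lam (J j))"
    and "1 / real (card (J j)) * (\<Sum>i\<in>J j. (ip p (xr i \<omega>) (del j \<omega>))\<^sup>2) \<le> A0 * (real s * (lam (J j))\<^sup>2 + Err (J j) \<omega>)"
proof -
  have opt: "(1 / (2 * real (card (J j)))) * (\<Sum>i\<in>J j. (x i r \<omega> - ip p (xr i \<omega>) (\<lambda>k. g j k \<omega>))\<^sup>2) + lam (J j) * l1 p (\<lambda>k. g j k \<omega>)
       \<le> (1 / (2 * real (card (J j)))) * (\<Sum>i\<in>J j. (Z i \<omega>)\<^sup>2) + lam (J j) * l1 p \<gamma>0"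
    using g_opt[OF j \<omega>] unfolding lam_def card_J J_def[symmetric] .
  note nodewise_rates[where g="\<lambda>k. g j k \<omega>", OF J_sub[OF j] J_size[OF j] \<omega> g_r opt]
  then show "l1 p (del j \<omega>) \<le> A0 * (real s * lam (J j) + Err (J j) \<omega> / lam (J j))"
    "1 / real (card (J j)) * (\<Sum>i\<in>J j. (ip p (xr i \<omega>) (del j \<omega>))\<^sup>2) \<le> A0 * (real s * (lam (J j))\<^sup>2 + Err (J j) \<omega>)"
    unfolding del_def by auto
qed

lemma psi_nonneg: "0 \<le> Err (J j) \<omega> / (lam (J j))\<^sup>2"
  by (simp add: Err_nonneg)

text \<open>The deviation is made relative to the rate \<open>s * lam\<close>, which is possible
  because \<open>s >= 1\<close>.\<close>

lemma rates':
  assumes j: "j \<in> {1..b}" and \<omega>: "\<omega> \<in> space M"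
  shows "l1 p (del j \<omega>) \<le> A0 * (real s * lam (J j)) * (1 + Err (J j) \<omega> / (lam (J j))\<^sup>2)"
proof -
  define l where "l = lam (J j)"
  have l0: "l > 0" using lam_pos[OF J_pos[OF j]] by (simp add: l_def)
  have "Err (J j) \<omega> / l = l * (Err (J j) \<omega> / l\<^sup>2)" using l0 by (simp add: power2_eq_square)
  also have "\<dots> \<le> (real s * l) * (Err (J j) \<omega> / l\<^sup>2)"
    using s1 l0 Err_nonneg by (intro mult_right_mono) auto
  finally have "A0 * (real s * l + Err (J j) \<omega> / l) \<le> A0 * (real s * l + (real s * l) * (Err (J j) \<omega> / l\<^sup>2))"
    using rate_pos by (intro mult_left_mono) auto
  then show ?thesis using rates(1)[OF j \<omega>] by (simp add: l_def algebra_simps)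
qed

lemma colG_nonneg: "0 \<le> colG j \<omega>"
  using lse_nonneg p2 psi2_pos by (simp add: colG_def)

lemma col_Bt:
  assumes j: "j \<in> {1..b}" and k: "k < p"
  shows "(\<Sum>i\<in>Bt j. (x i k \<omega>)\<^sup>2) \<le> real (n j) * colG j \<omega>"
  using lse_ge[OF k, where J="Bt j" and \<omega>=\<omega>] n_pos[OF j] psi2_pos by (simp add: colG_def field_simps)

lemma U_bounds:
  assumes j: "j \<in> {1..b}" and \<omega>: "\<omega> \<in> space M"
  shows "colG j \<omega> * l1 p (del j \<omega>) \<le> A0 * real s * lam (J j) * U j \<omega>"
    and "colG j \<omega> * (l1 p (del j \<omega>))\<^sup>2 \<le> A0\<^sup>2 * (real s)\<^sup>2 * (lam (J j))\<^sup>2 * U j \<omega>"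
proof -
  define w where "w = 1 + Err (J j) \<omega> / (lam (J j))\<^sup>2"
  define a where "a = A0 * (real s * lam (J j))"
  have w1: "1 \<le> w" using psi_nonneg by (simp add: w_def)
  have a0: "0 \<le> a" using rate_pos lam_pos[OF J_pos[OF j]] by (simp add: a_def)
  have G0: "0 \<le> colG j \<omega>" by (rule colG_nonneg)
  have l: "l1 p (del j \<omega>) \<le> a * w" using rates'[OF j \<omega>] by (simp add: a_def w_def)
  have Uw: "U j \<omega> = (colG j \<omega>)\<^sup>2 + w ^ 4" by (simp add: U_def w_def)
  have ww: "w \<le> w\<^sup>2" using w1 by (simp add: power2_eq_square)
  have Gw2: "colG j \<omega> * w\<^sup>2 \<le> U j \<omega>"
  proof -
    have "2 * colG j \<omega> * w\<^sup>2 \<le> (colG j \<omega>)\<^sup>2 + (w\<^sup>2)\<^sup>2" by (rule sum_squares_bound)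
    also have "(w\<^sup>2)\<^sup>2 = w ^ 4" by (simp flip: power_mult)
    finally have "2 * (colG j \<omega> * w\<^sup>2) \<le> U j \<omega>" by (simp add: Uw)
    moreover have "0 \<le> colG j \<omega> * w\<^sup>2" using G0 by simp
    ultimately show ?thesis by linarith
  qed
  have Gw: "colG j \<omega> * w \<le> U j \<omega>" using mult_left_mono[OF ww G0] Gw2 by linarith
  have "colG j \<omega> * l1 p (del j \<omega>) \<le> colG j \<omega> * (a * w)" by (rule mult_left_mono[OF l G0])
  also have "\<dots> = a * (colG j \<omega> * w)" by simp
  also have "\<dots> \<le> a * U j \<omega>" using Gw a0 by (rule mult_left_mono)
  finally show "colG j \<omega> * l1 p (del j \<omega>) \<le> A0 * real s * lam (J j) * U j \<omega>" by (simp add: a_def mult.assoc)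
  have "(l1 p (del j \<omega>))\<^sup>2 \<le> (a * w)\<^sup>2" using l l1_nonneg by (intro power_mono) auto
  then have "colG j \<omega> * (l1 p (del j \<omega>))\<^sup>2 \<le> colG j \<omega> * (a * w)\<^sup>2" using G0 by (rule mult_left_mono)
  also have "\<dots> = a\<^sup>2 * (colG j \<omega> * w\<^sup>2)" by (simp add: power_mult_distrib)
  also have "\<dots> \<le> a\<^sup>2 * U j \<omega>" using Gw2 by (intro mult_left_mono) auto
  finally show "colG j \<omega> * (l1 p (del j \<omega>))\<^sup>2 \<le> A0\<^sup>2 * (real s)\<^sup>2 * (lam (J j))\<^sup>2 * U j \<omega>"
    by (simp add: a_def power_mult_distrib mult.assoc)
qed

lemma U_nonneg: "0 \<le> U j \<omega>"
  by (simp add: U_def)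

text \<open>The lower bound \<open>ln p <= n j\<close> on the batch sizes enters here: it makes the
  second moment of \<open>lse\<close> of order \<open>(n j)^2\<close>, uniformly over the
  batches.\<close>

lemma U_moment:
  assumes j: "j \<in> {1..b}"
  shows "mean_le M (U j) (U_const K L H)"
proof -
  let ?n = "real (n j)"
  have n1: "?n \<ge> 1" using n_pos[OF j] by simp
  have "mean_le M (\<lambda>\<omega>. 1 / (psi2 K * ?n)\<^sup>2 * (lse (Bt j) \<omega>)\<^sup>2) (1 / (psi2 K * ?n)\<^sup>2 * (2 * (ln (real p) + ?n * ln 2)\<^sup>2 + 4))"
    using lse_second_moment[OF Bt_sub[OF j]] p2 by (intro mean_le_cmult) (auto simp: card_Bt)
  moreover have "1 / (psi2 K * ?n)\<^sup>2 * (2 * (ln (real p) + ?n * ln 2)\<^sup>2 + 4) \<le> 12 / (psi2 K)\<^sup>2"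
  proof -
    have "ln (real p) + ?n * ln 2 \<le> ?n + ?n * 1"
      using n_ln'[OF j] ln_2_less_1 by (intro add_mono mult_left_mono) auto
    then have "(ln (real p) + ?n * ln 2)\<^sup>2 \<le> (2 * ?n)\<^sup>2" using lp by (intro power_mono) auto
    moreover have "1 \<le> ?n\<^sup>2" using n1 by simp
    ultimately have "2 * (ln (real p) + ?n * ln 2)\<^sup>2 + 4 \<le> 12 * ?n\<^sup>2" by (simp add: power_mult_distrib)
    then have "1 / (psi2 K * ?n)\<^sup>2 * (2 * (ln (real p) + ?n * ln 2)\<^sup>2 + 4) \<le> 1 / (psi2 K * ?n)\<^sup>2 * (12 * ?n\<^sup>2)"
      by (intro mult_left_mono) auto
    also have "\<dots> = 12 / (psi2 K)\<^sup>2" using n1 by (simp add: power_mult_distrib)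
    finally show ?thesis .
  qed
  ultimately have "mean_le M (\<lambda>\<omega>. 1 / (psi2 K * ?n)\<^sup>2 * (lse (Bt j) \<omega>)\<^sup>2) (12 / (psi2 K)\<^sup>2)" by (rule mean_le_mono)
  then have "mean_le M (\<lambda>\<omega>. (colG j \<omega>)\<^sup>2) (12 / (psi2 K)\<^sup>2)" by (simp add: colG_def power_divide)
  from mean_le_add[OF this Err_moment[OF J_sub[OF j] J_size12[OF j]]]
  show ?thesis unfolding U_def U_const_def .
qed

text \<open>Majorants of the two sums over batches. They are linear in the \<open>U j\<close>, so
  their means add up although the summands are dependent.\<close>

definition "Y1 \<omega> = (\<Sum>j=1..b. A0 * real s * (real (n j) * lam (J j)) * U j \<omega>)"
definition "Y2 \<omega> = A0 * (real (card (J 1)) * Err (J 1) \<omega>) + (\<Sum>j=2..b. A0\<^sup>2 * (real s)\<^sup>2 * (real (n j) * (lam (J j))\<^sup>2) * U j \<omega>)"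

lemma U_const_nonneg: "0 \<le> U_const K L H"
  using mean_le_nonneg[OF U_moment[of 1] U_nonneg] b1 by simp

lemma Nb_eq: "Nb = real (\<Sum>i=1..b. n i)"
  unfolding Nb_def using card_J[of b] I_J by simp

lemma Y1_moment: "mean_le M Y1 (A0 * real s * U_const K L H * (2 * sqrt (448 * kk * ln (real p) * Nb)))"
proof -
  have "mean_le M Y1 (\<Sum>j=1..b. A0 * real s * (real (n j) * lam (J j)) * U_const K L H)"
    unfolding Y1_def
  proof (intro mean_le_sum mean_le_cmult U_moment)
    fix j assume "j \<in> {1..b}"
    then show "0 \<le> A0 * real s * (real (n j) * lam (J j))" using rate_pos lam_pos[OF J_pos[of j]] by simp
  qed
  moreover have "(\<Sum>j=1..b. A0 * real s * (real (n j) * lam (J j)) * U_const K L H)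
     = A0 * real s * U_const K L H * sqrt (448 * kk * ln (real p)) * (\<Sum>j=1..b. real (n j) / sqrt (real (\<Sum>i=1..j. n i)))"
    unfolding sum_distrib_left by (intro sum.cong refl) (simp add: lam_def lasso_const_def card_J real_sqrt_mult real_sqrt_divide)
  moreover have "\<dots> \<le> A0 * real s * U_const K L H * sqrt (448 * kk * ln (real p)) * (2 * sqrt (real (\<Sum>i=1..b. n i)))"
    using n_pos[of 1] b1 rate_pos U_const_nonneg kk lp by (intro mult_left_mono sum_size_over_sqrt) auto
  ultimately have "mean_le M Y1 (A0 * real s * U_const K L H * sqrt (448 * kk * ln (real p)) * (2 * sqrt (real (\<Sum>i=1..b. n i))))"
    by (auto intro: mean_le_mono)
  then show ?thesis unfolding Nb_eq by (simp only: real_sqrt_mult mult_ac)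
qed

lemma Y2_moment: "mean_le M Y2 (A0 * first_const K L H kk + A0\<^sup>2 * U_const K L H * (448 * kk) * ((real s)\<^sup>2 * ln (real p) * ln (Nb / real (n 1))))"
proof -
  have "mean_le M Y2 (A0 * first_const K L H kk + (\<Sum>j=2..b. A0\<^sup>2 * (real s)\<^sup>2 * (real (n j) * (lam (J j))\<^sup>2) * U_const K L H))"
    unfolding Y2_def using rate_pos b1 by (intro mean_le_add mean_le_sum mean_le_cmult U_moment Err_first_moment J_sub J_size12) auto
  moreover have "(\<Sum>j=2..b. A0\<^sup>2 * (real s)\<^sup>2 * (real (n j) * (lam (J j))\<^sup>2) * U_const K L H)
     = A0\<^sup>2 * U_const K L H * (448 * kk) * ((real s)\<^sup>2 * ln (real p)) * (\<Sum>j=2..b. real (n j) / real (\<Sum>i=1..j. n i))"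
    unfolding sum_distrib_left by (intro sum.cong refl) (subst lam_sq[OF J_pos], auto simp: card_J)
  moreover have "\<dots> \<le> A0\<^sup>2 * U_const K L H * (448 * kk) * ((real s)\<^sup>2 * ln (real p)) * ln (Nb / real (n 1))"
    unfolding Nb_eq using n_pos[of 1] b1 U_const_nonneg kk lp by (intro mult_left_mono sum_size_over_total) auto
  ultimately show ?thesis by (auto intro: mean_le_mono simp: mult.assoc)
qed

lemma Y1_bound:
  assumes \<omega>: "\<omega> \<in> space M"
  shows "(\<Sum>j=1..b. real (n j) * colG j \<omega> * l1 p (del j \<omega>)) \<le> Y1 \<omega>"
  unfolding Y1_def
proof (rule sum_mono)
  fix j assume j: "j \<in> {1..b}"
  from mult_left_mono[OF U_bounds(1)[OF j \<omega>], of "real (n j)"]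
  show "real (n j) * colG j \<omega> * l1 p (del j \<omega>) \<le> A0 * real s * (real (n j) * lam (J j)) * U j \<omega>"
    by (simp add: mult_ac)
qed

text \<open>The first batch is its own cumulative sample, so the prediction error applies and costs
  \<open>s * ln p\<close>; column norms times the squared l1 error would cost
  \<open>s^2 * ln p\<close>, which the first batch size need not dominate. For a later batch the
  prediction error refers to the whole cumulative sample and lacks the small weight of the batch, so
  there the column norms are used.\<close>

lemma Y2_bound:
  assumes \<omega>: "\<omega> \<in> space M"
  shows "(\<Sum>j=1..b. \<Sum>i\<in>Bt j. (ip p (xr i \<omega>) (del j \<omega>))\<^sup>2) \<le> A0 * (448 * kk) * (real s * ln (real p)) + Y2 \<omega>"
proof -
  let ?S = "\<lambda>j. \<Sum>i\<in>Bt j. (ip p (xr i \<omega>) (del j \<omega>))\<^sup>2"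
  have 1: "1 \<in> {1..b}" using b1 by simp
  have N1: "real (card (J 1)) > 0" by (rule J_pos[OF 1])
  have "?S 1 \<le> real (card (J 1)) * (A0 * (real s * (lam (J 1))\<^sup>2 + Err (J 1) \<omega>))"
    using rates(2)[OF 1 \<omega>] N1 unfolding J1[symmetric] by (simp add: field_simps)
  also have "\<dots> = A0 * (448 * kk) * (real s * ln (real p)) + A0 * (real (card (J 1)) * Err (J 1) \<omega>)"
  proof -
    have "real (card (J 1)) * (lam (J 1))\<^sup>2 = 448 * kk * ln (real p)" using lam_sq[OF N1] N1 by simp
    then have "A0 * real s * (real (card (J 1)) * (lam (J 1))\<^sup>2) = A0 * real s * (448 * kk * ln (real p))" by simp
    then show ?thesis by (simp only: distrib_left mult_ac)
  qed
  finally have first: "?S 1 \<le> A0 * (448 * kk) * (real s * ln (real p)) + A0 * (real (card (J 1)) * Err (J 1) \<omega>)" .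
  have rest: "(\<Sum>j=2..b. ?S j) \<le> (\<Sum>j=2..b. A0\<^sup>2 * (real s)\<^sup>2 * (real (n j) * (lam (J j))\<^sup>2) * U j \<omega>)"
  proof (rule sum_mono)
    fix j assume "j \<in> {2..b}"
    then have j: "j \<in> {1..b}" by auto
    have "?S j \<le> (real (n j) * colG j \<omega>) * (l1 p (del j \<omega>))\<^sup>2" by (intro quad_le_col col_Bt[OF j])
    also have "\<dots> = real (n j) * (colG j \<omega> * (l1 p (del j \<omega>))\<^sup>2)" by simp
    also have "\<dots> \<le> real (n j) * (A0\<^sup>2 * (real s)\<^sup>2 * (lam (J j))\<^sup>2 * U j \<omega>)"
      by (intro mult_left_mono U_bounds(2)[OF j \<omega>]) auto
    finally show "?S j \<le> A0\<^sup>2 * (real s)\<^sup>2 * (real (n j) * (lam (J j))\<^sup>2) * U j \<omega>" by (simp add: mult_ac)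
  qed
  have "{1..b} = insert 1 {2..b}" using b1 by auto
  then have "(\<Sum>j=1..b. ?S j) = ?S 1 + (\<Sum>j=2..b. ?S j)" by simp
  then show ?thesis using first rest by (simp add: Y2_def)
qed

end

section \<open>The denominator and the remainder term\<close>

lemma exp_neg_le: "0 < (y::real) \<Longrightarrow> exp (- y) \<le> 1 / y"
proof -
  assume y: "0 < y"
  have "y \<le> exp y" using exp_ge_add_one_self[of y] by linarith
  then have "1 / exp y \<le> 1 / y" using y by (intro divide_left_mono) auto
  then show ?thesis by (simp add: exp_minus divide_inverse)
qed

text \<open>Chosen such that \<open>sqrt (rho1_const L H * H) = 1 / (16 * L)\<close>, one half of
  the margin in \<open>cross_bound\<close>.\<close>

definition rho1_const :: "real \<Rightarrow> real \<Rightarrow> real" where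
  "rho1_const L H = 1 / (256 * L\<^sup>2 * H)"

text \<open>Collects the contributions of order \<open>1 / Nb\<close> to the failure probability of
  \<open>Ev\<close>: the first batch, the net together with the lower tail (\<open>4 + 1\<close>
  over \<open>tail_const K L\<close>), and the excess.\<close>

definition event_const :: "real \<Rightarrow> real \<Rightarrow> real \<Rightarrow> real \<Rightarrow> real" where
  "event_const K L H kk = 2 / eta_const K L * (rate_const K L H kk * first_const K L H kk) + 5 / tail_const K L
      + 1344 * kk / rho1_const L H"

definition event_const2 :: "real \<Rightarrow> real \<Rightarrow> real \<Rightarrow> real \<Rightarrow> real" where
  "event_const2 K L H kk = 2 / eta_const K L * ((rate_const K L H kk)\<^sup>2 * U_const K L H * (448 * kk))"

definition W_const :: "real \<Rightarrow> real \<Rightarrow> real \<Rightarrow> real \<Rightarrow> real" where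
  "W_const K L H kk = sqrt (448 * kk) * (5 + 2 * rate_const K L H kk * U_const K L H)"

context online
begin

definition "z i \<omega> = Z i \<omega> - ip p (xr i \<omega>) (del (fst i) \<omega>)"
definition "den \<omega> = (\<Sum>i\<in>I. z i \<omega> * x i r \<omega>)"
definition "zz \<omega> = (\<Sum>i\<in>I. (z i \<omega>)\<^sup>2)"
definition "S2 \<omega> = (\<Sum>i\<in>I. (ip p (xr i \<omega>) (del (fst i) \<omega>))\<^sup>2)"
text \<open>The conditions control, in this order, the distance from the population residuals, the
  column norms together with the restricted eigenvalues, the product of population residuals and
  fitted part, and the norm of the population residuals.\<close>

definition "Ev = {\<omega> \<in> space M. Y2 \<omega> \<le> eta_const K L * Nb / 2 \<and> good I \<omega> \<and> Rn I \<omega> \<le> rho1_const L H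
    \<and> Nb / (2 * L) \<le> (\<Sum>i\<in>I. (Z i \<omega>)\<^sup>2)}"

lemma bI: "b \<in> {1..b}" using b1 by simp

lemma Nb_J: "Nb = real (card (J b))" by (simp add: Nb_def flip: I_J)
lemma Nb_pos: "Nb > 0" using J_pos[OF bI] by (simp add: Nb_J)
lemma lamI: "0 < lam I" "(lam I)\<^sup>2 = 448 * kk * ln (real p) / Nb"
  using lam_pos[of I] lam_sq[of I] Nb_pos by (auto simp: Nb_def)
lemma NI: "12 / tail_const K L * ln (real p) \<le> real (card I)"
  using J_size12[OF bI] by (simp flip: I_J)

lemma eta_pos: "eta_const K L > 0"
  using K1 L1 by (simp add: eta_const_def)

lemma z_eq: "z i \<omega> = x i r \<omega> - ip p (xr i \<omega>) (\<lambda>k. g (fst i) k \<omega>)"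
  by (simp add: z_def Z_eq del_def ip_diff_right)

lemma first_size_parts:
  "A0 * (448 * kk) * (real s * ln (real p)) \<le> eta_const K L * Nb / 2"
  "448 * kk * (64 * L\<^sup>2 * H) * (real s * ln (real p)) \<le> Nb"
proof -
  have nN: "real (n 1) \<le> Nb" unfolding Nb_J using n_le_J(2)[OF bI] by simp
  have pos: "0 \<le> size_const K L kk * (real s * ln (real p))" "0 \<le> 2 * A0 * (448 * kk) / eta_const K L * (real s * ln (real p))"
    "0 \<le> 448 * kk * (64 * L\<^sup>2 * H) * (real s * ln (real p))"
    using sl_pos rate_pos eta_pos kk H1 L1 tail_const_pos re_const_pos
    by (auto simp: size_const_def intro!: mult_nonneg_nonneg add_nonneg_nonneg divide_nonneg_nonneg)
  have "size_const K L kk * (real s * ln (real p)) + 2 * A0 * (448 * kk) / eta_const K L * (real s * ln (real p))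
     + 448 * kk * (64 * L\<^sup>2 * H) * (real s * ln (real p)) \<le> real (n 1)"
    using n_first by (simp add: first_size_const_def algebra_simps)
  then have a: "2 * A0 * (448 * kk) / eta_const K L * (real s * ln (real p)) \<le> Nb"
    and c: "448 * kk * (64 * L\<^sup>2 * H) * (real s * ln (real p)) \<le> Nb"
    using pos nN by linarith+
  have "eta_const K L / 2 * (2 * A0 * (448 * kk) / eta_const K L * (real s * ln (real p))) \<le> eta_const K L / 2 * Nb"
    using eta_pos by (intro mult_left_mono a) auto
  moreover have "eta_const K L / 2 * (2 * A0 * (448 * kk) / eta_const K L * (real s * ln (real p))) = A0 * (448 * kk) * (real s * ln (real p))"
    using eta_pos by simp
  ultimately show "A0 * (448 * kk) * (real s * ln (real p)) \<le> eta_const K L * Nb / 2" by simp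
  show "448 * kk * (64 * L\<^sup>2 * H) * (real s * ln (real p)) \<le> Nb" by (rule c)
qed

lemma S2_bound: "\<omega> \<in> Ev \<Longrightarrow> S2 \<omega> \<le> eta_const K L * Nb"
proof -
  assume \<omega>: "\<omega> \<in> Ev"
  have "S2 \<omega> = (\<Sum>j=1..b. \<Sum>i\<in>Bt j. (ip p (xr i \<omega>) (del j \<omega>))\<^sup>2)"
    unfolding S2_def sum_I by (intro sum.cong refl) (auto simp: Bt_def)
  also have "\<dots> \<le> A0 * (448 * kk) * (real s * ln (real p)) + Y2 \<omega>"
    using \<omega> by (intro Y2_bound) (simp add: Ev_def)
  finally show ?thesis using first_size_parts(1) \<omega> by (simp add: Ev_def)
qed

lemma ip_xm: "u r = 0 \<Longrightarrow> ip p (\<lambda>k. xm i k \<omega>) u = ip p (xr i \<omega>) u"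
  unfolding ip_def by (intro sum.cong refl) (auto simp: xm_def)

lemma ip_Tn: "u r = 0 \<Longrightarrow> (\<Sum>i\<in>I. Z i \<omega> * ip p (xr i \<omega>) u) = Nb * ip p (\<lambda>k. Tn I k \<omega>) u"
proof -
  assume u: "u r = 0"
  have "Nb * ip p (\<lambda>k. Tn I k \<omega>) u = (\<Sum>k<p. \<Sum>i\<in>I. Z i \<omega> * xm i k \<omega> * u k)"
  proof -
    have "Nb * (Tn I k \<omega> * u k) = (\<Sum>i\<in>I. Z i \<omega> * xm i k \<omega> * u k)" for k
      using Nb_pos by (simp add: Tn_def Nb_def flip: sum_distrib_right)
    then show ?thesis by (simp add: ip_def sum_distrib_left)
  qed
  also have "\<dots> = (\<Sum>i\<in>I. Z i \<omega> * ip p (\<lambda>k. xm i k \<omega>) u)"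
    by (subst sum.swap) (simp add: ip_def sum_distrib_left mult.assoc)
  finally show ?thesis using ip_xm[of u, OF u] by simp
qed

text \<open>The population residual and the fitted part are orthogonal in mean. Their empirical
  product is a combination of scores, bounded by half the penalty times the l1 norm of
  \<open>\<gamma>0\<close> plus the root of the excess times its l2 norm; each part gets
  \<open>1 / (16 * L)\<close>.\<close>

lemma cross_bound:
  assumes R: "Rn I \<omega> \<le> rho1_const L H"
  shows "\<bar>\<Sum>i\<in>I. Z i \<omega> * ip p (xr i \<omega>) \<gamma>0\<bar> \<le> Nb / (8 * L)"
proof -
  have "\<bar>ip p (\<lambda>k. Tn I k \<omega>) \<gamma>0\<bar> \<le> lam I / 2 * l1 p \<gamma>0 + sqrt (Rn I \<omega>) * sqrt (ip p \<gamma>0 \<gamma>0)"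
    unfolding Rn_def by (rule ip_le_excess)
  also have "lam I / 2 * l1 p \<gamma>0 \<le> 1 / (16 * L)"
  proof -
    have "lam I * l1 p \<gamma>0 \<le> lam I * (sqrt (real s) * sqrt H)"
    proof (rule mult_left_mono)
      have "sqrt (real s) * sqrt (ip p \<gamma>0 \<gamma>0) \<le> sqrt (real s) * sqrt H" using Hg by (intro mult_left_mono) auto
      then show "l1 p \<gamma>0 \<le> sqrt (real s) * sqrt H" using l1_le_card_ip[OF sparse] by linarith
    qed (use lamI(1) in simp)
    also have "\<dots> = sqrt ((lam I)\<^sup>2 * real s * H)" using lamI(1) by (simp add: real_sqrt_mult)
    also have "\<dots> \<le> sqrt ((1 / (8 * L))\<^sup>2)"
    proof (rule real_sqrt_le_mono)
      have "448 * kk * ln (real p) * real s * H * (64 * L\<^sup>2) \<le> Nb" using first_size_parts(2) by (simp add: mult_ac)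
      then have "(lam I)\<^sup>2 * real s * H * (64 * L\<^sup>2) \<le> 1" unfolding lamI(2) using Nb_pos by (simp add: field_simps)
      then show "(lam I)\<^sup>2 * real s * H \<le> (1 / (8 * L))\<^sup>2" using L1 by (simp add: field_simps power_mult_distrib)
    qed
    also have "\<dots> = 1 / (8 * L)" using L1 by simp
    finally show ?thesis by simp
  qed
  also have "sqrt (Rn I \<omega>) * sqrt (ip p \<gamma>0 \<gamma>0) \<le> 1 / (16 * L)"
  proof -
    have "sqrt (Rn I \<omega>) * sqrt (ip p \<gamma>0 \<gamma>0) \<le> sqrt (rho1_const L H) * sqrt H"
      using R Hg by (intro mult_mono) (auto simp: Rn_nonneg ip_self_nonneg rho1_const_def H1 order.trans[OF _ H1])
    also have "\<dots> = sqrt ((1 / (16 * L))\<^sup>2)"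
      using H1 L1 by (simp add: rho1_const_def power_divide power_mult_distrib flip: real_sqrt_mult)
    also have "\<dots> = 1 / (16 * L)" using L1 by simp
    finally show ?thesis .
  qed
  finally have "\<bar>ip p (\<lambda>k. Tn I k \<omega>) \<gamma>0\<bar> \<le> 1 / (8 * L)" by simp
  then have "Nb * \<bar>ip p (\<lambda>k. Tn I k \<omega>) \<gamma>0\<bar> \<le> Nb * (1 / (8 * L))" using Nb_pos by (intro mult_left_mono) auto
  then show ?thesis unfolding ip_Tn[of \<gamma>0, OF g0r] using Nb_pos by (simp add: abs_mult)
qed

text \<open>In units of \<open>Nb / (8 * L)\<close>, the squared norm of the population residuals is
  at least \<open>4\<close>, and the cross term and the estimation error are at most
  \<open>1\<close> each.\<close>

lemma den_pos: assumes \<omega>: "\<omega> \<in> Ev" shows "den \<omega> > 0"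
proof -
  have ev: "good I \<omega>" "Rn I \<omega> \<le> rho1_const L H" "Nb / (2 * L) \<le> (\<Sum>i\<in>I. (Z i \<omega>)\<^sup>2)"
    using \<omega> by (auto simp: Ev_def)
  let ?d = "\<lambda>i. ip p (xr i \<omega>) (del (fst i) \<omega>)"
  have xr: "x i r \<omega> = Z i \<omega> + ip p (xr i \<omega>) \<gamma>0" for i by (simp add: Z_eq)
  have "den \<omega> = (\<Sum>i\<in>I. Z i \<omega> * x i r \<omega>) - (\<Sum>i\<in>I. ?d i * x i r \<omega>)"
    by (simp add: den_def z_def left_diff_distrib sum_subtractf)
  also have "(\<Sum>i\<in>I. Z i \<omega> * x i r \<omega>) = (\<Sum>i\<in>I. (Z i \<omega>)\<^sup>2) + (\<Sum>i\<in>I. Z i \<omega> * ip p (xr i \<omega>) \<gamma>0)"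
    unfolding xr by (simp add: distrib_left sum.distrib power2_eq_square)
  finally have den: "den \<omega> = (\<Sum>i\<in>I. (Z i \<omega>)\<^sup>2) + (\<Sum>i\<in>I. Z i \<omega> * ip p (xr i \<omega>) \<gamma>0) - (\<Sum>i\<in>I. ?d i * x i r \<omega>)" .
  have "\<bar>\<Sum>i\<in>I. ?d i * x i r \<omega>\<bar> \<le> (\<Sum>i\<in>I. \<bar>?d i\<bar> * \<bar>x i r \<omega>\<bar>)"
    by (rule order.trans[OF sum_abs]) (simp add: abs_mult)
  also have "\<dots> \<le> L2_set ?d I * L2_set (\<lambda>i. x i r \<omega>) I" by (rule L2_set_mult_ineq)
  also have "\<dots> \<le> sqrt (eta_const K L * Nb) * sqrt (48 * K\<^sup>2 * Nb)"
    unfolding L2_set_def using S2_bound[OF \<omega>] good_col[OF ev(1) r] eta_pos Nb_pos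
    by (intro mult_mono real_sqrt_le_mono) (auto simp: S2_def Nb_def intro: sum_nonneg)
  \<comment> \<open>This fixes \<open>eta_const\<close>: \<open>3072 = 48 * 64\<close>.\<close>
  also have "\<dots> = sqrt ((Nb / (8 * L))\<^sup>2)"
    using K1 L1 Nb_pos by (simp add: eta_const_def power_divide power_mult_distrib power2_eq_square field_simps flip: real_sqrt_mult)
  also have "\<dots> = Nb / (8 * L)" using L1 Nb_pos by simp
  finally have "\<bar>\<Sum>i\<in>I. ?d i * x i r \<omega>\<bar> \<le> Nb / (8 * L)" .
  moreover have "Nb / (2 * L) = 4 * (Nb / (8 * L))" by simp
  moreover have "0 < Nb / (8 * L)" using Nb_pos L1 by simp
  ultimately show ?thesis using ev(3) cross_bound[OF ev(2)] unfolding den by linarith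
qed

text \<open>Triangle inequality in units of \<open>q = sqrt (Nb / (8 * L))\<close>: the population
  residuals have norm at least \<open>2 * q\<close>, and the distance to them is at most
  \<open>q\<close>.\<close>

lemma zz_ge: assumes \<omega>: "\<omega> \<in> Ev" shows "zz \<omega> \<ge> Nb / (8 * L)"
proof -
  define q where "q = sqrt (Nb / (8 * L))"
  have q0: "q \<ge> 0" and q2: "q\<^sup>2 = Nb / (8 * L)" using Nb_pos L1 by (auto simp: q_def)
  let ?d = "\<lambda>i. ip p (xr i \<omega>) (del (fst i) \<omega>)"
  have "L2_set (\<lambda>i. Z i \<omega>) I = L2_set (\<lambda>i. z i \<omega> + ?d i) I" by (simp add: z_def)
  also have "\<dots> \<le> L2_set (\<lambda>i. z i \<omega>) I + L2_set ?d I" by (rule L2_set_triangle_ineq)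
  finally have tri: "L2_set (\<lambda>i. Z i \<omega>) I \<le> sqrt (zz \<omega>) + sqrt (S2 \<omega>)" by (simp add: L2_set_def zz_def S2_def)
  have "S2 \<omega> \<le> Nb / (8 * L)"
  proof -
    have "1 \<le> K\<^sup>2" using K1 by (rule one_le_power)
    moreover have "L * 1 \<le> L\<^sup>2" unfolding power2_eq_square using L1 by (intro mult_left_mono) auto
    ultimately have "1 * L \<le> K\<^sup>2 * L\<^sup>2" using L1 by (intro mult_mono) auto
    then have "8 * L \<le> 3072 * K\<^sup>2 * L\<^sup>2" using L1 by linarith
    then have "eta_const K L \<le> 1 / (8 * L)" unfolding eta_const_def using L1 by (intro divide_left_mono) (auto intro!: mult_pos_pos simp: order.strict_trans2[OF _ K1])
    from mult_right_mono[OF this, of Nb] show ?thesis using S2_bound[OF \<omega>] Nb_pos by simp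
  qed
  then have "sqrt (S2 \<omega>) \<le> q" by (simp add: q_def)
  moreover have "2 * q \<le> L2_set (\<lambda>i. Z i \<omega>) I"
  proof -
    have "2 * q = sqrt (Nb / (2 * L))" by (rule real_sqrt_unique[symmetric]) (use q0 q2 in \<open>auto simp: power_mult_distrib\<close>)
    also have "\<dots> \<le> L2_set (\<lambda>i. Z i \<omega>) I" unfolding L2_set_def using \<omega> by (intro real_sqrt_le_mono) (simp add: Ev_def)
    finally show ?thesis .
  qed
  ultimately have "q \<le> sqrt (zz \<omega>)" using tri by linarith
  then have "q\<^sup>2 \<le> (sqrt (zz \<omega>))\<^sup>2" using q0 by (intro power_mono)
  then show ?thesis using q2 by (simp add: zz_def sum_nonneg)
qed

definition "W1 \<omega> = Nb * (lam I / 2 + sqrt (Rn I \<omega>)) + Y1 \<omega>"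

text \<open>The optimality conditions of a nodewise lasso do not bound this entry, since the
  residuals of different batches belong to different coefficient vectors. The entry is split instead
  into the score of the population residuals and a sum over batches majorised by
  \<open>Y1\<close>.\<close>

lemma score_bound:
  assumes \<omega>: "\<omega> \<in> space M" and k: "k < p"
  shows "\<bar>\<Sum>i\<in>I. z i \<omega> * xm i k \<omega>\<bar> \<le> W1 \<omega>"
proof (cases "k = r")
  case True
  have "0 \<le> Y1 \<omega>" unfolding Y1_def using rate_pos U_nonneg lam_pos[OF J_pos]
    by (intro sum_nonneg mult_nonneg_nonneg) (auto simp: less_imp_le)
  then show ?thesis using True Nb_pos lamI(1) Rn_nonneg by (simp add: W1_def xm_def)
next
  case False
  then have xm: "xm i k \<omega> = x i k \<omega>" for i by (simp add: xm_def)
  have "(\<Sum>i\<in>I. z i \<omega> * xm i k \<omega>) = (\<Sum>i\<in>I. Z i \<omega> * xm i k \<omega>) - (\<Sum>i\<in>I. x i k \<omega> * ip p (xr i \<omega>) (del (fst i) \<omega>))"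
    by (simp add: z_def xm algebra_simps sum_subtractf)
  moreover have "\<bar>\<Sum>i\<in>I. Z i \<omega> * xm i k \<omega>\<bar> \<le> Nb * (lam I / 2 + sqrt (Rn I \<omega>))"
  proof -
    have "(max 0 (\<bar>Tn I k \<omega>\<bar> - lam I / 2))\<^sup>2 \<le> Rn I \<omega>"
      unfolding Rn_def excess_def using k by (intro member_le_sum[of k "{..<p}" "\<lambda>k. (max 0 (\<bar>Tn I k \<omega>\<bar> - lam I / 2))\<^sup>2"]) auto
    then have "max 0 (\<bar>Tn I k \<omega>\<bar> - lam I / 2) \<le> sqrt (Rn I \<omega>)" by (rule real_le_rsqrt)
    then have "\<bar>Tn I k \<omega>\<bar> \<le> lam I / 2 + sqrt (Rn I \<omega>)" by linarith
    then have "Nb * \<bar>Tn I k \<omega>\<bar> \<le> Nb * (lam I / 2 + sqrt (Rn I \<omega>))" using Nb_pos by (intro mult_left_mono) auto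
    moreover have "(\<Sum>i\<in>I. Z i \<omega> * xm i k \<omega>) = Nb * Tn I k \<omega>" using Nb_pos by (simp add: Tn_def Nb_def)
    ultimately show ?thesis using Nb_pos by (simp add: abs_mult)
  qed
  moreover have "\<bar>\<Sum>i\<in>I. x i k \<omega> * ip p (xr i \<omega>) (del (fst i) \<omega>)\<bar> \<le> Y1 \<omega>"
  proof -
    have "(\<Sum>i\<in>I. x i k \<omega> * ip p (xr i \<omega>) (del (fst i) \<omega>)) = (\<Sum>j=1..b. \<Sum>i\<in>Bt j. x i k \<omega> * ip p (xr i \<omega>) (del j \<omega>))"
      unfolding sum_I by (intro sum.cong refl) (auto simp: Bt_def)
    also have "\<bar>\<dots>\<bar> \<le> (\<Sum>j=1..b. real (n j) * colG j \<omega> * l1 p (del j \<omega>))"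
      by (rule order.trans[OF sum_abs]) (intro sum_mono col_ip_le col_Bt k, auto)
    also have "\<dots> \<le> Y1 \<omega>" by (rule Y1_bound[OF \<omega>])
    finally show ?thesis .
  qed
  ultimately show ?thesis unfolding W1_def by linarith
qed

lemma Y2_meas[measurable]: "Y2 \<in> borel_measurable M"
  using mean_leD(1)[OF Y2_moment] by (rule borel_measurable_integrable)

lemma Y1_meas[measurable]: "Y1 \<in> borel_measurable M"
  using mean_leD(1)[OF Y1_moment] by (rule borel_measurable_integrable)

lemma RI_meas[measurable]: "Rn I \<in> borel_measurable M" by (rule Rn_meas) simp

lemma y_le: "0 \<le> (y::real) \<Longrightarrow> y \<le> 1 + y ^ 8"
proof (cases "y \<le> 1")
  case True
  assume "0 \<le> y" then show ?thesis using True zero_le_power[of y 8] by linarith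
next
  case False
  then have "y ^ 1 \<le> y ^ 8" by (intro power_increasing) auto
  then show ?thesis by simp
qed

lemma first_moment_of_eighth:
  assumes "mean_le M (\<lambda>\<omega>. f \<omega> * (y \<omega>) ^ 8) 2" and [measurable]: "f \<in> borel_measurable M" "y \<in> borel_measurable M"
    and f: "\<And>\<omega>. 0 \<le> f \<omega> \<and> f \<omega> \<le> 1" and y: "\<And>\<omega>. 0 \<le> y \<omega>"
  shows "mean_le M (\<lambda>\<omega>. f \<omega> * y \<omega>) 3"
proof -
  have "mean_le M (\<lambda>\<omega>. 1 + f \<omega> * (y \<omega>) ^ 8) (1 + 2)" by (intro mean_le_add mean_le_const assms) auto
  then show ?thesis
  proof (rule mean_le_mono[OF mean_le_dom])
    fix \<omega>
    have "f \<omega> * y \<omega> \<le> f \<omega> * (1 + (y \<omega>) ^ 8)" using f[of \<omega>] y_le[OF y] by (intro mult_left_mono) auto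
    then show "0 \<le> f \<omega> * y \<omega> \<and> f \<omega> * y \<omega> \<le> 1 + f \<omega> * (y \<omega>) ^ 8"
      using f[of \<omega>] y[of \<omega>] by (auto simp: distrib_left)
  qed auto
qed

lemma RI_mean: "mean_le M (\<lambda>\<omega>. (real p)\<^sup>2 * Rn I \<omega> / (lam I)\<^sup>2) 3"
proof -
  have "mean_le M (\<lambda>\<omega>. 1 * ((real p)\<^sup>2 * Rn I \<omega> / (lam I)\<^sup>2)) 3"
    by (rule first_moment_of_eighth) (use Rn_moment[of I] NI in \<open>auto simp: Rn_nonneg\<close>)
  then show ?thesis by simp
qed

lemma ln_p_le: "ln (real p) \<le> real p"
  using p2 ln_le_minus_one[of "real p"] by simp

lemma lam_over_p: "(lam I)\<^sup>2 / (real p)\<^sup>2 \<le> 448 * kk / Nb"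
proof -
  have "ln (real p) \<le> (real p)\<^sup>2"
  proof -
    have "real p * 1 \<le> (real p)\<^sup>2" unfolding power2_eq_square using p2 by (intro mult_left_mono) auto
    then show ?thesis using ln_p_le by linarith
  qed
  then have "ln (real p) / (real p)\<^sup>2 \<le> 1" using p2 by (simp add: field_simps)
  from mult_left_mono[OF this, of "448 * kk / Nb"] show ?thesis
    unfolding lamI(2) using kk Nb_pos by simp
qed

text \<open>Since \<open>lam^2 / p^2\<close> is at most \<open>448 * kk / Nb\<close>, the excess has
  mean of order \<open>1 / Nb\<close> without a logarithm, even for bounded \<open>p\<close>;
  \<open>1344 = 3 * 448\<close>. The weight \<open>f\<close> is \<open>1\<close> for the nodewise
  scores and an indicator for the scores of the noise.\<close>

lemma excess_tail:
  assumes y: "mean_le M (\<lambda>\<omega>. f \<omega> * ((real p)\<^sup>2 * R \<omega> / (lam I)\<^sup>2)) 3" and f: "\<And>\<omega>. 0 \<le> f \<omega>" and R: "\<And>\<omega>. 0 \<le> R \<omega>" and t: "t > 0"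
  shows "prob {\<omega> \<in> space M. t \<le> f \<omega> * R \<omega>} \<le> 1344 * kk / t / Nb"
proof -
  have "mean_le M (\<lambda>\<omega>. (lam I)\<^sup>2 / (real p)\<^sup>2 * (f \<omega> * ((real p)\<^sup>2 * R \<omega> / (lam I)\<^sup>2))) ((lam I)\<^sup>2 / (real p)\<^sup>2 * 3)"
    by (intro mean_le_cmult y) auto
  then have "mean_le M (\<lambda>\<omega>. f \<omega> * R \<omega>) ((lam I)\<^sup>2 / (real p)\<^sup>2 * 3)" using lamI(1) p2 by simp
  then have "mean_le M (\<lambda>\<omega>. f \<omega> * R \<omega>) (1344 * kk / Nb)"
  proof (rule mean_le_mono)
    have "(lam I)\<^sup>2 / (real p)\<^sup>2 * 3 \<le> 448 * kk / Nb * 3" by (intro mult_right_mono lam_over_p) simp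
    then show "(lam I)\<^sup>2 / (real p)\<^sup>2 * 3 \<le> 1344 * kk / Nb" by simp
  qed
  from mean_le_prob[OF this _ t] show ?thesis using f R by (simp add: mult.commute)
qed

lemma Ev_sets: "Ev \<in> sets M"
proof -
  have "Ev = {\<omega> \<in> space M. Y2 \<omega> \<le> eta_const K L * Nb / 2} \<inter> (space M - bad I) \<inter> {\<omega> \<in> space M. Rn I \<omega> \<le> rho1_const L H}
     \<inter> {\<omega> \<in> space M. Nb / (2 * L) \<le> (\<Sum>i\<in>I. (ip p (xr i \<omega>) \<theta>)\<^sup>2)}"
    by (auto simp: Ev_def bad_def Z_def)
  also have "\<dots> \<in> sets M" using bad_sets[of I] quad_meas[of I \<theta>] by measurable
  finally show ?thesis .
qed

lemma Ev_prob:
  "prob (space M - Ev) \<le> (event_const K L H kk + event_const2 K L H kk * ((real s)\<^sup>2 * ln (real p) * ln (Nb / real (n 1)))) / Nb"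
proof -
  let ?m = "A0 * first_const K L H kk + A0\<^sup>2 * U_const K L H * (448 * kk) * ((real s)\<^sup>2 * ln (real p) * ln (Nb / real (n 1)))"
  let ?c = "tail_const K L"
  define E1 where "E1 = {\<omega> \<in> space M. eta_const K L * Nb / 2 \<le> Y2 \<omega>}"
  define E3 where "E3 = {\<omega> \<in> space M. rho1_const L H \<le> 1 * Rn I \<omega>}"
  define E4 where "E4 = {\<omega> \<in> space M. (\<Sum>i\<in>I. (ip p (xr i \<omega>) \<theta>)\<^sup>2) < real (card I) / 2 * bil p Sg \<theta> \<theta>}"
  have mE1: "E1 \<in> sets M" unfolding E1_def by measurable
  have mE3: "E3 \<in> sets M" unfolding E3_def by measurable
  have mE4: "E4 \<in> sets M" unfolding E4_def using quad_meas[OF order_refl, of \<theta>] by measurable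
  have mb: "bad I \<in> sets M" by (rule bad_sets) simp
  note ms = mE1 mE3 mE4 mb
  have Y20: "0 \<le> Y2 \<omega>" for \<omega> unfolding Y2_def using rate_pos Err_nonneg U_nonneg
    by (intro add_nonneg_nonneg mult_nonneg_nonneg sum_nonneg) (auto simp: less_imp_le)
  have p1: "prob E1 \<le> ?m / (eta_const K L * Nb / 2)"
    unfolding E1_def by (rule mean_le_prob[OF Y2_moment]) (use Y20 eta_pos Nb_pos in auto)
  have rho: "rho1_const L H > 0" using L1 H1 by (auto simp: rho1_const_def intro!: mult_pos_pos)
  have p3: "prob E3 \<le> 1344 * kk / rho1_const L H / Nb"
    unfolding E3_def by (rule excess_tail) (use RI_mean Rn_nonneg rho in auto)
  have cN: "?c * Nb > 0" using tail_const_pos Nb_pos by simp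
  have p4: "prob E4 \<le> 1 / (?c * Nb)"
    using lower_tail_quadratic[of I \<theta>] exp_neg_le[OF cN] unfolding E4_def Nb_def by simp
  have p2': "prob (bad I) \<le> 4 / (?c * Nb)"
  proof -
    have "ln (real p) \<le> real (card I)" using card_ge_ln[OF NI] lp by linarith
    then have "prob (bad I) \<le> 2 * exp (- (?c / 2 * Nb))" using bad_prob[of I] p2 by (simp add: Nb_def)
    also have "\<dots> \<le> 2 * (1 / (?c / 2 * Nb))" using cN by (intro mult_left_mono exp_neg_le) auto
    finally show ?thesis by simp
  qed
  \<comment> \<open>Coordinate \<open>r\<close> of \<open>\<theta>\<close> is \<open>1\<close>, so
    the population residual has second moment at least \<open>1 / L\<close>.\<close>
  have bil: "bil p Sg \<theta> \<theta> \<ge> 1 / L"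
  proof -
    have "1 = (\<theta> r)\<^sup>2" by (simp add: \<theta>_def g0r unit_fun_def)
    also have "\<dots> \<le> ip p \<theta> \<theta>" unfolding ip_self_sum using r by (intro member_le_sum[of r "{..<p}" "\<lambda>k. (\<theta> k)\<^sup>2"]) auto
    finally have "1 / L \<le> ip p \<theta> \<theta> / L" using L1 by (intro divide_right_mono) auto
    then show ?thesis using low[of \<theta>] by linarith
  qed
  have "space M - Ev \<subseteq> E1 \<union> (bad I \<union> (E3 \<union> E4))"
  proof
    fix \<omega> assume "\<omega> \<in> space M - Ev"
    moreover have "Nb / (2 * L) \<le> real (card I) / 2 * bil p Sg \<theta> \<theta>"
      using mult_left_mono[OF bil, of "Nb / 2"] Nb_pos by (simp add: Nb_def)
    ultimately show "\<omega> \<in> E1 \<union> (bad I \<union> (E3 \<union> E4))"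
      by (auto simp: Ev_def E1_def E3_def E4_def bad_def Z_def)
  qed
  then have "prob (space M - Ev) \<le> prob (E1 \<union> (bad I \<union> (E3 \<union> E4)))" by (intro finite_measure_mono sets.Un ms)
  also have "\<dots> \<le> prob E1 + (prob (bad I) + (prob E3 + prob E4))"
    by (intro order.trans[OF measure_Un_le] add_mono order_refl sets.Un ms)
  also have "\<dots> \<le> ?m / (eta_const K L * Nb / 2) + (4 / (?c * Nb) + (1344 * kk / rho1_const L H / Nb + 1 / (?c * Nb)))"
    by (intro add_mono p1 p2' p3 p4)
  also have "\<dots> = (event_const K L H kk + event_const2 K L H kk * ((real s)\<^sup>2 * ln (real p) * ln (Nb / real (n 1)))) / Nb"
  proof -
    have a: "?m / (eta_const K L * Nb / 2) = 2 / eta_const K L * ?m / Nb" by simp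
    have c: "4 / (?c * Nb) + (t + 1 / (?c * Nb)) = 5 / ?c / Nb + t" for t by (simp add: add_divide_distrib[symmetric])
    show ?thesis unfolding a c event_const_def event_const2_def
      by (simp only: add_divide_distrib distrib_left distrib_right mult.assoc add.assoc)
  qed
  finally show ?thesis .
qed

lemma W1_nonneg: "\<omega> \<in> space M \<Longrightarrow> 0 \<le> W1 \<omega>"
  using score_bound[of \<omega> r] r by (meson abs_ge_zero order_trans)

lemma W1_moment: "mean_le M W1 (W_const K L H kk * (real s * sqrt (ln (real p) * Nb)))"
proof -
  let ?l = "lam I"
  have l: "Nb * ?l = sqrt (448 * kk) * sqrt (ln (real p) * Nb)"
  proof -
    have "Nb * ?l = sqrt (448 * kk) * (Nb * sqrt (ln (real p) / Nb))" by (simp add: lam_def lasso_const_def Nb_def)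
    also have "Nb * sqrt (ln (real p) / Nb) = sqrt (Nb\<^sup>2) * sqrt (ln (real p) / Nb)" using Nb_pos by simp
    also have "\<dots> = sqrt (Nb\<^sup>2 * (ln (real p) / Nb))" by (rule real_sqrt_mult[symmetric])
    also have "Nb\<^sup>2 * (ln (real p) / Nb) = ln (real p) * Nb" using Nb_pos by (simp add: power2_eq_square)
    finally show ?thesis .
  qed
  have "mean_le M (\<lambda>\<omega>. Nb * ?l * (3/2 + (real p)\<^sup>2 * Rn I \<omega> / ?l\<^sup>2) + Y1 \<omega>)
      (Nb * ?l * (3/2 + 3) + A0 * real s * U_const K L H * (2 * sqrt (448 * kk * ln (real p) * Nb)))"
    using Nb_pos lamI(1) by (intro mean_le_add mean_le_cmult mean_le_const RI_mean Y1_moment) auto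
  then have "mean_le M W1 (Nb * ?l * (3/2 + 3) + A0 * real s * U_const K L H * (2 * sqrt (448 * kk * ln (real p) * Nb)))"
  proof (rule mean_le_dom)
    show "W1 \<in> borel_measurable M" unfolding W1_def by measurable
    fix \<omega> assume \<omega>: "\<omega> \<in> space M"
    define y where "y = Rn I \<omega> / ?l\<^sup>2"
    have y0: "0 \<le> y" by (simp add: y_def Rn_nonneg)
    have "sqrt (Rn I \<omega>) = ?l * sqrt y" using lamI(1) by (simp add: y_def real_sqrt_divide)
    \<comment> \<open>Trades the square root of the excess for the excess itself, whose mean is
      known.\<close>
    also have "sqrt y \<le> 1 + y"
      using y0 zero_le_power2[of "sqrt y - 1/2"] by (simp add: power2_eq_square algebra_simps)
    also have "y \<le> (real p)\<^sup>2 * y" using mult_right_mono[of 1 "(real p)\<^sup>2" y] y0 p2 by simp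
    finally have "sqrt (Rn I \<omega>) \<le> ?l * (1 + (real p)\<^sup>2 * y)" using lamI(1) by (simp add: mult_left_mono)
    then have "?l / 2 + sqrt (Rn I \<omega>) \<le> ?l * (3/2 + (real p)\<^sup>2 * y)" by (simp add: algebra_simps)
    from mult_left_mono[OF this, of Nb] Nb_pos
    show "0 \<le> W1 \<omega> \<and> W1 \<omega> \<le> Nb * ?l * (3/2 + (real p)\<^sup>2 * Rn I \<omega> / ?l\<^sup>2) + Y1 \<omega>"
      using W1_nonneg[OF \<omega>] by (simp add: W1_def y_def mult.assoc)
  qed
  moreover have "Nb * ?l * (3/2 + 3) + A0 * real s * U_const K L H * (2 * sqrt (448 * kk * ln (real p) * Nb))
     \<le> W_const K L H kk * (real s * sqrt (ln (real p) * Nb))"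
  proof -
    define q where "q = sqrt (448 * kk) * sqrt (ln (real p) * Nb)"
    have q0: "q \<ge> 0" using kk lp Nb_pos by (simp add: q_def)
    have "sqrt (448 * kk * ln (real p) * Nb) = q" by (simp add: q_def real_sqrt_mult)
    moreover have "q * (3/2 + 3) \<le> q * (5 * real s)" using q0 s1 by (intro mult_left_mono) auto
    moreover have "W_const K L H kk * (real s * sqrt (ln (real p) * Nb)) = q * (5 * real s) + A0 * real s * U_const K L H * (2 * q)"
      by (simp add: W_const_def q_def algebra_simps)
    ultimately show ?thesis unfolding l q_def[symmetric] by simp
  qed
  ultimately show ?thesis by (rule mean_le_mono)
qed

end

section \<open>Conditioning on the noise\<close>

text \<open>Independence of the generated sigma-algebras makes the joint law a product; Fubini's
  theorem then freezes \<open>Y\<close> while \<open>X\<close> is averaged.\<close>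

lemma (in prob_space) indep_nn_integral:
  assumes X[measurable]: "X \<in> measurable M S" and Y[measurable]: "Y \<in> measurable M T"
    and ind: "indep_set (sets (vimage_algebra (space M) X S)) (sets (vimage_algebra (space M) Y T))"
    and f[measurable]: "f \<in> borel_measurable (S \<Otimes>\<^sub>M T)"
  shows "(\<integral>\<^sup>+\<omega>. f (X \<omega>, Y \<omega>) \<partial>M) = (\<integral>\<^sup>+\<omega>. (\<integral>\<^sup>+\<omega>'. f (X \<omega>', Y \<omega>) \<partial>M) \<partial>M)"
proof -
  interpret X: prob_space "distr M S X" by (rule prob_space_distr) simp
  interpret Y: prob_space "distr M T Y" by (rule prob_space_distr) simp
  interpret XY: pair_sigma_finite "distr M S X" "distr M T Y" ..
  have "(\<integral>\<^sup>+\<omega>. f (X \<omega>, Y \<omega>) \<partial>M) = (\<integral>\<^sup>+q. f q \<partial>distr M (S \<Otimes>\<^sub>M T) (\<lambda>\<omega>. (X \<omega>, Y \<omega>)))"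
    by (subst nn_integral_distr) auto
  also have "distr M (S \<Otimes>\<^sub>M T) (\<lambda>\<omega>. (X \<omega>, Y \<omega>)) = distr M S X \<Otimes>\<^sub>M distr M T Y"
  proof (rule pair_measure_eqI[symmetric])
    fix A B assume "A \<in> sets (distr M S X)" "B \<in> sets (distr M T Y)"
    then have A[measurable]: "A \<in> sets S" and B[measurable]: "B \<in> sets T" by simp_all
    have "prob ((X -` A \<inter> space M) \<inter> (Y -` B \<inter> space M)) = prob (X -` A \<inter> space M) * prob (Y -` B \<inter> space M)"
      using ind in_vimage_algebra[OF A, of X "space M"] in_vimage_algebra[OF B, of Y "space M"] by (intro indep_setD)
    moreover have "(\<lambda>\<omega>. (X \<omega>, Y \<omega>)) -` (A \<times> B) \<inter> space M = (X -` A \<inter> space M) \<inter> (Y -` B \<inter> space M)" by auto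
    ultimately show "emeasure (distr M S X) A * emeasure (distr M T Y) B = emeasure (distr M (S \<Otimes>\<^sub>M T) (\<lambda>\<omega>. (X \<omega>, Y \<omega>))) (A \<times> B)"
      by (subst (1 2 3) emeasure_distr) (auto simp: emeasure_eq_measure ennreal_mult)
  qed (unfold_locales, simp)
  also have "(\<integral>\<^sup>+q. f q \<partial>(distr M S X \<Otimes>\<^sub>M distr M T Y)) = (\<integral>\<^sup>+y. \<integral>\<^sup>+x. f (x, y) \<partial>distr M S X \<partial>distr M T Y)"
    by (rule XY.nn_integral_snd[symmetric]) simp
  also have "\<dots> = (\<integral>\<^sup>+\<omega>. (\<integral>\<^sup>+x. f (x, Y \<omega>) \<partial>distr M S X) \<partial>M)"
    by (subst nn_integral_distr) auto
  also have "\<dots> = (\<integral>\<^sup>+\<omega>. (\<integral>\<^sup>+\<omega>'. f (X \<omega>', Y \<omega>) \<partial>M) \<partial>M)"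
  proof (rule nn_integral_cong)
    fix \<omega> assume "\<omega> \<in> space M"
    then have "Y \<omega> \<in> space T" by (rule measurable_space[OF Y])
    then show "(\<integral>\<^sup>+x. f (x, Y \<omega>) \<partial>distr M S X) = (\<integral>\<^sup>+\<omega>'. f (X \<omega>', Y \<omega>) \<partial>M)"
      by (subst nn_integral_distr) auto
  qed
  finally show ?thesis .
qed

lemma (in sub_gaussian_rows) row_mgf:
  assumes i: "i \<in> I" and k: "k < p"
  shows "mean_le M (\<lambda>\<omega>. exp (t * x i k \<omega>)) (exp (K\<^sup>2 * t\<^sup>2 / 2))"
proof -
  have "sub_gaussian M K (\<lambda>\<omega>. ip p (xr i \<omega>) (unit_fun k))"
    by (rule sg[OF i]) (simp add: ip_unit_unit k)
  then have "(\<integral>\<^sup>+\<omega>. ennreal (exp (t * x i k \<omega>)) \<partial>M) \<le> ennreal (exp (K\<^sup>2 * t\<^sup>2 / 2))"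
    using k by (simp add: sub_gaussian_def row_unit)
  then show ?thesis using i k by (intro mean_le_nn_integral) auto
qed

text \<open>For frozen noise the sum is a combination of independent sub-Gaussian row entries, and
  the subtracted term is the exponent of its moment bound; so the conditional mean is at most
  \<open>1\<close> whatever the noise. The size of the noise enters later, through this
  compensator.\<close>

lemma (in sub_gaussian_rows) noise_mgf:
  fixes e :: "'i \<Rightarrow> 'a \<Rightarrow> real"
  assumes iv: "indep_set
      (sets (vimage_algebra (space M) (\<lambda>\<omega>. \<lambda>i\<in>I. \<lambda>k\<in>{..<p}. x i k \<omega>) (\<Pi>\<^sub>M i\<in>I. \<Pi>\<^sub>M k\<in>{..<p}. borel)))
      (sets (vimage_algebra (space M) (\<lambda>\<omega>. \<lambda>i\<in>I. e i \<omega>) (\<Pi>\<^sub>M i\<in>I. borel)))"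
    and em: "\<And>i. i \<in> I \<Longrightarrow> e i \<in> borel_measurable M" and k: "k < p"
  shows "mean_le M (\<lambda>\<omega>. exp (\<Sum>i\<in>I. u * e i \<omega> * x i k \<omega> - K\<^sup>2 * (u * e i \<omega>)\<^sup>2 / 2)) 1"
proof -
  let ?S = "\<Pi>\<^sub>M i\<in>I. \<Pi>\<^sub>M k\<in>{..<p}. (borel :: real measure)" and ?T = "\<Pi>\<^sub>M i\<in>I. (borel :: real measure)"
  define F :: "(('i \<Rightarrow> nat \<Rightarrow> real) \<times> ('i \<Rightarrow> real)) \<Rightarrow> real" where
    "F q = exp (\<Sum>i\<in>I. u * snd q i * fst q i k - K\<^sup>2 * (u * snd q i)\<^sup>2 / 2)" for q
  have c1: "(\<lambda>q. snd q i) \<in> borel_measurable (?S \<Otimes>\<^sub>M ?T)" if "i \<in> I" for i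
    using measurable_compose[OF measurable_snd measurable_component_singleton[OF that]] .
  have c2: "(\<lambda>q. fst q i k) \<in> borel_measurable (?S \<Otimes>\<^sub>M ?T)" if "i \<in> I" for i
  proof -
    have "(\<lambda>q. fst q i) \<in> measurable (?S \<Otimes>\<^sub>M ?T) (\<Pi>\<^sub>M k\<in>{..<p}. borel)"
      using measurable_compose[OF measurable_fst measurable_component_singleton[OF that]] .
    from measurable_compose[OF this measurable_component_singleton[of k]] k show ?thesis by simp
  qed
  have F[measurable]: "F \<in> borel_measurable (?S \<Otimes>\<^sub>M ?T)"
    unfolding F_def using c1 c2 by (intro borel_measurable_exp[THEN measurable_compose[rotated]] borel_measurable_sum) auto
  have FX: "F (\<lambda>i\<in>I. \<lambda>k\<in>{..<p}. x i k \<omega>', \<lambda>i\<in>I. e i \<omega>) = exp (\<Sum>i\<in>I. u * e i \<omega> * x i k \<omega>' - K\<^sup>2 * (u * e i \<omega>)\<^sup>2 / 2)" for \<omega> \<omega>'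
    unfolding F_def using k by (intro arg_cong[of _ _ exp] sum.cong) auto
  have X: "(\<lambda>\<omega>. \<lambda>i\<in>I. \<lambda>k\<in>{..<p}. x i k \<omega>) \<in> measurable M ?S"
    by (intro measurable_restrict) auto
  have Y: "(\<lambda>\<omega>. \<lambda>i\<in>I. e i \<omega>) \<in> measurable M ?T"
    by (intro measurable_restrict em)
  have inner: "(\<integral>\<^sup>+\<omega>'. ennreal (exp (\<Sum>i\<in>I. c i * x i k \<omega>' - K\<^sup>2 * (c i)\<^sup>2 / 2)) \<partial>M) \<le> 1" for c :: "'i \<Rightarrow> real"
  proof -
    have "mean_le M (\<lambda>\<omega>'. exp (\<Sum>i\<in>I. c i * x i k \<omega>')) (exp (\<Sum>i\<in>I. K\<^sup>2 * (c i)\<^sup>2 / 2))"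
    proof (rule mean_le_exp_sum[OF finI])
      show "indep_vars (\<lambda>_. borel) (\<lambda>i \<omega>. c i * x i k \<omega>) I"
        using indep_vars_compose2[OF ind, of "\<lambda>i g. c i * g k" "\<lambda>_. borel"] k by simp
    qed (rule row_mgf[OF _ k])
    note m0 = this
    define S where "S = (\<Sum>i\<in>I. K\<^sup>2 * (c i)\<^sup>2 / 2)"
    note mm = m0[folded S_def]
    have eq: "exp (\<Sum>i\<in>I. c i * x i k \<omega>' - K\<^sup>2 * (c i)\<^sup>2 / 2) = exp (- S) * exp (\<Sum>i\<in>I. c i * x i k \<omega>')" for \<omega>'
      unfolding sum_subtractf S_def[symmetric] exp_add[symmetric] by simp
    have "exp (- S) * exp S = 1" by (simp flip: exp_add)
    then have m: "mean_le M (\<lambda>\<omega>'. exp (\<Sum>i\<in>I. c i * x i k \<omega>' - K\<^sup>2 * (c i)\<^sup>2 / 2)) 1"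
      unfolding eq using mean_le_cmult[OF mm, of "exp (- S)"] by simp
    then show ?thesis
      by (subst nn_integral_eq_integral) (auto simp: mean_le_def)
  qed
  have "(\<integral>\<^sup>+\<omega>. ennreal (exp (\<Sum>i\<in>I. u * e i \<omega> * x i k \<omega> - K\<^sup>2 * (u * e i \<omega>)\<^sup>2 / 2)) \<partial>M)
     = (\<integral>\<^sup>+\<omega>. (\<integral>\<^sup>+\<omega>'. ennreal (F (\<lambda>i\<in>I. \<lambda>k\<in>{..<p}. x i k \<omega>', \<lambda>i\<in>I. e i \<omega>)) \<partial>M) \<partial>M)"
    using indep_nn_integral[OF X Y iv, of "\<lambda>q. ennreal (F q)"] unfolding FX by simp
  also have "\<dots> \<le> (\<integral>\<^sup>+\<omega>. 1 \<partial>M)"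
    unfolding FX using inner by (intro nn_integral_mono) simp
  finally have "(\<integral>\<^sup>+\<omega>. ennreal (exp (\<Sum>i\<in>I. u * e i \<omega> * x i k \<omega> - K\<^sup>2 * (u * e i \<omega>)\<^sup>2 / 2)) \<partial>M) \<le> ennreal 1"
    by (simp add: emeasure_space_1)
  then show ?thesis using em k by (intro mean_le_nn_integral) (auto intro!: borel_measurable_exp[THEN measurable_compose[rotated]] borel_measurable_sum)
qed

section \<open>The main lasso and the exceptional event\<close>

text \<open>\<open>sqrt (8 * L)\<close> comes from the lower bound on the norm of the residuals,
  \<open>32 * L\<close> from the l1 rate of the main lasso, \<open>sqrt (448 * kk)\<close> from the
  penalty.\<close>

definition D_const :: "real \<Rightarrow> real \<Rightarrow> real" where
  "D_const L kk = sqrt (8 * L) * (32 * L) * sqrt (448 * kk)"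

definition all_const :: "real \<Rightarrow> real \<Rightarrow> real \<Rightarrow> real \<Rightarrow> real" where
  "all_const K L H kk = event_const K L H kk + 2 + 1344 * kk / rho_const K L kk"

locale online_noise = online M I p x Sg K L D r \<gamma>0 s H kk b n g
  for M :: "'a measure" and I :: "(nat \<times> nat) set" and p x Sg K L D r \<gamma>0 s H kk b n g +
  fixes e :: "nat \<times> nat \<Rightarrow> 'a \<Rightarrow> real" and \<beta>0 :: "nat \<Rightarrow> real" and bh :: "nat \<Rightarrow> 'a \<Rightarrow> real" and s0 :: nat and E :: real
  assumes E1: "E \<ge> 1" and kkE: "kk \<ge> 8 * K\<^sup>2 * E\<^sup>2"
    and e_ind: "indep_vars (\<lambda>_. borel) e I"
    and e_mgf: "\<And>u k. k < p \<Longrightarrow> mean_le M (\<lambda>\<omega>. exp (\<Sum>i\<in>I. u * e i \<omega> * x i k \<omega> - K\<^sup>2 * (u * e i \<omega>)\<^sup>2 / 2)) 1"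
    and e2: "\<And>i. i \<in> I \<Longrightarrow> mean_le M (\<lambda>\<omega>. (e i \<omega>)\<^sup>2) (8 * E\<^sup>2)"
    and e4: "\<And>i. i \<in> I \<Longrightarrow> mean_le M (\<lambda>\<omega>. (e i \<omega>) ^ 4) (96 * E ^ 4)"
    and sparse0: "card {k. k < p \<and> \<beta>0 k \<noteq> 0} \<le> s0" and sp: "s \<le> p"
    and size0: "256 * L * re_const K L * (real s0 * ln (real p)) \<le> Nb"
    and bh_opt: "\<And>\<omega>. \<omega> \<in> space M \<Longrightarrow>
       (1 / (2 * Nb)) * (\<Sum>i\<in>I. (ip p (xr i \<omega>) \<beta>0 + e i \<omega> - ip p (xr i \<omega>) (\<lambda>k. bh k \<omega>))\<^sup>2)
          + lam I * l1 p (\<lambda>k. bh k \<omega>)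
       \<le> (1 / (2 * Nb)) * (\<Sum>i\<in>I. (e i \<omega>)\<^sup>2) + lam I * l1 p \<beta>0"
begin

definition "Te k \<omega> = 1 / Nb * (\<Sum>i\<in>I. e i \<omega> * x i k \<omega>)"
definition "Qe \<omega> = excess p (lam I) (\<lambda>k. Te k \<omega>)"
definition "Ae = {\<omega> \<in> space M. (\<Sum>i\<in>I. (e i \<omega>)\<^sup>2) \<le> 16 * E\<^sup>2 * Nb}"

lemma e_meas[measurable]: "i \<in> I \<Longrightarrow> e i \<in> borel_measurable M"
  using e_ind by (auto simp: indep_vars_def)

lemma Te_meas[measurable]: "k < p \<Longrightarrow> Te k \<in> borel_measurable M"
  unfolding Te_def by (intro borel_measurable_times borel_measurable_sum borel_measurable_const) auto

lemma Qe_meas[measurable]: "Qe \<in> borel_measurable M"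
  unfolding Qe_def excess_def by (intro borel_measurable_sum borel_measurable_power borel_measurable_max borel_measurable_diff borel_measurable_abs borel_measurable_const) auto

lemma Ae_sets[measurable]: "Ae \<in> sets M"
proof -
  have [measurable]: "(\<lambda>\<omega>. \<Sum>i\<in>I. (e i \<omega>)\<^sup>2) \<in> borel_measurable M"
    by (intro borel_measurable_sum borel_measurable_power) auto
  show ?thesis unfolding Ae_def by measurable
qed

lemma Qe_nonneg: "0 \<le> Qe \<omega>" by (simp add: Qe_def excess_nonneg)

text \<open>Chebyshev's inequality for the sum of squares: the threshold is twice the bound
  \<open>8 * E^2\<close> on the mean per observation, and the fourth moments give
  \<open>96 / 64 <= 2\<close>.\<close>

lemma Ae_prob: "prob (space M - Ae) \<le> 2 / Nb"
proof -
  define Y where "Y i \<omega> = (e i \<omega>)\<^sup>2 - expectation (\<lambda>\<omega>. (e i \<omega>)\<^sup>2)" for i \<omega>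
  have int2: "integrable M (\<lambda>\<omega>. (e i \<omega>)\<^sup>2)" "expectation (\<lambda>\<omega>. (e i \<omega>)\<^sup>2) \<le> 8 * E\<^sup>2" if "i \<in> I" for i
    using e2[OF that] by (auto simp: mean_le_def)
  have "mean_le M (\<lambda>\<omega>. (\<Sum>i\<in>I. Y i \<omega>)\<^sup>2) (real (card I) * (96 * E ^ 4))"
  proof (rule second_moment_sum[OF finI])
    show "indep_vars (\<lambda>_. borel) Y I" unfolding Y_def by (rule indep_vars_compose2[OF e_ind]) auto
    fix i assume i: "i \<in> I"
    show "integrable M (Y i) \<and> expectation (Y i) = 0" using int2[OF i] by (simp add: Y_def[abs_def] prob_space)
    have i4: "integrable M (\<lambda>\<omega>. (e i \<omega>) ^ 4)" "expectation (\<lambda>\<omega>. (e i \<omega>) ^ 4) \<le> 96 * E ^ 4"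
      using e4[OF i] by (auto simp: mean_le_def)
    define m where "m = expectation (\<lambda>\<omega>. (e i \<omega>)\<^sup>2)"
    have eq: "(Y i \<omega>)\<^sup>2 = (e i \<omega>) ^ 4 + (- 2 * m) * (e i \<omega>)\<^sup>2 + m\<^sup>2" for \<omega>
      by (simp add: Y_def m_def[symmetric] power2_diff flip: power_mult)
    have "expectation (\<lambda>\<omega>. (Y i \<omega>)\<^sup>2) = expectation (\<lambda>\<omega>. (e i \<omega>) ^ 4) + (- 2 * m) * m + m\<^sup>2"
      unfolding eq using i4(1) int2(1)[OF i] by (simp add: prob_space m_def)
    also have "\<dots> = expectation (\<lambda>\<omega>. (e i \<omega>) ^ 4) - m\<^sup>2" by (simp add: power2_eq_square)
    also have "\<dots> \<le> 96 * E ^ 4" using i4(2) zero_le_power2[of m] by linarith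
    finally show "mean_le M (\<lambda>\<omega>. (Y i \<omega>)\<^sup>2) (96 * E ^ 4)"
      unfolding mean_le_def using i4(1) int2(1)[OF i] by (simp add: eq)
  qed
  then have m: "mean_le M (\<lambda>\<omega>. (\<Sum>i\<in>I. Y i \<omega>)\<^sup>2) (Nb * (96 * E ^ 4))" by (simp add: Nb_def)
  have t: "0 < (8 * E\<^sup>2 * Nb)\<^sup>2" using E1 Nb_pos by simp
  have "space M - Ae \<subseteq> {\<omega> \<in> space M. (8 * E\<^sup>2 * Nb)\<^sup>2 \<le> (\<Sum>i\<in>I. Y i \<omega>)\<^sup>2}"
  proof
    fix \<omega> assume \<omega>: "\<omega> \<in> space M - Ae"
    have "(\<Sum>i\<in>I. Y i \<omega>) = (\<Sum>i\<in>I. (e i \<omega>)\<^sup>2) - (\<Sum>i\<in>I. expectation (\<lambda>\<omega>. (e i \<omega>)\<^sup>2))"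
      by (simp add: Y_def sum_subtractf)
    moreover have "(\<Sum>i\<in>I. expectation (\<lambda>\<omega>. (e i \<omega>)\<^sup>2)) \<le> (\<Sum>i\<in>I. 8 * E\<^sup>2)" by (intro sum_mono int2)
    moreover have "(\<Sum>i\<in>I. 8 * E\<^sup>2) = 8 * E\<^sup>2 * Nb" by (simp add: Nb_def)
    moreover have "(\<Sum>i\<in>I. (e i \<omega>)\<^sup>2) > 16 * E\<^sup>2 * Nb" using \<omega> by (auto simp: Ae_def)
    ultimately have "8 * E\<^sup>2 * Nb \<le> (\<Sum>i\<in>I. Y i \<omega>)" by linarith
    then show "\<omega> \<in> {\<omega> \<in> space M. (8 * E\<^sup>2 * Nb)\<^sup>2 \<le> (\<Sum>i\<in>I. Y i \<omega>)\<^sup>2}"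
      using \<omega> E1 Nb_pos by (auto intro!: power_mono)
  qed
  then have "prob (space M - Ae) \<le> prob {\<omega> \<in> space M. (8 * E\<^sup>2 * Nb)\<^sup>2 \<le> (\<Sum>i\<in>I. Y i \<omega>)\<^sup>2}"
    by (rule finite_measure_mono) (rule borel_measurable_le[OF borel_measurable_const borel_measurable_integrable[OF mean_leD(1)[OF m]]])
  also have "\<dots> \<le> Nb * (96 * E ^ 4) / (8 * E\<^sup>2 * Nb)\<^sup>2" by (rule mean_le_prob[OF m _ t]) simp
  also have "\<dots> = (3 / 2) / Nb" using E1 Nb_pos by (simp add: power_mult_distrib power2_eq_square power4_eq_xxxx field_simps)
  also have "\<dots> \<le> 2 / Nb" using Nb_pos by (intro divide_right_mono) auto
  finally show ?thesis .
qed

text \<open>On \<open>Ae\<close> the compensator in \<open>e_mgf\<close> is at most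
  \<open>8 * K^2 * E^2 * t^2 * Nb\<close>; the bound \<open>kkE\<close> turns this into the exponent
  \<open>Nb * lam^2 / (16 * kk)\<close> that \<open>excess_moment\<close> requires.\<close>

lemma Qe_moment: "mean_le M (\<lambda>\<omega>. indicator Ae \<omega> * ((real p)\<^sup>2 * Qe \<omega> / (lam I)\<^sup>2) ^ 8) 2"
  unfolding Qe_def
proof (rule excess_moment[of p Te Ae Nb kk "lam I"])
  show "lam I = lasso_const kk * sqrt (ln (real p) / Nb)" by (simp add: lam_def Nb_def)
  fix k assume k: "k < p"
  define t where "t = lam I / (4 * kk)"
  define v where "v = exp (Nb * (lam I)\<^sup>2 / (16 * kk))"
  let ?S = "\<lambda>\<omega>. \<Sum>i\<in>I. e i \<omega> * x i k \<omega>"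
  have one: "indicator Ae \<omega> * exp (u * ?S \<omega>) \<le> v * exp (\<Sum>i\<in>I. u * e i \<omega> * x i k \<omega> - K\<^sup>2 * (u * e i \<omega>)\<^sup>2 / 2)"
    if u: "u = t \<or> u = - t" for u \<omega>
  proof (cases "\<omega> \<in> Ae")
    case False then show ?thesis by (simp add: v_def)
  next
    case True
    have "(\<Sum>i\<in>I. K\<^sup>2 * (u * e i \<omega>)\<^sup>2 / 2) = K\<^sup>2 * t\<^sup>2 / 2 * (\<Sum>i\<in>I. (e i \<omega>)\<^sup>2)"
      using u by (auto simp: sum_distrib_left power_mult_distrib mult.assoc)
    also have "\<dots> \<le> K\<^sup>2 * t\<^sup>2 / 2 * (16 * E\<^sup>2 * Nb)" using True by (intro mult_left_mono) (auto simp: Ae_def)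
    also have "\<dots> = (8 * K\<^sup>2 * E\<^sup>2) * (t\<^sup>2 * Nb)" by simp
    also have "\<dots> \<le> kk * (t\<^sup>2 * Nb)" using kkE Nb_pos by (intro mult_right_mono) auto
    also have "\<dots> = Nb * (lam I)\<^sup>2 / (16 * kk)" using kk by (simp add: t_def power_divide power2_eq_square)
    finally have "u * ?S \<omega> \<le> Nb * (lam I)\<^sup>2 / (16 * kk) + (\<Sum>i\<in>I. u * e i \<omega> * x i k \<omega> - K\<^sup>2 * (u * e i \<omega>)\<^sup>2 / 2)"
      by (simp add: sum_subtractf sum_distrib_left mult.assoc)
    then have "exp (u * ?S \<omega>) \<le> v * exp (\<Sum>i\<in>I. u * e i \<omega> * x i k \<omega> - K\<^sup>2 * (u * e i \<omega>)\<^sup>2 / 2)"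
      unfolding v_def exp_add[symmetric] by simp
    then show ?thesis using True by simp
  qed
  let ?G = "\<lambda>u \<omega>. v * exp (\<Sum>i\<in>I. u * e i \<omega> * x i k \<omega> - K\<^sup>2 * (u * e i \<omega>)\<^sup>2 / 2)"
  have "mean_le M (\<lambda>\<omega>. ?G t \<omega> + ?G (- t) \<omega>) (v * 1 + v * 1)"
    by (intro mean_le_add mean_le_cmult e_mgf k) (auto simp: v_def)
  then have "mean_le M (\<lambda>\<omega>. indicator Ae \<omega> * exp (Nb * lam I / (4 * kk) * \<bar>Te k \<omega>\<bar>)) (v * 1 + v * 1)"
  proof (rule mean_le_dom)
    fix \<omega>
    have "Nb * lam I / (4 * kk) * \<bar>Te k \<omega>\<bar> = t * \<bar>?S \<omega>\<bar>"
      using Nb_pos by (simp add: Te_def t_def abs_mult)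
    moreover have "exp (t * \<bar>?S \<omega>\<bar>) \<le> exp (t * ?S \<omega>) + exp (- t * ?S \<omega>)" by (cases "?S \<omega> \<ge> 0") auto
    ultimately have "indicator Ae \<omega> * exp (Nb * lam I / (4 * kk) * \<bar>Te k \<omega>\<bar>)
       \<le> indicator Ae \<omega> * exp (t * ?S \<omega>) + indicator Ae \<omega> * exp (- t * ?S \<omega>)"
      by (simp add: indicator_def)
    also have "\<dots> \<le> ?G t \<omega> + ?G (- t) \<omega>" by (intro add_mono one) auto
    finally show "0 \<le> indicator Ae \<omega> * exp (Nb * lam I / (4 * kk) * \<bar>Te k \<omega>\<bar>) \<and>
       indicator Ae \<omega> * exp (Nb * lam I / (4 * kk) * \<bar>Te k \<omega>\<bar>) \<le> ?G t \<omega> + ?G (- t) \<omega>" by simp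
  qed (use k in measurable)
  then show "mean_le M (\<lambda>\<omega>. indicator Ae \<omega> * exp (Nb * lam I / (4 * kk) * \<bar>Te k \<omega>\<bar>)) (2 * exp (Nb * (lam I)\<^sup>2 / (16 * kk)))"
    by (simp add: v_def)
qed (use p2 Nb_pos kk in auto)

lemma Qe_mean: "mean_le M (\<lambda>\<omega>. indicator Ae \<omega> * ((real p)\<^sup>2 * Qe \<omega> / (lam I)\<^sup>2)) 3"
  by (rule first_moment_of_eighth[OF Qe_moment]) (auto simp: Qe_nonneg indicator_def)

text \<open>Unlike the nodewise regressions, the main lasso enters at a single stage, so a bound
  outside one exceptional event suffices. The smallness budget is divided as for them, between the
  sparsity and the excess.\<close>

lemma bh_rate:
  assumes \<omega>: "\<omega> \<in> space M" and good: "good I \<omega>" and R: "Qe \<omega> \<le> rho_const K L kk"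
  shows "l1 p (\<lambda>k. bh k \<omega> - \<beta>0 k) \<le> 32 * L * (real s0 * lam I + Qe \<omega> / lam I)"
proof -
  define l where "l = lam I"
  have l0: "l > 0" and l2: "l\<^sup>2 = 448 * kk * ln (real p) / Nb" using lamI by (auto simp: l_def)
  interpret lp: lasso_point p I Nb l "\<lambda>i k. x i k \<omega>" \<beta>0 "\<lambda>k. bh k \<omega>" "\<lambda>i. e i \<omega>" s0
    using bh_opt[OF \<omega>] Nb_pos l0 sparse0 by unfold_locales (auto simp: l_def)
  have R': "excess p l lp.T = Qe \<omega>" by (simp add: Qe_def l_def lp.T_def[abs_def] Te_def)
  define a where "a = re_const K L * ln (real p) / Nb"
  have a0: "a \<ge> 0" using re_const_pos lp Nb_pos by (simp add: a_def)
  have RE: "1 / (2 * L) * ip p lp.\<delta> lp.\<delta> - a * (l1 p lp.\<delta>)\<^sup>2 \<le> lp.P"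
    using restricted_eigenvalue[OF order_refl p2 NI good, of lp.\<delta>] unfolding lp.P_def a_def Nb_def[symmetric] .
  have small: "a * (8 * l\<^sup>2 * real s0 + 2 * excess p l lp.T) \<le> 1 / (2 * L) * l\<^sup>2 / 8"
  proof -
    have as: "256 * L * (a * real s0) \<le> 1" using size0 Nb_pos by (simp add: a_def field_simps)
    have "16 * L * (a * (8 * l\<^sup>2 * real s0)) = 1/2 * l\<^sup>2 * (256 * L * (a * real s0))" by simp
    also have "\<dots> \<le> 1/2 * l\<^sup>2 * 1" by (intro mult_left_mono as) auto
    finally have 1: "16 * L * (a * (8 * l\<^sup>2 * real s0)) \<le> 1/2 * l\<^sup>2" by simp
    have "16 * L * (a * (2 * Qe \<omega>)) \<le> 16 * L * (a * (2 * rho_const K L kk))"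
      using R a0 L1 by (intro mult_left_mono) auto
    also have "\<dots> = 1/2 * l\<^sup>2"
      using L1 re_const_pos Nb_pos by (simp add: a_def rho_const_def l2 field_simps)
    finally have "16 * L * (a * (8 * l\<^sup>2 * real s0 + 2 * Qe \<omega>)) \<le> l\<^sup>2" using 1 by (simp add: algebra_simps)
    then show ?thesis unfolding R' using L1 by (simp add: field_simps)
  qed
  have "l1 p lp.\<delta> \<le> 2 * (8 * l\<^sup>2 * real s0 + 2 * Qe \<omega>) / (1 / (2 * L) * l)"
    using lp.fast_rate(1)[OF _ a0 RE small] L1 unfolding R' by auto
  also have "\<dots> = 32 * L * (real s0 * l) + 8 * L * (Qe \<omega> / l)"
    using l0 L1 by (simp add: field_simps power2_eq_square)
  also have "\<dots> \<le> 32 * L * (real s0 * l) + 32 * L * (Qe \<omega> / l)"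
    using L1 l0 Qe_nonneg by (intro add_left_mono mult_right_mono) auto
  finally show ?thesis by (simp add: lp.\<delta>_def l_def distrib_left)
qed

definition "Delta \<omega> = ip p (\<lambda>k. \<Sum>i\<in>I. z i \<omega> * xm i k \<omega>) (\<lambda>k. \<beta>0 k - bh k \<omega>) / sqrt (zz \<omega>)"

text \<open>Two kinds of sets: the first three have a probability that depends on the sample size
  but not on \<open>t\<close>, the last two are Markov events at a level \<open>t\<close> that stays
  fixed while \<open>Nb\<close> grows.\<close>

definition "exc t = (space M - Ev) \<union> (space M - Ae) \<union> {\<omega> \<in> space M. rho_const K L kk \<le> indicator Ae \<omega> * Qe \<omega>}
   \<union> {\<omega> \<in> space M. t * (real s * sqrt (ln (real p) * Nb)) \<le> W1 \<omega>}
   \<union> {\<omega> \<in> space M. t \<le> indicator Ae \<omega> * ((real p)\<^sup>2 * Qe \<omega> / (lam I)\<^sup>2)}"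

lemma W1_meas[measurable]: "W1 \<in> borel_measurable M"
  using mean_leD(1)[OF W1_moment] by (rule borel_measurable_integrable)

lemma exc_sets: "exc t \<in> sets M"
proof -
  have m3: "{\<omega> \<in> space M. rho_const K L kk \<le> indicator Ae \<omega> * Qe \<omega>} \<in> sets M" by measurable
  have m4: "{\<omega> \<in> space M. t * (real s * sqrt (ln (real p) * Nb)) \<le> W1 \<omega>} \<in> sets M" by measurable
  have m5: "{\<omega> \<in> space M. t \<le> indicator Ae \<omega> * ((real p)\<^sup>2 * Qe \<omega> / (lam I)\<^sup>2)} \<in> sets M" by measurable
  show ?thesis unfolding exc_def by (intro sets.Un sets.compl_sets Ev_sets Ae_sets m3 m4 m5)
qed

lemma exc_prob:
  assumes t: "t > 0"
  shows "prob (exc t) \<le> (all_const K L H kk + event_const2 K L H kk * ((real s)\<^sup>2 * ln (real p) * ln (Nb / real (n 1)))) / Nb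
     + (W_const K L H kk + 3) / t"
proof -
  define B3 where "B3 = {\<omega> \<in> space M. rho_const K L kk \<le> indicator Ae \<omega> * Qe \<omega>}"
  define B4 where "B4 = {\<omega> \<in> space M. t * (real s * sqrt (ln (real p) * Nb)) \<le> W1 \<omega>}"
  define B5 where "B5 = {\<omega> \<in> space M. t \<le> indicator Ae \<omega> * ((real p)\<^sup>2 * Qe \<omega> / (lam I)\<^sup>2)}"
  have m3: "B3 \<in> sets M" unfolding B3_def by measurable
  have m4: "B4 \<in> sets M" unfolding B4_def by measurable
  have m5: "B5 \<in> sets M" unfolding B5_def by measurable
  note ms = sets.compl_sets[OF Ev_sets] sets.compl_sets[OF Ae_sets] m3 m4 m5
  have q: "0 < real s * sqrt (ln (real p) * Nb)" using s1 lp Nb_pos by (intro mult_pos_pos) auto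
  have p3: "prob B3 \<le> 1344 * kk / rho_const K L kk / Nb"
    unfolding B3_def by (rule excess_tail[OF Qe_mean]) (auto simp: Qe_nonneg rho_pos)
  have "prob B4 \<le> W_const K L H kk * (real s * sqrt (ln (real p) * Nb)) / (t * (real s * sqrt (ln (real p) * Nb)))"
    unfolding B4_def by (rule mean_le_prob[OF W1_moment W1_nonneg]) (use q t in auto)
  also have "\<dots> = W_const K L H kk / t" by (rule nonzero_mult_divide_mult_cancel_right) (use q in linarith)
  finally have p4: "prob B4 \<le> W_const K L H kk / t" .
  have p5: "prob B5 \<le> 3 / t"
    unfolding B5_def by (rule mean_le_prob[OF Qe_mean _ t]) (auto simp: Qe_nonneg)
  have "prob (exc t) \<le> prob (space M - Ev) + prob (space M - Ae) + prob B3 + prob B4 + prob B5"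
    unfolding exc_def B3_def[symmetric] B4_def[symmetric] B5_def[symmetric]
    by (intro order.trans[OF measure_Un_le] add_mono order_refl sets.Un ms)
  also have "\<dots> \<le> (event_const K L H kk + event_const2 K L H kk * ((real s)\<^sup>2 * ln (real p) * ln (Nb / real (n 1)))) / Nb
     + 2 / Nb + 1344 * kk / rho_const K L kk / Nb + W_const K L H kk / t + 3 / t"
    by (intro add_mono Ev_prob Ae_prob p3 p4 p5)
  also have "\<dots> = (all_const K L H kk + event_const2 K L H kk * ((real s)\<^sup>2 * ln (real p) * ln (Nb / real (n 1)))) / Nb
     + (W_const K L H kk + 3) / t"
    by (simp add: all_const_def add_divide_distrib)
  finally show ?thesis .
qed

text \<open>\<open>W1\<close> over the norm of the residuals is of order
  \<open>t * s * sqrt (ln p)\<close>, and the l1 error of the main lasso is of order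
  \<open>s0 * lam\<close> plus the excess over \<open>lam\<close>. The first product is the assumed
  rate up to \<open>t\<close>; the second is of order \<open>t^2 / sqrt Nb\<close>, because the
  excess carries \<open>p^(-2)\<close> and \<open>s * ln p <= p^2\<close>.\<close>

lemma Delta_bound:
  assumes \<omega>: "\<omega> \<in> space M" "\<omega> \<notin> exc t" and t: "t > 0"
  shows "den \<omega> > 0" "zz \<omega> > 0"
    and "\<bar>Delta \<omega>\<bar> \<le> D_const L kk * t * (real s0 * real s * (ln (real p) / sqrt Nb) + t / sqrt Nb)"
proof -
  have ev: "\<omega> \<in> Ev" and ae: "\<omega> \<in> Ae" and w1: "W1 \<omega> \<le> t * (real s * sqrt (ln (real p) * Nb))"
    and R0: "Qe \<omega> \<le> rho_const K L kk" and yt: "(real p)\<^sup>2 * Qe \<omega> / (lam I)\<^sup>2 \<le> t"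
    using \<omega> by (auto simp: exc_def)
  show "den \<omega> > 0" by (rule den_pos[OF ev])
  have q: "0 < Nb / (8 * L)" using Nb_pos L1 by simp
  have z: "Nb / (8 * L) \<le> zz \<omega>" by (rule zz_ge[OF ev])
  then show zp: "zz \<omega> > 0" using q by linarith
  define l where "l = lam I"
  have l0: "l > 0" using lamI by (simp add: l_def)
  have good: "good I \<omega>" using ev by (simp add: Ev_def)
  have "\<bar>ip p (\<lambda>k. \<Sum>i\<in>I. z i \<omega> * xm i k \<omega>) (\<lambda>k. \<beta>0 k - bh k \<omega>)\<bar> \<le> (\<Sum>k<p. W1 \<omega> * \<bar>\<beta>0 k - bh k \<omega>\<bar>)"
    unfolding ip_def using score_bound[OF \<omega>(1)]
    by (intro order.trans[OF sum_abs] sum_mono) (auto simp: abs_mult intro!: mult_right_mono)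
  also have "\<dots> = W1 \<omega> * l1 p (\<lambda>k. bh k \<omega> - \<beta>0 k)" by (simp add: l1_def sum_distrib_left abs_minus_commute)
  also have "\<dots> \<le> t * (real s * sqrt (ln (real p) * Nb)) * (32 * L * (real s0 * l + Qe \<omega> / l))"
    using w1 bh_rate[OF \<omega>(1) good R0] W1_nonneg[OF \<omega>(1)] l1_nonneg unfolding l_def
    by (intro mult_mono) (auto intro: order.trans)
  finally have num: "\<bar>ip p (\<lambda>k. \<Sum>i\<in>I. z i \<omega> * xm i k \<omega>) (\<lambda>k. \<beta>0 k - bh k \<omega>)\<bar>
      \<le> t * (real s * sqrt (ln (real p) * Nb)) * (32 * L * (real s0 * l + Qe \<omega> / l))" .
  have "\<bar>Delta \<omega>\<bar> \<le> t * (real s * sqrt (ln (real p) * Nb)) * (32 * L * (real s0 * l + Qe \<omega> / l)) / sqrt (Nb / (8 * L))"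
    unfolding Delta_def abs_divide using num z q Nb_pos order.trans[OF abs_ge_zero num] by (intro frac_le) auto
  also have "\<dots> = t * sqrt (8 * L) * (32 * L) * (real s * sqrt (ln (real p))) * (real s0 * l + Qe \<omega> / l)"
    using Nb_pos L1 by (simp add: real_sqrt_mult real_sqrt_divide)
  also have "\<dots> \<le> t * sqrt (8 * L) * (32 * L) * (sqrt (448 * kk) * (real s0 * real s * (ln (real p) / sqrt Nb) + t / sqrt Nb))"
  proof (subst (2) mult.assoc, rule mult_left_mono)
    have l_eq: "l = sqrt (448 * kk) * (sqrt (ln (real p)) / sqrt Nb)"
      by (simp add: l_def lam_def lasso_const_def Nb_def real_sqrt_divide)
    have Rl: "Qe \<omega> / l \<le> t / (real p)\<^sup>2 * l"
      using yt l0 p2 by (simp add: l_def field_simps power2_eq_square)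
    have "real s * sqrt (ln (real p)) * (real s0 * l + Qe \<omega> / l) \<le> real s * sqrt (ln (real p)) * (real s0 * l + t / (real p)\<^sup>2 * l)"
      using Rl lp by (intro mult_left_mono) auto
    also have "\<dots> = sqrt (448 * kk) * (real s * (sqrt (ln (real p)) * sqrt (ln (real p))) * (real s0 + t / (real p)\<^sup>2) / sqrt Nb)"
    proof -
      define q where "q = sqrt (ln (real p))"
      show ?thesis unfolding l_eq q_def[symmetric] by (simp add: algebra_simps add_divide_distrib)
    qed
    also have "sqrt (ln (real p)) * sqrt (ln (real p)) = ln (real p)" using lp by simp
    also have "real s * ln (real p) * (real s0 + t / (real p)\<^sup>2) / sqrt Nb
       = real s0 * real s * (ln (real p) / sqrt Nb) + (real s * ln (real p) / (real p)\<^sup>2) * (t / sqrt Nb)"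
      by (simp add: algebra_simps add_divide_distrib)
    also have "\<dots> \<le> real s0 * real s * (ln (real p) / sqrt Nb) + 1 * (t / sqrt Nb)"
    proof (intro add_left_mono mult_right_mono)
      have "real s * ln (real p) \<le> real p * real p" using sp ln_p_le lp by (intro mult_mono) auto
      then show "real s * ln (real p) / (real p)\<^sup>2 \<le> 1" using p2 by (simp add: power2_eq_square)
    qed (use t Nb_pos in auto)
    finally show "real s * sqrt (ln (real p)) * (real s0 * l + Qe \<omega> / l)
       \<le> sqrt (448 * kk) * (real s0 * real s * (ln (real p) / sqrt Nb) + t / sqrt Nb)"
      using kk by (simp add: mult_left_mono)
  qed (use t L1 in auto)
  finally show "\<bar>Delta \<omega>\<bar> \<le> D_const L kk * t * (real s0 * real s * (ln (real p) / sqrt Nb) + t / sqrt Nb)"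
    by (simp add: D_const_def mult_ac)
qed

end

section \<open>Population regression\<close>

lemma bil_perturb:
  assumes sym: "\<And>k l. k < p \<Longrightarrow> l < p \<Longrightarrow> A k l = A l k"
  shows "bil p A (\<lambda>k. u k + t * w k) (\<lambda>k. u k + t * w k) = bil p A u u + 2 * t * bil p A u w + t\<^sup>2 * bil p A w w"
proof -
  have c: "bil p A y z = bil p A z y" for y z by (rule bil_commute) (rule sym)
  have "bil p A (\<lambda>k. u k + t * w k) z = bil p A u z + t * bil p A w z" for z
    by (simp add: bil_add_left bil_scale_left)
  then show ?thesis
    using c[of u "\<lambda>k. u k + t * w k"] c[of w "\<lambda>k. u k + t * w k"] c[of u w]
    by (simp add: algebra_simps power2_eq_square)
qed

text \<open>First-order condition: for nonzero \<open>a\<close> a small step against its sign makes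
  the expression negative. The denominator \<open>1 + |c|\<close> of the step also covers
  \<open>c = 0\<close>.\<close>

lemma linear_coeff_zero:
  fixes a c :: real
  assumes "\<And>t. 0 \<le> t * a + t\<^sup>2 * c"
  shows "a = 0"
proof (rule ccontr)
  assume a: "a \<noteq> 0"
  define t where "t = - a / (1 + \<bar>c\<bar>)"
  have "t * a + t\<^sup>2 * c \<le> t * a + t\<^sup>2 * \<bar>c\<bar>" by (intro add_left_mono mult_left_mono) auto
  also have "\<dots> = - (a\<^sup>2 / (1 + \<bar>c\<bar>)\<^sup>2)"
    unfolding t_def by (simp add: power_divide divide_simps add_nonneg_eq_0_iff) (simp add: power2_eq_square algebra_simps)
  also have "\<dots> < 0" using a by (simp add: add_pos_nonneg)
  finally show False using assms[of t] by linarith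
qed

text \<open>The dimension is a variable, so vectors are functions vanishing from \<open>p\<close>
  on, and compactness comes from Tychonoff's theorem for a product of intervals and points.\<close>

lemma compact_unit_sphere:
  "compact {f :: nat \<Rightarrow> real. (\<forall>k\<ge>p. f k = 0) \<and> ip p f f = 1}"
proof -
  let ?B = "PiE UNIV (\<lambda>k::nat. if k < p then {-1..1::real} else {0})"
  have "compactin (product_topology (\<lambda>_. euclidean) UNIV) ?B"
    by (subst compactin_PiE) auto
  then have B: "compact ?B" unfolding euclidean_product_topology compactin_euclidean_iff .
  have "closed {f :: nat \<Rightarrow> real. ip p f f = 1}"
    unfolding ip_def by (intro closed_Collect_eq continuous_on_sum continuous_on_mult continuous_on_product_coordinates continuous_on_const)
  then have "compact (?B \<inter> {f. ip p f f = 1})" by (rule compact_Int_closed[OF B])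
  also have "?B \<inter> {f. ip p f f = 1} = {f. (\<forall>k\<ge>p. f k = 0) \<and> ip p f f = 1}"
  proof (intro equalityI subsetI)
    fix f :: "nat \<Rightarrow> real" assume f: "f \<in> {f. (\<forall>k\<ge>p. f k = 0) \<and> ip p f f = 1}"
    have "\<bar>f k\<bar> \<le> 1" if "k < p" for k
    proof -
      have "(f k)\<^sup>2 \<le> ip p f f" unfolding ip_self_sum using that by (intro member_le_sum[of k "{..<p}" "\<lambda>k. (f k)\<^sup>2"]) auto
      then show ?thesis using f abs_square_le_1 by auto
    qed
    then show "f \<in> ?B \<inter> {f. ip p f f = 1}" using f by (auto simp: abs_le_iff minus_le_iff)
  next
    fix f :: "nat \<Rightarrow> real" assume f: "f \<in> ?B \<inter> {f. ip p f f = 1}"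
    have "f k = 0" if "k \<ge> p" for k
    proof -
      have "f k \<in> (if k < p then {-1..1} else {0})" using f by (auto simp: PiE_def Pi_def)
      then show ?thesis using that by simp
    qed
    then show "f \<in> {f. (\<forall>k\<ge>p. f k = 0) \<and> ip p f f = 1}" using f by simp
  qed
  finally show ?thesis .
qed

text \<open>The Rayleigh quotient attains its minimum on the sphere, and the minimiser is an
  eigenvector by the first-order condition; so the minimum belongs to the spectrum and is at least
  \<open>min_eigenvalue A\<close>.\<close>

lemma rayleigh_min_eigenvalue:
  fixes A :: "real mat"
  assumes A: "A \<in> carrier_mat p p"
    and sym: "\<And>k l. k < p \<Longrightarrow> l < p \<Longrightarrow> A $$ (k, l) = A $$ (l, k)"
  shows "min_eigenvalue A * ip p u u \<le> bil p (\<lambda>k l. A $$ (k, l)) u u"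
proof (cases "ip p u u = 0")
  case True
  then have "\<forall>k\<in>{..<p}. (u k)\<^sup>2 = 0" unfolding ip_self_sum by (subst (asm) sum_nonneg_eq_0_iff) auto
  then have "bil p (\<lambda>k l. A $$ (k, l)) u u = 0" by (simp add: bil_def)
  then show ?thesis using True by simp
next
  case False
  let ?A = "\<lambda>k l. A $$ (k, l)"
  let ?S = "{f :: nat \<Rightarrow> real. (\<forall>k\<ge>p. f k = 0) \<and> ip p f f = 1}"
  define nrm where "nrm w = (\<lambda>k. if k < p then 1 / sqrt (ip p w w) * w k else 0)" for w :: "nat \<Rightarrow> real"
  have nrm: "nrm w \<in> ?S" "bil p ?A (nrm w) (nrm w) * ip p w w = bil p ?A w w" if "ip p w w \<noteq> 0" for w
  proof -
    have pos: "ip p w w > 0" using that ip_self_nonneg[of p w] by simp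
    have "ip p (nrm w) (nrm w) = (1 / sqrt (ip p w w))\<^sup>2 * ip p w w"
      unfolding ip_self_sum nrm_def by (simp add: power_mult_distrib power_divide sum_divide_distrib)
    also have "\<dots> = 1" using pos by (simp add: power_divide)
    finally show "nrm w \<in> ?S" by (simp add: nrm_def)
    have "bil p ?A (nrm w) (nrm w) = (1 / sqrt (ip p w w))\<^sup>2 * bil p ?A w w"
      unfolding bil_def nrm_def by (simp add: sum_distrib_left power2_eq_square mult_ac)
    then show "bil p ?A (nrm w) (nrm w) * ip p w w = bil p ?A w w" using pos by (simp add: power_divide)
  qed
  have cont: "continuous_on ?S (\<lambda>f. bil p ?A f f)"
    unfolding bil_def by (intro continuous_on_sum continuous_on_mult continuous_on_const continuous_on_subset[OF continuous_on_product_coordinates]) auto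
  have ne: "?S \<noteq> {}" using nrm(1)[OF False] by (metis empty_iff)
  from continuous_attains_inf[OF compact_unit_sphere[of p] ne cont]
  obtain v where v1: "v \<in> ?S" and v2: "\<forall>f\<in>?S. bil p ?A v v \<le> bil p ?A f f" by (elim bexE)
  note v = v1 bspec[OF v2]
  define \<mu> where "\<mu> = bil p ?A v v"
  have min: "\<mu> * ip p w w \<le> bil p ?A w w" for w
  proof (cases "ip p w w = 0")
    case True
    then have "\<forall>k\<in>{..<p}. (w k)\<^sup>2 = 0" unfolding ip_self_sum by (subst (asm) sum_nonneg_eq_0_iff) auto
    then have "bil p ?A w w = 0" by (simp add: bil_def)
    then show ?thesis using True by simp
  next
    case False
    have "\<mu> * ip p w w \<le> bil p ?A (nrm w) (nrm w) * ip p w w"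
      using v(2)[OF nrm(1)[OF False]] ip_self_nonneg by (intro mult_right_mono) (auto simp: \<mu>_def)
    then show ?thesis using nrm(2)[OF False] by simp
  qed
  \<comment> \<open>The minimiser is perturbed in direction \<open>w\<close>; the linear coefficient
    of a nonnegative quadratic polynomial without constant term vanishes.\<close>
  have ev: "bil p ?A v w = \<mu> * ip p v w" for w
  proof -
    have "0 \<le> t * (2 * bil p ?A v w - 2 * \<mu> * ip p v w) + t\<^sup>2 * (bil p ?A w w - \<mu> * ip p w w)" for t
    proof -
      have "\<mu> * ip p (\<lambda>k. v k + t * w k) (\<lambda>k. v k + t * w k) \<le> bil p ?A (\<lambda>k. v k + t * w k) (\<lambda>k. v k + t * w k)"
        by (rule min)
      moreover have "bil p ?A (\<lambda>k. v k + t * w k) (\<lambda>k. v k + t * w k) = \<mu> + 2 * t * bil p ?A v w + t\<^sup>2 * bil p ?A w w"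
        using bil_perturb[of p ?A v t w, OF sym] by (simp add: \<mu>_def)
      moreover have "ip p (\<lambda>k. v k + t * w k) (\<lambda>k. v k + t * w k) = 1 + 2 * t * ip p v w + t\<^sup>2 * ip p w w"
        using v(1) by (simp add: ip_add_left ip_add_right ip_scale_left ip_scale_right ip_commute[of p w v] power2_eq_square algebra_simps)
      ultimately show ?thesis by (simp add: algebra_simps)
    qed
    from linear_coeff_zero[OF this] show ?thesis by simp
  qed
  define V where "V = vec p v"
  have "A *\<^sub>v V = \<mu> \<cdot>\<^sub>v V"
  proof (rule eq_vecI)
    fix k assume "k < dim_vec (\<mu> \<cdot>\<^sub>v V)"
    then have k: "k < p" by (simp add: V_def)
    have "(A *\<^sub>v V) $ k = (\<Sum>l<p. A $$ (k, l) * v l)"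
      using A k by (simp add: V_def scalar_prod_def atLeast0LessThan)
    also have "\<dots> = bil p ?A (unit_fun k) v" by (rule bil_unit_left[OF k, symmetric])
    also have "\<dots> = bil p ?A v (unit_fun k)" by (rule bil_commute) (rule sym)
    also have "\<dots> = \<mu> * v k" unfolding ev using ip_unit[OF k, of v] by simp
    finally show "(A *\<^sub>v V) $ k = (\<mu> \<cdot>\<^sub>v V) $ k" using k by (simp add: V_def)
  qed (use A in \<open>simp add: V_def\<close>)
  moreover have "V \<noteq> 0\<^sub>v p"
  proof
    assume "V = 0\<^sub>v p"
    then have "v k = 0" if "k < p" for k using that unfolding V_def by (metis index_vec index_zero_vec(1))
    then have "ip p v v = 0" by (simp add: ip_def)
    then show False using v(1) by simp
  qed
  moreover have "V \<in> carrier_vec p" by (simp add: V_def)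
  ultimately have "\<mu> \<in> spectrum A"
    using A unfolding spectrum_def eigenvalue_def eigenvector_def by auto
  then have "min_eigenvalue A \<le> \<mu>"
    unfolding min_eigenvalue_def using card_finite_spectrum(1)[OF A] by (intro Min_le)
  then have "min_eigenvalue A * ip p u u \<le> \<mu> * ip p u u" by (intro mult_right_mono ip_self_nonneg)
  then show ?thesis using min[of u] by linarith
qed

text \<open>The precision matrix is read off with \<open>the\<close>, so \<open>mat_inverse\<close>
  must be shown to succeed. A null vector of the matrix would contradict positive definiteness, so
  the determinant is nonzero.\<close>

lemma mat_inverse_exists:
  fixes A :: "real mat"
  assumes A: "A \<in> carrier_mat p p"
    and pd: "\<And>u. 0 < ip p u u \<Longrightarrow> 0 < bil p (\<lambda>k l. A $$ (k, l)) u u"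
  obtains B where "mat_inverse A = Some B" "A * B = 1\<^sub>m p" "B \<in> carrier_mat p p"
proof (cases "mat_inverse A")
  case None
  have "det A \<noteq> 0"
  proof
    assume "det A = 0"
    then obtain v where v: "v \<in> carrier_vec p" "v \<noteq> 0\<^sub>v p" "A *\<^sub>v v = 0\<^sub>v p"
      using det_0_iff_vec_prod_zero_field[OF A] by auto
    have "(\<Sum>l<p. A $$ (k, l) * v $ l) = 0" if "k < p" for k
    proof -
      have "(A *\<^sub>v v) $ k = (\<Sum>l<p. A $$ (k, l) * v $ l)"
        using A v(1) that by (simp add: scalar_prod_def atLeast0LessThan)
      then show ?thesis using v(3) that by simp
    qed
    moreover have "bil p (\<lambda>k l. A $$ (k, l)) (\<lambda>k. v $ k) (\<lambda>k. v $ k) = (\<Sum>k<p. v $ k * (\<Sum>l<p. A $$ (k, l) * v $ l))"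
      unfolding bil_def by (simp add: sum_distrib_left mult_ac)
    ultimately have z: "bil p (\<lambda>k l. A $$ (k, l)) (\<lambda>k. v $ k) (\<lambda>k. v $ k) = 0" by simp
    obtain k where k: "k < p" "v $ k \<noteq> 0" using v(1,2) by (metis carrier_vecD eq_vecI index_zero_vec)
    have "0 < (v $ k)\<^sup>2" using k by simp
    also have "\<dots> \<le> ip p (\<lambda>k. v $ k) (\<lambda>k. v $ k)"
      unfolding ip_self_sum using k by (intro member_le_sum[of k "{..<p}" "\<lambda>k. (v $ k)\<^sup>2"]) auto
    finally show False using pd z by fastforce
  qed
  then have "A \<in> Units (ring_mat TYPE(real) p ())" by (rule det_non_zero_imp_unit[OF A])
  then show thesis using mat_inverse(1)[OF A None, of "()"] by blast
next
  case (Some B)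
  then show thesis using mat_inverse(2)[OF A Some] that by auto
qed

text \<open>The column \<open>r\<close> of the inverse, scaled to have entry \<open>1\<close> at \<open>r\<close>, gives the population
  regression of covariate \<open>r\<close> on the others.\<close>

lemma population_regression:
  fixes A :: "real mat"
  assumes A: "A \<in> carrier_mat p p" and r: "r < p" and L: "L > 0"
    and sym: "\<And>k l. k < p \<Longrightarrow> l < p \<Longrightarrow> A $$ (k, l) = A $$ (l, k)"
    and low: "\<And>u. ip p u u / L \<le> bil p (\<lambda>k l. A $$ (k, l)) u u"
    and diag: "A $$ (r, r) \<le> D"
  obtains \<gamma> :: "nat \<Rightarrow> real" where "\<gamma> r = 0"
    "{k. k < p \<and> \<gamma> k \<noteq> 0} \<subseteq> {k. k < p \<and> k \<noteq> r \<and> the (mat_inverse A) $$ (k, r) \<noteq> 0}"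
    "ip p (\<lambda>k. unit_fun r k - \<gamma> k) (\<lambda>k. unit_fun r k - \<gamma> k) \<le> L * D" "ip p \<gamma> \<gamma> \<le> L * D"
    "\<And>k. k < p \<Longrightarrow> k \<noteq> r \<Longrightarrow> bil p (\<lambda>k l. A $$ (k, l)) (\<lambda>k. unit_fun r k - \<gamma> k) (unit_fun k) = 0"
proof -
  let ?A = "\<lambda>k l. A $$ (k, l)"
  have pd: "0 < bil p ?A u u" if "0 < ip p u u" for u
    using low[of u] divide_pos_pos[OF that L] by linarith
  obtain B where B: "mat_inverse A = Some B" "A * B = 1\<^sub>m p" "B \<in> carrier_mat p p"
    by (rule mat_inverse_exists[OF A pd])
  define t where "t k = B $$ (k, r)" for k
  have bc: "bil p ?A u w = bil p ?A w u" for u w by (rule bil_commute) (rule sym)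
  have bt: "bil p ?A t (unit_fun k) = (if k = r then 1 else 0)" if k: "k < p" for k
  proof -
    have "bil p ?A t (unit_fun k) = (\<Sum>l<p. A $$ (k, l) * t l)"
      unfolding bc[of t] by (rule bil_unit_left[OF k])
    also have "\<dots> = (A * B) $$ (k, r)" using A B(3) k r by (simp add: scalar_prod_def atLeast0LessThan t_def)
    also have "\<dots> = (if k = r then 1 else 0)" unfolding B(2) using k r by simp
    finally show ?thesis .
  qed
  have btt: "bil p ?A t t = t r"
  proof -
    have "bil p ?A t t = (\<Sum>k<p. t k * bil p ?A (unit_fun k) t)" by (rule bil_sum_left[symmetric])
    also have "\<dots> = (\<Sum>k<p. if k = r then t k else 0)"
      by (intro sum.cong refl) (simp add: bc[of "unit_fun _"] bt)
    finally show ?thesis using r by simp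
  qed
  have "0 < ip p t t"
  proof (rule ccontr)
    assume "\<not> 0 < ip p t t"
    then have "ip p t t = 0" using ip_self_nonneg[of p t] by simp
    then have "\<forall>k\<in>{..<p}. (t k)\<^sup>2 = 0" unfolding ip_self_sum by (subst (asm) sum_nonneg_eq_0_iff) auto
    then have "bil p ?A t (unit_fun r) = 0" by (simp add: bil_def)
    then show False using bt[OF r] by simp
  qed
  then have tr: "t r > 0" using pd[of t] btt by simp
  define \<theta> where "\<theta> k = 1 / t r * t k" for k
  define \<gamma> where "\<gamma> k = unit_fun r k - \<theta> k" for k
  have \<theta>\<gamma>: "(\<lambda>k. unit_fun r k - \<gamma> k) = \<theta>" by (simp add: \<gamma>_def)
  have \<theta>b: "bil p ?A \<theta> w = 1 / t r * bil p ?A t w" for w unfolding \<theta>_def by (rule bil_scale_left)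
  have \<theta>\<theta>: "bil p ?A \<theta> \<theta> = 1 / t r"
    using \<theta>b[of \<theta>] bc[of t \<theta>] \<theta>b[of t] btt tr by simp
  have \<theta>r: "bil p ?A \<theta> (unit_fun r) = 1 / t r" using bt[OF r] by (simp add: \<theta>b)
  have "bil p ?A \<theta> \<theta> \<le> D"
  proof -
    \<comment> \<open>Nonnegativity of the form at \<open>\<theta> - unit_fun r\<close> reads
      \<open>1 / t r - 2 / t r + A $$ (r, r) >= 0\<close>: the residual variance is at most the
      variance of covariate \<open>r\<close>.\<close>
    define d where "d = (\<lambda>k. \<theta> k + (- 1) * unit_fun r k)"
    have "0 \<le> ip p d d / L" using L ip_self_nonneg by simp
    also have "\<dots> \<le> bil p ?A d d" by (rule low)
    also have "\<dots> = bil p ?A \<theta> \<theta> + 2 * (- 1) * bil p ?A \<theta> (unit_fun r) + (- 1)\<^sup>2 * bil p ?A (unit_fun r) (unit_fun r)"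
      unfolding d_def by (rule bil_perturb) (rule sym)
    also have "bil p ?A (unit_fun r) (unit_fun r) = A $$ (r, r)" by (rule bil_unit_unit[OF r])
    finally show ?thesis using diag \<theta>\<theta> \<theta>r by simp
  qed
  then have "ip p \<theta> \<theta> / L \<le> D" using low[of \<theta>] by linarith
  then have b\<theta>: "ip p \<theta> \<theta> \<le> L * D" using L by (simp add: field_simps)
  \<comment> \<open>\<open>\<gamma>\<close> equals \<open>- \<theta>\<close> except at
    \<open>r\<close>, where it is \<open>0\<close> by the scaling of
    \<open>\<theta>\<close>.\<close>
  have "ip p \<gamma> \<gamma> \<le> ip p \<theta> \<theta>"
    unfolding ip_self_sum using tr by (intro sum_mono) (auto simp: \<gamma>_def unit_fun_def \<theta>_def)
  then have b\<gamma>: "ip p \<gamma> \<gamma> \<le> L * D" using b\<theta> by linarith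
  show thesis
  proof (rule that[of \<gamma>])
    show "\<gamma> r = 0" using tr by (simp add: \<gamma>_def unit_fun_def \<theta>_def)
    then show "{k. k < p \<and> \<gamma> k \<noteq> 0} \<subseteq> {k. k < p \<and> k \<noteq> r \<and> the (mat_inverse A) $$ (k, r) \<noteq> 0}"
      by (auto simp: \<gamma>_def unit_fun_def \<theta>_def t_def B(1))
    show "bil p ?A (\<lambda>k. unit_fun r k - \<gamma> k) (unit_fun k) = 0" if "k < p" "k \<noteq> r" for k
      unfolding \<theta>\<gamma> \<theta>b using bt[OF that(1)] that(2) by simp
  qed (use b\<theta> b\<gamma> \<theta>\<gamma> in auto)
qed

section \<open>Data streams\<close>

definition entry :: "'a stream_model \<Rightarrow> nat \<times> nat \<Rightarrow> nat \<Rightarrow> 'a \<Rightarrow> real" where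
  "entry S i k \<omega> = design S (fst i) \<omega> $$ (snd i, k)"

text \<open>A coefficient vector of the regression on the other covariates, with a zero inserted at \<open>r\<close>.\<close>

definition emb :: "nat \<Rightarrow> real vec \<Rightarrow> nat \<Rightarrow> real" where
  "emb r v k = (if k < r then v $ k else if k = r then 0 else v $ (k - 1))"

definition resid :: "'a stream_model \<Rightarrow> nat \<Rightarrow> (nat \<Rightarrow> 'a \<Rightarrow> real vec) \<Rightarrow> nat \<times> nat \<Rightarrow> 'a \<Rightarrow> real" where
  "resid S r gh i \<omega> = entry S i r \<omega> - ip (ncov S) (\<lambda>k. entry S i k \<omega>) (emb r (gh (fst i) \<omega>))"

lemma emb_r: "emb r v r = 0" by (simp add: emb_def)

lemma sum_skip:
  assumes r: "r < p"
  shows "(\<Sum>k<p - 1. f (if k < r then k else Suc k)) = (\<Sum>k\<in>{..<p} - {r}. f k)"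
proof (rule sum.reindex_bij_betw)
  show "bij_betw (\<lambda>k. if k < r then k else Suc k) {..<p - 1} ({..<p} - {r})"
    by (rule bij_betw_byWitness[where f' = "\<lambda>k. if k < r then k else k - 1"]) (use r in auto)
qed

lemma sum_emb:
  assumes r: "r < p" and z: "h r (0::real) = (0::real)"
  shows "(\<Sum>k<p. h k (emb r v k)) = (\<Sum>k<p - 1. h (if k < r then k else Suc k) (v $ k))"
proof -
  have "(\<Sum>k<p. h k (emb r v k)) = (\<Sum>k\<in>{..<p} - {r}. h k (emb r v k))"
    using r z by (subst sum.remove[of _ r]) (auto simp: emb_r)
  also have "\<dots> = (\<Sum>k<p - 1. h (if k < r then k else Suc k) (emb r v (if k < r then k else Suc k)))"
    by (rule sum_skip[OF r, symmetric])
  also have "\<dots> = (\<Sum>k<p - 1. h (if k < r then k else Suc k) (v $ k))"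
    by (intro sum.cong refl) (auto simp: emb_def)
  finally show ?thesis .
qed

lemma norm1_emb: "r < p \<Longrightarrow> v \<in> carrier_vec (p - 1) \<Longrightarrow> norm1 v = l1 p (emb r v)"
  using sum_emb[of r p "\<lambda>_ t. \<bar>t\<bar>" v] by (simp add: norm1_def l1_def)

lemma drop_col_mult:
  assumes A: "A \<in> carrier_mat m p" and r: "r < p" and v: "v \<in> carrier_vec (p - 1)" and i: "i < m"
  shows "(drop_col r A *\<^sub>v v) $ i = ip p (\<lambda>k. A $$ (i, k)) (emb r v)"
proof -
  have "(drop_col r A *\<^sub>v v) $ i = (\<Sum>k<p - 1. A $$ (i, if k < r then k else Suc k) * v $ k)"
    using A v i by (simp add: drop_col_def scalar_prod_def atLeast0LessThan)
  also have "\<dots> = ip p (\<lambda>k. A $$ (i, k)) (emb r v)"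
    unfolding ip_def by (rule sum_emb[OF r, of "\<lambda>k t. A $$ (i, k) * t", symmetric]) simp
  finally show ?thesis .
qed

lemma mult_mat_ip:
  assumes "A \<in> carrier_mat m p" "v \<in> carrier_vec p" "i < m"
  shows "(A *\<^sub>v v) $ i = ip p (\<lambda>k. A $$ (i, k)) (\<lambda>k. v $ k)"
  using assms by (simp add: scalar_prod_def atLeast0LessThan ip_def)

lemma norm1_l1: "v \<in> carrier_vec p \<Longrightarrow> norm1 v = l1 p (\<lambda>k. v $ k)"
  by (auto simp: norm1_def l1_def)

lemma norm2_sq: "v \<in> carrier_vec m \<Longrightarrow> (norm2 v)\<^sup>2 = (\<Sum>i<m. (v $ i)\<^sup>2)"
  by (auto simp: norm2_def sum_nonneg)

lemma norm2_dot: "norm2 v = sqrt (v \<bullet> v)"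
  by (simp add: norm2_def scalar_prod_def atLeast0LessThan power2_eq_square)

lemma foldr_append_dot:
  assumes "\<And>j. j \<in> set js \<Longrightarrow> v j \<in> carrier_vec (m j)" "\<And>j. j \<in> set js \<Longrightarrow> w j \<in> carrier_vec (m j)"
  shows "foldr (\<lambda>j u. v j @\<^sub>v u) js vNil \<in> carrier_vec (sum_list (map m js)) \<and>
    foldr (\<lambda>j u. v j @\<^sub>v u) js vNil \<bullet> foldr (\<lambda>j u. w j @\<^sub>v u) js vNil = (\<Sum>j\<leftarrow>js. v j \<bullet> w j)"
  using assms
proof (induction js arbitrary: v w)
  case Nil
  then show ?case by (simp add: scalar_prod_def)
next
  case (Cons a js)
  have v: "v a \<in> carrier_vec (m a)" and w: "w a \<in> carrier_vec (m a)" using Cons.prems by auto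
  have IHv: "foldr (\<lambda>j u. v j @\<^sub>v u) js vNil \<in> carrier_vec (sum_list (map m js))"
    and dot: "foldr (\<lambda>j u. v j @\<^sub>v u) js vNil \<bullet> foldr (\<lambda>j u. w j @\<^sub>v u) js vNil = (\<Sum>j\<leftarrow>js. v j \<bullet> w j)"
    using Cons.IH[of v w] Cons.prems by auto
  have IHw: "foldr (\<lambda>j u. w j @\<^sub>v u) js vNil \<in> carrier_vec (sum_list (map m js))"
    using Cons.IH[of w w] Cons.prems by auto
  show ?case
    using scalar_prod_append[OF v IHv w IHw] dot append_carrier_vec[OF v IHv] by simp
qed

lemma stack_dot:
  assumes "\<And>j. j \<in> {1..b} \<Longrightarrow> v j \<in> carrier_vec (m j)" "\<And>j. j \<in> {1..b} \<Longrightarrow> w j \<in> carrier_vec (m j)"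
  shows "stack b v \<bullet> stack b w = (\<Sum>j=1..b. v j \<bullet> w j)"
proof -
  have "stack b v \<bullet> stack b w = (\<Sum>j\<leftarrow>[1..<Suc b]. v j \<bullet> w j)"
    unfolding stack_def by (rule foldr_append_dot[of "[1..<Suc b]" v m w, THEN conjunct2]) (use assms in auto)
  also have "\<dots> = (\<Sum>j=1..b. v j \<bullet> w j)"
    by (simp only: interv_sum_list_conv_sum_set_nat set_upt atLeastLessThanSuc_atLeastAtMost)
  finally show ?thesis .
qed

lemma is_arg_minD: "is_arg_min f P x \<Longrightarrow> P y \<Longrightarrow> f x \<le> (f y :: real)"
  by (auto simp: is_arg_min_def not_less)

lemma sub_gaussian_mono:
  assumes sg: "sub_gaussian M K Z" and K: "K \<le> K'" and eq: "\<And>\<omega>. \<omega> \<in> space M \<Longrightarrow> Z \<omega> = Z' \<omega>"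
  shows "sub_gaussian M K' Z'"
proof -
  have int: "integrable M Z' = integrable M Z" by (rule Bochner_Integration.integrable_cong) (auto simp: eq)
  have mean: "integral\<^sup>L M Z' = integral\<^sup>L M Z" by (rule Bochner_Integration.integral_cong) (auto simp: eq)
  have "(\<integral>\<^sup>+\<omega>. ennreal (exp (t * Z' \<omega>)) \<partial>M) \<le> ennreal (exp (K'\<^sup>2 * t\<^sup>2 / 2))" for t
  proof -
    have "(\<integral>\<^sup>+\<omega>. ennreal (exp (t * Z' \<omega>)) \<partial>M) = (\<integral>\<^sup>+\<omega>. ennreal (exp (t * Z \<omega>)) \<partial>M)"
      by (rule nn_integral_cong) (simp add: eq)
    also have "\<dots> \<le> ennreal (exp (K\<^sup>2 * t\<^sup>2 / 2))" using sg by (simp add: sub_gaussian_def)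
    also have "\<dots> \<le> ennreal (exp (K'\<^sup>2 * t\<^sup>2 / 2))"
    proof -
      have "K\<^sup>2 \<le> K'\<^sup>2" using sg K by (intro power_mono) (auto simp: sub_gaussian_def)
      then have "K\<^sup>2 * t\<^sup>2 \<le> K'\<^sup>2 * t\<^sup>2" by (intro mult_right_mono) auto
      then show ?thesis by (intro ennreal_leI) simp
    qed
    finally show ?thesis .
  qed
  then show ?thesis using sg K int mean by (auto simp: sub_gaussian_def)
qed

text \<open>The moment generating function at \<open>1 / E\<close> and \<open>- (1 / E)\<close> is
  at most \<open>2\<close>, and one term of the exponential series bounds each even power;
  \<open>8\<close> is \<open>4\<close> times \<open>2!\<close> and \<open>96\<close> is
  \<open>4\<close> times \<open>4!\<close>.\<close>

lemma sub_exponential_moments: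
  assumes "prob_space M" and se: "sub_exponential M E Z" and E: "E \<le> E'"
  shows "mean_le M (\<lambda>\<omega>. (Z \<omega>)\<^sup>2) (8 * E'\<^sup>2)" "mean_le M (\<lambda>\<omega>. (Z \<omega>) ^ 4) (96 * E' ^ 4)"
proof -
  interpret prob_space M by fact
  have E0: "E > 0" and [measurable]: "Z \<in> borel_measurable M"
    and mgf: "\<And>t. \<bar>t\<bar> \<le> 1 / E \<Longrightarrow> (\<integral>\<^sup>+\<omega>. ennreal (exp (t * Z \<omega>)) \<partial>M) \<le> ennreal (exp (E\<^sup>2 * t\<^sup>2 / 2))"
    using se by (auto simp: sub_exponential_def)
  have m: "mean_le M (\<lambda>\<omega>. exp (t * Z \<omega>)) 2" if "t = 1 / E \<or> t = - (1 / E)" for t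
  proof -
    have "E\<^sup>2 * t\<^sup>2 / 2 = 1/2" using that E0 by (auto simp: power_divide)
    moreover have "exp (1/2) \<le> (2::real)"
    proof -
      have "(exp (1/2))\<^sup>2 \<le> (2::real)\<^sup>2" using exp_le by (simp add: power2_eq_square flip: exp_add)
      then show ?thesis by (rule power2_le_imp_le) simp
    qed
    moreover have "\<bar>t\<bar> \<le> 1 / E" using that E0 by auto
    ultimately have "(\<integral>\<^sup>+\<omega>. ennreal (exp (t * Z \<omega>)) \<partial>M) \<le> ennreal (exp (1/2))" "ennreal (exp (1/2)) \<le> ennreal 2"
      using mgf[of t] by (auto intro!: ennreal_leI simp del: ennreal_numeral)
    then have "(\<integral>\<^sup>+\<omega>. ennreal (exp (t * Z \<omega>)) \<partial>M) \<le> ennreal 2" by (rule order.trans)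
    then show ?thesis by (intro mean_le_nn_integral) auto
  qed
  have mo: "mean_le M (\<lambda>\<omega>. (Z \<omega>) ^ n) (fact n * E' ^ n * (2 + 2))" if "even n" for n
  proof (rule mean_le_dom)
    show "mean_le M (\<lambda>\<omega>. fact n * E' ^ n * (exp (1 / E * Z \<omega>) + exp (- (1 / E) * Z \<omega>))) (fact n * E' ^ n * (2 + 2))"
      using E E0 by (intro mean_le_cmult mean_le_add m) auto
    fix \<omega>
    have "(\<bar>Z \<omega>\<bar> / E) ^ n \<le> fact n * exp (\<bar>Z \<omega>\<bar> / E)" using E0 by (intro power_le_fact_exp) auto
    also have "exp (\<bar>Z \<omega>\<bar> / E) \<le> exp (1 / E * Z \<omega>) + exp (- (1 / E) * Z \<omega>)" by (cases "Z \<omega> \<ge> 0") auto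
    finally have "(Z \<omega>) ^ n \<le> E ^ n * (fact n * (exp (1 / E * Z \<omega>) + exp (- (1 / E) * Z \<omega>)))"
      using E0 that by (simp add: power_divide power_even_abs field_simps)
    also have "\<dots> \<le> E' ^ n * (fact n * (exp (1 / E * Z \<omega>) + exp (- (1 / E) * Z \<omega>)))"
      using E E0 by (intro mult_right_mono power_mono) auto
    finally show "0 \<le> (Z \<omega>) ^ n \<and> (Z \<omega>) ^ n \<le> fact n * E' ^ n * (exp (1 / E * Z \<omega>) + exp (- (1 / E) * Z \<omega>))"
      using that by (simp add: mult_ac zero_le_even_power)
  qed simp
  show "mean_le M (\<lambda>\<omega>. (Z \<omega>)\<^sup>2) (8 * E'\<^sup>2)" using mo[of 2] by (simp add: fact_numeral mult_ac)
  show "mean_le M (\<lambda>\<omega>. (Z \<omega>) ^ 4) (96 * E' ^ 4)" using mo[of 4] by (simp add: fact_numeral mult_ac)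
qed

locale data_stream =
  fixes S :: "'a stream_model"
  assumes lin: "linear_stream_model S"
begin

abbreviation "M \<equiv> psp S"
abbreviation "p \<equiv> ncov S"

sublocale prob_space M using lin by (simp add: linear_stream_model_def)

lemma b2: "nbatch S \<ge> 2" and n1: "\<And>j. j \<in> {1..nbatch S} \<Longrightarrow> bsize S j \<ge> 1"
  and beta0_carrier: "beta0 S \<in> carrier_vec p"
  and design_carrier: "\<And>j \<omega>. j \<in> {1..nbatch S} \<Longrightarrow> \<omega> \<in> space M \<Longrightarrow> design S j \<omega> \<in> carrier_mat (bsize S j) p"
  and noise_carrier: "\<And>j \<omega>. j \<in> {1..nbatch S} \<Longrightarrow> \<omega> \<in> space M \<Longrightarrow> noise S j \<omega> \<in> carrier_vec (bsize S j)"
  using lin by (auto simp: linear_stream_model_def)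

lemma design_row_eq: "design_row S = (\<lambda>i \<omega>. \<lambda>k\<in>{..<p}. entry S i k \<omega>)"
  by (auto simp: design_row_def entry_def fun_eq_iff)

lemma entry_meas[measurable]: "i \<in> obs S \<Longrightarrow> k < p \<Longrightarrow> entry S i k \<in> borel_measurable M"
proof -
  assume i: "i \<in> obs S" and k: "k < p"
  have "indep_vars (\<lambda>_. row_space S) (design_row S) (obs S)" using lin by (simp add: linear_stream_model_def)
  then have "(\<lambda>\<omega>. \<lambda>k\<in>{..<p}. entry S i k \<omega>) \<in> measurable M (\<Pi>\<^sub>M k\<in>{..<p}. borel)"
    using i by (simp add: indep_vars_def design_row_eq row_space_def)
  from measurable_compose[OF this measurable_component_singleton[of k]] k
  show "entry S i k \<in> borel_measurable M" by simp
qed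

lemma noise_meas[measurable]: "i \<in> obs S \<Longrightarrow> noise_entry S i \<in> borel_measurable M"
  using lin by (auto simp: linear_stream_model_def indep_vars_def)

lemma design_indep: "indep_vars (\<lambda>_. row_space S) (design_row S) (obs S)"
  and noise_indep: "indep_vars (\<lambda>_. borel) (noise_entry S) (obs S)"
  and design_distr: "i \<in> obs S \<Longrightarrow> i' \<in> obs S \<Longrightarrow> distr M (row_space S) (design_row S i) = distr M (row_space S) (design_row S i')"
  using lin unfolding linear_stream_model_def by blast+

lemma finite_obs: "finite (obs S)" by (simp add: obs_def)
lemma card_obs: "card (obs S) = totsize S" by (simp add: obs_def cumsize_def)
lemma first_obs: "(1, 0) \<in> obs S" using b2 n1[of 1] by (auto simp: obs_def)

lemma sum_obs: "(\<Sum>j=1..nbatch S. \<Sum>q<bsize S j. f (j, q)) = (\<Sum>i\<in>obs S. f i)"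
  unfolding obs_def by (subst sum.Sigma) auto

lemma bsize_le: "j \<in> {1..nbatch S} \<Longrightarrow> bsize S 1 \<le> totsize S"
  unfolding cumsize_def by (rule member_le_sum) auto

text \<open>The covariance matrix belongs to the first row and is carried to all rows by equality in
  distribution; it consists of second moments because sub-Gaussian variables are centred. The
  eigenvalue bound becomes \<open>low\<close> through the Rayleigh quotient.\<close>

lemma rows_stream:
  assumes sg: "\<And>i. i \<in> obs S \<Longrightarrow> sub_gaussian_vec M p K (\<lambda>\<omega>. row (design S (fst i) \<omega>) (snd i))"
    and K: "K \<le> K'" "1 \<le> K'" and L: "min_eigenvalue (cov_mat S) > 0" "1 / min_eigenvalue (cov_mat S) \<le> L'" "1 \<le> L'"
    and D: "max_diag (cov_mat S) \<le> D'" "1 \<le> D'"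
  shows "sub_gaussian_rows M (obs S) p (entry S) (\<lambda>k l. cov_mat S $$ (k, l)) K' L' D'"
proof (unfold_locales)
  show "finite (obs S)" by (rule finite_obs)
  show "K' \<ge> 1" "L' \<ge> 1" "D' \<ge> 1" using K L D by auto
  show ind: "indep_vars (\<lambda>_. \<Pi>\<^sub>M k\<in>{..<p}. borel) (\<lambda>i \<omega>. \<lambda>k\<in>{..<p}. entry S i k \<omega>) (obs S)"
    using lin by (simp add: linear_stream_model_def design_row_eq row_space_def)
  show sgu: "sub_gaussian M K' (\<lambda>\<omega>. ip p (\<lambda>k. entry S i k \<omega>) u)" if i: "i \<in> obs S" and u: "ip p u u = 1" for i u
  proof -
    define v where "v = vec p u"
    have "norm2 v = 1" using u by (simp add: v_def norm2_def ip_self_sum)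
    then have "sub_gaussian M K (\<lambda>\<omega>. row (design S (fst i) \<omega>) (snd i) \<bullet> v)"
      using sg[OF i] by (simp add: sub_gaussian_vec_def v_def)
    then show ?thesis
    proof (rule sub_gaussian_mono[OF _ K(1)])
      fix \<omega> assume "\<omega> \<in> space M"
      moreover have "fst i \<in> {1..nbatch S}" "snd i < bsize S (fst i)" using i by (auto simp: obs_def)
      ultimately show "row (design S (fst i) \<omega>) (snd i) \<bullet> v = ip p (\<lambda>k. entry S i k \<omega>) u"
        using design_carrier[of "fst i" \<omega>]
        by (auto simp: v_def scalar_prod_def atLeast0LessThan ip_def entry_def)
    qed
  qed
  have mean0: "integrable M (entry S i k)" "(\<integral>\<omega>. entry S i k \<omega> \<partial>M) = 0" if i: "i \<in> obs S" and k: "k < p" for i k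
    using sgu[OF i ip_unit_unit[OF k]] by (simp_all add: sub_gaussian_def ip_unit[OF k])
  show cov: "(\<integral>\<omega>. entry S i k \<omega> * entry S i l \<omega> \<partial>M) = cov_mat S $$ (k, l)" if i: "i \<in> obs S" and k: "k < p" and l: "l < p" for i k l
  proof -
    have rv: "design_row S i' \<in> measurable M (row_space S)" if "i' \<in> obs S" for i'
      using design_indep that by (simp add: indep_vars_def)
    have fm: "(\<lambda>g. g k * g l) \<in> borel_measurable (row_space S)"
      unfolding row_space_def using k l by (intro borel_measurable_times measurable_component_singleton) auto
    have tr: "(\<integral>\<omega>. entry S i' k \<omega> * entry S i' l \<omega> \<partial>M) = (\<integral>g. g k * g l \<partial>distr M (row_space S) (design_row S i'))" if "i' \<in> obs S" for i'
    proof -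
      have "(\<integral>g. g k * g l \<partial>distr M (row_space S) (design_row S i')) = (\<integral>\<omega>. design_row S i' \<omega> k * design_row S i' \<omega> l \<partial>M)"
        by (rule integral_distr[OF rv[OF that] fm])
      also have "\<dots> = (\<integral>\<omega>. entry S i' k \<omega> * entry S i' l \<omega> \<partial>M)"
        unfolding design_row_eq using k l by simp
      finally show ?thesis by simp
    qed
    have "distr M (row_space S) (design_row S i) = distr M (row_space S) (design_row S (1, 0))"
      by (rule design_distr[OF i first_obs])
    then have "(\<integral>\<omega>. entry S i k \<omega> * entry S i l \<omega> \<partial>M) = (\<integral>\<omega>. entry S (1, 0) k \<omega> * entry S (1, 0) l \<omega> \<partial>M)"
      using tr[OF i] tr[OF first_obs] by simp
    also have "\<dots> = cov_mat S $$ (k, l)"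
      using k l mean0(2)[OF first_obs k] mean0(2)[OF first_obs l]
      by (simp add: cov_mat_def covariance_def entry_def)
    finally show ?thesis .
  qed
  have carr: "cov_mat S \<in> carrier_mat p p" by (simp add: cov_mat_def)
  have sym: "cov_mat S $$ (k, l) = cov_mat S $$ (l, k)" if "k < p" "l < p" for k l
    using that by (simp add: cov_mat_def covariance_def mult.commute)
  show "ip p u u / L' \<le> bil p (\<lambda>k l. cov_mat S $$ (k, l)) u u" for u
  proof -
    have "1 / L' \<le> min_eigenvalue (cov_mat S)" using L by (simp add: field_simps)
    from mult_right_mono[OF this ip_self_nonneg[of p u]]
    have "ip p u u / L' \<le> min_eigenvalue (cov_mat S) * ip p u u" by simp
    then show ?thesis using rayleigh_min_eigenvalue[OF carr sym, of u] by linarith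
  qed
  show "cov_mat S $$ (k, k) \<le> D'" if "k < p" for k
  proof -
    have "cov_mat S $$ (k, k) \<le> max_diag (cov_mat S)"
      unfolding max_diag_def using that carr by (intro Max_ge) auto
    then show ?thesis using D by linarith
  qed
qed

context
  fixes r :: nat and gh :: "nat \<Rightarrow> 'a \<Rightarrow> real vec"
  assumes r: "r < p"
    and gh: "\<And>j \<omega>. j \<in> {1..nbatch S} \<Longrightarrow> \<omega> \<in> space M \<Longrightarrow> gh j \<omega> \<in> carrier_vec (p - 1)"
begin

lemma zhat_carrier: "j \<in> {1..nbatch S} \<Longrightarrow> \<omega> \<in> space M \<Longrightarrow> zhat S r gh j \<omega> \<in> carrier_vec (bsize S j)"
proof -
  assume *: "j \<in> {1..nbatch S}" "\<omega> \<in> space M"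
  note dc = carrier_matD(1)[OF design_carrier[OF *]]
  show "zhat S r gh j \<omega> \<in> carrier_vec (bsize S j)"
    by (rule carrier_vecI) (simp add: zhat_def drop_col_def dc)
qed

lemma zhat_entry: "j \<in> {1..nbatch S} \<Longrightarrow> \<omega> \<in> space M \<Longrightarrow> q < bsize S j \<Longrightarrow> zhat S r gh j \<omega> $ q = resid S r gh (j, q) \<omega>"
proof -
  assume *: "j \<in> {1..nbatch S}" "\<omega> \<in> space M" "q < bsize S j"
  note dc = design_carrier[OF *(1,2)]
  have "dim_vec (drop_col r (design S j \<omega>) *\<^sub>v gh j \<omega>) = bsize S j" using dc by (simp add: drop_col_def)
  then show ?thesis using dc r * drop_col_mult[OF dc r gh[OF *(1,2)] *(3)]
    by (auto simp: zhat_def resid_def entry_def)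
qed

lemma zhat_dot:
  assumes \<omega>: "\<omega> \<in> space M" and w: "\<And>j. j \<in> {1..nbatch S} \<Longrightarrow> w j \<in> carrier_vec (bsize S j)"
    and h: "\<And>j q. j \<in> {1..nbatch S} \<Longrightarrow> q < bsize S j \<Longrightarrow> w j $ q = h (j, q)"
  shows "(\<Sum>j=1..nbatch S. zhat S r gh j \<omega> \<bullet> w j) = (\<Sum>i\<in>obs S. resid S r gh i \<omega> * h i)"
proof -
  have "(\<Sum>j=1..nbatch S. zhat S r gh j \<omega> \<bullet> w j) = (\<Sum>j=1..nbatch S. \<Sum>q<bsize S j. resid S r gh (j, q) \<omega> * h (j, q))"
  proof (intro sum.cong refl)
    fix j assume j: "j \<in> {1..nbatch S}"
    show "zhat S r gh j \<omega> \<bullet> w j = (\<Sum>q<bsize S j. resid S r gh (j, q) \<omega> * h (j, q))"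
      using w[OF j] h[OF j] zhat_entry[OF j \<omega>] by (auto simp: scalar_prod_def atLeast0LessThan)
  qed
  then show ?thesis using sum_obs[of "\<lambda>i. resid S r gh i \<omega> * h i"] by simp
qed

definition "dn \<omega> = (\<Sum>i\<in>obs S. resid S r gh i \<omega> * entry S i r \<omega>)"
definition "z2 \<omega> = (\<Sum>i\<in>obs S. (resid S r gh i \<omega>)\<^sup>2)"

lemma odl_denom_eq: "\<omega> \<in> space M \<Longrightarrow> odl_denom S r gh \<omega> = dn \<omega>"
proof -
  assume \<omega>: "\<omega> \<in> space M"
  show ?thesis unfolding odl_denom_def dn_def
  proof (rule zhat_dot[OF \<omega>])
    fix j assume j: "j \<in> {1..nbatch S}"
    note dc = design_carrier[OF j \<omega>]
    show "col (design S j \<omega>) r \<in> carrier_vec (bsize S j)" by (rule carrier_vecI) (simp add: carrier_matD(1)[OF dc])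
    show "col (design S j \<omega>) r $ q = entry S (j, q) r \<omega>" if "q < bsize S j" for q
      using dc r that by (auto simp: entry_def)
  qed
qed

lemma zz_eq: "\<omega> \<in> space M \<Longrightarrow> (\<Sum>j=1..nbatch S. zhat S r gh j \<omega> \<bullet> zhat S r gh j \<omega>) = z2 \<omega>"
  using zhat_dot[of \<omega> "\<lambda>j. zhat S r gh j \<omega>" "\<lambda>i. resid S r gh i \<omega>"] zhat_carrier zhat_entry
  by (simp add: z2_def power2_eq_square)

lemma tau_hat_eq: "\<omega> \<in> space M \<Longrightarrow> tau_hat S r gh \<omega> = sqrt (z2 \<omega>) / dn \<omega>"
  by (simp only: tau_hat_def zz_eq odl_denom_eq)

lemma W_stat_eq: "\<omega> \<in> space M \<Longrightarrow> W_stat S r gh \<omega> = (\<Sum>i\<in>obs S. resid S r gh i \<omega> * noise_entry S i \<omega>) / sqrt (z2 \<omega>)"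
proof -
  assume \<omega>: "\<omega> \<in> space M"
  have "stack (nbatch S) (\<lambda>j. zhat S r gh j \<omega>) \<bullet> stack (nbatch S) (\<lambda>j. noise S j \<omega>) = (\<Sum>j=1..nbatch S. zhat S r gh j \<omega> \<bullet> noise S j \<omega>)"
    by (rule stack_dot) (use zhat_carrier[OF _ \<omega>] noise_carrier[OF _ \<omega>] in auto)
  also have "\<dots> = (\<Sum>i\<in>obs S. resid S r gh i \<omega> * noise_entry S i \<omega>)"
    by (rule zhat_dot[OF \<omega>]) (use noise_carrier[OF _ \<omega>] in \<open>auto simp: noise_entry_def\<close>)
  finally have a: "stack (nbatch S) (\<lambda>j. zhat S r gh j \<omega>) \<bullet> stack (nbatch S) (\<lambda>j. noise S j \<omega>) = (\<Sum>i\<in>obs S. resid S r gh i \<omega> * noise_entry S i \<omega>)" .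
  have "stack (nbatch S) (\<lambda>j. zhat S r gh j \<omega>) \<bullet> stack (nbatch S) (\<lambda>j. zhat S r gh j \<omega>) = (\<Sum>j=1..nbatch S. zhat S r gh j \<omega> \<bullet> zhat S r gh j \<omega>)"
    by (rule stack_dot) (use zhat_carrier[OF _ \<omega>] in auto)
  then show ?thesis unfolding W_stat_def norm2_dot a zz_eq[OF \<omega>] by simp
qed

lemma response_entry:
  assumes j: "j \<in> {1..nbatch S}" and \<omega>: "\<omega> \<in> space M"
  shows "response S j \<omega> \<in> carrier_vec (bsize S j)"
    and "q < bsize S j \<Longrightarrow> response S j \<omega> $ q = ip p (\<lambda>k. entry S (j, q) k \<omega>) (\<lambda>k. beta0 S $ k) + noise_entry S (j, q) \<omega>"
proof -
  note dc = design_carrier[OF j \<omega>] and nc = noise_carrier[OF j \<omega>]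
  show "response S j \<omega> \<in> carrier_vec (bsize S j)" by (rule carrier_vecI) (simp add: response_def carrier_vecD[OF nc])
  show "response S j \<omega> $ q = ip p (\<lambda>k. entry S (j, q) k \<omega>) (\<lambda>k. beta0 S $ k) + noise_entry S (j, q) \<omega>" if "q < bsize S j"
    using dc nc that mult_mat_ip[OF dc beta0_carrier that] by (simp add: response_def entry_def noise_entry_def)
qed

lemma odl_eq:
  assumes \<omega>: "\<omega> \<in> space M" and bh: "bh \<omega> \<in> carrier_vec p"
  shows "odl S r bh gh \<omega> = bh \<omega> $ r + inverse (dn \<omega>) *
     ((\<Sum>i\<in>obs S. resid S r gh i \<omega> * (ip p (\<lambda>k. entry S i k \<omega>) (\<lambda>k. beta0 S $ k) + noise_entry S i \<omega>))
      - (\<Sum>i\<in>obs S. resid S r gh i \<omega> * ip p (\<lambda>k. entry S i k \<omega>) (\<lambda>k. bh \<omega> $ k)))"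
proof -
  have a: "(\<Sum>j=1..nbatch S. zhat S r gh j \<omega> \<bullet> response S j \<omega>)
     = (\<Sum>i\<in>obs S. resid S r gh i \<omega> * (ip p (\<lambda>k. entry S i k \<omega>) (\<lambda>k. beta0 S $ k) + noise_entry S i \<omega>))"
    by (rule zhat_dot[OF \<omega>]) (use response_entry[OF _ \<omega>] in auto)
  have c: "(\<Sum>j=1..nbatch S. zhat S r gh j \<omega> \<bullet> (design S j \<omega> *\<^sub>v bh \<omega>))
     = (\<Sum>i\<in>obs S. resid S r gh i \<omega> * ip p (\<lambda>k. entry S i k \<omega>) (\<lambda>k. bh \<omega> $ k))"
  proof (rule zhat_dot[OF \<omega>])
    fix j assume j: "j \<in> {1..nbatch S}"
    note dc = design_carrier[OF j \<omega>]
    show "design S j \<omega> *\<^sub>v bh \<omega> \<in> carrier_vec (bsize S j)" by (rule carrier_vecI) (simp add: carrier_matD(1)[OF dc])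
    show "(design S j \<omega> *\<^sub>v bh \<omega>) $ q = ip p (\<lambda>k. entry S (j, q) k \<omega>) (\<lambda>k. bh \<omega> $ k)" if "q < bsize S j" for q
      using mult_mat_ip[OF dc bh that] by (simp add: entry_def)
  qed
  show ?thesis unfolding odl_def a c odl_denom_eq[OF \<omega>] ..
qed

text \<open>Defined as a difference, so that the decomposition holds at every sample point, also
  where a denominator vanishes.\<close>

definition "Dl bh \<omega> = (odl S r bh gh \<omega> - beta0 S $ r) / tau_hat S r gh \<omega> - W_stat S r gh \<omega>"

text \<open>Coordinate \<open>r\<close> of the error of \<open>bh\<close> enters the correction
  multiplied by \<open>dn\<close>; after division by \<open>dn\<close> it cancels against the
  initial error. What remains involves the other covariates only.\<close>

lemma Dl_eq:
  assumes \<omega>: "\<omega> \<in> space M" and bh: "bh \<omega> \<in> carrier_vec p" and d: "dn \<omega> \<noteq> 0"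
  shows "Dl bh \<omega> = ip p (\<lambda>k. \<Sum>i\<in>obs S. resid S r gh i \<omega> * (if k = r then 0 else entry S i k \<omega>))
     (\<lambda>k. beta0 S $ k - bh \<omega> $ k) / sqrt (z2 \<omega>)"
proof -
  define z where "z i = resid S r gh i \<omega>" for i
  define y where "y i = (\<lambda>k. entry S i k \<omega>)" for i
  define v where "v = (\<lambda>k. beta0 S $ k - bh \<omega> $ k)"
  define W where "W = (\<Sum>i\<in>obs S. z i * noise_entry S i \<omega>)"
  have dn: "dn \<omega> = (\<Sum>i\<in>obs S. z i * y i r)" by (simp add: dn_def z_def y_def)
  have tot: "(\<Sum>i\<in>obs S. z i * (ip p (y i) (\<lambda>k. beta0 S $ k) + noise_entry S i \<omega>)) - (\<Sum>i\<in>obs S. z i * ip p (y i) (\<lambda>k. bh \<omega> $ k))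
     = W + (\<Sum>i\<in>obs S. z i * ip p (y i) v)"
    unfolding W_def v_def by (simp add: ip_diff_right algebra_simps sum.distrib sum_subtractf)
  have "(\<Sum>i\<in>obs S. z i * ip p (y i) v) = (\<Sum>k<p. (\<Sum>i\<in>obs S. z i * y i k) * v k)"
    unfolding ip_def sum_distrib_left sum_distrib_right by (subst sum.swap) (simp add: mult.assoc)
  also have "\<dots> = dn \<omega> * v r + (\<Sum>k<p. (\<Sum>i\<in>obs S. z i * (if k = r then 0 else y i k)) * v k)"
    using r by (subst (1 2) sum.remove[of _ r]) (auto simp: dn intro!: sum.cong)
  finally have cross: "(\<Sum>i\<in>obs S. z i * ip p (y i) v) = dn \<omega> * v r + ip p (\<lambda>k. \<Sum>i\<in>obs S. z i * (if k = r then 0 else y i k)) v"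
    by (simp add: ip_def)
  have "odl S r bh gh \<omega> - beta0 S $ r = inverse (dn \<omega>) * (W + ip p (\<lambda>k. \<Sum>i\<in>obs S. z i * (if k = r then 0 else y i k)) v)"
    unfolding odl_eq[of \<omega> bh, OF \<omega> bh] z_def[symmetric] y_def[symmetric] tot cross using d
    by (simp add: v_def field_simps)
  then have "(odl S r bh gh \<omega> - beta0 S $ r) / tau_hat S r gh \<omega>
     = (W + ip p (\<lambda>k. \<Sum>i\<in>obs S. z i * (if k = r then 0 else y i k)) v) / sqrt (z2 \<omega>)"
    unfolding tau_hat_eq[OF \<omega>] using d by simp
  then show ?thesis unfolding Dl_def W_stat_eq[OF \<omega>]
    by (simp add: W_def z_def y_def v_def add_divide_distrib cong: if_cong)
qed

lemma Dl_meas: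
  assumes bh: "random_vec M p bh" and ghm: "\<And>j. j \<in> {1..nbatch S} \<Longrightarrow> random_vec M (p - 1) (gh j)"
  shows "Dl bh \<in> borel_measurable M"
proof -
  have rm: "resid S r gh i \<in> borel_measurable M" if i: "i \<in> obs S" for i
  proof -
    have j: "fst i \<in> {1..nbatch S}" using i by (auto simp: obs_def)
    have em: "(\<lambda>\<omega>. emb r (gh (fst i) \<omega>) k) \<in> borel_measurable M" if "k < p" for k
      using ghm[OF j] that r by (cases "k < r"; cases "k = r") (auto simp: emb_def random_vec_def)
    show ?thesis unfolding resid_def ip_def using i r em
      by (intro borel_measurable_diff borel_measurable_sum borel_measurable_times) auto
  qed
  have bm: "(\<lambda>\<omega>. bh \<omega> $ k) \<in> borel_measurable M" if "k < p" for k using bh that by (simp add: random_vec_def)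
  have im: "(\<lambda>\<omega>. ip p (\<lambda>k. entry S i k \<omega>) (\<lambda>k. bh \<omega> $ k)) \<in> borel_measurable M" if "i \<in> obs S" for i
    unfolding ip_def using that bm by (intro borel_measurable_sum borel_measurable_times) auto
  have im0: "(\<lambda>\<omega>. ip p (\<lambda>k. entry S i k \<omega>) (\<lambda>k. beta0 S $ k)) \<in> borel_measurable M" if "i \<in> obs S" for i
    unfolding ip_def using that by (intro borel_measurable_sum borel_measurable_times) auto
  have dm: "dn \<in> borel_measurable M" unfolding dn_def using rm r
    by (intro borel_measurable_sum borel_measurable_times) auto
  have zm: "z2 \<in> borel_measurable M" unfolding z2_def using rm
    by (intro borel_measurable_sum borel_measurable_power) auto
  let ?O = "\<lambda>\<omega>. bh \<omega> $ r + inverse (dn \<omega>) *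
     ((\<Sum>i\<in>obs S. resid S r gh i \<omega> * (ip p (\<lambda>k. entry S i k \<omega>) (\<lambda>k. beta0 S $ k) + noise_entry S i \<omega>))
      - (\<Sum>i\<in>obs S. resid S r gh i \<omega> * ip p (\<lambda>k. entry S i k \<omega>) (\<lambda>k. bh \<omega> $ k)))"
  have om: "?O \<in> borel_measurable M"
    using bm[OF r] dm rm im im0
    by (intro borel_measurable_add borel_measurable_times borel_measurable_inverse borel_measurable_diff borel_measurable_sum) auto
  have "(\<lambda>\<omega>. (?O \<omega> - beta0 S $ r) / (sqrt (z2 \<omega>) / dn \<omega>) - (\<Sum>i\<in>obs S. resid S r gh i \<omega> * noise_entry S i \<omega>) / sqrt (z2 \<omega>)) \<in> borel_measurable M"
    using om dm zm rm
    by (intro borel_measurable_diff borel_measurable_divide borel_measurable_sum borel_measurable_times borel_measurable_const) auto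
  then show ?thesis
    by (rule measurable_cong[THEN iffD1, rotated])
       (use bh in \<open>simp add: Dl_def odl_eq tau_hat_eq W_stat_eq random_vec_def\<close>)
qed

end

end

section \<open>Objectives in coordinates and the remainder of a single model\<close>

context data_stream
begin

lemma cumsize_sum: "cumsize S j = (\<Sum>i=1..j. bsize S i)" by (simp add: cumsize_def)

lemma nodewise_objective:
  assumes \<omega>: "\<omega> \<in> space M" and j: "j \<in> {1..nbatch S}" and v: "v \<in> carrier_vec (p - 1)" and r: "r < p"
  shows "lasso_objective S j l (\<lambda>i. col (design S i \<omega>) r) (\<lambda>i. drop_col r (design S i \<omega>)) v =
    (1 / (2 * real (cumsize S j))) * (\<Sum>i\<in>(SIGMA i:{1..j}. {..<bsize S i}). (entry S i r \<omega> - ip p (\<lambda>k. entry S i k \<omega>) (emb r v))\<^sup>2)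
      + l * l1 p (emb r v)"
proof -
  have "(norm2 (col (design S i \<omega>) r - drop_col r (design S i \<omega>) *\<^sub>v v))\<^sup>2
     = (\<Sum>q<bsize S i. (entry S (i, q) r \<omega> - ip p (\<lambda>k. entry S (i, q) k \<omega>) (emb r v))\<^sup>2)" if i: "i \<in> {1..j}" for i
  proof -
    have i': "i \<in> {1..nbatch S}" using i j by auto
    note dc = design_carrier[OF i' \<omega>]
    have dim: "dim_vec (drop_col r (design S i \<omega>) *\<^sub>v v) = bsize S i" by (simp add: drop_col_def carrier_matD(1)[OF dc])
    have "col (design S i \<omega>) r - drop_col r (design S i \<omega>) *\<^sub>v v \<in> carrier_vec (bsize S i)"
      by (rule carrier_vecI) (simp add: drop_col_def carrier_matD(1)[OF dc])
    then show ?thesis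
    proof (subst norm2_sq, assumption, intro sum.cong refl arg_cong[of _ _ power2])
      fix q assume "q \<in> {..<bsize S i}"
      then have q: "q < bsize S i" by simp
      show "(col (design S i \<omega>) r - drop_col r (design S i \<omega>) *\<^sub>v v) $ q = entry S (i, q) r \<omega> - ip p (\<lambda>k. entry S (i, q) k \<omega>) (emb r v)"
        using q dim r carrier_matD[OF dc] drop_col_mult[OF dc r v q] by (simp add: entry_def)
    qed
  qed
  then have "(\<Sum>i=1..j. (norm2 (col (design S i \<omega>) r - drop_col r (design S i \<omega>) *\<^sub>v v))\<^sup>2)
      = (\<Sum>i=1..j. \<Sum>q<bsize S i. (entry S (i, q) r \<omega> - ip p (\<lambda>k. entry S (i, q) k \<omega>) (emb r v))\<^sup>2)"
    by (intro sum.cong refl)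
  also have "\<dots> = (\<Sum>i\<in>(SIGMA i:{1..j}. {..<bsize S i}). (entry S i r \<omega> - ip p (\<lambda>k. entry S i k \<omega>) (emb r v))\<^sup>2)"
    by (subst sum.Sigma) (auto intro!: sum.cong)
  finally show ?thesis unfolding lasso_objective_def norm1_emb[OF r v] by simp
qed

lemma online_objective:
  assumes \<omega>: "\<omega> \<in> space M" and v: "v \<in> carrier_vec p"
  shows "lasso_objective S (nbatch S) l (\<lambda>i. response S i \<omega>) (\<lambda>i. design S i \<omega>) v =
    (1 / (2 * real (totsize S))) * (\<Sum>i\<in>obs S. (ip p (\<lambda>k. entry S i k \<omega>) (\<lambda>k. beta0 S $ k) + noise_entry S i \<omega>
        - ip p (\<lambda>k. entry S i k \<omega>) (\<lambda>k. v $ k))\<^sup>2) + l * l1 p (\<lambda>k. v $ k)"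
proof -
  have "(norm2 (response S i \<omega> - design S i \<omega> *\<^sub>v v))\<^sup>2
     = (\<Sum>q<bsize S i. (ip p (\<lambda>k. entry S (i, q) k \<omega>) (\<lambda>k. beta0 S $ k) + noise_entry S (i, q) \<omega>
        - ip p (\<lambda>k. entry S (i, q) k \<omega>) (\<lambda>k. v $ k))\<^sup>2)" if i: "i \<in> {1..nbatch S}" for i
  proof -
    note dc = design_carrier[OF i \<omega>] and nc = noise_carrier[OF i \<omega>]
    have dim: "dim_vec (design S i \<omega> *\<^sub>v v) = bsize S i" by (simp add: carrier_matD(1)[OF dc])
    have "response S i \<omega> - design S i \<omega> *\<^sub>v v \<in> carrier_vec (bsize S i)"
      by (rule carrier_vecI) (simp add: carrier_matD(1)[OF dc])
    then show ?thesis
    proof (subst norm2_sq, assumption, intro sum.cong refl arg_cong[of _ _ power2])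
      fix q assume "q \<in> {..<bsize S i}"
      then have q: "q < bsize S i" by simp
      show "(response S i \<omega> - design S i \<omega> *\<^sub>v v) $ q = ip p (\<lambda>k. entry S (i, q) k \<omega>) (\<lambda>k. beta0 S $ k) + noise_entry S (i, q) \<omega>
        - ip p (\<lambda>k. entry S (i, q) k \<omega>) (\<lambda>k. v $ k)"
        using q dim carrier_vecD[OF nc] mult_mat_ip[OF dc v q] mult_mat_ip[OF dc beta0_carrier q]
        by (simp add: response_def entry_def noise_entry_def carrier_matD(1)[OF dc])
    qed
  qed
  then have "(\<Sum>i=1..nbatch S. (norm2 (response S i \<omega> - design S i \<omega> *\<^sub>v v))\<^sup>2)
      = (\<Sum>i=1..nbatch S. \<Sum>q<bsize S i. (ip p (\<lambda>k. entry S (i, q) k \<omega>) (\<lambda>k. beta0 S $ k) + noise_entry S (i, q) \<omega>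
        - ip p (\<lambda>k. entry S (i, q) k \<omega>) (\<lambda>k. v $ k))\<^sup>2)"
    by (intro sum.cong refl)
  also have "\<dots> = (\<Sum>i\<in>obs S. (ip p (\<lambda>k. entry S i k \<omega>) (\<lambda>k. beta0 S $ k) + noise_entry S i \<omega>
        - ip p (\<lambda>k. entry S i k \<omega>) (\<lambda>k. v $ k))\<^sup>2)"
    by (rule sum_obs)
  finally show ?thesis unfolding lasso_objective_def norm1_l1[OF v] by simp
qed

lemma totsize_pos: "totsize S \<ge> 1"
  using bsize_le[of 1] n1[of 1] b2 by auto

lemma emb_restrict:
  assumes "\<gamma> r = 0" "k < p" "r < p"
  shows "emb r (vec (p - 1) (\<lambda>k. \<gamma> (if k < r then k else Suc k))) k = \<gamma> k"
  using assms by (auto simp: emb_def)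

lemma noise_design_indep:
  "indep_set
      (sets (vimage_algebra (space M) (\<lambda>\<omega>. \<lambda>i\<in>obs S. \<lambda>k\<in>{..<p}. entry S i k \<omega>) (\<Pi>\<^sub>M i\<in>obs S. \<Pi>\<^sub>M k\<in>{..<p}. borel)))
      (sets (vimage_algebra (space M) (\<lambda>\<omega>. \<lambda>i\<in>obs S. noise_entry S i \<omega>) (\<Pi>\<^sub>M i\<in>obs S. borel)))"
  using lin unfolding linear_stream_model_def design_row_eq row_space_def by blast

text \<open>A bound for one model whose constants depend on \<open>K\<close>, \<open>L\<close>,
  \<open>D\<close> and \<open>kk\<close> only. The summand \<open>1 / tail_const K L\<close> covers
  \<open>p = 1\<close>; the absolute values give one bound for both cases, whatever the signs of the
  collected constants.\<close>

lemma remainder_bound: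
  assumes sg: "\<And>i. i \<in> obs S \<Longrightarrow> sub_gaussian_vec M p K0 (\<lambda>\<omega>. row (design S (fst i) \<omega>) (snd i))"
    and K: "K0 \<le> K" "1 \<le> K" and L: "min_eigenvalue (cov_mat S) > 0" "1 / min_eigenvalue (cov_mat S) \<le> L" "1 \<le> L"
    and D: "max_diag (cov_mat S) \<le> D" "1 \<le> D"
    and se: "\<And>i. i \<in> obs S \<Longrightarrow> sub_exponential M E0 (noise_entry S i)" and E: "E0 \<le> E" "1 \<le> E"
    and r: "r < p"
    and kk: "kk \<ge> 1" "kk \<ge> 16 * (L * D / psi2 K)\<^sup>2" "kk \<ge> 8 * K\<^sup>2 * E\<^sup>2"
    and lam: "\<And>j. j \<in> {1..nbatch S} \<Longrightarrow> lam j = lasso_const kk * sqrt (ln (real p) / real (cumsize S j))"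
    and bhat: "online_lasso S lam bhat" and ghat: "nodewise_lasso S r lam ghat"
    and size1: "first_size_const K L (L * D) kk * real (sparsity_prec1 S r) * ln (real p) \<le> real (bsize S 1)"
    and size2: "\<And>j. j \<in> {2..nbatch S} \<Longrightarrow> ln (real p) \<le> real (bsize S j)"
    and size0: "256 * L * re_const K L * (real (sparsity_coef S) * ln (real p)) \<le> real (totsize S)"
    and t: "t > 0"
  shows "\<exists>A\<in>sets M. prob A \<le> (\<bar>all_const K L (L * D) kk\<bar> + 1 / tail_const K L + \<bar>event_const2 K L (L * D) kk\<bar> *
          ((real (sparsity_prec1 S r))\<^sup>2 * ln (real p) * ln (real (totsize S) / real (bsize S 1)))) / real (totsize S)
        + \<bar>W_const K L (L * D) kk + 3\<bar> / t \<and>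
      (\<forall>\<omega>\<in>space M - A. dn r ghat \<omega> \<noteq> 0 \<and> \<bar>Dl r ghat bhat \<omega>\<bar> \<le>
         D_const L kk * t * (real (sparsity_coef S) * real (sparsity_prec1 S r) * (ln (real p) / sqrt (real (totsize S))) + t / sqrt (real (totsize S))))"
proof -
  let ?Sg = "\<lambda>k l. cov_mat S $$ (k, l)" and ?s = "sparsity_prec1 S r" and ?N = "real (totsize S)" and ?H = "L * D"
  let ?q = "(real ?s)\<^sup>2 * ln (real p) * ln (?N / real (bsize S 1))"
  interpret R: sub_gaussian_rows M "obs S" p "entry S" ?Sg K L D
    using rows_stream[OF sg K L D] by simp
  have gh: "ghat j \<omega> \<in> carrier_vec (p - 1)" if "j \<in> {1..nbatch S}" "\<omega> \<in> space M" for j \<omega>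
    using ghat that by (auto simp: nodewise_lasso_def random_vec_def)
  have bh: "bhat \<omega> \<in> carrier_vec p" if "\<omega> \<in> space M" for \<omega>
    using bhat that by (auto simp: online_lasso_def random_vec_def)
  have N1: "?N \<ge> 1" using totsize_pos by simp
  have nN: "real (bsize S 1) \<le> ?N" "1 \<le> real (bsize S 1)" using bsize_le[of 1] n1[of 1] b2 by auto
  have q0: "?q \<ge> 0" using nN r by (intro mult_nonneg_nonneg) auto
  have c0: "tail_const K L > 0" by (rule R.tail_const_pos)
  have D0: "D_const L kk \<ge> 0" using L kk by (simp add: D_const_def)
  show ?thesis
  proof (cases "p \<ge> 2")
    \<comment> \<open>For \<open>p = 1\<close> the penalty is zero and there is no other covariate:
      the residuals are the covariate itself, and the remainder vanishes. Only a zero denominator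
      has to be excluded, by the lower tail.\<close>
    case False
    then have p1: "p = 1" and r0: "r = 0" using r by auto
    define A where "A = {\<omega> \<in> space M. (\<Sum>i\<in>obs S. (ip p (\<lambda>k. entry S i k \<omega>) (unit_fun 0))\<^sup>2) < real (card (obs S)) / 2 * bil p ?Sg (unit_fun 0) (unit_fun 0)}"
    have "A \<in> sets M" unfolding A_def using R.quad_meas[OF order_refl, of "unit_fun 0"] by measurable
    moreover have "prob A \<le> (1 / tail_const K L) / ?N"
    proof -
      have "prob A \<le> exp (- (tail_const K L * ?N))"
        unfolding A_def using R.lower_tail_quadratic[OF order_refl, of "unit_fun 0"] by (simp add: card_obs)
      also have "\<dots> \<le> 1 / (tail_const K L * ?N)" using c0 N1 by (intro exp_neg_le) auto
      finally show ?thesis by simp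
    qed
    then have "prob A \<le> (\<bar>all_const K L ?H kk\<bar> + 1 / tail_const K L + \<bar>event_const2 K L ?H kk\<bar> * ?q) / ?N + \<bar>W_const K L ?H kk + 3\<bar> / t"
    proof (rule order.trans)
      have "(1 / tail_const K L) / ?N \<le> (\<bar>all_const K L ?H kk\<bar> + 1 / tail_const K L + \<bar>event_const2 K L ?H kk\<bar> * ?q) / ?N"
        using q0 N1 by (intro divide_right_mono) auto
      moreover have "0 \<le> \<bar>W_const K L ?H kk + 3\<bar> / t" using t by simp
      ultimately show "(1 / tail_const K L) / ?N \<le> (\<bar>all_const K L ?H kk\<bar> + 1 / tail_const K L + \<bar>event_const2 K L ?H kk\<bar> * ?q) / ?N + \<bar>W_const K L ?H kk + 3\<bar> / t"
        by linarith
    qed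
    moreover have "dn r ghat \<omega> \<noteq> 0 \<and> Dl r ghat bhat \<omega> = 0" if \<omega>: "\<omega> \<in> space M - A" for \<omega>
    proof -
      have "0 < bil p ?Sg (unit_fun 0) (unit_fun 0)"
      proof -
        have "0 < ip p (unit_fun 0) (unit_fun 0) / L" using p1 L by (simp add: ip_unit_unit)
        then show ?thesis using R.low[of "unit_fun 0"] by linarith
      qed
      then have "0 < real (card (obs S)) / 2 * bil p ?Sg (unit_fun 0) (unit_fun 0)" using N1 by (simp add: card_obs)
      also have "\<dots> \<le> (\<Sum>i\<in>obs S. (ip p (\<lambda>k. entry S i k \<omega>) (unit_fun 0))\<^sup>2)" using \<omega> by (simp add: A_def not_less)
      also have "\<dots> = dn r ghat \<omega>"
      proof -
        have e: "dn r ghat \<omega> = (\<Sum>i\<in>obs S. resid S r ghat i \<omega> * entry S i r \<omega>)" by (rule dn_def) (use r gh in auto)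
        show ?thesis unfolding e by (simp add: resid_def ip_def p1 r0 emb_def unit_fun_def power2_eq_square)
      qed
      finally have d: "dn r ghat \<omega> \<noteq> 0" by simp
      have "Dl r ghat bhat \<omega> = 0"
        using \<omega> by (subst Dl_eq[OF r gh _ bh d]) (auto simp: ip_def p1 r0)
      with d show ?thesis by simp
    qed
    moreover have "0 \<le> D_const L kk * t * (real (sparsity_coef S) * real ?s * (ln (real p) / sqrt ?N) + t / sqrt ?N)"
      using D0 t p1 N1 by simp
    ultimately show ?thesis by (intro bexI[of _ A]) auto
  next
    case p2: True
    have carr: "cov_mat S \<in> carrier_mat p p" by (simp add: cov_mat_def)
    have sym: "cov_mat S $$ (k, l) = cov_mat S $$ (l, k)" if "k < p" "l < p" for k l
      using that by (simp add: cov_mat_def covariance_def mult.commute)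
    have Lp: "L > 0" using L by simp
    obtain \<gamma> where \<gamma>: "\<gamma> r = 0"
      "{k. k < p \<and> \<gamma> k \<noteq> 0} \<subseteq> {k. k < p \<and> k \<noteq> r \<and> the (mat_inverse (cov_mat S)) $$ (k, r) \<noteq> 0}"
      "ip p (\<lambda>k. unit_fun r k - \<gamma> k) (\<lambda>k. unit_fun r k - \<gamma> k) \<le> ?H" "ip p \<gamma> \<gamma> \<le> ?H"
      "\<And>k. k < p \<Longrightarrow> k \<noteq> r \<Longrightarrow> bil p ?Sg (\<lambda>k. unit_fun r k - \<gamma> k) (unit_fun k) = 0"
      by (rule population_regression[OF carr r Lp _ R.low R.diag[OF r]], (rule sym; assumption), (rule that; assumption))
    have "card {k. k < p \<and> \<gamma> k \<noteq> 0} \<le> sparsity_prec S r"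
      unfolding sparsity_prec_def prec_mat_def by (rule card_mono[OF _ \<gamma>(2)]) simp
    then have sp: "card {k. k < p \<and> \<gamma> k \<noteq> 0} \<le> ?s" by (simp add: sparsity_prec1_def)
    have H1: "?H \<ge> 1" using mult_mono[of 1 L 1 D] L D by simp
    interpret Nw: nodewise M "obs S" p "entry S" ?Sg K L D r \<gamma> ?s ?H kk
      by unfold_locales (use p2 r \<gamma> sp H1 kk in \<open>auto simp: sparsity_prec1_def\<close>)
    \<comment> \<open>The population coefficients as a vector of length \<open>p - 1\<close>, the
      competitor in the nodewise objectives.\<close>
    define v0 where "v0 = vec (p - 1) (\<lambda>k. \<gamma> (if k < r then k else Suc k))"
    have v0: "emb r v0 k = \<gamma> k" if "k < p" for k unfolding v0_def by (rule emb_restrict[where \<gamma>=\<gamma>, OF \<gamma>(1) that r])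
    have ipv0: "ip p f (emb r v0) = ip p f \<gamma>" for f unfolding ip_def by (intro sum.cong refl) (simp add: v0)
    have l1v0: "l1 p (emb r v0) = l1 p \<gamma>" unfolding l1_def by (intro sum.cong refl) (simp add: v0)
    interpret On: online M "obs S" p "entry S" ?Sg K L D r \<gamma> ?s ?H kk "nbatch S" "bsize S" "\<lambda>j k \<omega>. emb r (ghat j \<omega>) k"
    proof
      show "obs S = (SIGMA j:{1..nbatch S}. {..<bsize S j})" by (simp add: obs_def)
      show "nbatch S \<ge> 1" using b2 by simp
      show "emb r (ghat j \<omega>) r = 0" for j \<omega> by (rule emb_r)
      fix j \<omega> assume j: "j \<in> {1..nbatch S}" and \<omega>: "\<omega> \<in> space M"
      have "is_arg_min (lasso_objective S j (lam j) (\<lambda>i. col (design S i \<omega>) r) (\<lambda>i. drop_col r (design S i \<omega>)))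
          (\<lambda>v. v \<in> carrier_vec (p - 1)) (ghat j \<omega>)"
        using ghat j \<omega> by (simp add: nodewise_lasso_def)
      from is_arg_minD[OF this, of v0]
      have "lasso_objective S j (lam j) (\<lambda>i. col (design S i \<omega>) r) (\<lambda>i. drop_col r (design S i \<omega>)) (ghat j \<omega>)
         \<le> lasso_objective S j (lam j) (\<lambda>i. col (design S i \<omega>) r) (\<lambda>i. drop_col r (design S i \<omega>)) v0"
        by (simp add: v0_def)
      then show "(1 / (2 * real (\<Sum>i=1..j. bsize S i))) * (\<Sum>i\<in>(SIGMA i:{1..j}. {..<bsize S i}). (entry S i r \<omega> - ip p (\<lambda>k. entry S i k \<omega>) (\<lambda>k. emb r (ghat j \<omega>) k))\<^sup>2)
          + lasso_const kk * sqrt (ln (real p) / real (\<Sum>i=1..j. bsize S i)) * l1 p (\<lambda>k. emb r (ghat j \<omega>) k)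
       \<le> (1 / (2 * real (\<Sum>i=1..j. bsize S i))) * (\<Sum>i\<in>(SIGMA i:{1..j}. {..<bsize S i}). (Nw.Z i \<omega>)\<^sup>2)
          + lasso_const kk * sqrt (ln (real p) / real (\<Sum>i=1..j. bsize S i)) * l1 p \<gamma>"
        unfolding nodewise_objective[OF \<omega> j gh[OF j \<omega>] r] nodewise_objective[OF \<omega> j _ r, of v0, unfolded v0_def, OF vec_carrier, folded v0_def]
          ipv0 l1v0 lam[OF j] Nw.Z_eq cumsize_sum .
    qed (use n1 size1 size2 in auto)
    have Nb: "On.Nb = ?N" by (simp add: On.Nb_def card_obs)
    have lamI: "Nw.lam (obs S) = lam (nbatch S)"
      using lam[of "nbatch S"] b2 by (simp add: Nw.lam_def card_obs)
    interpret Nz: online_noise M "obs S" p "entry S" ?Sg K L D r \<gamma> ?s ?H kk "nbatch S" "bsize S" "\<lambda>j k \<omega>. emb r (ghat j \<omega>) k"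
      "noise_entry S" "\<lambda>k. beta0 S $ k" "\<lambda>k \<omega>. bhat \<omega> $ k" "sparsity_coef S" E
    proof
      show "indep_vars (\<lambda>_. borel) (noise_entry S) (obs S)" by (rule noise_indep)
      show "mean_le M (\<lambda>\<omega>. exp (\<Sum>i\<in>obs S. u * noise_entry S i \<omega> * entry S i k \<omega> - K\<^sup>2 * (u * noise_entry S i \<omega>)\<^sup>2 / 2)) 1" if "k < p" for u k
        by (rule R.noise_mgf[OF noise_design_indep noise_meas that])
      show "mean_le M (\<lambda>\<omega>. (noise_entry S i \<omega>)\<^sup>2) (8 * E\<^sup>2)" "mean_le M (\<lambda>\<omega>. (noise_entry S i \<omega>) ^ 4) (96 * E ^ 4)" if "i \<in> obs S" for i
        using sub_exponential_moments[OF prob_space_axioms se[OF that] E(1)] by auto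
      show "card {k. k < p \<and> beta0 S $ k \<noteq> 0} \<le> sparsity_coef S" by (simp add: sparsity_coef_def)
      have "sparsity_prec S r \<le> card {..<p}" unfolding sparsity_prec_def by (rule card_mono) auto
      then show "?s \<le> p" using p2 by (simp add: sparsity_prec1_def)
      show "256 * L * re_const K L * (real (sparsity_coef S) * ln (real p)) \<le> On.Nb" using size0 by (simp add: Nb)
      fix \<omega> assume \<omega>: "\<omega> \<in> space M"
      have "is_arg_min (lasso_objective S (nbatch S) (lam (nbatch S)) (\<lambda>i. response S i \<omega>) (\<lambda>i. design S i \<omega>))
          (\<lambda>v. v \<in> carrier_vec p) (bhat \<omega>)"
        using bhat \<omega> by (simp add: online_lasso_def)
      from is_arg_minD[OF this beta0_carrier]
      show "1 / (2 * On.Nb) * (\<Sum>i\<in>obs S. (ip p (\<lambda>k. entry S i k \<omega>) (\<lambda>k. beta0 S $ k) + noise_entry S i \<omega> - ip p (\<lambda>k. entry S i k \<omega>) (\<lambda>k. bhat \<omega> $ k))\<^sup>2)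
          + Nw.lam (obs S) * l1 p (\<lambda>k. bhat \<omega> $ k)
         \<le> 1 / (2 * On.Nb) * (\<Sum>i\<in>obs S. (noise_entry S i \<omega>)\<^sup>2) + Nw.lam (obs S) * l1 p (\<lambda>k. beta0 S $ k)"
        unfolding online_objective[OF \<omega> bh[OF \<omega>]] online_objective[OF \<omega> beta0_carrier] Nb lamI by simp
    qed (use E kk in auto)
    have zr: "On.z i \<omega> = resid S r ghat i \<omega>" for i \<omega>
      by (simp add: On.z_eq resid_def)
    have "prob (Nz.exc t) \<le> (\<bar>all_const K L ?H kk\<bar> + 1 / tail_const K L + \<bar>event_const2 K L ?H kk\<bar> * ?q) / ?N + \<bar>W_const K L ?H kk + 3\<bar> / t"
    proof -
      have "prob (Nz.exc t) \<le> (all_const K L ?H kk + event_const2 K L ?H kk * ?q) / ?N + (W_const K L ?H kk + 3) / t"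
        using Nz.exc_prob[OF t] by (simp add: Nb)
      also have "\<dots> \<le> (\<bar>all_const K L ?H kk\<bar> + 1 / tail_const K L + \<bar>event_const2 K L ?H kk\<bar> * ?q) / ?N + \<bar>W_const K L ?H kk + 3\<bar> / t"
      proof (rule add_mono; rule divide_right_mono)
        have "event_const2 K L ?H kk * ?q \<le> \<bar>event_const2 K L ?H kk\<bar> * ?q" using q0 by (intro mult_right_mono) auto
        moreover have "0 < 1 / tail_const K L" using c0 by simp
        ultimately show "all_const K L ?H kk + event_const2 K L ?H kk * ?q \<le> \<bar>all_const K L ?H kk\<bar> + 1 / tail_const K L + \<bar>event_const2 K L ?H kk\<bar> * ?q"
          by linarith
      qed (use t in auto)
      finally show ?thesis .
    qed
    moreover have "dn r ghat \<omega> \<noteq> 0 \<and> \<bar>Dl r ghat bhat \<omega>\<bar> \<le> D_const L kk * t * (real (sparsity_coef S) * real ?s * (ln (real p) / sqrt ?N) + t / sqrt ?N)"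
      if \<omega>: "\<omega> \<in> space M - Nz.exc t" for \<omega>
    proof -
      have b: "On.den \<omega> > 0" "\<bar>Nz.Delta \<omega>\<bar> \<le> D_const L kk * t * (real (sparsity_coef S) * real ?s * (ln (real p) / sqrt ?N) + t / sqrt ?N)"
        using Nz.Delta_bound[of \<omega> t] \<omega> t by (auto simp: Nb)
      have e: "dn r ghat \<omega> = (\<Sum>i\<in>obs S. resid S r ghat i \<omega> * entry S i r \<omega>)" by (rule dn_def) (use r gh in auto)
      have e2: "z2 r ghat \<omega> = (\<Sum>i\<in>obs S. (resid S r ghat i \<omega>)\<^sup>2)" by (rule z2_def) (use r gh in auto)
      have "On.den \<omega> = dn r ghat \<omega>" unfolding e by (simp add: On.den_def zr)
      then have d: "dn r ghat \<omega> \<noteq> 0" using b by simp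
      have "Nz.Delta \<omega> = Dl r ghat bhat \<omega>"
        using \<omega> by (subst Dl_eq[OF r gh _ bh d]) (auto simp: Nz.Delta_def On.zz_def e2 zr Nw.xm_def)
      with d b show ?thesis by simp
    qed
    ultimately show ?thesis using Nz.exc_sets by (intro bexI[of _ "Nz.exc t"]) auto
  qed
qed

end

section \<open>The asymptotic decomposition\<close>

theorem theorem1:
  fixes K L D E :: real
  shows "\<exists>C>0. \<exists>c>0. \<forall>(S :: nat \<Rightarrow> 'a stream_model) lam r bhat ghat.
    (\<forall>m. linear_stream_model (S m)) \<and>
    filterlim (\<lambda>m. totsize (S m)) at_top sequentially \<and>
    sub_gaussian_design K S \<and> bounded_covariance L D S \<and> sub_exponential_noise E S \<and>
    (\<forall>m. r m < ncov (S m)) \<and>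
    (\<forall>m. \<forall>j \<in> {1..nbatch (S m)}.
       lam m j = C * sqrt (ln (real (ncov (S m))) / real (cumsize (S m) j))) \<and>
    (\<forall>m. online_lasso (S m) (lam m) (bhat m)) \<and>
    (\<forall>m. nodewise_lasso (S m) (r m) (lam m) (ghat m)) \<and>
    (\<forall>m. real (bsize (S m) 1) \<ge> c * real (sparsity_prec1 (S m) (r m)) * ln (real (ncov (S m)))) \<and>
    (\<forall>m. \<forall>j \<in> {2..nbatch (S m)}. real (bsize (S m) j) \<ge> c * ln (real (ncov (S m)))) \<and>
    (\<lambda>m. real (sparsity_coef (S m)) * real (sparsity_prec1 (S m) (r m)) *
          (ln (real (ncov (S m))) / sqrt (real (totsize (S m))))) \<longlonglongrightarrow> 0 \<and>
    (\<lambda>m. (real (sparsity_prec1 (S m) (r m)))\<^sup>2 * (ln (real (ncov (S m))) / real (totsize (S m))) *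
          ln (real (totsize (S m)) / real (bsize (S m) 1))) \<longlonglongrightarrow> 0
    \<longrightarrow>
    (\<exists>\<Delta>.
      (\<forall>m. \<forall>\<omega> \<in> space (psp (S m)).
         (odl (S m) (r m) (bhat m) (ghat m) \<omega> - beta0 (S m) $ r m) / tau_hat (S m) (r m) (ghat m) \<omega>
           = W_stat (S m) (r m) (ghat m) \<omega> + \<Delta> m \<omega>) \<and>
      little_o_P_1 (\<lambda>m. psp (S m)) \<Delta> \<and>
      (\<lambda>m. measure (psp (S m)) {\<omega> \<in> space (psp (S m)). odl_denom (S m) (r m) (ghat m) \<omega> = 0})
        \<longlonglongrightarrow> 0)"
proof -
  \<comment> \<open>The parameters are arbitrary reals; raising them to at least \<open>1\<close>
    keeps the assumed bounds valid and meets the normalisation in the locales.\<close>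
  define K' L' D' E' where "K' = max 1 K" and "L' = max 1 L" and "D' = max 1 D" and "E' = max 1 E"
  have K': "K \<le> K'" "1 \<le> K'" and L': "L \<le> L'" "1 \<le> L'" and D': "D \<le> D'" "1 \<le> D'" and E': "E \<le> E'" "1 \<le> E'"
    by (auto simp: K'_def L'_def D'_def E'_def)
  define H where "H = L' * D'"
  \<comment> \<open>The summands are the three lower bounds on \<open>kk\<close>: the normalisation,
    the nodewise scores and the scores of the noise.\<close>
  define kk where "kk = 1 + 16 * (H / psi2 K')\<^sup>2 + 8 * K'\<^sup>2 * E'\<^sup>2"
  have kk: "kk \<ge> 1" "kk \<ge> 16 * (L' * D' / psi2 K')\<^sup>2" "kk \<ge> 8 * K'\<^sup>2 * E'\<^sup>2"
    by (auto simp: kk_def H_def)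
  define C where "C = lasso_const kk"
  have C0: "C > 0" using kk by (simp add: C_def lasso_const_def)
  \<comment> \<open>The entry \<open>1\<close> turns the condition on the later batches into the
    bound of their sizes by \<open>ln p\<close> from below; the other entry is for the first
    batch.\<close>
  define c where "c = max 1 (first_size_const K' L' H kk)"
  have c1: "c \<ge> 1" and cf: "first_size_const K' L' H kk \<le> c" by (auto simp: c_def)
  have "0 < 8192 * K' ^ 4 * L'\<^sup>2" using K' L' by (intro mult_pos_pos) auto
  then have tc0: "tail_const K' L' > 0" by (simp add: tail_const_def)
  then have re0: "re_const K' L' > 0" using K' by (simp add: re_const_def)
  show ?thesis
  proof (rule exI[of _ C], rule conjI[OF C0], rule exI[of _ c], rule conjI, use c1 in linarith, intro allI impI)
    fix S :: "nat \<Rightarrow> 'a stream_model" and lam r bhat ghat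
    assume asm: "(\<forall>m. linear_stream_model (S m)) \<and>
    filterlim (\<lambda>m. totsize (S m)) at_top sequentially \<and>
    sub_gaussian_design K S \<and> bounded_covariance L D S \<and> sub_exponential_noise E S \<and>
    (\<forall>m. r m < ncov (S m)) \<and>
    (\<forall>m. \<forall>j \<in> {1..nbatch (S m)}.
       lam m j = C * sqrt (ln (real (ncov (S m))) / real (cumsize (S m) j))) \<and>
    (\<forall>m. online_lasso (S m) (lam m) (bhat m)) \<and>
    (\<forall>m. nodewise_lasso (S m) (r m) (lam m) (ghat m)) \<and>
    (\<forall>m. real (bsize (S m) 1) \<ge> c * real (sparsity_prec1 (S m) (r m)) * ln (real (ncov (S m)))) \<and>
    (\<forall>m. \<forall>j \<in> {2..nbatch (S m)}. real (bsize (S m) j) \<ge> c * ln (real (ncov (S m)))) \<and>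
    (\<lambda>m. real (sparsity_coef (S m)) * real (sparsity_prec1 (S m) (r m)) *
          (ln (real (ncov (S m))) / sqrt (real (totsize (S m))))) \<longlonglongrightarrow> 0 \<and>
    (\<lambda>m. (real (sparsity_prec1 (S m) (r m)))\<^sup>2 * (ln (real (ncov (S m))) / real (totsize (S m))) *
          ln (real (totsize (S m)) / real (bsize (S m) 1))) \<longlonglongrightarrow> 0"
    let ?p = "\<lambda>m. ncov (S m)" and ?N = "\<lambda>m. real (totsize (S m))" and ?s = "\<lambda>m. sparsity_prec1 (S m) (r m)"
      and ?sc = "\<lambda>m. sparsity_coef (S m)" and ?M = "\<lambda>m. psp (S m)"
    have lin: "linear_stream_model (S m)" for m using asm by blast
    have N_top: "filterlim (\<lambda>m. totsize (S m)) at_top sequentially" using asm by blast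
    have sgd: "sub_gaussian_design K S" and bc: "bounded_covariance L D S" and sen: "sub_exponential_noise E S" using asm by blast+
    have r: "r m < ?p m" for m using asm by blast
    have lam: "lam m j = C * sqrt (ln (real (?p m)) / real (cumsize (S m) j))" if "j \<in> {1..nbatch (S m)}" for m j
      using asm that by blast
    have ol: "online_lasso (S m) (lam m) (bhat m)" and nl: "nodewise_lasso (S m) (r m) (lam m) (ghat m)" for m
      using asm by blast+
    have size_first: "c * real (?s m) * ln (real (?p m)) \<le> real (bsize (S m) 1)" for m using asm by blast
    have nj: "c * ln (real (?p m)) \<le> real (bsize (S m) j)" if "j \<in> {2..nbatch (S m)}" for m j using asm that by blast
    define \<rho> where "\<rho> m = real (?sc m) * real (?s m) * (ln (real (?p m)) / sqrt (?N m))" for m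
    define \<pi> where "\<pi> m = (real (?s m))\<^sup>2 * (ln (real (?p m)) / ?N m) * ln (?N m / real (bsize (S m) 1))" for m
    have \<rho>0: "\<rho> \<longlonglongrightarrow> 0" and \<pi>0: "\<pi> \<longlonglongrightarrow> 0" unfolding \<rho>_def \<pi>_def using asm by blast+
    have st: "data_stream (S m)" for m by unfold_locales (rule lin)
    have s1: "real (?s m) \<ge> 1" for m by (simp add: sparsity_prec1_def)
    have lnp: "ln (real (?p m)) \<ge> 0" for m using r[of m] by simp
    have N_real: "filterlim ?N at_top sequentially"
      by (rule filterlim_compose[OF filterlim_real_sequentially N_top])
    have N_inv: "(\<lambda>m. 1 / ?N m) \<longlonglongrightarrow> 0"
      using tendsto_inverse_0_at_top[OF N_real] by (simp add: divide_inverse)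
    have N_sqrt: "(\<lambda>m. 1 / sqrt (?N m)) \<longlonglongrightarrow> 0"
      using tendsto_inverse_0_at_top[OF filterlim_compose[OF sqrt_at_top N_real]] by (simp add: divide_inverse)
    have gh: "ghat m j \<omega> \<in> carrier_vec (?p m - 1)" if "j \<in> {1..nbatch (S m)}" "\<omega> \<in> space (?M m)" for m j \<omega>
      using nl[of m] that by (auto simp: nodewise_lasso_def random_vec_def)
    define \<Delta> where "\<Delta> m \<omega> = (odl (S m) (r m) (bhat m) (ghat m) \<omega> - beta0 (S m) $ r m) / tau_hat (S m) (r m) (ghat m) \<omega>
       - W_stat (S m) (r m) (ghat m) \<omega>" for m \<omega>
    have \<Delta>_Dl: "data_stream.Dl (S m) (r m) (ghat m) (bhat m) \<omega> = \<Delta> m \<omega>" for m \<omega>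
      unfolding \<Delta>_def by (rule data_stream.Dl_def[OF st r gh])
    have \<Delta>_meas: "\<Delta> m \<in> borel_measurable (?M m)" for m
    proof -
      have "data_stream.Dl (S m) (r m) (ghat m) (bhat m) \<in> borel_measurable (?M m)"
        by (rule data_stream.Dl_meas[OF st r gh]) (use ol[of m] nl[of m] in \<open>auto simp: online_lasso_def nodewise_lasso_def\<close>)
      then show ?thesis unfolding \<Delta>_Dl[abs_def] by (simp add: \<Delta>_Dl cong: measurable_cong)
    qed
    define bd where "bd t m = (\<bar>all_const K' L' H kk\<bar> + 1 / tail_const K' L') * (1 / ?N m) + \<bar>event_const2 K' L' H kk\<bar> * \<pi> m
       + \<bar>W_const K' L' H kk + 3\<bar> / t" for t m
    have evL: "\<forall>\<^sub>F m in sequentially. 1 / min_eigenvalue (cov_mat (S m)) \<le> L'"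
    proof -
      have "\<forall>\<^sub>F m in sequentially. 1 / min_eigenvalue (cov_mat (S m)) \<le> L" using bc by (simp add: bounded_covariance_def)
      then show ?thesis by eventually_elim (use L' in linarith)
    qed
    have evD: "\<forall>\<^sub>F m in sequentially. max_diag (cov_mat (S m)) \<le> D'"
    proof -
      have "\<forall>\<^sub>F m in sequentially. max_diag (cov_mat (S m)) \<le> D" using bc by (simp add: bounded_covariance_def)
      then show ?thesis by eventually_elim (use D' in linarith)
    qed
    \<comment> \<open>The first rate condition gives this, since \<open>sparsity_prec1\<close> is at
      least \<open>1\<close> and \<open>sqrt N <= N\<close>.\<close>
    have evS: "\<forall>\<^sub>F m in sequentially. 256 * L' * re_const K' L' * (real (?sc m) * ln (real (?p m))) \<le> ?N m"
    proof -
      have "1 / (256 * L' * re_const K' L') > 0" using L' re0 by simp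
      from order_tendstoD(2)[OF \<rho>0 this]
      show ?thesis
      proof eventually_elim
        case (elim m)
        have N1: "?N m \<ge> 1" using data_stream.totsize_pos[OF st[of m]] by simp
        have "real (?sc m) * ln (real (?p m)) * 1 \<le> real (?sc m) * ln (real (?p m)) * real (?s m)"
          using s1[of m] lnp[of m] by (intro mult_left_mono) auto
        also have "\<dots> = \<rho> m * sqrt (?N m)" using N1 by (simp add: \<rho>_def)
        also have "\<dots> \<le> 1 / (256 * L' * re_const K' L') * sqrt (?N m)"
          using elim N1 by (intro mult_right_mono) auto
        also have "\<dots> \<le> 1 / (256 * L' * re_const K' L') * ?N m"
        proof (rule mult_left_mono)
          have "?N m \<le> (?N m)\<^sup>2" using N1 by (simp add: power2_eq_square)
          then show "sqrt (?N m) \<le> ?N m" using N1 by (intro real_le_lsqrt) auto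
        qed (use L' re0 in auto)
        finally have "256 * L' * re_const K' L' * (real (?sc m) * ln (real (?p m)) * 1) \<le> 256 * L' * re_const K' L' * (1 / (256 * L' * re_const K' L') * ?N m)"
          using L' re0 by (intro mult_left_mono) auto
        then show ?case using L' re0 by simp
      qed
    qed
    have key: "\<forall>\<^sub>F m in sequentially. \<exists>A\<in>sets (?M m). measure (?M m) A \<le> bd t m \<and>
        (\<forall>\<omega>\<in>space (?M m) - A. odl_denom (S m) (r m) (ghat m) \<omega> \<noteq> 0 \<and>
           \<bar>\<Delta> m \<omega>\<bar> \<le> D_const L' kk * t * (\<rho> m + t * (1 / sqrt (?N m))))" if t: "t > 0" for t
      using evL evD evS
    proof eventually_elim
      case (elim m)
      interpret data_stream "S m" by (rule st)
      have "\<exists>A\<in>sets (?M m). measure (?M m) A \<le> (\<bar>all_const K' L' (L' * D') kk\<bar> + 1 / tail_const K' L' + \<bar>event_const2 K' L' (L' * D') kk\<bar> *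
          ((real (?s m))\<^sup>2 * ln (real (?p m)) * ln (?N m / real (bsize (S m) 1)))) / ?N m
        + \<bar>W_const K' L' (L' * D') kk + 3\<bar> / t \<and>
      (\<forall>\<omega>\<in>space (?M m) - A. dn (r m) (ghat m) \<omega> \<noteq> 0 \<and> \<bar>Dl (r m) (ghat m) (bhat m) \<omega>\<bar> \<le>
         D_const L' kk * t * (real (?sc m) * real (?s m) * (ln (real (?p m)) / sqrt (?N m)) + t / sqrt (?N m)))"
      proof (rule remainder_bound[where lam="lam m" and ?K0.0=K and ?E0.0=E])
        fix i assume i: "i \<in> obs (S m)"
        show "sub_gaussian_vec (?M m) (?p m) K (\<lambda>\<omega>. row (design (S m) (fst i) \<omega>) (snd i))"
          using sgd i by (auto simp: sub_gaussian_design_def split: prod.splits)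
        show "sub_exponential (?M m) E (noise_entry (S m) i)"
          using sen i by (auto simp: sub_exponential_noise_def)
      next
        show "min_eigenvalue (cov_mat (S m)) > 0" using bc by (simp add: bounded_covariance_def)
        show "first_size_const K' L' (L' * D') kk * real (?s m) * ln (real (?p m)) \<le> real (bsize (S m) 1)"
        proof -
          have "first_size_const K' L' H kk * real (?s m) * ln (real (?p m)) \<le> c * real (?s m) * ln (real (?p m))"
            using cf lnp[of m] by (intro mult_right_mono) auto
          then show ?thesis using size_first[of m] by (simp add: H_def)
        qed
        show "ln (real (?p m)) \<le> real (bsize (S m) j)" if "j \<in> {2..nbatch (S m)}" for j
          using nj[OF that] mult_right_mono[OF c1 lnp[of m]] by simp
        show "lam m j = lasso_const kk * sqrt (ln (real (?p m)) / real (cumsize (S m) j))" if "j \<in> {1..nbatch (S m)}" for j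
          using lam[OF that] by (simp add: C_def)
      qed (use K' L' D' E' kk r elim ol nl t in auto)
      then obtain A where A: "A \<in> sets (?M m)" "measure (?M m) A \<le> (\<bar>all_const K' L' (L' * D') kk\<bar> + 1 / tail_const K' L' + \<bar>event_const2 K' L' (L' * D') kk\<bar> *
          ((real (?s m))\<^sup>2 * ln (real (?p m)) * ln (?N m / real (bsize (S m) 1)))) / ?N m
        + \<bar>W_const K' L' (L' * D') kk + 3\<bar> / t"
        and A2: "\<And>\<omega>. \<omega> \<in> space (?M m) - A \<Longrightarrow> dn (r m) (ghat m) \<omega> \<noteq> 0 \<and> \<bar>Dl (r m) (ghat m) (bhat m) \<omega>\<bar> \<le>
         D_const L' kk * t * (real (?sc m) * real (?s m) * (ln (real (?p m)) / sqrt (?N m)) + t / sqrt (?N m))" by blast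
      have "measure (?M m) A \<le> bd t m"
        using A(2) by (simp add: bd_def \<pi>_def H_def add_divide_distrib)
      moreover have "odl_denom (S m) (r m) (ghat m) \<omega> \<noteq> 0 \<and> \<bar>\<Delta> m \<omega>\<bar> \<le> D_const L' kk * t * (\<rho> m + t * (1 / sqrt (?N m)))"
        if \<omega>: "\<omega> \<in> space (?M m) - A" for \<omega>
      proof -
        have "odl_denom (S m) (r m) (ghat m) \<omega> = dn (r m) (ghat m) \<omega>"
          by (rule odl_denom_eq[OF r gh]) (use \<omega> in auto)
        then show ?thesis using A2[OF \<omega>] unfolding \<Delta>_Dl by (simp add: \<rho>_def)
      qed
      ultimately show ?case using A(1) by blast
    qed
    have small: "\<forall>\<^sub>F m in sequentially. \<exists>A\<in>sets (?M m). measure (?M m) A < \<epsilon> \<and>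
        (\<forall>\<omega>\<in>space (?M m) - A. odl_denom (S m) (r m) (ghat m) \<omega> \<noteq> 0 \<and> \<bar>\<Delta> m \<omega>\<bar> < e)"
      if \<epsilon>: "\<epsilon> > 0" and e: "e > 0" for \<epsilon> e :: real
    proof -
      define w where "w = \<bar>W_const K' L' H kk + 3\<bar>"
      \<comment> \<open>Makes \<open>w / t\<close>, the part of the probability bound that does not
        vanish with growing \<open>N\<close>, smaller than \<open>\<epsilon>\<close>;
        \<open>w + 1\<close> keeps \<open>t\<close> positive when \<open>w = 0\<close>.\<close>
      define t where "t = 2 * (w + 1) / \<epsilon>"
      have w0: "0 \<le> w" by (simp add: w_def)
      then have t: "t > 0" unfolding t_def using \<epsilon> by (intro divide_pos_pos) auto
      have "w / t < \<epsilon>"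
      proof -
        have "w / t = \<epsilon> * (w / (2 * (w + 1)))" using \<epsilon> by (simp add: t_def)
        also have "\<dots> < \<epsilon> * 1"
        proof (rule mult_strict_left_mono)
          show "w / (2 * (w + 1)) < 1" using w0 by (simp add: divide_less_eq)
        qed (rule \<epsilon>)
        finally show ?thesis by simp
      qed
      moreover have "(\<lambda>m. bd t m) \<longlonglongrightarrow> (\<bar>all_const K' L' H kk\<bar> + 1 / tail_const K' L') * 0 + \<bar>event_const2 K' L' H kk\<bar> * 0 + w / t"
        unfolding bd_def w_def by (intro tendsto_intros N_inv \<pi>0)
      ultimately have "\<forall>\<^sub>F m in sequentially. bd t m < \<epsilon>" by (intro order_tendstoD(2)) auto
      moreover have "(\<lambda>m. D_const L' kk * t * (\<rho> m + t * (1 / sqrt (?N m)))) \<longlonglongrightarrow> D_const L' kk * t * (0 + t * 0)"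
        by (intro tendsto_intros N_sqrt \<rho>0)
      then have "\<forall>\<^sub>F m in sequentially. D_const L' kk * t * (\<rho> m + t * (1 / sqrt (?N m))) < e"
        using e by (intro order_tendstoD(2)) auto
      ultimately show ?thesis using key[OF t]
      proof eventually_elim
        case (elim m)
        then show ?case by (meson le_less_trans)
      qed
    qed
    \<comment> \<open>\<open>B m\<close> is merely covered by a measurable exceptional set
      \<open>A\<close>; monotonicity of the measure asks for measurability of the larger
      set.\<close>
    have conv: "(\<lambda>m. measure (?M m) (B m)) \<longlonglongrightarrow> 0"
      if e: "e > 0" and B: "\<And>m. B m \<subseteq> {\<omega> \<in> space (?M m). odl_denom (S m) (r m) (ghat m) \<omega> = 0 \<or> \<bar>\<Delta> m \<omega>\<bar> \<ge> e}" for e :: real and B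
    proof (rule LIMSEQ_I)
      fix \<epsilon> :: real assume "\<epsilon> > 0"
      from small[OF this e] have "\<forall>\<^sub>F m in sequentially. norm (measure (?M m) (B m) - 0) < \<epsilon>"
      proof eventually_elim
        case (elim m)
        then obtain A where A: "A \<in> sets (?M m)" "measure (?M m) A < \<epsilon>"
          "\<And>\<omega>. \<omega> \<in> space (?M m) - A \<Longrightarrow> odl_denom (S m) (r m) (ghat m) \<omega> \<noteq> 0 \<and> \<bar>\<Delta> m \<omega>\<bar> < e" by blast
        interpret data_stream "S m" by (rule st)
        have "B m \<subseteq> A"
        proof
          fix \<omega> assume "\<omega> \<in> B m"
          then have "\<omega> \<in> space (?M m)" "odl_denom (S m) (r m) (ghat m) \<omega> = 0 \<or> e \<le> \<bar>\<Delta> m \<omega>\<bar>"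
            using B[of m] by auto
          then show "\<omega> \<in> A" using A(3)[of \<omega>] by force
        qed
        then have "measure (?M m) (B m) \<le> measure (?M m) A" using A(1) by (rule finite_measure_mono)
        then show ?case using A(2) by simp
      qed
      then show "\<exists>m0. \<forall>m\<ge>m0. norm (measure (?M m) (B m) - 0) < \<epsilon>" by (simp add: eventually_sequentially)
    qed
    show "\<exists>\<Delta>.
      (\<forall>m. \<forall>\<omega> \<in> space (psp (S m)).
         (odl (S m) (r m) (bhat m) (ghat m) \<omega> - beta0 (S m) $ r m) / tau_hat (S m) (r m) (ghat m) \<omega>
           = W_stat (S m) (r m) (ghat m) \<omega> + \<Delta> m \<omega>) \<and>
      little_o_P_1 (\<lambda>m. psp (S m)) \<Delta> \<and>
      (\<lambda>m. measure (psp (S m)) {\<omega> \<in> space (psp (S m)). odl_denom (S m) (r m) (ghat m) \<omega> = 0})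
        \<longlonglongrightarrow> 0"
    proof (intro exI[of _ \<Delta>] conjI)
      show "little_o_P_1 (\<lambda>m. psp (S m)) \<Delta>"
        unfolding little_o_P_1_def
      proof (intro conjI allI impI \<Delta>_meas)
        fix e :: real assume "e > 0"
        then show "(\<lambda>m. measure (?M m) {\<omega> \<in> space (?M m). \<bar>\<Delta> m \<omega>\<bar> > e}) \<longlonglongrightarrow> 0"
          by (rule conv) auto
      qed
      show "(\<lambda>m. measure (?M m) {\<omega> \<in> space (?M m). odl_denom (S m) (r m) (ghat m) \<omega> = 0}) \<longlonglongrightarrow> 0"
        by (rule conv[of 1]) auto
    qed (simp add: \<Delta>_def)
  qed
qed

end
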